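(* Let $q\ge 1$ and $r_1\le r_2\le\dots\le r_{q+1}$ be positive integers with $r_2\ge (r_1-1)!+1$. Then: (A) For every $\delta>0$ there is $N_\delta$ such that for all $n\ge N_\delta$, every graph $G\in \mathrm{EX}(n,K_{q+1}(r_1,\dots,r_{q+1}))$ has a vertex partition $V(G)=U_1\cup\dots\cup U_q$ with $G=N_1\vee N_2\vee\dots\vee N_q$ where $N_i=G[U_i]$ (i.e. every two vertices in different parts are adjacent), such that: (1) $\frac nq-\delta n\le |U_i|\le \frac nq+\delta n$ for all $i$; (2) $N_1\in\mathrm{EX}(|U_1|,K_2(r_1,r_2))$; (3) $N_i\in \mathrm{EX}(|U_i|,K_2(1,r_2))$ for $i=2,\dots,q$. (B) Conversely, for $n$ sufficiently large, if $\hat N_1,\dots,\hat N_q$ are graphs such that (4) there is a graph $N_1\vee\dots\vee N_q\in\mathrm{EX}(n,K_{q+1}(r_1,\dots,r_{q+1}))$ satisfying (1)–(3) with $v(\hat N_i)=v(N_i)$ for all $i$, (5) $\hat N_1\in\mathrm{EX}(v(\hat N_1),K_2(r_1,r_2))$, and (6) for each $i\ne 1$, $\hat N_i$ has the maximum number of edges among graphs on $v(\hat N_i)$ vertices containing none of $K_2(1,r_2)$, $K_2(2,2)$, $K_3(1,1,1)$, then $\hat N_1\vee\dots\vee\hat N_q\in \mathrm{EX}(n,K_{q+1}(r_1,\dots,r_{q+1}))$.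
   Context: $K_m(r_1,\dots,r_m)$ denotes the complete $m$-partite graph with parts of sizes $r_1,\dots,r_m$. For a graph or family $\mathcal F$, $\mathrm{ex}(n,\mathcal F)$ is the maximum number of edges of an $n$-vertex graph containing no member of $\mathcal F$ as a subgraph, and $\mathrm{EX}(n,\mathcal F)$ is the set of such graphs with exactly $\mathrm{ex}(n,\mathcal F)$ edges. $G_1\vee G_2$ denotes the join (disjoint union plus all edges between the two graphs). $v(G)$ is the number of vertices. *)

theory Defs
  imports Complex_Main "HOL-Library.Disjoint_Sets"
begin

type_synonym 'a graph = "'a set \<times> 'a set set"

abbreviation verts :: "'a graph \<Rightarrow> 'a set" where "verts \<equiv> fst"
abbreviation edges :: "'a graph \<Rightarrow> 'a set set" where "edges \<equiv> snd"

definition simple_graph :: "'a graph \<Rightarrow> bool" where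
  "simple_graph G \<longleftrightarrow> finite (verts G) \<and> (\<forall>e\<in>edges G. e \<subseteq> verts G \<and> card e = 2)"

text \<open>\<open>G\<close> has a (not necessarily induced) subgraph isomorphic to \<open>H\<close>.\<close>

definition contains_copy :: "'a graph \<Rightarrow> 'b graph \<Rightarrow> bool" where
  "contains_copy G H \<longleftrightarrow>
     (\<exists>f. inj_on f (verts H) \<and> f ` verts H \<subseteq> verts G \<and> (\<forall>e\<in>edges H. f ` e \<in> edges G))"

definition free_of :: "'a graph \<Rightarrow> 'b graph set \<Rightarrow> bool" where
  "free_of G \<F> \<longleftrightarrow> (\<forall>H\<in>\<F>. \<not> contains_copy G H)"

text \<open>The maximum is over graphs whose vertices are natural numbers: every finite graph has an
  isomorphic copy there, so that the value does not depend on the vertex type of the graphs in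
  \<open>EX_graphs\<close> below.\<close>

definition ex_number :: "nat \<Rightarrow> 'b graph set \<Rightarrow> nat" where
  "ex_number n \<F> =
     Max {card (edges G) | G :: nat graph. simple_graph G \<and> card (verts G) = n \<and> free_of G \<F>}"

definition EX_graphs :: "nat \<Rightarrow> 'b graph set \<Rightarrow> 'a graph set" where
  "EX_graphs n \<F> =
     {G. simple_graph G \<and> card (verts G) = n \<and> free_of G \<F> \<and> card (edges G) = ex_number n \<F>}"

text \<open>The complete multipartite graph with part sizes \<open>rs\<close>; vertex \<open>(i, j)\<close> is the \<open>j\<close>-th
  vertex of the \<open>i\<close>-th part, both counted from \<open>0\<close>.\<close>

definition complete_multipartite :: "nat list \<Rightarrow> (nat \<times> nat) graph" where
  "complete_multipartite rs =
     (let V = (SIGMA i:{..<length rs}. {..<rs ! i})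
      in (V, {{u, v} | u v. u \<in> V \<and> v \<in> V \<and> fst u \<noteq> fst v}))"

definition induced_graph :: "'a graph \<Rightarrow> 'a set \<Rightarrow> 'a graph" where
  "induced_graph G U = (U, {e \<in> edges G. e \<subseteq> U})"

text \<open>\<open>graph_join q N\<close> is the join of \<open>N 1, \<dots>, N q\<close>. It is the join in the usual sense only if the
  vertex sets of the factors are pairwise disjoint, which is required wherever it is used.\<close>

definition graph_join :: "nat \<Rightarrow> (nat \<Rightarrow> 'a graph) \<Rightarrow> 'a graph" where
  "graph_join q N =
     (\<Union>i\<in>{1..q}. verts (N i),
      (\<Union>i\<in>{1..q}. edges (N i)) \<union>
      {{u, v} | u v i j. i \<in> {1..q} \<and> j \<in> {1..q} \<and> i \<noteq> j \<and> u \<in> verts (N i) \<and> v \<in> verts (N j)})"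

text \<open>The three conditions on the factors of an extremal graph on \<open>n\<close> vertices.\<close>

definition factor_conditions ::
    "nat \<Rightarrow> (nat \<Rightarrow> nat) \<Rightarrow> real \<Rightarrow> nat \<Rightarrow> (nat \<Rightarrow> 'a graph) \<Rightarrow> bool" where
  "factor_conditions q r \<delta> n N \<longleftrightarrow>
     (\<forall>i\<in>{1..q}. real n / real q - \<delta> * real n \<le> real (card (verts (N i))) \<and>
                 real (card (verts (N i))) \<le> real n / real q + \<delta> * real n) \<and>
     N 1 \<in> EX_graphs (card (verts (N 1))) {complete_multipartite [r 1, r 2]} \<and>
     (\<forall>i\<in>{2..q}. N i \<in> EX_graphs (card (verts (N i))) {complete_multipartite [1, r 2]})"

end

theory Submission
  imports Defs "HOL-Algebra.Algebraic_Closure_Type" "HOL-Library.Z2" "HOL-Library.Function_Algebras"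
    "HOL-Library.FuncSet"
begin

text \<open>
  A lower bound for the extremal number comes from joins of a \<open>K(r 1, r 2)\<close>-free graph with graphs of
  girth at least 5 and maximum degree less than \<open>r 2\<close>: such joins are free of the forbidden graph, and
  switching edges shows that on large vertex sets girth 5 costs no edges compared with
  \<open>K(1, r 2)\<close>-freeness. Conversely, Erdos-Simonovits stability gives an extremal graph a partition
  into \<open>q\<close> classes of nearly equal size that spans few edges and leaves out few edges between the
  classes. Apart from boundedly many exceptional vertices, every vertex is adjacent to almost all of
  the other classes, so \<open>K(r 1, r 2)\<close> in one class, or \<open>K(1, r 2)\<close> in one class together with a
  large complete bipartite graph with smaller side \<open>r 1 - 1\<close> in another one, would extend to the
  forbidden graph. The hypothesis on \<open>r 2\<close> enters through projective norm graphs: they give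
  \<open>K(r 1, r 2)\<close>-free graphs with of the order of \<open>n powr (2 - 1 / r 1)\<close> edges, more than any
  exceptional configuration can contribute. So there are no exceptional vertices, one class
  is free of \<open>K(r 1, r 2)\<close> and the others are free of \<open>K(1, r 2)\<close>; comparing the number of edges
  with the lower bound forces equality everywhere. Part (B) is the same count for the new join.
\<close>

section \<open>Projective norm graphs\<close>

text \<open>Girth 5 is imposed because the parts of the forbidden graph may spread over several
  factors: a factor that is only \<open>K(1, r 2)\<close>-free can absorb pieces of many parts.
  Without triangles and 4-cycles it meets at most two parts, and if it meets two, it holds at most
  \<open>r 2\<close> of their vertices, so an embedding can be pushed out of it. Both bounds are
  sums over the classes, and equality of the totals is to give equality of every summand, so not one
  exceptional vertex may survive. Boundedly many of them cost O(n) edges. The gain comes from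
  superadditivity of the extremal number: a linear number of vertices of the heavy class are
  neighbours of an exceptional vertex, these span few edges, and the rest of the class is too small
  to make up for the loss of order \<open>n powr (2 - 1 / r 1)\<close>. For \<open>r 1 = 1\<close>
  this order is linear too, but then an exceptional vertex yields the forbidden graph directly. The
  norm graphs live in characteristic 2: powers of 2 approximate every size up to a constant factor,
  and \<open>A + A = 0\<close> removes the loops.\<close>

text \<open>Polynomial functions of the coordinates below \<open>t\<close> with degree at most
  \<open>d i\<close> in coordinate \<open>i\<close>. The recursion splits off the last variable
  because the decomposition below interpolates in that variable; functions replace formal
  polynomials because only values on a finite solution set matter.\<close>

fun poly_funs :: "nat \<Rightarrow> (nat \<Rightarrow> nat) \<Rightarrow> ((nat \<Rightarrow> 'f::field) \<Rightarrow> 'f) set" where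
  "poly_funs 0 d = {f. \<exists>c. f = (\<lambda>_. c)}"
| "poly_funs (Suc t) d = {f. \<exists>c. (\<forall>k. c k \<in> poly_funs t d) \<and> f = (\<lambda>x. \<Sum>k\<le>d t. c k x * x t ^ k)}"

lemma poly_funs_SucI:
  "(\<And>k. c k \<in> poly_funs t d) \<Longrightarrow> (\<And>x. f x = (\<Sum>k\<le>d t. c k x * x t ^ k)) \<Longrightarrow> f \<in> poly_funs (Suc t) d"
  by auto

lemma poly_funs_const: "(\<lambda>_. c) \<in> poly_funs t d"
proof (induction t arbitrary: c)
  case (Suc t)
  show ?case
  proof (rule poly_funs_SucI)
    show "(\<lambda>_. if k = 0 then c else 0) \<in> poly_funs t d" for k by (rule Suc.IH)
    have "(\<Sum>k\<in>{0}. (if k = 0 then c else 0) * x t ^ k) = (\<Sum>k\<le>d t. (if k = 0 then c else 0) * x t ^ k)"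
      for x :: "nat \<Rightarrow> 'a" by (rule sum.mono_neutral_left) auto
    thus "c = (\<Sum>k\<le>d t. (if k = 0 then c else 0) * x t ^ k)" for x :: "nat \<Rightarrow> 'a"
      by simp
  qed
qed auto

lemma poly_funs_add:
  "f \<in> poly_funs t d \<Longrightarrow> g \<in> poly_funs t d \<Longrightarrow> (\<lambda>x. f x + g x) \<in> poly_funs t d"
proof (induction t arbitrary: f g)
  case (Suc t)
  then obtain a b where ab: "\<And>k. a k \<in> poly_funs t d" "f = (\<lambda>x. \<Sum>k\<le>d t. a k x * x t ^ k)"
     "\<And>k. b k \<in> poly_funs t d" "g = (\<lambda>x. \<Sum>k\<le>d t. b k x * x t ^ k)" by auto
  show ?case
    by (rule poly_funs_SucI[where c="\<lambda>k x. a k x + b k x"])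
       (auto intro!: Suc.IH ab simp: ab(2,4) sum.distrib algebra_simps)
qed auto

lemma poly_funs_smult:
  "f \<in> poly_funs t d \<Longrightarrow> (\<lambda>x. a * f x) \<in> poly_funs t d"
proof (induction t arbitrary: f)
  case (Suc t)
  then obtain c where c: "\<And>k. c k \<in> poly_funs t d" "f = (\<lambda>x. \<Sum>k\<le>d t. c k x * x t ^ k)" by auto
  show ?case
    by (rule poly_funs_SucI[where c="\<lambda>k x. a * c k x"])
       (auto intro!: Suc.IH c simp: c(2) sum_distrib_left algebra_simps)
qed auto

lemma poly_funs_sum:
  "(\<And>j. j \<in> J \<Longrightarrow> f j \<in> poly_funs t d) \<Longrightarrow> (\<lambda>x. \<Sum>j\<in>J. f j x) \<in> poly_funs t d"
  by (induction J rule: infinite_finite_induct) (auto intro: poly_funs_const poly_funs_add)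

lemma poly_funs_mono:
  "f \<in> poly_funs t d \<Longrightarrow> (\<And>i. i < t \<Longrightarrow> d i \<le> d' i) \<Longrightarrow> f \<in> poly_funs t d'"
proof (induction t arbitrary: f)
  case (Suc t)
  then obtain c where c: "\<And>k. c k \<in> poly_funs t d" "f = (\<lambda>x. \<Sum>k\<le>d t. c k x * x t ^ k)" by auto
  show ?case
  proof (rule poly_funs_SucI)
    show "(if k \<le> d t then c k else (\<lambda>_. 0)) \<in> poly_funs t d'" for k
      using Suc.IH[OF c(1)] Suc.prems(2) by (auto intro: poly_funs_const)
    have "d t \<le> d' t" using Suc.prems(2) by auto
    thus "f x = (\<Sum>k\<le>d' t. (if k \<le> d t then c k else (\<lambda>_. 0)) x * x t ^ k)" for x
      unfolding c(2) by (intro sum.mono_neutral_cong_left) auto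
  qed
qed auto

lemma poly_funs_mult_poly:
  assumes "f \<in> poly_funs t d" "degree p \<le> d t"
  shows "(\<lambda>x. f x * poly p (x t)) \<in> poly_funs (Suc t) d"
proof (rule poly_funs_SucI)
  show "(\<lambda>x. coeff p k * f x) \<in> poly_funs t d" for k by (intro poly_funs_smult assms)
  show "f x * poly p (x t) = (\<Sum>k\<le>d t. coeff p k * f x * x t ^ k)" for x
  proof -
    have "poly p (x t) = (\<Sum>k\<le>d t. coeff p k * x t ^ k)"
      unfolding poly_altdef using assms(2) by (intro sum.mono_neutral_left) (auto simp: coeff_eq_0)
    thus ?thesis by (simp add: sum_distrib_left algebra_simps)
  qed
qed

text \<open>All degree bounds are raised, not only that of \<open>x i\<close>: starting from
  \<open>\<lambda>i. i\<close> this gives \<open>poly_funs t Suc\<close>, the space to which the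
  decomposition applies.\<close>

lemma poly_funs_mult_var:
  "f \<in> poly_funs t d \<Longrightarrow> i < t \<Longrightarrow> (\<lambda>x. x i * f x) \<in> poly_funs t (\<lambda>j. Suc (d j))"
proof (induction t arbitrary: f)
  case (Suc t)
  then obtain c where c: "\<And>k. c k \<in> poly_funs t d" "f = (\<lambda>x. \<Sum>k\<le>d t. c k x * x t ^ k)" by auto
  have c': "c k \<in> poly_funs t (\<lambda>j. Suc (d j))" for k by (rule poly_funs_mono[OF c(1)]) auto
  show ?case
  proof (cases "i = t")
    case True
    show ?thesis
    proof (rule poly_funs_SucI)
      show "(case k of 0 \<Rightarrow> (\<lambda>_. 0) | Suc k \<Rightarrow> c k) \<in> poly_funs t (\<lambda>j. Suc (d j))" for k
        by (auto split: nat.split intro: poly_funs_const c')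
      show "x i * f x = (\<Sum>k\<le>Suc (d t). (case k of 0 \<Rightarrow> (\<lambda>_. 0) | Suc k \<Rightarrow> c k) x * x t ^ k)" for x
        by (subst sum.atMost_Suc_shift) (simp add: c(2) True sum_distrib_left algebra_simps)
    qed
  next
    case False
    with Suc.prems have "i < t" by auto
    have "(\<lambda>x. x i * f x) \<in> poly_funs (Suc t) (\<lambda>j. if j = t then d t else Suc (d j))"
    proof (rule poly_funs_SucI[where c="\<lambda>k x. x i * c k x"])
      show "(\<lambda>x. x i * c k x) \<in> poly_funs t (\<lambda>j. if j = t then d t else Suc (d j))" for k
        by (rule poly_funs_mono[OF Suc.IH[OF c(1) \<open>i < t\<close>]]) auto
    qed (simp add: c(2) sum_distrib_left algebra_simps)
    thus ?thesis by (rule poly_funs_mono) auto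
  qed
qed auto

definition lagrange_poly :: "('j \<Rightarrow> 'f::field) \<Rightarrow> 'j set \<Rightarrow> 'j \<Rightarrow> 'f poly" where
  "lagrange_poly z J k = (\<Prod>j\<in>J - {k}. smult (inverse (z k - z j)) [:- z j, 1:])"

lemma degree_lagrange_poly: "finite J \<Longrightarrow> k \<in> J \<Longrightarrow> degree (lagrange_poly z J k) \<le> card J - 1"
  unfolding lagrange_poly_def
proof (rule order.trans[OF degree_prod_sum_le])
  assume "finite J" "k \<in> J"
  have "(\<Sum>j\<in>J - {k}. degree (smult (inverse (z k - z j)) [:- z j, 1:])) \<le> of_nat (card (J - {k})) * 1"
    by (rule sum_bounded_above, rule order.trans[OF degree_smult_le]) simp
  thus "sum (degree \<circ> (\<lambda>j. smult (inverse (z k - z j)) [:- z j, 1:])) (J - {k}) \<le> card J - 1"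
    using \<open>finite J\<close> \<open>k \<in> J\<close> by (simp del: smult_pCons)
qed auto

lemma poly_lagrange_poly_node:
  assumes "finite J" "inj_on z J" "j \<in> J" "k \<in> J"
  shows "poly (lagrange_poly z J k) (z j) = (if j = k then 1 else 0)"
proof (cases "j = k")
  case True
  have "(z k - z l) * inverse (z k - z l) = 1" if "l \<in> J - {k}" for l using assms that by (subst right_inverse) (auto dest: inj_onD)
  with True show ?thesis unfolding lagrange_poly_def poly_prod
    by (intro trans[OF prod.neutral]) (auto simp: algebra_simps)
next
  case False
  with assms show ?thesis unfolding lagrange_poly_def poly_prod
    by (auto intro!: prod_zero bexI[of _ j])
qed

lemma lagrange_interpolation:
  assumes "finite J" "inj_on z J" "degree p < card J"
  shows "poly p y = (\<Sum>k\<in>J. poly p (z k) * poly (lagrange_poly z J k) y)"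
proof -
  define r where "r = (\<Sum>k\<in>J. smult (poly p (z k)) (lagrange_poly z J k))"
  have "degree r \<le> card J - 1" unfolding r_def
    by (intro degree_sum_le assms order.trans[OF degree_smult_le] degree_lagrange_poly)
  with assms(3) have deg: "degree r < card J" by linarith
  have "p = r"
  proof (rule poly_eqI_degree[where A="z ` J"])
    fix x assume "x \<in> z ` J"
    then obtain j where j: "j \<in> J" "x = z j" by auto
    have "poly r x = (\<Sum>k\<in>J. poly p (z k) * (if j = k then 1 else 0))"
      unfolding r_def poly_sum using assms j by (intro sum.cong) (auto simp: poly_lagrange_poly_node)
    also have "\<dots> = poly p x" using assms(1) j by (simp add: if_distrib cong: if_cong)
    finally show "poly p x = poly r x" by simp
  qed (use deg assms in \<open>auto simp: card_image\<close>)
  thus ?thesis by (metis (mono_tags, lifting) poly_smult poly_sum r_def sum.cong)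
qed

text \<open>Exposes the factor \<open>y - z j\<close>, which extends a product over
  \<open>i < t\<close> by its last factor when \<open>y = x t\<close> and
  \<open>z = a t\<close>.\<close>

lemma poly_lagrange_poly_remove:
  assumes "finite J" "j \<in> J" "k \<in> J" "j \<noteq> k"
  shows "poly (lagrange_poly z J k) y =
    (y - z j) * inverse (z k - z j) * poly (lagrange_poly z (J - {j}) k) y"
proof -
  have *: "J - {k} = insert j (J - {j} - {k})" "J - {j} - {k} = J - {k} - {j}" using assms by auto
  show ?thesis unfolding lagrange_poly_def
    by (subst *(1), subst prod.insert) (use assms in \<open>auto simp: algebra_simps\<close>)
qed

text \<open>Lagrange interpolation in the last variable at the nodes \<open>a t k\<close>: at the node \<open>a t k\<close> the
  product with index \<open>k\<close> vanishes, and the induction hypothesis applies to the remaining ones.\<close>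

lemma poly_funs_decomposition:
  assumes "finite J" "card J = Suc t" "\<And>i. i < t \<Longrightarrow> inj_on (a i) J" "F \<in> poly_funs t Suc"
  shows "\<exists>g. (\<forall>j\<in>J. g j \<in> poly_funs t (\<lambda>i. i)) \<and>
             (\<forall>x. F x = (\<Sum>j\<in>J. (\<Prod>i<t. x i - a i j) * g j x))"
  using assms
proof (induction t arbitrary: J F)
  case 0
  then obtain j where J: "J = {j}" by (auto simp: card_Suc_eq)
  show ?case by (rule exI[of _ "\<lambda>_. F"]) (use 0 J in auto)
next
  case (Suc t)
  let ?z = "a t"
  note fin = \<open>finite J\<close>
  obtain c where c: "\<And>k. c k \<in> poly_funs t Suc" "F = (\<lambda>x. \<Sum>m\<le>Suc t. c m x * x t ^ m)"
    using Suc.prems(4) by auto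
  define G where "G k = (\<lambda>x. \<Sum>m\<le>Suc t. ?z k ^ m * c m x)" for k
  have G: "G k \<in> poly_funs t Suc" for k
    unfolding G_def by (intro poly_funs_sum poly_funs_smult c)
  have ex: "\<exists>g. (\<forall>j\<in>J-{k}. g j \<in> poly_funs t (\<lambda>i. i)) \<and>
             (\<forall>x. G k x = (\<Sum>j\<in>J-{k}. (\<Prod>i<t. x i - a i j) * g j x))" if "k \<in> J" for k
    using that Suc.prems by (intro Suc.IH G) (auto intro: inj_on_diff)
  have "\<exists>h. \<forall>k\<in>J. (\<forall>j\<in>J-{k}. h k j \<in> poly_funs t (\<lambda>i. i)) \<and>
             (\<forall>x. G k x = (\<Sum>j\<in>J-{k}. (\<Prod>i<t. x i - a i j) * h k j x))"
    by (rule bchoice, rule ballI, rule ex)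
  then obtain h where h: "\<And>k j. k \<in> J \<Longrightarrow> j \<in> J - {k} \<Longrightarrow> h k j \<in> poly_funs t (\<lambda>i. i)"
    "\<And>k x. k \<in> J \<Longrightarrow> G k x = (\<Sum>j\<in>J-{k}. (\<Prod>i<t. x i - a i j) * h k j x)" by (elim exE) (auto simp only: Ball_def)
  \<comment> \<open>Taking out the node of \<open>j\<close> leaves \<open>t + 1\<close> nodes, so
    the Lagrange polynomials have degree at most \<open>t\<close>, exactly what
    \<open>\<lambda>i. i\<close> allows in the last variable.\<close>
  define g where "g j = (\<lambda>x. \<Sum>k\<in>J-{j}. h k j x *
      poly (smult (inverse (?z k - ?z j)) (lagrange_poly ?z (J - {j}) k)) (x t))" for j
  have "g j \<in> poly_funs (Suc t) (\<lambda>i. i)" if "j \<in> J" for j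
    unfolding g_def
  proof (intro poly_funs_sum poly_funs_mult_poly h)
    fix k assume k: "k \<in> J - {j}"
    have "degree (lagrange_poly ?z (J - {j}) k) \<le> card (J - {j}) - 1"
      using k fin by (intro degree_lagrange_poly) auto
    also have "\<dots> = t" using that Suc.prems(2) fin by simp
    finally show "degree (smult (inverse (?z k - ?z j)) (lagrange_poly ?z (J - {j}) k)) \<le> t"
      by (meson degree_smult_le order.trans)
  qed (use that in auto)
  moreover have "F x = (\<Sum>j\<in>J. (\<Prod>i<Suc t. x i - a i j) * g j x)" for x
  proof -
    define p where "p = (\<Sum>m\<le>Suc t. monom (c m x) m)"
    have p: "poly p y = (\<Sum>m\<le>Suc t. c m x * y ^ m)" for y
      unfolding p_def poly_sum by (simp add: poly_monom)
    have "degree p \<le> Suc t" unfolding p_def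
    proof (rule degree_sum_le)
      show "degree (monom (c m x) m) \<le> Suc t" if "m \<in> {..Suc t}" for m
        using that degree_monom_le[of "c m x" m] by simp
    qed simp
    hence "F x = (\<Sum>k\<in>J. poly p (?z k) * poly (lagrange_poly ?z J k) (x t))"
      using lagrange_interpolation[OF fin, of ?z p "x t"] Suc.prems(2,3) by (simp add: c(2) p)
    also have "\<dots> = (\<Sum>k\<in>J. G k x * poly (lagrange_poly ?z J k) (x t))"
      by (simp add: p G_def mult.commute)
    also have "\<dots> = (\<Sum>k\<in>J. \<Sum>j\<in>J. if j \<noteq> k then (\<Prod>i<t. x i - a i j) * h k j x * poly (lagrange_poly ?z J k) (x t) else 0)"
    proof (rule sum.cong[OF refl])
      fix k assume k: "k \<in> J"
      show "G k x * poly (lagrange_poly ?z J k) (x t) = (\<Sum>j\<in>J. if j \<noteq> k then (\<Prod>i<t. x i - a i j) * h k j x * poly (lagrange_poly ?z J k) (x t) else 0)"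
        unfolding h(2)[OF k] sum_distrib_right
        by (intro sum.mono_neutral_cong_left) (use fin in auto)
    qed
    also have "\<dots> = (\<Sum>j\<in>J. \<Sum>k\<in>J. if j \<noteq> k then (\<Prod>i<t. x i - a i j) * h k j x * poly (lagrange_poly ?z J k) (x t) else 0)"
      by (rule sum.swap)
    also have "\<dots> = (\<Sum>j\<in>J. (\<Prod>i<Suc t. x i - a i j) * g j x)"
    proof (rule sum.cong[OF refl])
      fix j assume j: "j \<in> J"
      show "(\<Sum>k\<in>J. if j \<noteq> k then (\<Prod>i<t. x i - a i j) * h k j x * poly (lagrange_poly ?z J k) (x t) else 0)
          = (\<Prod>i<Suc t. x i - a i j) * g j x"
        unfolding g_def sum_distrib_left
        by (rule sum.mono_neutral_cong_right)
           (use fin j in \<open>auto simp: poly_lagrange_poly_remove[of J j]\<close>)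
    qed
    finally show ?thesis .
  qed
  ultimately show ?case by blast
qed

section \<open>Counting solutions of product equations by dimension\<close>

lemma sum_fun_apply: "(\<Sum>i\<in>A. f i) x = (\<Sum>i\<in>A. f i x)"
  by (induction A rule: infinite_finite_induct) auto

interpretation fun_space: vector_space "\<lambda>(a::'f::field) (f::'x \<Rightarrow> 'f) x. a * f x"
  by standard (auto simp: algebra_simps fun_eq_iff)

fun monomial_funs :: "nat \<Rightarrow> (nat \<Rightarrow> nat) \<Rightarrow> ((nat \<Rightarrow> 'f::field) \<Rightarrow> 'f) set" where
  "monomial_funs 0 d = {\<lambda>_. 1}"
| "monomial_funs (Suc t) d = (\<lambda>(m, k) x. m x * x t ^ k) ` (monomial_funs t d \<times> {..d t})"

text \<open>Only an inequality, since over a small field different exponents may give the same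
  function.\<close>

lemma monomial_funs_card:
  defines "M \<equiv> (\<lambda>t d. monomial_funs t d :: ((nat \<Rightarrow> 'f::field) \<Rightarrow> 'f) set)"
  shows "finite (M t d) \<and> card (M t d) \<le> (\<Prod>i<t. Suc (d i))"
  unfolding M_def
proof (induction t)
  case (Suc t)
  let ?A = "monomial_funs t d \<times> {..d t} :: (((nat \<Rightarrow> 'f) \<Rightarrow> 'f) \<times> nat) set"
  have "card (monomial_funs (Suc t) d :: ((nat \<Rightarrow> 'f) \<Rightarrow> 'f) set) \<le> card ?A"
    using Suc unfolding monomial_funs.simps by (intro card_image_le) auto
  also have "\<dots> \<le> (\<Prod>i<t. Suc (d i)) * Suc (d t)"
    using Suc by (simp add: card_cartesian_product del: mult_Suc_right)
  finally have "card (monomial_funs (Suc t) d :: ((nat \<Rightarrow> 'f) \<Rightarrow> 'f) set) \<le> (\<Prod>i<Suc t. Suc (d i))"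
    by simp
  with Suc show ?case by simp
qed auto

lemma poly_funs_span: "f \<in> poly_funs t d \<Longrightarrow> f \<in> fun_space.span (monomial_funs t d)"
proof (induction t arbitrary: f)
  case 0
  then obtain c where c: "f = (\<lambda>_. c)" by auto
  have "(\<lambda>_. c * 1) \<in> fun_space.span (monomial_funs 0 d)"
    by (rule fun_space.span_scale) (auto intro: fun_space.span_base)
  thus ?case using c by simp
next
  case (Suc t)
  then obtain c where c: "\<And>k. c k \<in> poly_funs t d" "f = (\<lambda>x. \<Sum>k\<le>d t. c k x * x t ^ k)" by auto
  have *: "(\<lambda>x. g x * x t ^ k) \<in> fun_space.span (monomial_funs (Suc t) d)"
    if "g \<in> fun_space.span (monomial_funs t d)" "k \<le> d t" for g and k
    using that(1)
  proof (induction rule: fun_space.span_induct_alt)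
    case base
    show ?case using fun_space.span_zero by (simp add: zero_fun_def)
  next
    case (step a m y)
    have "(\<lambda>x. m x * x t ^ k) \<in> fun_space.span (monomial_funs (Suc t) d)"
      using step.hyps \<open>k \<le> d t\<close> by (intro fun_space.span_base) auto
    from fun_space.span_add[OF fun_space.span_scale[OF this, of a] step.IH]
    show ?case by (simp add: plus_fun_def algebra_simps)
  qed
  have "f = (\<Sum>k\<le>d t. (\<lambda>x. c k x * x t ^ k))" by (simp add: c(2) fun_eq_iff sum_fun_apply)
  also have "\<dots> \<in> fun_space.span (monomial_funs (Suc t) d)"
    by (intro fun_space.span_sum *) (use Suc.IH c in auto)
  finally show ?case .
qed

text \<open>The functions \<open>f s\<close> are diagonal on \<open>S\<close>, hence linearly
  independent, and they lie in the span of the monomials of degree at most \<open>i\<close> in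
  coordinate \<open>i\<close>; there are at most \<open>1 * 2 * ... * t\<close> of those.\<close>

lemma card_le_by_separation:
  fixes f :: "(nat \<Rightarrow> 'f::field) \<Rightarrow> (nat \<Rightarrow> 'f) \<Rightarrow> 'f"
  assumes "finite S" "\<And>s. s \<in> S \<Longrightarrow> f s \<in> poly_funs t (\<lambda>i. i)"
    and "\<And>s. s \<in> S \<Longrightarrow> f s s \<noteq> 0" "\<And>s x. s \<in> S \<Longrightarrow> x \<in> S \<Longrightarrow> x \<noteq> s \<Longrightarrow> f s x = 0"
  shows "card S \<le> fact t"
proof -
  let ?B = "monomial_funs t (\<lambda>i. i) :: ((nat \<Rightarrow> 'f) \<Rightarrow> 'f) set"
  have inj: "inj_on f S" by (rule inj_onI) (metis assms(3,4))
  have ind: "fun_space.independent (f ` S)"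
    unfolding fun_space.dependent_finite[OF finite_imageI[OF assms(1)]]
  proof (rule notI, elim exE conjE bexE)
    fix u h assume 0: "(\<Sum>x\<in>f ` S. (\<lambda>y. u x * x y)) = 0" and "h \<in> f ` S" "u h \<noteq> 0"
    then obtain s where s: "s \<in> S" "h = f s" by auto
    have "0 = (\<Sum>x\<in>f ` S. (\<lambda>y. u x * x y)) s" using 0 by simp
    also have "\<dots> = (\<Sum>r\<in>S. u (f r) * f r s)" by (simp add: sum_fun_apply sum.reindex[OF inj])
    also have "\<dots> = (\<Sum>r\<in>{s}. u (f r) * f r s)"
    proof (rule sum.mono_neutral_right[OF assms(1)])
      show "\<forall>r\<in>S - {s}. u (f r) * f r s = 0"
      proof
        fix r assume r: "r \<in> S - {s}"
        hence "f r s = 0" by (intro assms(4) s(1)) auto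
        thus "u (f r) * f r s = 0" by simp
      qed
    qed (use s(1) in auto)
    also have "\<dots> = u (f s) * f s s" by simp
    finally have "u (f s) = 0" using assms(3)[OF s(1)] by (metis mult_eq_0_iff)
    with \<open>u h \<noteq> 0\<close> s(2) show False by simp
  qed
  have "card S = card (f ` S)" using inj by (simp add: card_image)
  also have "\<dots> \<le> card ?B"
  proof -
    have "f ` S \<subseteq> fun_space.span ?B" using poly_funs_span assms(2) by blast
    from fun_space.independent_span_bound[OF _ ind this] monomial_funs_card[of t "\<lambda>i. i", where 'f='f]
    show ?thesis by simp
  qed
  also have "\<dots> \<le> (\<Prod>i<t. Suc i)" using monomial_funs_card by blast
  also have "\<dots> = fact t" by (induction t) auto
  finally show ?thesis .
qed

text \<open>The functions on the solution set \<open>S\<close> are all of the form \<open>b ^ N * f\<close> with \<open>f\<close> in a space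
  of dimension at most \<open>fact t\<close>, by the decomposition above, whose products equal \<open>c j * b\<close> on \<open>S\<close>.\<close>

lemma product_system_solutions:
  fixes a :: "nat \<Rightarrow> 'j \<Rightarrow> 'f::field"
  assumes S: "finite S" and J: "finite J" "card J = Suc t" and inj: "\<And>i. i < t \<Longrightarrow> inj_on (a i) J"
    and sol: "\<And>x j. x \<in> S \<Longrightarrow> j \<in> J \<Longrightarrow> (\<Prod>i<t. x i - a i j) = c j * b x"
    and b: "\<And>x. x \<in> S \<Longrightarrow> b x \<noteq> 0"
    and diff: "\<And>x y. x \<in> S \<Longrightarrow> y \<in> S \<Longrightarrow> x \<noteq> y \<Longrightarrow> \<exists>i<t. x i \<noteq> y i"
  shows "card S \<le> fact t"
proof -
  let ?V = "poly_funs t (\<lambda>i. i) :: ((nat \<Rightarrow> 'f) \<Rightarrow> 'f) set"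
  define W where "W N = {F. \<exists>f\<in>?V. \<forall>x\<in>S. F x = b x ^ N * f x}" for N :: nat
  have up: "\<exists>g\<in>?V. \<forall>x\<in>S. f x = b x * g x" if f: "f \<in> poly_funs t Suc" for f
  proof -
    obtain g where g: "\<And>j. j \<in> J \<Longrightarrow> g j \<in> ?V" "\<And>x. f x = (\<Sum>j\<in>J. (\<Prod>i<t. x i - a i j) * g j x)"
      using poly_funs_decomposition[where a=a, OF J inj f] by blast
    show ?thesis
    proof (intro bexI ballI)
      show "(\<lambda>x. \<Sum>j\<in>J. c j * g j x) \<in> ?V" by (intro poly_funs_sum poly_funs_smult g)
      show "f x = b x * (\<Sum>j\<in>J. c j * g j x)" if "x \<in> S" for x
        unfolding g(2) sum_distrib_left by (rule sum.cong) (use that sol in auto)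
    qed
  qed
  have mult: "(\<lambda>x. (x i - z) * F x) \<in> W (Suc N)" if FW: "F \<in> W N" and it: "i < t" for F i N z
  proof -
    obtain f where f: "f \<in> ?V" "\<And>x. x \<in> S \<Longrightarrow> F x = b x ^ N * f x" using FW unfolding W_def by auto
    have "(\<lambda>x. (x i) * f x + (- z) * f x) \<in> poly_funs t Suc"
      using poly_funs_mult_var[OF f(1) it] poly_funs_mono[OF f(1), of Suc]
      by (intro poly_funs_add poly_funs_smult) auto
    then obtain g where "g \<in> ?V" and *: "\<forall>x\<in>S. x i * f x + (- z) * f x = b x * g x" using up by blast
    moreover have "\<forall>x\<in>S. (x i - z) * F x = b x ^ Suc N * g x"
    proof (intro ballI)
      fix x assume x: "x \<in> S"
      have "(x i - z) * F x = b x ^ N * (x i * f x + (- z) * f x)" by (simp add: f(2)[OF x] algebra_simps)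
      also have "\<dots> = b x ^ Suc N * g x" using * x by simp
      finally show "(x i - z) * F x = b x ^ Suc N * g x" .
    qed
    ultimately show ?thesis unfolding W_def by blast
  qed
  \<comment> \<open>One factor \<open>x i - y i\<close> per point \<open>y\<close> of
    \<open>T\<close>, with a coordinate \<open>i\<close> in which \<open>y\<close> differs from
    \<open>s\<close>. Each factor costs one power of \<open>b\<close>, which is nonzero on
    \<open>S\<close> and is divided out afterwards.\<close>
  have "\<exists>F\<in>W (card T). F s \<noteq> 0 \<and> (\<forall>x\<in>T. F x = 0)" if "finite T" "T \<subseteq> S" "s \<in> S" "s \<notin> T" for s T
    using that
  proof (induction T rule: finite_induct)
    case empty
    have "(\<lambda>_. 1) \<in> W 0" unfolding W_def using poly_funs_const by fastforce
    thus ?case by (intro bexI[of _ "\<lambda>_. 1"]) auto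
  next
    case (insert y T)
    then obtain F where F: "F \<in> W (card T)" "F s \<noteq> 0" "\<forall>x\<in>T. F x = 0" by auto
    obtain i where i: "i < t" "s i \<noteq> y i" using insert diff[of s y] by auto
    show ?case
      by (rule bexI[of _ "\<lambda>x. (x i - y i) * F x"]) (use F i mult insert in auto)
  qed
  from this[of "S - {s}" s for s]
  have ex: "\<exists>F\<in>W (card (S - {s})). F s \<noteq> 0 \<and> (\<forall>x\<in>S - {s}. F x = 0)" if "s \<in> S" for s
    using that S by (simp del: card_Diff_insert card_Diff_singleton)
  have "\<exists>f\<in>?V. f s \<noteq> 0 \<and> (\<forall>x\<in>S - {s}. f x = 0)" if s: "s \<in> S" for s
  proof -
    obtain F where F: "F \<in> W (card (S - {s}))" "F s \<noteq> 0" "\<forall>x\<in>S - {s}. F x = 0"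
      using ex[OF s] by blast
    from F(1) obtain f where f: "f \<in> ?V" "\<forall>x\<in>S. F x = b x ^ card (S - {s}) * f x"
      unfolding W_def by blast
    have "f s \<noteq> 0" using f(2) F(2) s by (metis mult_zero_right)
    moreover have "f x = 0" if "x \<in> S - {s}" for x
    proof -
      have "b x ^ card (S - {s}) * f x = 0" using f(2) F(3) that by auto
      thus ?thesis using b[of x] that by (metis DiffD1 mult_eq_0_iff power_not_zero)
    qed
    ultimately show ?thesis using f(1) by blast
  qed
  then obtain f where "\<And>s. s \<in> S \<Longrightarrow> f s \<in> ?V \<and> f s s \<noteq> 0 \<and> (\<forall>x\<in>S - {s}. f s x = 0)" by metis
  thus ?thesis by (intro card_le_by_separation[OF S, of f]) auto
qed

section \<open>Finite fields of characteristic 2 and their norms\<close>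

lemma char2_add_self: "(x :: bit alg_closure) + x = 0"
proof -
  have "(1 :: bit alg_closure) + 1 = to_ac (1 + 1)" by (simp only: to_ac_add to_ac_1)
  also have "\<dots> = 0" by simp
  finally have "x * (1 + 1) = 0" by simp
  thus ?thesis by (simp only: distrib_left mult_1_right)
qed

lemma char2_minus: "(x :: bit alg_closure) - y = x + y"
proof -
  have "x + y - (x - y) = y + y" by (simp add: algebra_simps del: mult_2 mult_2_right)
  hence "x + y - (x - y) = 0" by (simp only: char2_add_self)
  thus ?thesis by simp
qed

lemma frobenius_add: "((x :: bit alg_closure) + y) ^ (2 ^ k) = x ^ (2 ^ k) + y ^ (2 ^ k)"
proof (induction k)
  case (Suc k)
  have sq: "(a + b)\<^sup>2 = a\<^sup>2 + b\<^sup>2" for a b :: "bit alg_closure"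
  proof -
    have "(a + b)\<^sup>2 = a\<^sup>2 + b\<^sup>2 + (a * b + a * b)" by (simp add: power2_eq_square algebra_simps)
    thus ?thesis by (simp only: char2_add_self add_0_right)
  qed
  show ?case by (simp only: power_Suc2 power_mult Suc.IH sq)
qed simp

lemma frobenius_inj: "(x :: bit alg_closure) ^ (2 ^ k) = y ^ (2 ^ k) \<Longrightarrow> x = y"
proof -
  assume "x ^ (2 ^ k) = y ^ (2 ^ k)"
  hence "(x + y) ^ (2 ^ k) = 0" by (simp add: frobenius_add char2_add_self)
  hence "x - y = 0" by (simp add: char2_minus)
  thus ?thesis by simp
qed

text \<open>The subfield with \<open>2 ^ m\<close> elements, as the fixed points of the
  \<open>m\<close>-th iterate of the Frobenius map on the algebraic closure of the two-element
  field.\<close>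

definition field2 :: "nat \<Rightarrow> bit alg_closure set" where
  "field2 m = {x. x ^ (2 ^ m) = x}"

text \<open>The elements are the roots of \<open>X ^ (2 ^ m) + X\<close>. Its derivative is 1
  because \<open>2 ^ m\<close> vanishes in the field, so no root is multiple and the number of roots
  is the degree.\<close>

lemma card_field2:
  assumes "m > 0"
  shows "card (field2 m) = 2 ^ m"
proof -
  define p :: "bit alg_closure poly" where "p = monom 1 (2 ^ m) + monom 1 1"
  have one: "(1::nat) < 2 ^ m" using assms by (metis one_less_numeral_iff one_less_power semiring_norm(76))
  have deg: "degree p = 2 ^ m" unfolding p_def
    using one by (subst degree_add_eq_left) (auto simp: degree_monom_eq)
  have "(of_nat (2 ^ m) :: bit alg_closure) = 0"
    using assms char2_add_self[of 1] by (cases m) auto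
  hence "pderiv p = 1" unfolding p_def by (simp add: pderiv_add pderiv_monom one_pCons)
  have p0: "p \<noteq> 0" using deg by auto
  have simple: False if "p = [:- x, 1:] * ([:- x, 1:] * r)" for x r
  proof -
    from that have "pderiv p = [:- x, 1:] * pderiv ([:- x, 1:] * r) + [:- x, 1:] * r * pderiv [:- x, 1:]"
      by (simp only: pderiv_mult)
    hence "poly (pderiv p) x = 0" by (simp only: poly_add poly_mult) simp
    with \<open>pderiv p = 1\<close> show False by simp
  qed
  obtain A where A: "size A = degree p" "p = smult (lead_coeff p) (\<Prod>x\<in>#A. [:- x, 1:])"
    using alg_closed_imp_factorization[OF p0] by blast
  have cnt: "count A x = 1" if "x \<in># A" for x
  proof (rule ccontr)
    assume "count A x \<noteq> 1"
    moreover have "count A x > 0" using that by simp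
    ultimately have "count A x > 1" by linarith
    hence "count (A - {#x#}) x > 0" by simp
    then obtain B where "A - {#x#} = add_mset x B" by (metis count_greater_zero_iff mset_add)
    with that have "A = add_mset x (add_mset x B)" by (metis insert_DiffM)
    hence "p = [:- x, 1:] * ([:- x, 1:] * smult (lead_coeff p) (\<Prod>x\<in>#B. [:- x, 1:]))"
      using A(2) by (simp only: image_mset_add_mset prod_mset.add_mset mult_smult_right)
    thus False by (rule simple)
  qed
  have "poly (\<Prod>x\<in>#A. [:- x, 1:]) y = 0 \<longleftrightarrow> y \<in># A" for y
    by (induction A) auto
  hence "poly p y = 0 \<longleftrightarrow> y \<in># A" for y
    using p0 by (subst A(2)) simp
  hence "{x. poly p x = 0} = set_mset A" by auto
  moreover have "size A = card (set_mset A)"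
    by (simp add: size_multiset_overloaded_eq cnt)
  ultimately have "card {x. poly p x = 0} = 2 ^ m" using deg A(1) by simp
  moreover have "{x. poly p x = 0} = field2 m"
    unfolding field2_def p_def by (auto simp: poly_monom simp flip: char2_minus)
  ultimately show ?thesis by simp
qed

lemma finite_field2: "m > 0 \<Longrightarrow> finite (field2 m)"
  using card_field2[of m] by (metis card.infinite power_not_zero zero_neq_numeral)

lemma field2_add: "x \<in> field2 m \<Longrightarrow> y \<in> field2 m \<Longrightarrow> x + y \<in> field2 m"
  by (auto simp: field2_def frobenius_add)

lemma field2_divide: "x \<in> field2 m \<Longrightarrow> y \<in> field2 m \<Longrightarrow> x / y \<in> field2 m"
  by (auto simp: field2_def power_divide)

text \<open>The norm of the extension of degree \<open>t\<close> over the field with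
  \<open>2 ^ k\<close> elements: the product of the conjugates.\<close>

definition norm2 :: "nat \<Rightarrow> nat \<Rightarrow> bit alg_closure \<Rightarrow> bit alg_closure" where
  "norm2 k t x = (\<Prod>i<t. x ^ (2 ^ (k * i)))"

lemma norm2_eq_0_iff: "t > 0 \<Longrightarrow> norm2 k t x = 0 \<longleftrightarrow> x = 0"
  by (auto simp: norm2_def)

lemma norm2_field2:
  assumes "x \<in> field2 (k * t)" "t > 0"
  shows "norm2 k t x \<in> field2 k"
proof -
  have "norm2 k t x ^ (2 ^ k) = (\<Prod>i<t. x ^ (2 ^ (k * Suc i)))"
    unfolding norm2_def prod_power_distrib
    by (intro prod.cong) (auto simp: power_add mult.commute simp flip: power_mult)
  also have "\<dots> = norm2 k t x"
  proof -
    obtain u where u: "t = Suc u" using assms(2) by (cases t) auto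
    have "(\<Prod>i<Suc u. x ^ (2 ^ (k * Suc i))) = (\<Prod>i<u. x ^ (2 ^ (k * Suc i))) * x"
      using assms(1) u by (simp add: field2_def)
    also have "\<dots> = norm2 k t x"
      unfolding norm2_def u by (subst prod.lessThan_Suc_shift) (simp add: mult.commute)
    finally show ?thesis using u by simp
  qed
  finally show ?thesis by (simp add: field2_def)
qed

text \<open>The projective norm graphs of Alon, Ronyai and Szabo, in characteristic 2.\<close>

lemma norm_graph_exists:
  assumes "k > 0" "t > 0"
  obtains V :: "(bit alg_closure \<times> bit alg_closure) set" and R where
    "finite V" "card V = 2 ^ (k * t) * (2 ^ k - 1)" "symp R" "irreflp R"
    "\<And>v. v \<in> V \<Longrightarrow> card {u \<in> V. R v u} \<ge> 2 ^ (k * t) - 1"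
    "\<And>J. J \<subseteq> V \<Longrightarrow> card J = Suc t \<Longrightarrow> card {v \<in> V. \<forall>j\<in>J. R j v} \<le> fact t"
proof -
  define V where "V = field2 (k * t) \<times> (field2 k - {0})"
  \<comment> \<open>The conjunct \<open>a * b \<noteq> 0\<close> makes \<open>R\<close> irreflexive
    on the whole type and not only on \<open>V\<close>: a loop would need
    \<open>norm2 k t (A + A) = 0\<close> to be nonzero.\<close>
  define R where "R = (\<lambda>(A, a) (B, b). norm2 k t (A + B) = a * b \<and> a * b \<noteq> 0)"
  have kt: "k * t > 0" using assms by simp
  have fin: "finite V" unfolding V_def using kt assms finite_field2 by blast
  have 0: "0 \<in> field2 k" by (simp add: field2_def)
  show thesis
  proof (rule that[of V R])
    show "card V = 2 ^ (k * t) * (2 ^ k - 1)"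
      unfolding V_def using 0 kt assms finite_field2 by (simp add: card_cartesian_product card_field2)
    show "symp R" unfolding R_def by (rule sympI) (auto simp: add.commute mult.commute)
    show "irreflp R" unfolding R_def
      by (rule irreflpI) (use assms in \<open>auto simp: char2_add_self norm2_eq_0_iff\<close>, metis assms(2) mult_eq_0_iff norm2_eq_0_iff)
    show "card {u \<in> V. R v u} \<ge> 2 ^ (k * t) - 1" if "v \<in> V" for v
    proof -
      obtain A a where v: "v = (A, a)" by force
      let ?f = "\<lambda>B. (B, norm2 k t (A + B) / a)"
      have a: "a \<noteq> 0" "a \<in> field2 k" "A \<in> field2 (k * t)" using that v by (auto simp: V_def)
      have nz: "norm2 k t (A + B) \<noteq> 0" if "B \<noteq> A" for B
      proof -
        have "A - B \<noteq> 0" using that by simp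
        thus ?thesis using assms(2) by (simp add: norm2_eq_0_iff char2_minus)
      qed
      have "?f ` (field2 (k * t) - {A}) \<subseteq> {u \<in> V. R v u}"
        using a nz assms by (auto simp: V_def v R_def intro!: field2_divide norm2_field2 field2_add)
      hence "card (?f ` (field2 (k * t) - {A})) \<le> card {u \<in> V. R v u}"
        using fin by (intro card_mono) auto
      moreover have "card (?f ` (field2 (k * t) - {A})) = 2 ^ (k * t) - 1"
        using a kt by (subst card_image) (auto intro: inj_onI simp: card_field2)
      ultimately show ?thesis by simp
    qed
    show "card {v \<in> V. \<forall>j\<in>J. R j v} \<le> fact t" if J: "J \<subseteq> V" "card J = Suc t" for J
    proof (cases "{v \<in> V. \<forall>j\<in>J. R j v} = {}")
      case False
      define T where "T = {v \<in> V. \<forall>j\<in>J. R j v}"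
      have finJ: "finite J" using J(1) fin finite_subset by blast
      obtain j0 where j0: "j0 \<in> J" using J(2) by (metis card.empty ex_in_conv nat.distinct(1))
      \<comment> \<open>The conjugates of the first components turn the norm equation into a product
        of linear factors. The second component of a common neighbour is the unknown factor
        \<open>b\<close>; it is recovered from the equation of one fixed \<open>j0\<close>.\<close>
      define a where "a = (\<lambda>i (j :: bit alg_closure \<times> bit alg_closure). fst j ^ (2 ^ (k * i)))"
      define b where "b = (\<lambda>x. (\<Prod>i<t. x i - a i j0) / snd j0)"
      define \<phi> where "\<phi> = (\<lambda>(v :: bit alg_closure \<times> bit alg_closure) i. fst v ^ (2 ^ (k * i)))"
      have prod: "(\<Prod>i<t. \<phi> v i - a i j) = snd j * snd v" "snd j \<noteq> 0" "snd v \<noteq> 0"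
        if "v \<in> T" "j \<in> J" for v j
      proof -
        have Rjv: "R j v" using that T_def by auto
        have "(\<Prod>i<t. \<phi> v i - a i j) = norm2 k t (fst j + fst v)"
          unfolding norm2_def \<phi>_def a_def by (intro prod.cong) (auto simp: char2_minus frobenius_add add.commute)
        thus "(\<Prod>i<t. \<phi> v i - a i j) = snd j * snd v" "snd j \<noteq> 0" "snd v \<noteq> 0"
          using Rjv unfolding R_def by (auto split: prod.splits)
      qed
      have b: "b (\<phi> v) = snd v" if "v \<in> T" for v
        unfolding b_def using prod[OF that j0] by simp
      \<comment> \<open>Vertices of \<open>J\<close> with the same first component also have the
        same second one, as both are determined by a common neighbour. This is why the case without
        common neighbours was split off.\<close>
      have "fst j = fst j' \<Longrightarrow> j = j'" if "j \<in> J" "j' \<in> J" for j j'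
      proof -
        assume eq: "fst j = fst j'"
        obtain v where v: "v \<in> T" using False T_def by auto
        have "snd j * snd v = snd j' * snd v"
          using prod(1)[OF v that(1)] prod(1)[OF v that(2)] eq by (simp add: a_def)
        thus ?thesis using prod(3)[OF v that(1)] eq by (simp add: prod_eq_iff)
      qed
      hence inj: "inj_on (a i) J" for i
        by (intro inj_onI) (auto simp: a_def dest!: frobenius_inj)
      have "card (\<phi> ` T) \<le> fact t"
      proof (rule product_system_solutions[where a=a and c=snd and b=b])
        show "finite (\<phi> ` T)" using fin T_def by auto
        show "(\<Prod>i<t. x i - a i j) = snd j * b x" if "x \<in> \<phi> ` T" "j \<in> J" for x j
        proof -
          obtain v where v: "v \<in> T" "x = \<phi> v" using \<open>x \<in> \<phi> ` T\<close> by blast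
          show ?thesis using prod(1)[OF v(1) \<open>j \<in> J\<close>] b[OF v(1)] v(2) by simp
        qed
        show "b x \<noteq> 0" if "x \<in> \<phi> ` T" for x using that prod(3)[OF _ j0] b by auto
        show "\<exists>i<t. x i \<noteq> y i" if "x \<in> \<phi> ` T" "y \<in> \<phi> ` T" "x \<noteq> y" for x y
        proof (rule exI[of _ 0])
          show "0 < t \<and> x 0 \<noteq> y 0" using that assms(2) by (auto simp: \<phi>_def)
        qed
      qed (use finJ J(2) inj in auto)
      moreover have "inj_on \<phi> T"
      proof (rule inj_onI)
        fix u v assume uv: "u \<in> T" "v \<in> T" "\<phi> u = \<phi> v"
        hence "fst u = fst v" using fun_cong[OF uv(3), of 0] unfolding \<phi>_def by simp
        moreover have "snd u = snd v" using b uv by metis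
        ultimately show "u = v" by (simp add: prod_eq_iff)
      qed
      ultimately show ?thesis by (simp add: card_image T_def)
    qed (simp only: card.empty le0)
  qed (rule fin)
qed

section \<open>Graphs as symmetric relations\<close>

definition adj :: "'a graph \<Rightarrow> 'a \<Rightarrow> 'a \<Rightarrow> bool" where
  "adj G u v \<longleftrightarrow> {u, v} \<in> edges G"

definition graph_of :: "'a set \<Rightarrow> ('a \<Rightarrow> 'a \<Rightarrow> bool) \<Rightarrow> 'a graph" where
  "graph_of V R = (V, {{u, v} | u v. u \<in> V \<and> v \<in> V \<and> R u v})"

text \<open>Ordered pairs are counted, so \<open>pair_count R V V\<close> is twice the number of
  edges; edge counts stay in this doubled form throughout.\<close>

definition pair_count :: "('a \<Rightarrow> 'a \<Rightarrow> bool) \<Rightarrow> 'a set \<Rightarrow> 'a set \<Rightarrow> nat" where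
  "pair_count R A B = (\<Sum>u\<in>A. card {v \<in> B. R u v})"

text \<open>Parts may be larger than prescribed, and their disjointness is implied by irreflexivity
  of the relation. Both keep the constructions of embeddings short.\<close>

definition is_blocks ::
    "('a \<Rightarrow> 'a \<Rightarrow> bool) \<Rightarrow> 'a set \<Rightarrow> 'i set \<Rightarrow> ('i \<Rightarrow> nat) \<Rightarrow> ('i \<Rightarrow> 'a set) \<Rightarrow> bool" where
  "is_blocks R V I r A \<longleftrightarrow> (\<forall>i\<in>I. A i \<subseteq> V \<and> r i \<le> card (A i)) \<and>
     (\<forall>i\<in>I. \<forall>j\<in>I. i \<noteq> j \<longrightarrow> (\<forall>u\<in>A i. \<forall>v\<in>A j. R u v))"

definition has_blocks :: "('a \<Rightarrow> 'a \<Rightarrow> bool) \<Rightarrow> 'a set \<Rightarrow> 'i set \<Rightarrow> ('i \<Rightarrow> nat) \<Rightarrow> bool" where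
  "has_blocks R V I r \<longleftrightarrow> (\<exists>A. is_blocks R V I r A)"

definition has_bip :: "('a \<Rightarrow> 'a \<Rightarrow> bool) \<Rightarrow> 'a set \<Rightarrow> nat \<Rightarrow> nat \<Rightarrow> bool" where
  "has_bip R V a b \<longleftrightarrow> (\<exists>A B. A \<subseteq> V \<and> B \<subseteq> V \<and> a \<le> card A \<and> b \<le> card B \<and> (\<forall>u\<in>A. \<forall>v\<in>B. R u v))"

lemma verts_graph_of [simp]: "verts (graph_of V R) = V"
  by (simp add: graph_of_def)

lemma simple_graph_of: "finite V \<Longrightarrow> irreflp R \<Longrightarrow> simple_graph (graph_of V R)"
  by (auto simp: simple_graph_def graph_of_def irreflp_def card_insert_if)

lemma symp_adj [simp]: "symp (adj G)"
  by (auto simp: symp_def adj_def insert_commute)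

lemma irreflp_adj: "simple_graph G \<Longrightarrow> irreflp (adj G)"
  by (force simp: irreflp_def adj_def simple_graph_def)

lemma graph_of_adj: "simple_graph G \<Longrightarrow> graph_of (verts G) (adj G) = G"
  by (cases G) (fastforce simp: graph_of_def adj_def simple_graph_def card_2_iff)

lemma adj_graph_of: "symp R \<Longrightarrow> adj (graph_of V R) u v \<longleftrightarrow> u \<in> V \<and> v \<in> V \<and> R u v"
  by (auto simp: adj_def graph_of_def doubleton_eq_iff dest: sympD)

lemma pair_count_edges:
  assumes V: "finite V" and R: "symp R" "irreflp R"
  shows "pair_count R V V = 2 * card (edges (graph_of V R))"
proof -
  let ?P = "SIGMA u:V. {v \<in> V. R u v}"
  let ?g = "\<lambda>(u, v). {u, v}"
  have img: "?g ` ?P = edges (graph_of V R)"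
    unfolding graph_of_def by auto
  have "pair_count R V V = card ?P" using V by (simp add: pair_count_def)
  also have "\<dots> = (\<Sum>e\<in>?g ` ?P. card {p \<in> ?P. ?g p = e})"
    using sum.image_gen[of ?P "\<lambda>_. 1 :: nat" ?g] V by simp
  also have "\<dots> = (\<Sum>e\<in>?g ` ?P. 2)"
  proof (rule sum.cong[OF refl])
    fix e assume "e \<in> ?g ` ?P"
    then obtain u v where uv: "u \<in> V" "v \<in> V" "R u v" "e = {u, v}" by auto
    have "u \<noteq> v" using uv(3) R(2) by (auto simp: irreflp_def)
    have "{p \<in> ?P. ?g p = e} = {(u, v), (v, u)}"
      using uv R(1) by (auto simp: doubleton_eq_iff dest: sympD)
    thus "card {p \<in> ?P. ?g p = e} = 2" using \<open>u \<noteq> v\<close> by simp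
  qed
  finally show ?thesis by (simp add: img mult.commute)
qed

lemma pair_count_adj: "simple_graph G \<Longrightarrow> pair_count (adj G) (verts G) (verts G) = 2 * card (edges G)"
  using pair_count_edges[of "verts G" "adj G"] graph_of_adj[of G] irreflp_adj[of G]
  by (simp add: simple_graph_def)

lemma contains_multipartite_iff:
  assumes G: "simple_graph G"
  shows "contains_copy G (complete_multipartite rs) \<longleftrightarrow>
         has_blocks (adj G) (verts G) {..<length rs} (\<lambda>i. rs ! i)"
proof
  assume "contains_copy G (complete_multipartite rs)"
  then obtain f where f: "inj_on f (SIGMA i:{..<length rs}. {..<rs ! i})"
    "f ` (SIGMA i:{..<length rs}. {..<rs ! i}) \<subseteq> verts G"
    "\<And>u v. u \<in> (SIGMA i:{..<length rs}. {..<rs ! i}) \<Longrightarrow> v \<in> (SIGMA i:{..<length rs}. {..<rs ! i})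
      \<Longrightarrow> fst u \<noteq> fst v \<Longrightarrow> f ` {u, v} \<in> edges G"
  proof -
    from \<open>contains_copy G _\<close> obtain f where f: "inj_on f (SIGMA i:{..<length rs}. {..<rs ! i})"
      "f ` (SIGMA i:{..<length rs}. {..<rs ! i}) \<subseteq> verts G"
      "\<forall>e\<in>{{u, v} |u v. u \<in> (SIGMA i:{..<length rs}. {..<rs ! i}) \<and>
        v \<in> (SIGMA i:{..<length rs}. {..<rs ! i}) \<and> fst u \<noteq> fst v}. f ` e \<in> edges G"
      unfolding contains_copy_def complete_multipartite_def Let_def fst_conv snd_conv by (elim exE conjE)
    show thesis
    proof (rule that[OF f(1,2)])
      fix u v assume "u \<in> (SIGMA i:{..<length rs}. {..<rs ! i})" "v \<in> (SIGMA i:{..<length rs}. {..<rs ! i})"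
        "fst u \<noteq> fst v"
      thus "f ` {u, v} \<in> edges G" by (intro bspec[OF f(3)] CollectI exI[of _ u] exI[of _ v]) simp
    qed
  qed
  show "has_blocks (adj G) (verts G) {..<length rs} (\<lambda>i. rs ! i)"
    unfolding has_blocks_def is_blocks_def
  proof (intro exI[of _ "\<lambda>i. f ` ({i} \<times> {..<rs ! i})"] conjI ballI impI)
    fix i assume i: "i \<in> {..<length rs}"
    show "f ` ({i} \<times> {..<rs ! i}) \<subseteq> verts G" using f(2) i by auto
    have "inj_on f ({i} \<times> {..<rs ! i})" using i by (intro inj_on_subset[OF f(1)]) auto
    thus "rs ! i \<le> card (f ` ({i} \<times> {..<rs ! i}))" by (simp add: card_image)
  next
    fix i j u v assume ij: "i \<in> {..<length rs}" "j \<in> {..<length rs}" "i \<noteq> j"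
      and "u \<in> f ` ({i} \<times> {..<rs ! i})" "v \<in> f ` ({j} \<times> {..<rs ! j})"
    then obtain a b where ab: "a < rs ! i" "b < rs ! j" "u = f (i, a)" "v = f (j, b)" by auto
    show "adj G u v" using f(3)[of "(i, a)" "(j, b)"] ij ab by (simp add: adj_def)
  qed
next
  assume "has_blocks (adj G) (verts G) {..<length rs} (\<lambda>i. rs ! i)"
  then obtain A where A: "\<And>i. i < length rs \<Longrightarrow> A i \<subseteq> verts G \<and> rs ! i \<le> card (A i)"
    "\<And>i j u v. i < length rs \<Longrightarrow> j < length rs \<Longrightarrow> i \<noteq> j \<Longrightarrow> u \<in> A i \<Longrightarrow> v \<in> A j \<Longrightarrow> adj G u v"
    unfolding has_blocks_def is_blocks_def by (metis lessThan_iff)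
  have fin: "finite (A i)" if "i < length rs" for i
    using A(1)[OF that] G by (auto simp: simple_graph_def intro: finite_subset)
  have "\<exists>g. inj_on g {..<rs ! i} \<and> g ` {..<rs ! i} \<subseteq> A i" if "i < length rs" for i
    using card_le_inj[of "{..<rs ! i}" "A i"] A(1)[OF that] fin[OF that] by auto
  then obtain g where g: "\<And>i. i < length rs \<Longrightarrow> inj_on (g i) {..<rs ! i} \<and> g i ` {..<rs ! i} \<subseteq> A i"
    by metis
  have gA: "g i a \<in> A i" if "i < length rs" "a < rs ! i" for i a using g that by blast
  define f where "f = (\<lambda>(i, a). g i a)"
  have adjf: "adj G (f u) (f v)"
    if "u \<in> (SIGMA i:{..<length rs}. {..<rs ! i})" "v \<in> (SIGMA i:{..<length rs}. {..<rs ! i})" "fst u \<noteq> fst v" for u v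
    using that A(2) gA unfolding f_def by (auto split: prod.splits)
  show "contains_copy G (complete_multipartite rs)"
    unfolding contains_copy_def complete_multipartite_def Let_def fst_conv snd_conv
  proof (intro exI[of _ f] conjI)
    show "inj_on f (SIGMA i:{..<length rs}. {..<rs ! i})"
    proof (rule inj_onI)
      fix u v assume uv: "u \<in> (SIGMA i:{..<length rs}. {..<rs ! i})" "v \<in> (SIGMA i:{..<length rs}. {..<rs ! i})" "f u = f v"
      have "fst u = fst v" using adjf[OF uv(1,2)] uv(3) irreflp_adj[OF G] by (auto simp: irreflp_def)
      moreover have "snd u = snd v"
        using uv g[of "fst u"] \<open>fst u = fst v\<close> unfolding f_def by (auto dest: inj_onD split: prod.splits)
      ultimately show "u = v" by (simp add: prod_eq_iff)
    qed
    show "f ` (SIGMA i:{..<length rs}. {..<rs ! i}) \<subseteq> verts G"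
      using A(1) gA by (fastforce simp: f_def)
    show "\<forall>e\<in>{{u, v} |u v. u \<in> (SIGMA i:{..<length rs}. {..<rs ! i}) \<and>
        v \<in> (SIGMA i:{..<length rs}. {..<rs ! i}) \<and> fst u \<noteq> fst v}. f ` e \<in> edges G"
    proof (rule ballI, unfold mem_Collect_eq, elim exE conjE)
      fix e u v assume "e = {u, v}" "fst u \<noteq> fst v"
        "u \<in> (SIGMA i:{..<length rs}. {..<rs ! i})" "v \<in> (SIGMA i:{..<length rs}. {..<rs ! i})"
      thus "f ` e \<in> edges G" using adjf[of u v] by (simp add: adj_def)
    qed
  qed
qed

lemma is_blocksD:
  assumes "is_blocks R V I r A"
  shows "i \<in> I \<Longrightarrow> A i \<subseteq> V" "i \<in> I \<Longrightarrow> r i \<le> card (A i)"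
    "i \<in> I \<Longrightarrow> j \<in> I \<Longrightarrow> i \<noteq> j \<Longrightarrow> u \<in> A i \<Longrightarrow> v \<in> A j \<Longrightarrow> R u v"
  using assms unfolding is_blocks_def by blast+

lemma has_blocksI:
  assumes "\<And>i. i \<in> I \<Longrightarrow> A i \<subseteq> V" "\<And>i. i \<in> I \<Longrightarrow> r i \<le> card (A i)"
    "\<And>i j u v. i \<in> I \<Longrightarrow> j \<in> I \<Longrightarrow> i \<noteq> j \<Longrightarrow> u \<in> A i \<Longrightarrow> v \<in> A j \<Longrightarrow> R u v"
  shows "has_blocks R V I r"
  unfolding has_blocks_def by (rule exI[of _ A]) (use assms in \<open>auto simp: is_blocks_def\<close>)

text \<open>Renumbers the parts and lowers the prescribed sizes at once.\<close>

lemma has_blocks_reindex: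
  assumes "bij_betw \<pi> I J" "\<And>i. i \<in> I \<Longrightarrow> r i \<le> s (\<pi> i)"
  shows "has_blocks R V J s \<Longrightarrow> has_blocks R V I r"
proof -
  assume "has_blocks R V J s"
  then obtain A where "is_blocks R V J s A" unfolding has_blocks_def by blast
  note A = is_blocksD[OF this]
  have \<pi>: "\<pi> i \<in> J" if "i \<in> I" for i
    using assms(1) that unfolding bij_betw_def by auto
  have \<pi>': "\<pi> i \<noteq> \<pi> j" if "i \<in> I" "j \<in> I" "i \<noteq> j" for i j
    using assms(1) that unfolding bij_betw_def inj_on_def by auto
  show ?thesis
  proof (rule has_blocksI[where A="\<lambda>i. A (\<pi> i)"])
    show "A (\<pi> i) \<subseteq> V" if "i \<in> I" for i using A(1) \<pi> that by blast
    show "r i \<le> card (A (\<pi> i))" if "i \<in> I" for i using A(2) \<pi> that assms(2) order.trans by blast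
    show "R u v" if "i \<in> I" "j \<in> I" "i \<noteq> j" "u \<in> A (\<pi> i)" "v \<in> A (\<pi> j)" for i j u v
      using A(3)[OF \<pi>[OF that(1)] \<pi>[OF that(2)] \<pi>'[OF that(1-3)]] that by blast
  qed
qed

lemma has_blocks_mono_rel:
  assumes "\<And>u v. u \<in> V \<Longrightarrow> v \<in> V \<Longrightarrow> R u v \<Longrightarrow> R' u v" "has_blocks R V I r"
  shows "has_blocks R' V I r"
proof -
  obtain A where "is_blocks R V I r A" using assms(2) unfolding has_blocks_def by blast
  note A = is_blocksD[OF this]
  show ?thesis
    by (rule has_blocksI[where A=A]) (use A assms(1) in \<open>blast+\<close>)
qed

lemma free_multipartite_iff:
  assumes "finite V" "symp R" "irreflp R"
  shows "free_of (graph_of V R) {complete_multipartite rs} \<longleftrightarrow>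
         \<not> has_blocks R V {..<length rs} (\<lambda>i. rs ! i)"
  using contains_multipartite_iff[OF simple_graph_of[OF assms(1,3)], of rs]
    has_blocks_mono_rel[of V "adj (graph_of V R)" R "{..<length rs}"]
    has_blocks_mono_rel[of V R "adj (graph_of V R)" "{..<length rs}"] adj_graph_of[OF assms(2)]
  unfolding free_of_def verts_graph_of by blast

lemma has_blocks_bip_iff:
  assumes "symp R"
  shows "has_blocks R V {..<length [a, b]} (\<lambda>i. [a, b] ! i) \<longleftrightarrow> has_bip R V a b"
proof
  assume "has_blocks R V {..<length [a, b]} (\<lambda>i. [a, b] ! i)"
  then obtain A where "is_blocks R V {..<length [a, b]} (\<lambda>i. [a, b] ! i) A" unfolding has_blocks_def by blast
  note A = is_blocksD[OF this]
  show "has_bip R V a b" unfolding has_bip_def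
    using A(1)[of 0] A(1)[of 1] A(2)[of 0] A(2)[of 1] A(3)[of 0 1]
    by (intro exI[of _ "A 0"] exI[of _ "A 1"]) auto
next
  assume "has_bip R V a b"
  then obtain A B where AB: "A \<subseteq> V" "B \<subseteq> V" "a \<le> card A" "b \<le> card B" "\<forall>u\<in>A. \<forall>v\<in>B. R u v"
    unfolding has_bip_def by auto
  show "has_blocks R V {..<length [a, b]} (\<lambda>i. [a, b] ! i)"
    by (rule has_blocksI[where A="\<lambda>i. if i = 0 then A else B"])
       (use AB sympD[OF assms] in \<open>auto simp: less_Suc_eq\<close>)
qed

lemma free_bip_iff:
  assumes "finite V" "symp R" "irreflp R"
  shows "free_of (graph_of V R) {complete_multipartite [a, b]} \<longleftrightarrow> \<not> has_bip R V a b"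
  using free_multipartite_iff[OF assms] has_blocks_bip_iff[OF assms(2)] by metis

lemma free_triangle_iff:
  assumes "finite V" "symp R" "irreflp R"
  shows "free_of (graph_of V R) {complete_multipartite [1, 1, 1]} \<longleftrightarrow>
         \<not> (\<exists>u\<in>V. \<exists>v\<in>V. \<exists>w\<in>V. R u v \<and> R v w \<and> R u w)"
proof -
  have "has_blocks R V {..<length [1, 1, 1 :: nat]} (\<lambda>i. [1, 1, 1] ! i) \<longleftrightarrow>
     (\<exists>u\<in>V. \<exists>v\<in>V. \<exists>w\<in>V. R u v \<and> R v w \<and> R u w)" (is "?l = ?r")
  proof
    assume ?l
    then obtain A where "is_blocks R V {..<length [1, 1, 1 :: nat]} (\<lambda>i. [1, 1, 1] ! i) A" unfolding has_blocks_def by blast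
  note A = is_blocksD[OF this]
    have ne: "A i \<noteq> {}" if "1 \<le> card (A i)" for i using that by auto
    obtain u v w where "u \<in> A 0" "v \<in> A 1" "w \<in> A 2"
      using ne[of 0] ne[of 1] ne[of 2] A(2)[of 0] A(2)[of 1] A(2)[of 2] by auto
    moreover from this have "R u v" "R v w" "R u w"
      using A(3)[of 0 1 u v] A(3)[of 1 2 v w] A(3)[of 0 2 u w] by auto
    moreover have "A 0 \<subseteq> V" "A 1 \<subseteq> V" "A 2 \<subseteq> V" using A(1)[of 0] A(1)[of 1] A(1)[of 2] by auto
    ultimately show ?r by blast
  next
    assume ?r
    then obtain u v w where uvw: "u \<in> V" "v \<in> V" "w \<in> V" "R u v" "R v w" "R u w" by auto
    show ?l
      by (rule has_blocksI[where A="\<lambda>i. if i = 0 then {u} else if i = 1 then {v} else {w}"])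
         (use uvw sympD[OF assms(2)] in \<open>auto simp: less_Suc_eq\<close>)
  qed
  thus ?thesis using free_multipartite_iff[OF assms] by metis
qed

section \<open>Extremal numbers and change of the vertex type\<close>

definition image_graph :: "('a \<Rightarrow> 'b) \<Rightarrow> 'a graph \<Rightarrow> 'b graph" where
  "image_graph f G = (f ` verts G, (`) f ` edges G)"

text \<open>\<open>ex_number\<close> refers to graphs on natural numbers; injections carry graphs
  there and back. A copy of a forbidden graph in the image is pulled back by the inverse
  injection.\<close>

lemma image_graph:
  assumes G: "simple_graph G" and f: "inj_on f (verts G)"
  shows "simple_graph (image_graph f G)" "card (verts (image_graph f G)) = card (verts G)"
    "card (edges (image_graph f G)) = card (edges G)"
    "free_of G F \<Longrightarrow> free_of (image_graph f G) F"
proof -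
  have sub: "e \<subseteq> verts G" "card e = 2" if "e \<in> edges G" for e using that G by (auto simp: simple_graph_def)
  show "simple_graph (image_graph f G)"
    using G sub by (auto simp: simple_graph_def image_graph_def card_image[OF inj_on_subset[OF f]])
  show "card (verts (image_graph f G)) = card (verts G)"
    using f by (simp add: image_graph_def card_image)
  have "inj_on ((`) f) (edges G)"
    using sub(1) f by (intro inj_onI) (metis inj_on_image_eq_iff)
  thus "card (edges (image_graph f G)) = card (edges G)" by (simp add: image_graph_def card_image)
  have "contains_copy G H" if "contains_copy (image_graph f G) H" for H :: "'c graph"
  proof -
    obtain g where g: "inj_on g (verts H)" "g ` verts H \<subseteq> f ` verts G" "\<And>e. e \<in> edges H \<Longrightarrow> g ` e \<in> (`) f ` edges G"
      using \<open>contains_copy (image_graph f G) H\<close> unfolding contains_copy_def image_graph_def fst_conv snd_conv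
      by (elim exE conjE, intro that) auto
    let ?h = "inv_into (verts G) f"
    show ?thesis unfolding contains_copy_def
    proof (intro exI[of _ "?h \<circ> g"] conjI ballI)
      show "inj_on (?h \<circ> g) (verts H)"
        by (intro comp_inj_on g(1) inj_on_inv_into g(2))
      show "(?h \<circ> g) ` verts H \<subseteq> verts G"
      proof (rule image_subsetI)
        fix x assume "x \<in> verts H"
        hence "g x \<in> f ` verts G" using g(2) by blast
        thus "(?h \<circ> g) x \<in> verts G" by (simp add: inv_into_into)
      qed
      fix e assume "e \<in> edges H"
      hence "g ` e \<in> (`) f ` edges G" by (rule g(3))
      then obtain e' where e': "g ` e = f ` e'" "e' \<in> edges G" by (rule imageE)
      have "(?h \<circ> g) ` e = ?h ` f ` e'" by (simp only: image_comp[symmetric] e'(1))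
      also have "\<dots> = e'" by (rule inv_into_image_cancel[OF f sub(1)[OF e'(2)]])
      finally show "(?h \<circ> g) ` e \<in> edges G" using e'(2) by (simp only:)
    qed
  qed
  thus "free_of G F \<Longrightarrow> free_of (image_graph f G) F" by (auto simp: free_of_def)
qed

lemma finite_edge_counts:
  "finite {card (edges G) | G :: nat graph. simple_graph G \<and> card (verts G) = n \<and> free_of G F}"
proof (rule finite_subset)
  show "{card (edges G) | G :: nat graph. simple_graph G \<and> card (verts G) = n \<and> free_of G F} \<subseteq> {..2 ^ n}"
  proof safe
    fix V :: "nat set" and E assume "simple_graph (V, E)"
    hence "E \<subseteq> Pow V" "finite V" by (auto simp: simple_graph_def)
    hence "card E \<le> card (Pow V)" by (intro card_mono) auto
    thus "card (edges (V, E)) \<le> 2 ^ card (verts (V, E))" using \<open>finite V\<close> by (simp add: card_Pow)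
  qed
qed simp

lemma card_edges_le_ex_number:
  fixes G :: "'a graph"
  assumes "simple_graph G" "free_of G F"
  shows "card (edges G) \<le> ex_number (card (verts G)) F"
proof -
  have "finite (verts G)" using assms by (simp add: simple_graph_def)
  then obtain f :: "'a \<Rightarrow> nat" where f: "inj_on f (verts G)" using finite_imp_inj_to_nat_seg by blast
  show ?thesis unfolding ex_number_def
    by (rule Max_ge[OF finite_edge_counts]) (use image_graph[OF assms(1) f] assms(2) in \<open>blast intro: sym\<close>)
qed

text \<open>If every forbidden graph has an edge, the edgeless graph is admissible, so the maximum
  in \<open>ex_number\<close> is taken over a nonempty finite set. The extremal graph is moved to
  the given vertex set \<open>V\<close>.\<close>

lemma ex_number_attained:
  fixes V :: "'a set"
  assumes "finite V" "\<forall>H\<in>F. edges H \<noteq> {}"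
  obtains R where "symp R" "irreflp R" "free_of (graph_of V R) F" "\<And>u v. R u v \<Longrightarrow> u \<in> V \<and> v \<in> V"
    "pair_count R V V = 2 * ex_number (card V) F"
proof -
  let ?S = "{card (edges G) | G :: nat graph. simple_graph G \<and> card (verts G) = card V \<and> free_of G F}"
  have "simple_graph ({..<card V}, {})" "free_of ({..<card V}, {}) F"
    using assms(2) by (auto simp: simple_graph_def free_of_def contains_copy_def)
  hence "?S \<noteq> {}" by (metis (mono_tags, lifting) card_lessThan empty_Collect_eq fst_conv)
  hence "Max ?S \<in> ?S" by (rule Max_in[OF finite_edge_counts])
  then obtain G :: "nat graph" where G: "simple_graph G" "card (verts G) = card V" "free_of G F"
    "card (edges G) = ex_number (card V) F" unfolding ex_number_def by auto
  have "finite (verts G)" using G by (simp add: simple_graph_def)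
  then obtain f where f: "bij_betw f (verts G) V"
    using finite_same_card_bij[of "verts G" V] G(2) assms(1) by auto
  let ?H = "image_graph f G"
  have H: "simple_graph ?H" "verts ?H = V" "free_of ?H F" "card (edges ?H) = ex_number (card V) F"
    using image_graph[OF G(1), of f] f G by (auto simp: bij_betw_def image_graph_def)
  show thesis
  proof (rule that[of "adj ?H"])
    show "free_of (graph_of V (adj ?H)) F" using graph_of_adj[OF H(1)] H by simp
    show "pair_count (adj ?H) V V = 2 * ex_number (card V) F" using pair_count_adj[OF H(1)] H by simp
    show "u \<in> V \<and> v \<in> V" if "adj ?H u v" for u v
      using that H(1,2) by (auto simp: adj_def simple_graph_def)
  qed (use irreflp_adj[OF H(1)] in auto)
qed

lemma pair_count_le_ex_number:
  assumes "finite V" "symp R" "irreflp R" "free_of (graph_of V R) F"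
  shows "pair_count R V V \<le> 2 * ex_number (card V) F"
  using card_edges_le_ex_number[OF simple_graph_of[OF assms(1,3)] assms(4)] pair_count_edges[OF assms(1-3)]
  by simp

lemma edges_multipartite_nonempty:
  assumes "i < length rs" "j < length rs" "i \<noteq> j" "rs ! i > 0" "rs ! j > 0"
  shows "edges (complete_multipartite rs) \<noteq> {}"
proof -
  have "{(i, 0), (j, 0)} \<in> edges (complete_multipartite rs)"
    unfolding complete_multipartite_def Let_def snd_conv
    using assms by (intro CollectI exI[of _ "(i, 0)"] exI[of _ "(j, 0)"]) auto
  thus ?thesis by auto
qed

lemma edges_bip_nonempty: "a > 0 \<Longrightarrow> b > 0 \<Longrightarrow> edges (complete_multipartite [a, b]) \<noteq> {}"
  by (rule edges_multipartite_nonempty[of 0 _ 1]) auto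

section \<open>Bounds for complete bipartite graphs\<close>

text \<open>In a disjoint union, one vertex \<open>a0\<close> of a complete bipartite graph
  determines the component of the opposite side and then of its own side, so the whole copy lies in
  one component. Monotonicity is a special case.\<close>

lemma ex_number_bip_superadditive:
  assumes "s > 0" "t > 0"
  defines "F \<equiv> {complete_multipartite [s, t]}"
  shows "ex_number a F + ex_number b F \<le> ex_number (a + b) F"
proof -
  define V1 V2 where "V1 = {..<a}" and "V2 = {a..<a + b}"
  have ne: "\<forall>H\<in>F. edges H \<noteq> {}" unfolding F_def using edges_bip_nonempty assms by auto
  obtain R1 where R1: "symp R1" "irreflp R1" "free_of (graph_of V1 R1) F" "\<And>u v. R1 u v \<Longrightarrow> u \<in> V1 \<and> v \<in> V1"
    "pair_count R1 V1 V1 = 2 * ex_number (card V1) F"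
    using ex_number_attained[of V1 F] ne by (auto simp: V1_def)
  obtain R2 where R2: "symp R2" "irreflp R2" "free_of (graph_of V2 R2) F" "\<And>u v. R2 u v \<Longrightarrow> u \<in> V2 \<and> v \<in> V2"
    "pair_count R2 V2 V2 = 2 * ex_number (card V2) F"
    using ex_number_attained[of V2 F] ne by (auto simp: V2_def)
  have fin: "finite V1" "finite V2" by (auto simp: V1_def V2_def)
  have disj: "V1 \<inter> V2 = {}" by (auto simp: V1_def V2_def)
  define R where "R = (\<lambda>u v. R1 u v \<or> R2 u v)"
  have sym: "symp R" using R1(1) R2(1) unfolding R_def symp_def by blast
  have irr: "irreflp R" using R1(2) R2(2) unfolding R_def irreflp_def by blast
  have nb1: "\<not> has_bip R1 V1 s t" using R1(3) free_bip_iff[OF fin(1) R1(1,2)] by (simp add: F_def)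
  have nb2: "\<not> has_bip R2 V2 s t" using R2(3) free_bip_iff[OF fin(2) R2(1,2)] by (simp add: F_def)
  have "\<not> has_bip R (V1 \<union> V2) s t"
  proof
    assume "has_bip R (V1 \<union> V2) s t"
    then obtain A B where AB: "s \<le> card A" "t \<le> card B" "\<And>u v. u \<in> A \<Longrightarrow> v \<in> B \<Longrightarrow> R u v"
      unfolding has_bip_def by blast
    have "A \<noteq> {}" "B \<noteq> {}" using AB(1,2) assms by auto
    then obtain a0 b0 where ab: "a0 \<in> A" "b0 \<in> B" by blast
    have R12: "R1 u v \<longleftrightarrow> R u v" "R1 v u \<longleftrightarrow> R v u" if "u \<in> V1" for u v
      using that R2(4) disj unfolding R_def by blast+
    have R21: "R2 u v \<longleftrightarrow> R u v" "R2 v u \<longleftrightarrow> R v u" if "u \<in> V2" for u v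
      using that R1(4) disj unfolding R_def by blast+
    show False
    proof (cases "a0 \<in> V1")
      case True
      have B: "B \<subseteq> V1" using AB(3)[OF ab(1)] R12(1)[OF True] R1(4) by blast
      have A: "A \<subseteq> V1" using AB(3)[OF _ ab(2)] R12(2)[of b0] B ab(2) R1(4) by blast
      have "\<forall>u\<in>A. \<forall>v\<in>B. R1 u v" using AB(3) R12(1) A by blast
      with A B AB(1,2) nb1 show False unfolding has_bip_def by blast
    next
      case False
      hence a0: "a0 \<in> V2" using AB(3)[OF ab] R1(4) R2(4) unfolding R_def by blast
      have B: "B \<subseteq> V2" using AB(3)[OF ab(1)] R21(1)[OF a0] R2(4) by blast
      have A: "A \<subseteq> V2" using AB(3)[OF _ ab(2)] R21(2)[of b0] B ab(2) R2(4) by blast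
      have "\<forall>u\<in>A. \<forall>v\<in>B. R2 u v" using AB(3) R21(1) A by blast
      with A B AB(1,2) nb2 show False unfolding has_bip_def by blast
    qed
  qed
  hence "free_of (graph_of (V1 \<union> V2) R) F"
    using free_bip_iff[OF _ sym irr] fin by (simp add: F_def)
  hence "pair_count R (V1 \<union> V2) (V1 \<union> V2) \<le> 2 * ex_number (card (V1 \<union> V2)) F"
    using fin by (intro pair_count_le_ex_number sym irr) auto
  moreover have "pair_count R (V1 \<union> V2) (V1 \<union> V2) = pair_count R1 V1 V1 + pair_count R2 V2 V2"
  proof -
    have "{v \<in> V1 \<union> V2. R u v} = {v \<in> V1. R1 u v}" if "u \<in> V1" for u
      using that R1(4) R2(4) disj unfolding R_def by blast
    moreover have "{v \<in> V1 \<union> V2. R u v} = {v \<in> V2. R2 u v}" if "u \<in> V2" for u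
      using that R1(4) R2(4) disj unfolding R_def by blast
    ultimately show ?thesis unfolding pair_count_def using fin disj by (simp add: sum.union_disjoint)
  qed
  moreover have "card V1 = a" "card V2 = b" "card (V1 \<union> V2) = a + b"
    using disj fin by (simp_all add: V1_def V2_def card_Un_disjoint)
  ultimately show ?thesis using R1(5) R2(5) by simp
qed

lemma ex_number_bip_mono:
  assumes "s > 0" "t > 0" "a \<le> b"
  shows "ex_number a {complete_multipartite [s, t]} \<le> ex_number b {complete_multipartite [s, t]}"
  using ex_number_bip_superadditive[OF assms(1,2), of a "b - a"] assms(3) by simp

text \<open>With \<open>x = 2 ^ k\<close> the norm graph for \<open>t = s - 1\<close> has fewer than
  \<open>x ^ s\<close> vertices and at least \<open>x ^ (2 * s - 1) / 4\<close> ordered adjacent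
  pairs; isolated vertices fill up to \<open>n\<close>. Rounding \<open>n\<close> down to a power of
  \<open>2 ^ s\<close> costs the factor \<open>2 ^ (2 * s - 1)\<close>, and 8 is 4 times the
  doubling in \<open>pair_count\<close>.\<close>

lemma ex_number_bip_lower:
  assumes s: "s \<ge> 2" and t: "t \<ge> fact (s - 1) + 1"
  shows "\<exists>c>0. \<exists>N0. \<forall>n\<ge>N0. c * real n powr (2 - 1 / real s) \<le> real (ex_number n {complete_multipartite [s, t]})"
proof (intro exI[of _ "1 / (8 * 2 ^ (2 * s - 1)) :: real"] exI[of _ "2 ^ s :: nat"] conjI allI impI)
  fix n :: nat assume n: "2 ^ s \<le> n"
  let ?F = "{complete_multipartite [s, t]}"
  \<comment> \<open>The admissible orders are close to powers of \<open>2 ^ s\<close>; consecutive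
    ones differ by a constant factor.\<close>
  obtain k where k: "(2 ^ s) ^ k \<le> n" "n < (2 ^ s) ^ (k + 1)"
  proof -
    have "(2::nat) \<le> 2 ^ s" using s by (cases s) auto
    moreover have "1 \<le> n" using n by (metis le_trans one_le_numeral one_le_power)
    ultimately show thesis using ex_power_ivl1[of "2 ^ s" n] that by blast
  qed
  have k0: "k > 0" using k(2) n by (cases k) auto
  obtain u where u: "s = Suc u" "u > 0" using s by (cases s) auto
  obtain V :: "(bit alg_closure \<times> bit alg_closure) set" and R where
    V: "finite V" "card V = 2 ^ (k * u) * (2 ^ k - 1)" and R: "symp R" "irreflp R"
    and deg: "\<And>v. v \<in> V \<Longrightarrow> card {w \<in> V. R v w} \<ge> 2 ^ (k * u) - 1"
    and com: "\<And>J. J \<subseteq> V \<Longrightarrow> card J = Suc u \<Longrightarrow> card {v \<in> V. \<forall>j\<in>J. R j v} \<le> fact u"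
    using norm_graph_exists[OF k0 u(2)] by blast
  have "\<not> has_bip R V s t"
  proof
    assume "has_bip R V s t"
    then obtain A B where AB: "A \<subseteq> V" "B \<subseteq> V" "s \<le> card A" "t \<le> card B" "\<forall>u\<in>A. \<forall>v\<in>B. R u v"
      unfolding has_bip_def by blast
    obtain J where J: "J \<subseteq> A" "card J = s" using obtain_subset_with_card_n[OF AB(3)] by metis
    have "card B \<le> card {v \<in> V. \<forall>j\<in>J. R j v}"
      using V(1) AB J by (intro card_mono) auto
    also have "\<dots> \<le> fact u" using J AB(1) u by (intro com) auto
    finally show False using AB(4) t u by simp
  qed
  hence "pair_count R V V \<le> 2 * ex_number (card V) ?F"
    using free_bip_iff[OF V(1) R] by (intro pair_count_le_ex_number V R) simp
  also have "\<dots> \<le> 2 * ex_number n ?F"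
  proof -
    have "card V \<le> 2 ^ (k * u) * 2 ^ k" using V(2) by simp
    also have "\<dots> = (2 ^ s) ^ k" by (simp add: u power_add algebra_simps flip: power_mult)
    also have "\<dots> \<le> n" by (rule k(1))
    finally show ?thesis using ex_number_bip_mono[of s t "card V" n] s t by simp
  qed
  finally have 1: "pair_count R V V \<le> 2 * ex_number n ?F" .
  define x where "x = (2::real) ^ k"
  have x2: "x \<ge> 2" unfolding x_def using k0 power_increasing[of 1 k "2::real"] by simp
  have xu: "x ^ u \<ge> x" using u x2 power_increasing[of 1 u x] by simp
  have "real (card V * (2 ^ (k * u) - 1)) \<le> real (pair_count R V V)"
    unfolding pair_count_def of_nat_le_iff using sum_bounded_below[of V "2 ^ (k * u) - 1" "\<lambda>v. card {w \<in> V. R v w}"] deg by simp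
  moreover have "real (card V * (2 ^ (k * u) - 1)) = x ^ u * (x - 1) * (x ^ u - 1)"
    by (simp add: V(2) x_def power_mult of_nat_diff)
  moreover have "x ^ u * (x - 1) * (x ^ u - 1) \<ge> x ^ u * (x / 2) * (x ^ u / 2)"
    using x2 xu by (intro mult_mono) auto
  moreover have "x ^ u * (x / 2) * (x ^ u / 2) = x ^ (2 * s - 1) / 4"
    by (simp add: u mult_2 power_add)
  ultimately have 2: "x ^ (2 * s - 1) / 4 \<le> 2 * real (ex_number n ?F)" using 1 by linarith
  have "real n \<le> (2 * x) ^ s"
  proof -
    have "real n \<le> real ((2 ^ s) ^ (k + 1))" using k(2) by (simp only: of_nat_le_iff)
    also have "\<dots> = (2 * x) ^ s" by (simp add: x_def power_mult_distrib flip: power_mult)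
    finally show ?thesis .
  qed
  hence "real n powr (2 - 1 / real s) \<le> ((2 * x) ^ s) powr (2 - 1 / real s)"
    using s by (intro powr_mono2) (auto simp: field_simps)
  also have "\<dots> = (2 * x) powr (real s * (2 - 1 / real s))"
    using x2 powr_realpow[of "2 * x" s, symmetric] by (simp only: powr_powr)
  also have "real s * (2 - 1 / real s) = real (2 * s - 1)" using s by (simp add: field_simps of_nat_diff)
  also have "(2 * x) powr real (2 * s - 1) = (2 * x) ^ (2 * s - 1)" using x2 by (intro powr_realpow) simp
  also have "\<dots> = 2 ^ (2 * s - 1) * x ^ (2 * s - 1)" by (simp add: power_mult_distrib)
  finally have "1 / (8 * 2 ^ (2 * s - 1)) * real n powr (2 - 1 / real s) \<le> x ^ (2 * s - 1) / 8"
    by (simp add: field_simps)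
  with 2 show "1 / (8 * 2 ^ (2 * s - 1)) * real n powr (2 - 1 / real s) \<le> real (ex_number n ?F)"
    by linarith
qed simp

section \<open>Pigeonhole on neighbourhoods and the Kovari-Sos-Turan bound\<close>

lemma ex_subset_card: "n \<le> card S \<Longrightarrow> \<exists>T. T \<subseteq> S \<and> card T = n"
  by (erule obtain_subset_with_card_n) blast

text \<open>There are only \<open>2 ^ card B\<close> traces on \<open>B\<close>, so some trace is
  shared by \<open>m\<close> vertices, and these are then completely joined to it.\<close>

lemma common_neighbourhood:
  assumes "finite Xs" "finite B" "2 ^ card B * m \<le> card Xs"
  obtains Z W where "Z \<subseteq> Xs" "card Z = m" "W \<subseteq> B" "\<And>z. z \<in> Z \<Longrightarrow> {b \<in> B. R z b} = W"
proof -
  let ?f = "\<lambda>x. {b \<in> B. R x b}"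
  have "\<exists>y\<in>Pow B. card Xs \<le> card (?f -` {y} \<inter> Xs) * card (Pow B)"
    using assms by (intro pigeonhole_card) auto
  then obtain W where W: "W \<subseteq> B" "card Xs \<le> card (?f -` {W} \<inter> Xs) * 2 ^ card B"
    using assms(2) by (auto simp: card_Pow)
  have "2 ^ card B * m \<le> 2 ^ card B * card (?f -` {W} \<inter> Xs)"
    using assms(3) W(2) by (metis le_trans mult.commute)
  hence "m \<le> card (?f -` {W} \<inter> Xs)" by simp
  then obtain Z where "Z \<subseteq> ?f -` {W} \<inter> Xs" "card Z = m" by (rule obtain_subset_with_card_n)
  thus thesis using W(1) by (intro that[of Z W]) auto
qed

text \<open>Vertices of degree at most \<open>L\<close> contribute at most \<open>L * card Xs\<close>; for the others the degree is
  at most \<open>s ^ s / L ^ (s - 1)\<close> times the number of \<open>s\<close>-subsets of the neighbourhood.\<close>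

lemma kovari_sos_turan:
  fixes L :: real
  assumes fin: "finite Xs" "finite Y" and s: "s > 0" "real s \<le> L"
    and few: "\<And>P. P \<subseteq> Y \<Longrightarrow> card P = s \<Longrightarrow> card {x \<in> Xs. \<forall>p\<in>P. R x p} \<le> t"
  shows "real (pair_count R Xs Y) \<le> L * card Xs + real s ^ s * t * real (card Y) ^ s / L ^ (s - 1)"
proof -
  define d where "d x = card {y \<in> Y. R x y}" for x
  define PP where "PP = {P. P \<subseteq> Y \<and> card P = s}"
  have finPP: "finite PP" unfolding PP_def using fin by auto
  have L0: "L > 0" using s by linarith
  have "(\<Sum>x\<in>Xs. d x choose s) = (\<Sum>x\<in>Xs. card {P \<in> PP. \<forall>p\<in>P. R x p})"
  proof (rule sum.cong[OF refl])
    fix x assume "x \<in> Xs"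
    have "d x choose s = card {P. P \<subseteq> {y \<in> Y. R x y} \<and> card P = s}"
      unfolding d_def using fin by (subst n_subsets) auto
    also have "{P. P \<subseteq> {y \<in> Y. R x y} \<and> card P = s} = {P \<in> PP. \<forall>p\<in>P. R x p}"
      unfolding PP_def by auto
    finally show "d x choose s = card {P \<in> PP. \<forall>p\<in>P. R x p}" .
  qed
  also have "\<dots> = (\<Sum>P\<in>PP. card {x \<in> Xs. \<forall>p\<in>P. R x p})"
    using sum_multicount_gen[of Xs PP "\<lambda>x P. \<forall>p\<in>P. R x p" "\<lambda>P. card {x \<in> Xs. \<forall>p\<in>P. R x p}"] fin finPP by simp
  also have "\<dots> \<le> of_nat (card PP) * t"
    by (rule sum_bounded_above) (auto simp: PP_def few)
  also have "\<dots> \<le> card Y ^ s * t"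
  proof -
    have "card PP = card Y choose s" unfolding PP_def using fin by (simp add: n_subsets)
    also have "\<dots> \<le> card Y ^ s" by (cases "s \<le> card Y") (auto simp: binomial_le_pow binomial_eq_0)
    finally show ?thesis by simp
  qed
  finally have cnt: "(\<Sum>x\<in>Xs. d x choose s) \<le> card Y ^ s * t" .
  have pt: "real (d x) \<le> L + real s ^ s / L ^ (s - 1) * real (d x choose s)" for x
  proof (cases "real (d x) \<le> L")
    case True
    thus ?thesis using L0 s by (intro order.trans[OF True]) auto
  next
    case False
    hence ds: "s \<le> d x" using s by linarith
    have "real (d x) * L ^ (s - 1) \<le> real (d x) * real (d x) ^ (s - 1)"
      using False L0 by (intro mult_left_mono power_mono) auto
    also have "\<dots> = real (d x) ^ s" using s by (metis power_minus_mult mult.commute)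
    also have "\<dots> = real s ^ s * (real (d x) / real s) ^ s" using s by (simp add: power_divide)
    also have "\<dots> \<le> real s ^ s * real (d x choose s)"
      using binomial_ge_n_over_k_pow_k[OF ds, where 'a=real] by (intro mult_left_mono) auto
    finally have "real (d x) \<le> real s ^ s / L ^ (s - 1) * real (d x choose s)"
      using L0 by (simp add: field_simps)
    thus ?thesis using L0 by linarith
  qed
  have "real (pair_count R Xs Y) = (\<Sum>x\<in>Xs. real (d x))" unfolding pair_count_def d_def by simp
  also have "\<dots> \<le> (\<Sum>x\<in>Xs. L + real s ^ s / L ^ (s - 1) * real (d x choose s))"
    by (intro sum_mono pt)
  also have "\<dots> = L * card Xs + real s ^ s / L ^ (s - 1) * real (\<Sum>x\<in>Xs. d x choose s)"
    by (simp add: sum.distrib sum_distrib_left)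
  also have "\<dots> \<le> L * card Xs + real s ^ s / L ^ (s - 1) * real (card Y ^ s * t)"
    using cnt L0 by (intro add_left_mono mult_left_mono) (simp_all only: of_nat_le_iff, simp)
  finally show ?thesis by (simp add: algebra_simps)
qed

text \<open>The threshold \<open>\<mu> * m powr (1 - 1 / s)\<close> makes both terms multiples of
  \<open>m powr (2 - 1 / s)\<close>. The parameter \<open>\<mu>\<close> stays free: if one side is
  only a small fraction \<open>\<kappa>\<close> of \<open>m\<close>, then a large
  \<open>\<mu>\<close> followed by a smaller \<open>\<kappa>\<close> makes the constant as small as
  desired.\<close>

lemma kovari_sos_turan_powr:
  fixes m \<kappa> \<mu> :: real
  assumes fin: "finite Xs" "finite Y" and s: "s > 0" "real s \<le> \<mu>" and m: "m \<ge> 1" "card Xs \<le> \<kappa> * m" "card Y \<le> m"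
    and few: "\<And>P. P \<subseteq> Y \<Longrightarrow> card P = s \<Longrightarrow> card {x \<in> Xs. \<forall>p\<in>P. R x p} \<le> t"
  shows "real (pair_count R Xs Y) \<le> (\<mu> * \<kappa> + real s ^ s * t / \<mu> ^ (s - 1)) * m powr (2 - 1 / s)"
proof -
  define L where "L = \<mu> * m powr (1 - 1 / s)"
  have m1: "m powr (1 - 1 / s) \<ge> 1" using s m by (intro ge_one_powr_ge_zero) (auto simp: field_simps)
  have l0: "\<mu> > 0" using s by linarith
  have "\<mu> * 1 \<le> L" unfolding L_def using m1 l0 by (intro mult_left_mono) auto
  hence "real s \<le> L" using s by linarith
  from kovari_sos_turan[OF fin s(1) this few]
  have "real (pair_count R Xs Y) \<le> L * card Xs + real s ^ s * t * real (card Y) ^ s / L ^ (s - 1)" by simp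
  also have "L * card Xs \<le> L * (\<kappa> * m)" using m l0 by (intro mult_left_mono) (auto simp: L_def)
  also have "L * (\<kappa> * m) = \<mu> * \<kappa> * m powr (2 - 1 / s)"
  proof -
    have "m powr (2 - 1 / s) = m powr (1 - 1 / s) * m powr 1"
      by (subst powr_add[symmetric]) simp
    thus ?thesis using m by (simp add: L_def algebra_simps)
  qed
  also have "real s ^ s * t * real (card Y) ^ s / L ^ (s - 1) \<le> real s ^ s * t * m ^ s / L ^ (s - 1)"
    using m l0 by (intro divide_right_mono mult_left_mono power_mono) (auto simp: L_def)
  also have "real s ^ s * t * m ^ s / L ^ (s - 1) = real s ^ s * t / \<mu> ^ (s - 1) * m powr (2 - 1 / s)"
  proof -
    have e: "real s - (1 - 1 / real s) * real (s - 1) = 2 - 1 / real s"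
      using s(1) by (simp add: of_nat_diff field_simps)
    have "L ^ (s - 1) = \<mu> ^ (s - 1) * m powr ((1 - 1 / s) * real (s - 1))"
      using m by (simp add: L_def power_mult_distrib powr_powr flip: powr_realpow)
    moreover have "m ^ s = m powr s" using m by (simp add: powr_realpow)
    moreover have "m powr real s / m powr ((1 - 1 / s) * real (s - 1)) = m powr (2 - 1 / s)"
      by (subst powr_diff[symmetric]) (simp only: e)
    ultimately show ?thesis by (metis (no_types, lifting) times_divide_times_eq)
  qed
  finally show ?thesis by (simp add: algebra_simps)
qed

text \<open>Induction on the number of factors other than the first. A triangle-free factor meets at most
  two of the parts; if it meets two of them then it contains at most \<open>b\<close> of their vertices, and these
  two parts are merged after removing these vertices.\<close>

section \<open>Freeness of joins\<close>

lemma join_bip: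
  fixes A :: "'i \<Rightarrow> 'a set"
  assumes "finite Q" "finite I" "card Q + 2 \<le> card I" "i0 \<in> I" "a \<le> b" "finite U0"
    "symp R" "irreflp R" "\<And>c. c \<in> Q \<Longrightarrow> finite (U c)"
    "\<And>c. c \<in> Q \<Longrightarrow> \<not> has_bip R (U c) 1 b" "\<And>c. c \<in> Q \<Longrightarrow> \<not> has_bip R (U c) 2 2"
    "\<And>c. c \<in> Q \<Longrightarrow> \<not> (\<exists>u\<in>U c. \<exists>v\<in>U c. \<exists>w\<in>U c. R u v \<and> R v w \<and> R u w)"
    "\<And>i. i \<in> I \<Longrightarrow> A i \<subseteq> U0 \<union> (\<Union>c\<in>Q. U c)" "a \<le> card (A i0)" "\<And>i. i \<in> I - {i0} \<Longrightarrow> b \<le> card (A i)"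
    "\<And>i j u v. i \<in> I \<Longrightarrow> j \<in> I \<Longrightarrow> i \<noteq> j \<Longrightarrow> u \<in> A i \<Longrightarrow> v \<in> A j \<Longrightarrow> R u v"
  shows "has_bip R U0 a b"
  using assms
proof (induction Q arbitrary: I A i0 rule: finite_induct)
  case empty
  have "card (I - {i0}) \<noteq> 0" using empty.prems(1-3) by simp
  hence "I - {i0} \<noteq> {}" by (metis card.empty)
  then obtain i1 where i1: "i1 \<in> I" "i1 \<noteq> i0" by blast
  have "A i0 \<subseteq> U0" "A i1 \<subseteq> U0" using empty.prems(12)[OF empty.prems(3)] empty.prems(12)[OF i1(1)] by auto
  moreover have "\<forall>u\<in>A i0. \<forall>v\<in>A i1. R u v" using empty.prems(15) empty.prems(3) i1 by blast
  moreover have "b \<le> card (A i1)" using empty.prems(14) i1 by blast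
  ultimately show ?case unfolding has_bip_def using empty.prems(13) by blast
next
  case (insert c Q)
  note I = insert.prems(1) and cI = insert.prems(2) and i0 = insert.prems(3) and ab = insert.prems(4)
    and sub = insert.prems(12) and ci0 = insert.prems(13) and ci = insert.prems(14) and adjA = insert.prems(15)
  have finA: "finite (A i)" if "i \<in> I" for i
    using sub[OF that] insert.prems(5,8) insert.hyps(1) by (auto intro!: finite_subset[of "A i"])
  define H where "H = {i \<in> I. A i \<inter> U c \<noteq> {}}"
  have H: "H \<subseteq> I" by (auto simp: H_def)
  have H3: "\<not> (\<exists>i\<in>H. \<exists>j\<in>H. \<exists>k\<in>H. i \<noteq> j \<and> j \<noteq> k \<and> i \<noteq> k)"
  proof
    assume "\<exists>i\<in>H. \<exists>j\<in>H. \<exists>k\<in>H. i \<noteq> j \<and> j \<noteq> k \<and> i \<noteq> k"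
    then obtain i j k where ijk: "i \<in> H" "j \<in> H" "k \<in> H" "i \<noteq> j" "j \<noteq> k" "i \<noteq> k" by blast
    then obtain u v w where "u \<in> A i" "u \<in> U c" "v \<in> A j" "v \<in> U c" "w \<in> A k" "w \<in> U c"
      unfolding H_def by blast
    moreover have "i \<in> I" "j \<in> I" "k \<in> I" using ijk H by auto
    moreover from calculation have "R u v" "R v w" "R u w"
      using ijk by (auto intro: adjA[of i j] adjA[of j k] adjA[of i k])
    ultimately show False using insert.prems(11)[of c] by blast
  qed
  have IH: "has_bip R U0 a b" if "I' \<subseteq> I" "card Q + 2 \<le> card I'" "i' \<in> I'"
    "\<And>i. i \<in> I' \<Longrightarrow> A' i \<subseteq> U0 \<union> (\<Union>c\<in>Q. U c)" "a \<le> card (A' i')" "\<And>i. i \<in> I' - {i'} \<Longrightarrow> b \<le> card (A' i)"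
    "\<And>i j u v. i \<in> I' \<Longrightarrow> j \<in> I' \<Longrightarrow> i \<noteq> j \<Longrightarrow> u \<in> A' i \<Longrightarrow> v \<in> A' j \<Longrightarrow> R u v" for I' i' and A' :: "'i \<Rightarrow> 'a set"
  proof (rule insert.IH[of I' i' A'])
    show "finite I'" using finite_subset[OF that(1) I] .
    show "finite (U d)" if "d \<in> Q" for d by (rule insert.prems(8)[OF insertI2[OF that]])
    show "\<not> has_bip R (U d) 1 b" if "d \<in> Q" for d by (rule insert.prems(9)[OF insertI2[OF that]])
    show "\<not> has_bip R (U d) 2 2" if "d \<in> Q" for d by (rule insert.prems(10)[OF insertI2[OF that]])
    show "\<not> (\<exists>u\<in>U d. \<exists>v\<in>U d. \<exists>w\<in>U d. R u v \<and> R v w \<and> R u w)" if "d \<in> Q" for d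
      by (rule insert.prems(11)[OF insertI2[OF that]])
    show "R u v" if "i \<in> I'" "j \<in> I'" "i \<noteq> j" "u \<in> A' i" "v \<in> A' j" for i j u v
      by (rule \<open>\<And>i j u v. i \<in> I' \<Longrightarrow> j \<in> I' \<Longrightarrow> i \<noteq> j \<Longrightarrow> u \<in> A' i \<Longrightarrow> v \<in> A' j \<Longrightarrow> R u v\<close>[OF that])
  qed (fact that insert.prems)+
  show ?case
  proof (cases "\<exists>k\<in>H. \<exists>l\<in>H. k \<noteq> l")
    case True
    then obtain k l where kl: "k \<in> H" "l \<in> H" "k \<noteq> l" by blast
    hence kI: "k \<in> I" "l \<in> I" using H by auto
    have Hkl: "H = {k, l}" using H3 kl by blast
    define S T where "S = A k \<inter> U c" and "T = A l \<inter> U c"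
    have ST: "S \<noteq> {}" "T \<noteq> {}" using kl unfolding H_def S_def T_def by blast+
    have finST: "finite S" "finite T" using finA kI by (auto simp: S_def T_def)
    have RST: "\<forall>u\<in>S. \<forall>v\<in>T. R u v" "\<forall>u\<in>T. \<forall>v\<in>S. R u v"
      using adjA[OF kI] adjA[OF kI(2,1)] kl(3) unfolding S_def T_def by blast+
    have sc: "S \<subseteq> U c" "T \<subseteq> U c" by (auto simp: S_def T_def)
    have card1: "1 \<le> card S" "1 \<le> card T" using ST finST by (simp_all add: Suc_leI card_gt_0_iff)
    \<comment> \<open>\<open>S\<close> and \<open>T\<close> are completely joined, so without
      4-cycles one of them is a single vertex, and then the other has fewer than \<open>b\<close>
      elements. Together they have at most \<open>b\<close>.\<close>
    have "\<not> (2 \<le> card S \<and> 2 \<le> card T)" using insert.prems(10)[of c] sc RST(1) unfolding has_bip_def by blast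
    moreover have "\<not> b \<le> card T" using insert.prems(9)[of c] sc RST(1) card1(1) unfolding has_bip_def by blast
    moreover have "\<not> b \<le> card S" using insert.prems(9)[of c] sc RST(2) card1(2) unfolding has_bip_def by blast
    ultimately have STb: "card S + card T \<le> b" using card1 by linarith
    \<comment> \<open>Merging \<open>A k\<close> and \<open>A l\<close> outside \<open>U c\<close>
      uses up one part together with one factor, so the number of parts still exceeds that of the
      factors by 2. The merged part keeps all but \<open>b\<close> vertices of two parts, hence at
      least \<open>a\<close> if one of them was the small part and at least \<open>b\<close>
      otherwise.\<close>
    define A' where "A' = A(k := (A k \<union> A l) - U c)"
    have "A k \<inter> A l = {}" using adjA[OF kI kl(3)] insert.prems(7) by (auto simp: irreflp_def)
    hence "card (A k \<union> A l) = card (A k) + card (A l)" using finA kI by (intro card_Un_disjoint) auto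
    moreover have "card (A k \<union> A l) - card (S \<union> T) \<le> card ((A k \<union> A l) - (S \<union> T))"
      using finST by (intro diff_card_le_card_Diff) auto
    moreover have "card ((A k \<union> A l) - (S \<union> T)) = card (A' k)"
      by (rule arg_cong[of _ _ card]) (auto simp: A'_def S_def T_def)
    moreover have "card (S \<union> T) \<le> card S + card T" by (rule card_Un_le)
    ultimately have cA': "card (A k) + card (A l) \<le> card (A' k) + b" using STb by linarith
    \<comment> \<open>The merged part takes over the role of the small part if that was one of the
      two.\<close>
    define i' where "i' = (if i0 \<in> {k, l} then k else i0)"
    show ?thesis
    proof (rule IH[of "I - {l}" i' A'])
      show "card Q + 2 \<le> card (I - {l})" using cI kI(2) I insert.hyps by simp
      show "i' \<in> I - {l}" using i0 kI kl(3) by (auto simp: i'_def)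
      show "A' i \<subseteq> U0 \<union> (\<Union>c\<in>Q. U c)" if "i \<in> I - {l}" for i
      proof (cases "i = k")
        case True
        thus ?thesis using sub[OF kI(1)] sub[OF kI(2)] by (auto simp: A'_def)
      next
        case False
        hence "A i \<inter> U c = {}" using that Hkl unfolding H_def by blast
        thus ?thesis using sub[of i] that False by (auto simp: A'_def)
      qed
      show "a \<le> card (A' i')"
      proof (cases "i0 \<in> {k, l}")
        case True
        hence "a + b \<le> card (A k) + card (A l)" using ci0 ci[of k] ci[of l] kI kl(3) by auto
        thus ?thesis using cA' True by (simp add: i'_def)
      next
        case False
        thus ?thesis using ci0 by (simp add: i'_def A'_def)
      qed
      show "b \<le> card (A' i)" if "i \<in> I - {l} - {i'}" for i
      proof (cases "i = k")
        case True
        with that have "i0 \<noteq> k" "i0 \<noteq> l" by (auto simp: i'_def split: if_splits)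
        hence "b \<le> card (A k)" "b \<le> card (A l)" using ci kI by auto
        thus ?thesis using cA' True by simp
      next
        case False
        hence "i \<noteq> i0" using that by (auto simp: i'_def split: if_splits)
        thus ?thesis using False that ci by (auto simp: A'_def)
      qed
      show "R u v" if ij: "i \<in> I - {l}" "j \<in> I - {l}" "i \<noteq> j" and uv: "u \<in> A' i" "v \<in> A' j" for i j u v
      proof -
        obtain i2 where "i2 \<in> I" "u \<in> A i2" "i2 = i \<or> (i = k \<and> i2 = l)"
          using ij(1) uv(1) kI by (auto simp: A'_def split: if_splits)
        moreover obtain j2 where "j2 \<in> I" "v \<in> A j2" "j2 = j \<or> (j = k \<and> j2 = l)"
          using ij(2) uv(2) kI by (auto simp: A'_def split: if_splits)
        ultimately show ?thesis using adjA[of i2 j2 u v] ij by auto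
      qed
    qed auto
  next
    case False
    have "card H \<le> 1"
    proof (cases "H = {}")
      case False
      then obtain h where "h \<in> H" by blast
      hence "H = {h}" using \<open>\<not> (\<exists>k\<in>H. \<exists>l\<in>H. k \<noteq> l)\<close> by blast
      thus ?thesis by simp
    qed simp
    hence cI': "card Q + 2 \<le> card (I - H)" using cI insert.hyps H I finite_subset[OF H I] by (simp add: card_Diff_subset)
    have cards: "a \<le> card (A i)" if "i \<in> I" for i using ci0 ci[of i] ab that by (cases "i = i0") auto
    have "I - H \<noteq> {}" using cI' by (metis card.empty add_2_eq_Suc' not_less_eq_eq le0)
    \<comment> \<open>If the small part itself is dropped, any remaining part serves in its place,
      since \<open>a \<le> b\<close>.\<close>
    define i' where "i' = (if i0 \<in> I - H then i0 else (SOME i. i \<in> I - H))"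
    have i': "i' \<in> I - H" unfolding i'_def using \<open>I - H \<noteq> {}\<close> by (metis some_in_eq)
    show ?thesis
    proof (rule IH[of "I - H" i' A])
      show "A i \<subseteq> U0 \<union> (\<Union>c\<in>Q. U c)" if "i \<in> I - H" for i
        using that sub[of i] unfolding H_def by auto
      show "b \<le> card (A i)" if "i \<in> I - H - {i'}" for i
        using that ci[of i] by (auto simp: i'_def split: if_splits)
      show "R u v" if "i \<in> I - H" "j \<in> I - H" "i \<noteq> j" "u \<in> A i" "v \<in> A j" for i j u v
        using that by (intro adjA[of i j]) auto
    qed (use i' cI' cards in auto)
  qed
qed

section \<open>Star-free graphs of girth 5\<close>

lemma has_bip_1_iff:
  assumes "finite V"
  shows "has_bip R V 1 b \<longleftrightarrow> (\<exists>u\<in>V. b \<le> card {w \<in> V. R u w})"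
proof
  assume "has_bip R V 1 b"
  then obtain A B where AB: "A \<subseteq> V" "B \<subseteq> V" "1 \<le> card A" "b \<le> card B" "\<forall>u\<in>A. \<forall>v\<in>B. R u v"
    unfolding has_bip_def by blast
  from AB(3) obtain u where u: "u \<in> A" by (metis card.empty ex_in_conv not_one_le_zero)
  have "card B \<le> card {w \<in> V. R u w}" using assms AB u by (intro card_mono) auto
  thus "\<exists>u\<in>V. b \<le> card {w \<in> V. R u w}" using AB u by (intro bexI[of _ u]) auto
next
  assume "\<exists>u\<in>V. b \<le> card {w \<in> V. R u w}"
  then obtain u where "u \<in> V" "b \<le> card {w \<in> V. R u w}" by blast
  thus "has_bip R V 1 b" unfolding has_bip_def
    by (intro exI[of _ "{u}"] exI[of _ "{w \<in> V. R u w}"]) auto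
qed

lemma has_bip_2_2_iff:
  "has_bip R V 2 2 \<longleftrightarrow> (\<exists>p\<in>V. \<exists>q\<in>V. \<exists>w\<in>V. \<exists>z\<in>V. p \<noteq> q \<and> w \<noteq> z \<and> R p w \<and> R p z \<and> R q w \<and> R q z)"
proof
  assume "has_bip R V 2 2"
  then obtain A B where AB: "A \<subseteq> V" "B \<subseteq> V" "2 \<le> card A" "2 \<le> card B" "\<forall>u\<in>A. \<forall>v\<in>B. R u v"
    unfolding has_bip_def by blast
  obtain A' where "A' \<subseteq> A" "card A' = 2" using AB(3) obtain_subset_with_card_n by metis
  then obtain p q where "p \<in> A" "q \<in> A" "p \<noteq> q" by (auto simp: card_2_iff)
  moreover obtain B' where "B' \<subseteq> B" "card B' = 2" using AB(4) obtain_subset_with_card_n by metis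
  then obtain w z where "w \<in> B" "z \<in> B" "w \<noteq> z" by (auto simp: card_2_iff)
  ultimately show "\<exists>p\<in>V. \<exists>q\<in>V. \<exists>w\<in>V. \<exists>z\<in>V. p \<noteq> q \<and> w \<noteq> z \<and> R p w \<and> R p z \<and> R q w \<and> R q z"
    using AB(1,2,5) by blast
next
  assume "\<exists>p\<in>V. \<exists>q\<in>V. \<exists>w\<in>V. \<exists>z\<in>V. p \<noteq> q \<and> w \<noteq> z \<and> R p w \<and> R p z \<and> R q w \<and> R q z"
  then obtain p q w z where "p \<in> V" "q \<in> V" "w \<in> V" "z \<in> V" "p \<noteq> q" "w \<noteq> z"
    "R p w" "R p z" "R q w" "R q z" by blast
  thus "has_bip R V 2 2" unfolding has_bip_def
    by (intro exI[of _ "{p, q}"] exI[of _ "{w, z}"]) auto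
qed

abbreviation (input) girth5_family :: "nat \<Rightarrow> (nat \<times> nat) graph set" where
  "girth5_family b \<equiv> {complete_multipartite [1, b], complete_multipartite [2, 2], complete_multipartite [1, 1, 1]}"

lemma free_girth5_iff:
  assumes "finite V" "symp R" "irreflp R"
  shows "free_of (graph_of V R) (girth5_family b) \<longleftrightarrow> \<not> has_bip R V 1 b \<and> \<not> has_bip R V 2 2 \<and>
     \<not> (\<exists>u\<in>V. \<exists>v\<in>V. \<exists>w\<in>V. R u v \<and> R v w \<and> R u w)"
proof -
  have "free_of (graph_of V R) (girth5_family b) \<longleftrightarrow> free_of (graph_of V R) {complete_multipartite [1, b]} \<and>
      free_of (graph_of V R) {complete_multipartite [2, 2]} \<and> free_of (graph_of V R) {complete_multipartite [1, 1, 1]}"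
    unfolding free_of_def by blast
  thus ?thesis by (simp only: free_bip_iff[OF assms] free_triangle_iff[OF assms])
qed

lemma girth5_edges_nonempty: "b > 0 \<Longrightarrow> \<forall>H\<in>girth5_family b. edges H \<noteq> {}"
  using edges_bip_nonempty[of 1 b] edges_bip_nonempty[of 2 2]
    edges_multipartite_nonempty[of 0 "[1, 1, 1]" 1] by auto

section \<open>Gaining an edge by switching\<close>

definition far :: "('a \<Rightarrow> 'a \<Rightarrow> bool) \<Rightarrow> 'a \<Rightarrow> 'a \<Rightarrow> bool" where
  "far R z w \<longleftrightarrow> z \<noteq> w \<and> \<not> R z w \<and> (\<forall>p. R z p \<longrightarrow> \<not> R p w) \<and> (\<forall>p q. R z p \<longrightarrow> R p q \<longrightarrow> \<not> R q w)"

text \<open>The edge \<open>{x, y}\<close> is replaced by \<open>{u, x}\<close> and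
  \<open>{v, y}\<close>: the degrees of \<open>x\<close> and \<open>y\<close> stay, \<open>u\<close>
  and \<open>v\<close> gain one each, and \<open>u = v\<close> is allowed. The condition
  \<open>far\<close> means distance at least 4, so that the new edges close no short cycle.\<close>

definition switch :: "('a \<Rightarrow> 'a \<Rightarrow> bool) \<Rightarrow> 'a \<Rightarrow> 'a \<Rightarrow> 'a \<Rightarrow> 'a \<Rightarrow> 'a \<Rightarrow> 'a \<Rightarrow> bool" where
  "switch R u v x y a b \<longleftrightarrow> R a b \<and> {a, b} \<noteq> {x, y} \<or> {a, b} = {u, x} \<or> {a, b} = {v, y}"

lemma switch_sym: "symp R \<Longrightarrow> symp (switch R u v x y)"
  unfolding switch_def symp_def by (metis doubleton_eq_iff)

lemma switch_swap: "switch R u v x y = switch R v u y x"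
  unfolding switch_def by (intro ext) (auto simp: insert_commute)

text \<open>Excludes triangles through the new edge \<open>{u, x}\<close>. The statement for
  \<open>{v, y}\<close> is the same one after exchanging \<open>u, x\<close> with
  \<open>v, y\<close>, by \<open>switch_swap\<close>.\<close>

lemma switch_no_path2:
  assumes R: "symp R" "irreflp R" and xy: "R x y"
    and far: "far R u x" "far R u y" "far R v x" "far R v y"
    and "switch R u v x y x c" "switch R u v x y c u"
  shows False
proof -
  have s: "R a b \<Longrightarrow> R b a" "\<not> R a a" for a b using R by (auto dest: sympD simp: irreflp_def)
  have ne: "x \<noteq> y" "u \<noteq> x" "u \<noteq> y" "v \<noteq> x" "v \<noteq> y" using xy s(2)[of x] far by (auto simp: far_def)
  have "R x c \<and> c \<noteq> y \<or> c = u" using assms(8) ne by (auto simp: switch_def doubleton_eq_iff)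
  moreover have "R c u \<or> c = x \<or> c = y" using assms(9) ne by (auto simp: switch_def doubleton_eq_iff)
  moreover have "\<not> R u c \<or> \<not> R c x" using far(1) unfolding far_def by blast
  ultimately show False using ne s(1)[of x c] s(1)[of c u] s(2)[of u] s(2)[of x] by (elim disjE conjE) simp_all
qed

text \<open>Excludes 4-cycles through the new edge \<open>{u, x}\<close>. The remaining three edges
  would be old, giving a path from \<open>u\<close> to \<open>x\<close> that is too short, or they
  would use the second new edge; then \<open>c\<close> would be a common neighbour of
  \<open>x\<close> and \<open>y\<close> in the old graph, which has no triangle.\<close>

lemma switch_no_path3:
  assumes R: "symp R" "irreflp R" and xy: "R x y"
    and far: "far R u x" "far R u y" "far R v x" "far R v y"
    and tri: "\<forall>p q r. R p q \<longrightarrow> R q r \<longrightarrow> \<not> R p r"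
    and c: "switch R u v x y x c" "c \<noteq> u" and e: "switch R u v x y c e" "e \<noteq> x" "switch R u v x y e u"
  shows False
proof -
  have s: "R a b \<Longrightarrow> R b a" "\<not> R a a" for a b using R by (auto dest: sympD simp: irreflp_def)
  have ne: "x \<noteq> y" "u \<noteq> x" "u \<noteq> y" "v \<noteq> x" "v \<noteq> y" using xy s(2)[of x] far by (auto simp: far_def)
  have xc: "R x c" "c \<noteq> y" using c ne by (auto simp: switch_def doubleton_eq_iff)
  have "c \<noteq> v" using s(1)[OF xc(1)] far(3) unfolding far_def by auto
  hence ce: "R c e" using e(1) xc c(2) s by (auto simp: switch_def doubleton_eq_iff)
  from e(3) have "R e u \<or> e = y" using e(2) ne by (auto simp: switch_def doubleton_eq_iff)
  thus False
  proof
    assume "R e u"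
    from s(1)[OF this] s(1)[OF ce] s(1)[OF xc(1)] have "R u e" "R e c" "R c x" .
    thus False using far(1) by (simp add: far_def)
  next
    assume "e = y"
    thus False using tri xc(1) ce xy by blast
  qed
qed

text \<open>A short cycle cannot use a new edge, by the two path lemmas; so all its edges are old,
  contrary to the assumption on \<open>R\<close>.\<close>

lemma switch_girth5:
  assumes R: "symp R" "irreflp R" and xy: "R x y"
    and far: "far R u x" "far R u y" "far R v x" "far R v y"
    and tri: "\<forall>p q r. R p q \<longrightarrow> R q r \<longrightarrow> \<not> R p r"
    and C4: "\<forall>p q w z. p \<noteq> q \<longrightarrow> w \<noteq> z \<longrightarrow> R p w \<longrightarrow> R p z \<longrightarrow> R q w \<longrightarrow> \<not> R q z"
  defines "R' \<equiv> switch R u v x y"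
  shows "R' p q \<Longrightarrow> R' q r \<Longrightarrow> R' p r \<Longrightarrow> False"
    and "p \<noteq> q \<Longrightarrow> w \<noteq> z \<Longrightarrow> R' p w \<Longrightarrow> R' p z \<Longrightarrow> R' q w \<Longrightarrow> R' q z \<Longrightarrow> False"
proof -
  have s': "R' a b \<Longrightarrow> R' b a" for a b unfolding R'_def by (rule sympD[OF switch_sym[OF R(1)]])
  have yx: "R y x" using R xy by (auto dest: sympD)
  have new: "R a b \<or> a = u \<and> b = x \<or> a = x \<and> b = u \<or> a = v \<and> b = y \<or> a = y \<and> b = v" if "R' a b" for a b
    using that by (auto simp: R'_def switch_def doubleton_eq_iff)
  have p2: False if "R' x c" "R' c u" for c
    using switch_no_path2[OF R xy far] that unfolding R'_def by blast
  have p2': False if "R' y c" "R' c v" for c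
    using switch_no_path2[OF R yx far(4,3,2,1)] that unfolding R'_def switch_swap[of R u] by blast
  have t: "R a b" if "R' a b" "R' b c" "R' a c" for a b c
    using new[OF that(1)] p2 p2' s' that by blast
  show False if "R' p q" "R' q r" "R' p r"
    using tri t[OF that] t[OF that(2) s'[OF that(3)] s'[OF that(1)]] t[OF that(3) s'[OF that(2)] that(1)] by blast
  have p3: False if "R' x c" "c \<noteq> u" "R' c e" "e \<noteq> x" "R' e u" for c e
    using switch_no_path3[OF R xy far tri] that unfolding R'_def by blast
  have p3': False if "R' y c" "c \<noteq> v" "R' c e" "e \<noteq> y" "R' e v" for c e
    using switch_no_path3[OF R yx far(4,3,2,1) tri] that unfolding R'_def switch_swap[of R u] by blast
  have c: "R p w" if pq: "p \<noteq> q" "w \<noteq> z" "R' p w" "R' p z" "R' q w" "R' q z" for p q w z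
  proof (rule ccontr)
    assume "\<not> R p w"
    with new[OF pq(3)] consider "p = u" "w = x" | "p = x" "w = u" | "p = v" "w = y" | "p = y" "w = v" by blast
    thus False
    proof cases
      case 1 thus False using p3[of q z] s' pq by blast
    next
      case 2 thus False using p3[of z q] s' pq by blast
    next
      case 3 thus False using p3'[of q z] s' pq by blast
    next
      case 4 thus False using p3'[of z q] s' pq by blast
    qed
  qed
  show False if pq: "p \<noteq> q" "w \<noteq> z" "R' p w" "R' p z" "R' q w" "R' q z"
    using C4 pq c[OF pq] c[of p q z w] c[of q p w z] c[of q p z w] by metis
qed

lemma switch_degree:
  assumes V: "finite V" "u \<in> V" "v \<in> V" "x \<in> V" "y \<in> V" and R: "symp R" "irreflp R" and xy: "R x y"
    and far: "far R u x" "far R u y" "far R v x" "far R v y" and "z \<in> V"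
  shows "card {w \<in> V. switch R u v x y z w} = card {w \<in> V. R z w} + of_bool (z = u) + of_bool (z = v)"
proof -
  have s: "R a b \<Longrightarrow> R b a" "\<not> R a a" for a b using R by (auto dest: sympD simp: irreflp_def)
  have ne: "x \<noteq> y" "u \<noteq> x" "u \<noteq> y" "v \<noteq> x" "v \<noteq> y" using xy s(2)[of x] far by (auto simp: far_def)
  have nr: "\<not> R x u" "\<not> R u x" "\<not> R y v" "\<not> R v y" "\<not> R u y" "\<not> R v x" using far s(1)[of x u] s(1)[of y v] by (auto simp: far_def)
  let ?N = "\<lambda>z. {w \<in> V. R z w}"
  let ?M = "{w \<in> V. switch R u v x y z w}"
  have swap: "card (insert b (?N a - {c})) = card (?N a)" if "c \<in> ?N a" "b \<notin> ?N a" for a b c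
  proof -
    have "card (insert b (?N a - {c})) = Suc (card (?N a - {c}))"
      using that V(1) by (intro card_insert_disjoint) auto
    also have "\<dots> = card (?N a)" using that V(1) by (intro card_Suc_Diff1) auto
    finally show ?thesis .
  qed
  consider "z = x" | "z = y" | "z = u" "z = v" | "z = u" "z \<noteq> v" | "z = v" "z \<noteq> u" | "z \<notin> {x, y, u, v}" by blast
  thus ?thesis
  proof cases
    case 1
    have "?M = insert u (?N x - {y})" using 1 ne V by (auto simp: switch_def doubleton_eq_iff)
    thus ?thesis using swap[of y x u] 1 ne V xy nr by simp
  next
    case 2
    have "?M = insert v (?N y - {x})" using 2 ne V by (auto simp: switch_def doubleton_eq_iff)
    thus ?thesis using swap[of x y v] 2 ne V xy s(1)[OF xy] nr by simp
  next
    case 3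
    have "?M = insert x (insert y (?N z))" using 3 ne V by (auto simp: switch_def doubleton_eq_iff)
    moreover have "x \<notin> insert y (?N z)" "y \<notin> ?N z" using 3 ne nr by auto
    ultimately show ?thesis using 3 V(1) by simp
  next
    case 4
    have "?M = insert x (?N z)" using 4 ne V by (auto simp: switch_def doubleton_eq_iff)
    moreover have "x \<notin> ?N z" using 4 nr by auto
    ultimately show ?thesis using 4 V(1) by simp
  next
    case 5
    have "?M = insert y (?N z)" using 5 ne V by (auto simp: switch_def doubleton_eq_iff)
    moreover have "y \<notin> ?N z" using 5 nr by auto
    ultimately show ?thesis using 5 V(1) by simp
  next
    case 6
    hence "?M = ?N z" by (auto simp: switch_def doubleton_eq_iff)
    thus ?thesis using 6 by simp
  qed
qed

text \<open>A total deficiency of 2 sits at one vertex or at two; the case \<open>u = v\<close>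
  corresponds to a switch that raises one degree by 2.\<close>

lemma two_deficient_vertices:
  fixes f :: "'a \<Rightarrow> nat"
  assumes "finite V" "\<And>z. z \<in> V \<Longrightarrow> f z \<le> d" "(\<Sum>z\<in>V. f z) + 2 \<le> d * card V"
  obtains u v where "u \<in> V" "v \<in> V" "\<And>z. z \<in> V \<Longrightarrow> f z + of_bool (z = u) + of_bool (z = v) \<le> d"
proof (cases "\<exists>z\<in>V. f z + 2 \<le> d")
  case True
  then obtain z where "z \<in> V" "f z + 2 \<le> d" by blast
  thus thesis using assms(2) by (intro that[of z z]) auto
next
  case False
  let ?D = "{z \<in> V. f z < d}"
  have "d * card V = (\<Sum>z\<in>V. d)" by simp
  also have "\<dots> \<le> (\<Sum>z\<in>V. f z + of_bool (z \<in> ?D))"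
    using False assms(2) by (intro sum_mono) (force simp: of_bool_def)
  also have "\<dots> = (\<Sum>z\<in>V. f z) + (\<Sum>z\<in>V. of_bool (z \<in> ?D))" by (simp add: sum.distrib)
  also have "(\<Sum>z\<in>V. of_bool (z \<in> ?D)) = card ?D"
    using assms(1) by (simp add: of_bool_def sum.If_cases Int_def)
  finally have "2 \<le> card ?D" using assms(3) by linarith
  then obtain D where "D \<subseteq> ?D" "card D = 2" by (rule obtain_subset_with_card_n)
  then obtain u v where "u \<in> ?D" "v \<in> ?D" "u \<noteq> v" by (auto simp: card_2_iff)
  thus thesis using assms(2) by (intro that[of u v]) (auto simp: of_bool_def Suc_le_eq)
qed

text \<open>A maximal graph falls short of degree \<open>d\<close> everywhere by at most 1 in total;
  otherwise there are vertices \<open>u\<close>, \<open>v\<close> with room for one more edge each,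
  and a switch with an edge far from both gains an edge. The bound on \<open>m\<close> is the size
  of the ball of radius 4 around \<open>{u, v}\<close>, plus two vertices.\<close>

lemma girth5_extremal_lower:
  assumes m: "m \<ge> 2 * (d + 1) ^ 4 + 2" and d: "d > 0"
  shows "d * m \<le> 2 * ex_number m (girth5_family (Suc d)) + 1"
proof (rule ccontr)
  let ?F = "girth5_family (Suc d)"
  assume contra: "\<not> d * m \<le> 2 * ex_number m ?F + 1"
  define V where "V = {..<m}"
  have V: "finite V" "card V = m" by (auto simp: V_def)
  obtain R where R: "symp R" "irreflp R" and free: "free_of (graph_of V R) ?F"
    and RV: "\<And>u v. R u v \<Longrightarrow> u \<in> V \<and> v \<in> V" and pc: "pair_count R V V = 2 * ex_number m ?F"
    using ex_number_attained[OF V(1) girth5_edges_nonempty[of "Suc d"]] V(2) by (metis zero_less_Suc)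
  have max: "pair_count R' V V \<le> pair_count R V V" if "symp R'" "irreflp R'" "free_of (graph_of V R') ?F" for R'
    using pair_count_le_ex_number[OF V(1) that] V(2) pc by simp
  define N where "N z = {w \<in> V. R z w}" for z
  note free_all = free[unfolded free_girth5_iff[OF V(1) R]]
  note free' = free_all[THEN conjunct1] free_all[THEN conjunct2, THEN conjunct1] free_all[THEN conjunct2, THEN conjunct2]
  have deg: "card (N z) \<le> d" if "z \<in> V" for z
    using free'(1) that unfolding has_bip_1_iff[OF V(1)] N_def by (metis not_less_eq_eq)
  have tri: "\<forall>p q r. R p q \<longrightarrow> R q r \<longrightarrow> \<not> R p r" using free'(3) RV by blast
  have C4: "\<forall>p q w z. p \<noteq> q \<longrightarrow> w \<noteq> z \<longrightarrow> R p w \<longrightarrow> R p z \<longrightarrow> R q w \<longrightarrow> \<not> R q z"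
    using free'(2) RV unfolding has_bip_2_2_iff by blast
  have s: "R a b \<Longrightarrow> R b a" "\<not> R a a" for a b using R by (auto dest: sympD simp: irreflp_def)
  have "(\<Sum>z\<in>V. card (N z)) + 2 \<le> d * card V"
    using contra pc V(2) by (simp add: pair_count_def N_def)
  from two_deficient_vertices[OF V(1) deg this]
  obtain u v where uv: "u \<in> V" "v \<in> V" "\<And>z. z \<in> V \<Longrightarrow> card (N z) + of_bool (z = u) + of_bool (z = v) \<le> d" by metis
  define E where "E S = S \<union> (\<Union>z\<in>S. N z)" for S
  have E: "finite (E S) \<and> E S \<subseteq> V \<and> card (E S) \<le> (d + 1) * card S" if "S \<subseteq> V" for S
  proof -
    have S: "finite S" using that V(1) finite_subset by blast
    have "card (E S) \<le> card S + card (\<Union>z\<in>S. N z)" unfolding E_def by (rule card_Un_le)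
    also have "card (\<Union>z\<in>S. N z) \<le> (\<Sum>z\<in>S. card (N z))" by (rule card_UN_le[OF S])
    also have "\<dots> \<le> of_nat (card S) * d" using that deg by (intro sum_bounded_above) auto
    finally have "card (E S) \<le> (d + 1) * card S" by (simp add: algebra_simps)
    moreover have "E S \<subseteq> V" using that by (auto simp: E_def N_def)
    ultimately show ?thesis using V(1) finite_subset by blast
  qed
  \<comment> \<open>The closed ball of radius \<open>k\<close> around \<open>{u, v}\<close>. An
    endpoint outside \<open>B 4\<close> has all its neighbours outside \<open>B 3\<close>, so both
    endpoints are far from \<open>u\<close> and \<open>v\<close>.\<close>
  define B where "B k = (E ^^ k) {u, v}" for k
  have B: "B k \<subseteq> V \<and> card (B k) \<le> 2 * (d + 1) ^ k" for k
  proof (induction k)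
    case 0
    show ?case using uv card_insert_le_m1[of 2 "{v}" u] by (simp add: B_def)
  next
    case (Suc k)
    have "card (B (Suc k)) \<le> (d + 1) * card (B k)" using E[of "B k"] Suc by (simp add: B_def)
    also have "\<dots> \<le> (d + 1) * (2 * (d + 1) ^ k)" using Suc by (intro mult_left_mono) auto
    finally show ?case using E[of "B k"] Suc by (simp add: B_def algebra_simps)
  qed
  have step: "a \<in> B (Suc k)" if "b \<in> B k" "R b a \<or> a = b" for a b k
    using that RV by (auto simp: B_def E_def N_def)
  have uvB: "u \<in> B 0" "v \<in> B 0" by (auto simp: B_def)
  have mono: "b \<in> B l" if "b \<in> B k" "k \<le> l" for b k l
    using that(2,1) by (induction rule: dec_induct) (auto intro: step)
  have far: "far R c a" if a: "a \<notin> B 3" and c: "c \<in> B 0" for a c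
    unfolding far_def
  proof (intro conjI allI impI notI)
    show False if "c = a" using mono[OF c, of 3] a that by simp
    show False if "R c a" using mono[OF step[OF c disjI1[OF that]], of 3] a by simp
    show False if "R c p" "R p a" for p
      using mono[OF step[OF step[OF c disjI1[OF that(1)]] disjI1[OF that(2)]], of 3] a by simp
    show False if "R c p" "R p q" "R q a" for p q
      using mono[OF step[OF step[OF step[OF c disjI1[OF that(1)]] disjI1[OF that(2)]] disjI1[OF that(3)]], of 3] a by simp
  qed
  show False
  proof (cases "\<exists>x\<in>V - B 4. \<exists>y. R x y")
    case True
    then obtain x y where xy: "x \<notin> B 4" "R x y" by blast
    have xyV: "x \<in> V" "y \<in> V" using RV xy by auto
    have x3: "x \<notin> B 3" using step[of x 3 x] xy(1) by auto
    have y3: "y \<notin> B 3" using step[of y 3 x] xy s(1)[OF xy(2)] by auto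
    have fars: "far R u x" "far R u y" "far R v x" "far R v y" using far x3 y3 uvB by auto
    let ?R' = "switch R u v x y"
    have deg': "card {w \<in> V. ?R' z w} = card (N z) + of_bool (z = u) + of_bool (z = v)" if "z \<in> V" for z
      unfolding N_def by (rule switch_degree) (use V uv xyV R xy fars that in auto)
    note g = switch_girth5[OF R xy(2) fars tri C4]
    have sym': "symp ?R'" by (rule switch_sym[OF R(1)])
    have "u \<noteq> x" "v \<noteq> y" using fars by (auto simp: far_def)
    hence irr': "irreflp ?R'" using s(2) by (auto simp: irreflp_def switch_def doubleton_eq_iff)
    have "free_of (graph_of V ?R') ?F"
      unfolding free_girth5_iff[OF V(1) sym' irr'] has_bip_1_iff[OF V(1)] has_bip_2_2_iff
    proof (intro conjI notI)
      assume "\<exists>z\<in>V. Suc d \<le> card {w \<in> V. ?R' z w}"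
      thus False using deg' uv(3) by (metis not_less_eq_eq)
    next
      assume "\<exists>p\<in>V. \<exists>q\<in>V. \<exists>w\<in>V. \<exists>z\<in>V. p \<noteq> q \<and> w \<noteq> z \<and> ?R' p w \<and> ?R' p z \<and> ?R' q w \<and> ?R' q z"
      thus False using g(2) by blast
    next
      assume "\<exists>a\<in>V. \<exists>b\<in>V. \<exists>c\<in>V. ?R' a b \<and> ?R' b c \<and> ?R' a c"
      thus False using g(1) by blast
    qed
    from max[OF sym' irr' this] have "pair_count ?R' V V \<le> pair_count R V V" .
    moreover have "pair_count ?R' V V = pair_count R V V + 1 + 1"
      using uv(1,2) V(1) unfolding pair_count_def by (simp add: deg' sum.distrib of_bool_def flip: N_def)
    ultimately show False by simp
  next
    \<comment> \<open>All vertices outside the ball are isolated. Two of them can be joined: an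
      isolated edge lies on no cycle, and degree 1 is allowed because \<open>d > 0\<close>.\<close>
    case False
    have B4: "B 4 \<subseteq> V" "card (B 4) \<le> 2 * (d + 1) ^ 4" using B[of 4] by auto
    have "finite (B 4)" using B4(1) V(1) finite_subset by blast
    hence "2 \<le> card (V - B 4)" using B4 V m by (simp add: card_Diff_subset)
    then obtain D where "D \<subseteq> V - B 4" "card D = 2" by (rule obtain_subset_with_card_n)
    then obtain x y where xy: "x \<in> V - B 4" "y \<in> V - B 4" "x \<noteq> y" by (auto simp: card_2_iff)
    have iso: "\<not> R x w" "\<not> R w x" "\<not> R y w" "\<not> R w y" for w using False xy s(1)[of w x] s(1)[of w y] by blast+
    define R' where "R' = (\<lambda>a b. R a b \<or> {a, b} = {x, y})"
    have sym': "symp R'" using R(1) by (auto simp: R'_def symp_def insert_commute)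
    have irr': "irreflp R'" using s(2) xy(3) by (auto simp: R'_def irreflp_def doubleton_eq_iff)
    have nb: "R' x w \<longleftrightarrow> w = y" "R' y w \<longleftrightarrow> w = x" "R' w x \<longleftrightarrow> w = y" "R' w y \<longleftrightarrow> w = x"
      "a \<noteq> x \<Longrightarrow> a \<noteq> y \<Longrightarrow> R' a w \<longleftrightarrow> R a w" for a w
      using iso xy(3) by (auto simp: R'_def doubleton_eq_iff)
    have deg': "card {w \<in> V. R' z w} = card (N z) + of_bool (z = x) + of_bool (z = y)" if "z \<in> V" for z
    proof -
      consider "z = x" | "z = y" | "z \<noteq> x" "z \<noteq> y" by blast
      thus ?thesis
      proof cases
        case 1
        moreover have "{w \<in> V. R' x w} = {y}" "N x = {}" using xy nb iso by (auto simp: N_def)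
        ultimately show ?thesis using xy by simp
      next
        case 2
        moreover have "{w \<in> V. R' y w} = {x}" "N y = {}" using xy nb iso by (auto simp: N_def)
        ultimately show ?thesis using xy by simp
      next
        case 3
        thus ?thesis by (simp add: nb N_def)
      qed
    qed
    have "free_of (graph_of V R') ?F"
      unfolding free_girth5_iff[OF V(1) sym' irr'] has_bip_1_iff[OF V(1)] has_bip_2_2_iff
    proof (intro conjI notI)
      assume "\<exists>z\<in>V. Suc d \<le> card {w \<in> V. R' z w}"
      then obtain z where z: "z \<in> V" "Suc d \<le> card {w \<in> V. R' z w}" by blast
      show False
      proof (cases "z = x \<or> z = y")
        case True
        hence "N z = {}" using iso by (auto simp: N_def)
        thus False using z deg'[OF z(1)] d xy(3) True by (auto simp: of_bool_def split: if_splits)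
      next
        case False
        thus False using z deg'[OF z(1)] deg[OF z(1)] by simp
      qed
    next
      assume "\<exists>p\<in>V. \<exists>q\<in>V. \<exists>w\<in>V. \<exists>z\<in>V. p \<noteq> q \<and> w \<noteq> z \<and> R' p w \<and> R' p z \<and> R' q w \<and> R' q z"
      thus False using nb C4 by metis
    next
      assume "\<exists>a\<in>V. \<exists>b\<in>V. \<exists>c\<in>V. R' a b \<and> R' b c \<and> R' a c"
      thus False using nb tri xy(3) by metis
    qed
    from max[OF sym' irr' this] have "pair_count R' V V \<le> pair_count R V V" .
    moreover have "pair_count R' V V = pair_count R V V + 1 + 1"
      using xy(1,2) V(1) unfolding pair_count_def by (simp add: deg' sum.distrib of_bool_def flip: N_def)
    ultimately show False by simp
  qed
qed

lemma ex_number_star_upper: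
  assumes "b > 0"
  shows "2 * ex_number m {complete_multipartite [1, b]} \<le> (b - 1) * m"
proof -
  have "\<forall>H\<in>{complete_multipartite [1, b]}. edges H \<noteq> {}" using edges_bip_nonempty[of 1 b] assms by simp
  from ex_number_attained[OF finite_lessThan[of m] this] obtain R where
    R: "symp R" "irreflp R" "free_of (graph_of {..<m} R) {complete_multipartite [1, b]}"
    "pair_count R {..<m} {..<m} = 2 * ex_number (card {..<m}) {complete_multipartite [1, b]}" by metis
  have "\<not> has_bip R {..<m} 1 b" using R(3) free_bip_iff[OF _ R(1,2)] by simp
  hence star: "\<not> b \<le> card {w \<in> {..<m}. R z w}" if "z < m" for z
    using that unfolding has_bip_1_iff[OF finite_lessThan] by blast
  have "card {w \<in> {..<m}. R z w} \<le> b - 1" if "z < m" for z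
    using star[OF that] by linarith
  hence "pair_count R {..<m} {..<m} \<le> of_nat (card {..<m}) * (b - 1)"
    unfolding pair_count_def by (intro sum_bounded_above) auto
  thus ?thesis using R(4) by (simp add: mult.commute)
qed

lemma ex_number_girth5_le_star:
  assumes "b > 0"
  shows "ex_number m (girth5_family b) \<le> ex_number m {complete_multipartite [1, b]}"
proof -
  from ex_number_attained[OF finite_lessThan[of m] girth5_edges_nonempty[OF assms]] obtain R where
    R: "symp R" "irreflp R" "free_of (graph_of {..<m} R) (girth5_family b)"
    "pair_count R {..<m} {..<m} = 2 * ex_number (card {..<m}) (girth5_family b)" by metis
  have "free_of (graph_of {..<m} R) {complete_multipartite [1, b]}" using R(3) by (auto simp: free_of_def)
  from pair_count_le_ex_number[OF _ R(1,2) this] R(4) show ?thesis by simp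
qed

text \<open>Both numbers lie between \<open>((b - 1) * m - 1) / 2\<close> and
  \<open>(b - 1) * m / 2\<close>, an interval that contains only one integer.\<close>

lemma ex_number_girth5_eq_star:
  assumes "b \<ge> 2" "m \<ge> 2 * b ^ 4 + 2"
  shows "ex_number m (girth5_family b) = ex_number m {complete_multipartite [1, b]}"
proof -
  obtain d where d: "b = Suc d" "d > 0" using assms(1) by (cases b) auto
  have "d * m \<le> 2 * ex_number m (girth5_family b) + 1" using girth5_extremal_lower[of d m] d assms(2) by simp
  moreover have "2 * ex_number m {complete_multipartite [1, b]} \<le> d * m" using ex_number_star_upper[of b m] d by simp
  moreover have "ex_number m (girth5_family b) \<le> ex_number m {complete_multipartite [1, b]}"
    using ex_number_girth5_le_star[of b m] d by simp
  ultimately show ?thesis by linarith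
qed

section \<open>Erdos-Simonovits stability\<close>

lemma pair_count_swap: "symp R \<Longrightarrow> finite A \<Longrightarrow> finite B \<Longrightarrow> pair_count R A B = pair_count R B A"
proof -
  assume R: "symp R" and fin: "finite A" "finite B"
  have "pair_count R A B = (\<Sum>v\<in>B. card {u \<in> A. R u v})" unfolding pair_count_def
    by (rule sum_multicount_gen) (use fin in auto)
  also have "\<dots> = pair_count R B A" unfolding pair_count_def
    by (intro sum.cong arg_cong[of _ _ card]) (use R in \<open>auto dest: sympD\<close>)
  finally show ?thesis .
qed

lemma pair_count_le: "finite B \<Longrightarrow> pair_count R A B \<le> card A * card B"
  unfolding pair_count_def using sum_bounded_above[of A "\<lambda>u. card {v \<in> B. R u v}" "card B"]
  by (simp add: card_mono)

lemma pair_count_mono: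
  assumes "finite A'" "finite B'" "A \<subseteq> A'" "B \<subseteq> B'"
  shows "pair_count R A B \<le> pair_count R A' B'"
proof -
  have "pair_count R A B \<le> pair_count R A B'" unfolding pair_count_def
    using assms by (intro sum_mono card_mono) auto
  also have "\<dots> \<le> pair_count R A' B'" unfolding pair_count_def
    using assms by (intro sum_mono2) auto
  finally show ?thesis .
qed

lemma pair_count_remove:
  assumes "finite V" "v \<in> V" "symp R" "irreflp R"
  shows "pair_count R V V = pair_count R (V - {v}) (V - {v}) + 2 * card {w \<in> V. R v w}"
proof -
  let ?W = "V - {v}"
  have *: "card {w \<in> V. R u w} = card {w \<in> ?W. R u w} + of_bool (R u v)" for u
  proof (cases "R u v")
    case True
    hence "{w \<in> V. R u w} = insert v {w \<in> ?W. R u w}" using assms(2) by auto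
    thus ?thesis using True assms(1) by simp
  next
    case False
    hence "{w \<in> V. R u w} = {w \<in> ?W. R u w}" by auto
    thus ?thesis using False by simp
  qed
  have "(\<Sum>u\<in>?W. of_bool (R u v)) = card {w \<in> ?W. R w v}"
    using assms(1) by (simp add: of_bool_def sum.If_cases Int_def)
  also have "{w \<in> ?W. R w v} = {w \<in> V. R v w}"
    using assms by (auto dest: sympD simp: irreflp_def)
  finally have "(\<Sum>u\<in>?W. card {w \<in> V. R u w}) = pair_count R ?W ?W + card {w \<in> V. R v w}"
    by (simp add: pair_count_def * sum.distrib)
  thus ?thesis using assms(1,2) by (simp add: pair_count_def[of R V] sum.remove)
qed

text \<open>A subset maximizing \<open>pair_count R V' V' - \<alpha> * (card V' ^ 2 + card V')\<close> has minimum degree at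
  least \<open>\<alpha> * card V'\<close>.\<close>

lemma dense_core:
  fixes \<alpha> :: real
  assumes V: "finite V" and R: "symp R" "irreflp R"
  obtains V' where "V' \<subseteq> V" "\<And>v. v \<in> V' \<Longrightarrow> \<alpha> * card V' \<le> card {w \<in> V'. R v w}"
    "pair_count R V V - \<alpha> * (real (card V) ^ 2 + card V) \<le>
     pair_count R V' V' - \<alpha> * (real (card V') ^ 2 + card V')"
proof -
  define f where "f W = pair_count R W W - \<alpha> * (real (card W) ^ 2 + card W)" for W
  have "finite (f ` Pow V)" "f ` Pow V \<noteq> {}" using V by auto
  from Max_in[OF this] obtain V' where V': "V' \<subseteq> V" "f V' = Max (f ` Pow V)" by auto
  have max: "f W \<le> f V'" if "W \<subseteq> V" for W
    unfolding V'(2) using that V by (intro Max_ge) auto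
  have finV': "finite V'" using V' V finite_subset by blast
  have "\<alpha> * card V' \<le> card {w \<in> V'. R v w}" if v: "v \<in> V'" for v
  proof -
    have "card V' > 0" using v finV' by (auto simp: card_gt_0_iff)
    hence c: "real (card (V' - {v})) = real (card V') - 1" using v finV' by (simp add: of_nat_diff)
    have "f (V' - {v}) \<le> f V'" using V'(1) by (intro max) auto
    hence "pair_count R (V' - {v}) (V' - {v}) - \<alpha> * ((real (card V') - 1) ^ 2 + (real (card V') - 1))
       \<le> pair_count R V' V' - \<alpha> * (real (card V') ^ 2 + card V')" unfolding f_def c .
    thus ?thesis using pair_count_remove[OF finV' v R] by (simp add: power2_eq_square algebra_simps)
  qed
  moreover have "f V \<le> f V'" by (rule max) simp
  ultimately show thesis using V'(1) by (intro that[of V']) (auto simp: f_def)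
qed

section \<open>The Erdos-Stone theorem\<close>

lemma has_blocks_mono: "has_blocks R V I r \<Longrightarrow> V \<subseteq> V' \<Longrightarrow> has_blocks R V' I r"
  unfolding has_blocks_def is_blocks_def by (elim ex_forward) blast

lemma blocks_exact:
  assumes "has_blocks R V I (\<lambda>_. m)"
  obtains B where "is_blocks R V I (\<lambda>_. m) B" "\<forall>i\<in>I. card (B i) = m"
proof -
  obtain A where A: "is_blocks R V I (\<lambda>_. m) A" using assms unfolding has_blocks_def by blast
  have "\<exists>B. i \<in> I \<longrightarrow> B \<subseteq> A i \<and> card B = m" for i
    using is_blocksD(2)[OF A, of i] ex_subset_card[of m "A i"] by blast
  hence "\<exists>B. \<forall>i. i \<in> I \<longrightarrow> B i \<subseteq> A i \<and> card (B i) = m" by (intro choice allI)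
  then obtain B where B: "\<And>i. i \<in> I \<Longrightarrow> B i \<subseteq> A i \<and> card (B i) = m" by blast
  have "is_blocks R V I (\<lambda>_. m) B" unfolding is_blocks_def
  proof (intro conjI ballI impI)
    show "B i \<subseteq> V" "m \<le> card (B i)" if "i \<in> I" for i using B[OF that] is_blocksD(1)[OF A that] by auto
    show "R u v" if "i \<in> I" "j \<in> I" "i \<noteq> j" "u \<in> B i" "v \<in> B j" for i j u v
      using B[OF that(1)] B[OF that(2)] is_blocksD(3)[OF A that(1-3)] that(4,5) by blast
  qed
  thus thesis using B by (intro that) auto
qed

text \<open>Both the induction for Erdos-Stone and the stability argument sort the vertices by their
  numbers of neighbours in the blocks of a complete multipartite graph with equal parts. A vertex is
  \<open>rich\<close> if it could contribute to one further part.\<close>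

locale block_family =
  fixes V :: "'a set" and R and p M :: nat and B :: "nat \<Rightarrow> 'a set"
  assumes finV: "finite V" and symR: "symp R" and irrR: "irreflp R"
    and blocks: "is_blocks R V {1..p} (\<lambda>_. M) B" and exact: "\<And>i. i \<in> {1..p} \<Longrightarrow> card (B i) = M"
begin

definition W where "W = (\<Union>i\<in>{1..p}. B i)"
definition g where "g x i = card {b \<in> B i. R x b}"

lemma B_sub: "i \<in> {1..p} \<Longrightarrow> B i \<subseteq> V" using is_blocksD(1)[OF blocks] .

lemma B_fin: "i \<in> {1..p} \<Longrightarrow> finite (B i)" using B_sub finV finite_subset by blast

lemma B_disj: "i \<in> {1..p} \<Longrightarrow> j \<in> {1..p} \<Longrightarrow> i \<noteq> j \<Longrightarrow> B i \<inter> B j = {}"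
  using is_blocksD(3)[OF blocks, of i j] irrR unfolding irreflp_def by blast

lemma W_fin: "finite W" using B_fin by (auto simp: W_def)

lemma W_card: "card W = p * M"
proof -
  have "card W = (\<Sum>i\<in>{1..p}. card (B i))" unfolding W_def
    using B_fin B_disj by (intro card_UN_disjoint) auto
  thus ?thesis using exact by simp
qed

lemma g_le: "i \<in> {1..p} \<Longrightarrow> g x i \<le> M"
  unfolding g_def using card_mono[OF B_fin, of i "{b \<in> B i. R x b}"] exact by auto

lemma nb_W: "card {b \<in> W. R x b} = (\<Sum>i\<in>{1..p}. g x i)"
proof -
  have "{b \<in> W. R x b} = (\<Union>i\<in>{1..p}. {b \<in> B i. R x b})" by (auto simp: W_def)
  thus ?thesis unfolding g_def using B_fin B_disj by (simp add: card_UN_disjoint disjoint_iff)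
qed

lemma nb_W_le: "card {b \<in> W. R x b} \<le> p * M"
  unfolding nb_W using sum_bounded_above[of "{1..p}" "g x" M] g_le by simp

lemma nb_W_le': "i \<in> {1..p} \<Longrightarrow> card {b \<in> W. R x b} \<le> (p - 1) * M + g x i"
proof -
  assume i: "i \<in> {1..p}"
  have "(\<Sum>j\<in>{1..p} - {i}. g x j) \<le> of_nat (card ({1..p} - {i})) * M"
    by (rule sum_bounded_above) (use g_le in auto)
  moreover have "(\<Sum>j\<in>{1..p}. g x j) = g x i + (\<Sum>j\<in>{1..p} - {i}. g x j)"
    by (rule sum.remove) (use i in auto)
  moreover have "card ({1..p} - {i}) = p - 1" using i by simp
  ultimately show ?thesis unfolding nb_W by simp
qed

lemma degree_count:
  assumes "\<And>b. b \<in> V \<Longrightarrow> D \<le> real (card {w \<in> V. R b w})"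
  shows "real p * M * D \<le> (\<Sum>x\<in>V. real (card {b \<in> W. R x b}))"
proof -
  have "W \<subseteq> V" using B_sub unfolding W_def by blast
  hence "real (card W) * D \<le> (\<Sum>b\<in>W. real (card {w \<in> V. R b w}))"
    using sum_bounded_below[of W D "\<lambda>b. real (card {w \<in> V. R b w})"] assms by auto
  also have "\<dots> = real (pair_count R V W)"
    using pair_count_swap[OF symR finV W_fin] by (simp add: pair_count_def)
  finally show ?thesis by (simp add: W_card pair_count_def)
qed

definition rich where "rich m = {x \<in> V. \<forall>i\<in>{1..p}. m \<le> g x i}"

text \<open>Among so many rich vertices, \<open>m\<close> have the same trace on the union of the
  blocks. They form the new part, and the trace cuts the old blocks down to parts that still have at
  least \<open>m\<close> vertices.\<close>

lemma extend:
  assumes "m > 0" "2 ^ (p * M) * m \<le> card (rich m)"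
  shows "has_blocks R V {1..Suc p} (\<lambda>_. m)"
proof -
  have "finite (rich m)" using finV by (simp add: rich_def)
  from common_neighbourhood[OF this W_fin, of m R] obtain Z Y where
    Z: "Z \<subseteq> rich m" "card Z = m" "Y \<subseteq> W" "\<And>z. z \<in> Z \<Longrightarrow> {b \<in> W. R z b} = Y"
    using assms(2) by (auto simp: W_card)
  obtain z where z: "z \<in> Z" using Z(2) assms(1) by fastforce
  have BY: "B i \<inter> Y = {b \<in> B i. R z b}" if "i \<in> {1..p}" for i
    using Z(4)[OF z] that by (auto simp: W_def)
  show ?thesis
  proof (rule has_blocksI[where A="\<lambda>i. if i = Suc p then Z else B i \<inter> Y"])
    fix i assume i: "i \<in> {1..Suc p}"
    show "(if i = Suc p then Z else B i \<inter> Y) \<subseteq> V" using Z(1) B_sub[of i] i by (auto simp: rich_def)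
    show "m \<le> card (if i = Suc p then Z else B i \<inter> Y)"
    proof (cases "i = Suc p")
      case False
      hence "i \<in> {1..p}" using i by auto
      thus ?thesis using z Z(1) False BY[of i] by (auto simp: rich_def g_def)
    qed (use Z in simp)
  next
    fix i j u v assume ij: "i \<in> {1..Suc p}" "j \<in> {1..Suc p}" "i \<noteq> j"
      "u \<in> (if i = Suc p then Z else B i \<inter> Y)" "v \<in> (if j = Suc p then Z else B j \<inter> Y)"
    have ZY: "R a b" if "a \<in> Z" "b \<in> Y" for a b using Z(4)[OF that(1)] that(2) by blast
    consider "i = Suc p" "j \<in> {1..p}" | "j = Suc p" "i \<in> {1..p}" | "i \<in> {1..p}" "j \<in> {1..p}" using ij by force
    thus "R u v"
    proof cases
      case 1 thus ?thesis using ij ZY by auto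
    next
      case 2 thus ?thesis using ij ZY[of v u] sympD[OF symR] by auto
    next
      case 3 thus ?thesis using ij is_blocksD(3)[OF blocks, of i j u v] by auto
    qed
  qed
qed

end

text \<open>Induction on the number of parts: from much larger blocks of size \<open>M\<close>,
  obtained for one part fewer, double counting the edges that leave the blocks yields a positive
  proportion of rich vertices.\<close>

lemma erdos_stone_min_degree:
  assumes "\<epsilon> > 0" "m > 0"
  shows "\<exists>N0::nat. \<forall>(V::'a set) R. finite V \<longrightarrow> symp R \<longrightarrow> irreflp R \<longrightarrow> N0 \<le> card V \<longrightarrow>
    (p > 0 \<longrightarrow> (\<forall>v\<in>V. (1 - 1 / real p + \<epsilon>) * card V \<le> card {w \<in> V. R v w})) \<longrightarrow>
    has_blocks R V {1..Suc p} (\<lambda>_. m)"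
  using assms
proof (induction p arbitrary: m)
  case 0
  show ?case
  proof (intro exI[of _ m] allI impI)
    fix V :: "'a set" and R assume "m \<le> card V"
    thus "has_blocks R V {1..Suc 0} (\<lambda>_. m)" by (intro has_blocksI[where A="\<lambda>_. V"]) auto
  qed
next
  case (Suc p)
  define P where "P = Suc p"
  \<comment> \<open>The loss \<open>m\<close> for a vertex that is not rich must be at most half of
    the surplus \<open>\<epsilon> * M\<close>.\<close>
  define M where "M = m + nat \<lceil>2 * m / \<epsilon>\<rceil>"
  have M: "M > 0" "2 * m \<le> \<epsilon> * M"
  proof -
    have "2 * m / \<epsilon> \<le> M" unfolding M_def by linarith
    thus "2 * m \<le> \<epsilon> * M" using Suc.prems(1) by (simp add: field_simps)
  qed (use Suc.prems in \<open>simp add: M_def\<close>)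
  obtain N1 where N1: "\<forall>(V::'a set) R. finite V \<longrightarrow> symp R \<longrightarrow> irreflp R \<longrightarrow> N1 \<le> card V \<longrightarrow>
    (p > 0 \<longrightarrow> (\<forall>v\<in>V. (1 - 1 / real p + \<epsilon>) * card V \<le> card {w \<in> V. R v w})) \<longrightarrow>
    has_blocks R V {1..P} (\<lambda>_. M)" using Suc.IH[OF Suc.prems(1) M(1)] unfolding P_def by (elim exE)
  define c where "c = 2 * (2 ^ (P * M) * m) / \<epsilon>"
  show ?case
  proof (intro exI[of _ "N1 + nat \<lceil>c\<rceil>"] allI impI)
    fix V :: "'a set" and R
    assume V: "finite V" and R: "symp R" "irreflp R" and n: "N1 + nat \<lceil>c\<rceil> \<le> card V"
      and deg: "0 < Suc p \<longrightarrow> (\<forall>v\<in>V. (1 - 1 / real (Suc p) + \<epsilon>) * card V \<le> card {w \<in> V. R v w})"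
    define n where "n = real (card V)"
    have deg': "(1 - 1 / real P + \<epsilon>) * n \<le> card {w \<in> V. R v w}" if "v \<in> V" for v
      using deg that by (simp add: P_def n_def)
    have "has_blocks R V {1..P} (\<lambda>_. M)"
    proof (rule N1[THEN spec, THEN spec, THEN mp, THEN mp, THEN mp, THEN mp, THEN mp, OF V R])
      show "p > 0 \<longrightarrow> (\<forall>v\<in>V. (1 - 1 / real p + \<epsilon>) * card V \<le> card {w \<in> V. R v w})"
      proof
      assume p: "p > 0"
      have "(1 - 1 / real p + \<epsilon>) * n \<le> (1 - 1 / real P + \<epsilon>) * n"
        using p by (intro mult_right_mono) (auto simp: P_def n_def field_simps)
      thus "\<forall>v\<in>V. (1 - 1 / real p + \<epsilon>) * card V \<le> card {w \<in> V. R v w}"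
        using deg' order.trans unfolding n_def by blast
      qed
    qed (use n in simp)
    then obtain B where B: "is_blocks R V {1..P} (\<lambda>_. M) B" "\<forall>i\<in>{1..P}. card (B i) = M"
      by (rule blocks_exact) 
    interpret block_family V R P M B using V R B by unfold_locales auto
    have "real P * M * ((1 - 1 / real P + \<epsilon>) * n) \<le> (\<Sum>x\<in>V. real (card {b \<in> W. R x b}))"
      by (rule degree_count) (rule deg')
    \<comment> \<open>A vertex that is not rich has fewer than \<open>m\<close> neighbours in some
      block and at most \<open>M\<close> in each of the others.\<close>
    also have "\<dots> \<le> (\<Sum>x\<in>V. (real P - 1) * M + m + (if x \<in> rich m then real M else 0))"
    proof (rule sum_mono)
      fix x assume x: "x \<in> V"
      have P1: "real (P - 1) = real P - 1" by (simp add: P_def)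
      show "real (card {b \<in> W. R x b}) \<le> (real P - 1) * M + m + (if x \<in> rich m then real M else 0)"
      proof (cases "x \<in> rich m")
        case True
        have "real (card {b \<in> W. R x b}) \<le> real (P * M)" using nb_W_le by (simp only: of_nat_le_iff)
        thus ?thesis using True by (simp add: algebra_simps)
      next
        case False
        then obtain i where i: "i \<in> {1..P}" "g x i \<le> m" using x unfolding rich_def by force
        have "real (card {b \<in> W. R x b}) \<le> real ((P - 1) * M + g x i)" using nb_W_le'[OF i(1)] by (simp only: of_nat_le_iff)
        also have "\<dots> = (real P - 1) * M + g x i" by (simp only: of_nat_add of_nat_mult P1)
        finally show ?thesis using i(2) False by simp
      qed
    qed
    also have "\<dots> = ((real P - 1) * M + m) * n + M * card (rich m)"
    proof -
      have "(\<Sum>x\<in>V. if x \<in> rich m then real M else 0) = M * card (rich m)"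
        using V by (simp add: sum.If_cases rich_def Int_def)
      thus ?thesis by (simp only: sum.distrib sum_constant) (simp add: n_def algebra_simps)
    qed
    finally have cnt: "real P * M * ((1 - 1 / real P + \<epsilon>) * n) \<le> ((real P - 1) * M + m) * n + M * card (rich m)" .
    have "real P > 0" by (simp add: P_def)
    hence "real P * (1 - 1 / real P + \<epsilon>) = real P - 1 + real P * \<epsilon>" by (simp add: field_simps)
    hence "real P * M * ((1 - 1 / real P + \<epsilon>) * n) = (real P - 1 + real P * \<epsilon>) * (M * n)"
      by (metis (no_types, opaque_lifting) mult.assoc mult.left_commute)
    with cnt have "(real P - 1 + real P * \<epsilon>) * (M * n) \<le> ((real P - 1) * M + m) * n + M * card (rich m)" by linarith
    hence "(real P * M * \<epsilon> - m) * n \<le> M * card (rich m)" by (simp add: algebra_simps)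
    moreover have "(\<epsilon> * M / 2) * n \<le> (real P * M * \<epsilon> - m) * n"
    proof (intro mult_right_mono)
      have "1 * (M * \<epsilon>) \<le> real P * (M * \<epsilon>)" using Suc.prems by (intro mult_right_mono) (auto simp: P_def)
      thus "\<epsilon> * M / 2 \<le> real P * M * \<epsilon> - m" using M(2) by (simp add: algebra_simps)
    qed (simp add: n_def)
    ultimately have "M * (\<epsilon> / 2 * n) \<le> M * real (card (rich m))" by (simp add: algebra_simps)
    hence "\<epsilon> / 2 * n \<le> card (rich m)" using M(1) by simp
    moreover have "real (2 ^ (P * M) * m) \<le> \<epsilon> / 2 * n"
    proof -
      have "c \<le> n" using n unfolding n_def by linarith
      thus ?thesis using Suc.prems(1) by (simp add: c_def field_simps)
    qed
    ultimately have "real (2 ^ (P * M) * m) \<le> real (card (rich m))" by linarith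
    hence "2 ^ (P * M) * m \<le> card (rich m)" by (simp only: of_nat_le_iff)
    thus "has_blocks R V {1..Suc (Suc p)} (\<lambda>_. m)" using extend[OF Suc.prems(2)] by (simp add: P_def)
  qed
qed

text \<open>Passing to the dense core turns edge density into minimum degree. The core is large: its
  at most \<open>n' ^ 2\<close> ordered pairs must carry the surplus of order
  \<open>\<epsilon> * n ^ 2\<close> which the maximized quantity inherits from
  \<open>V\<close>.\<close>

lemma erdos_stone_edges:
  fixes \<epsilon> :: real
  assumes \<epsilon>: "\<epsilon> > 0" and m: "m > 0" and q: "q > 0"
  shows "\<exists>N0::nat. \<forall>(V::'a set) R. finite V \<longrightarrow> symp R \<longrightarrow> irreflp R \<longrightarrow> N0 \<le> card V \<longrightarrow>
    \<not> has_blocks R V {1..Suc q} (\<lambda>_. m) \<longrightarrow> pair_count R V V \<le> (1 - 1 / real q + \<epsilon>) * real (card V) ^ 2"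
proof -
  have "\<epsilon> / 2 > 0" using \<epsilon> by simp
  from erdos_stone_min_degree[OF this m, of q]
  obtain N1 where N1: "\<forall>(V::'a set) R. finite V \<longrightarrow> symp R \<longrightarrow> irreflp R \<longrightarrow> N1 \<le> card V \<longrightarrow>
    (q > 0 \<longrightarrow> (\<forall>v\<in>V. (1 - 1 / real q + \<epsilon> / 2) * card V \<le> card {w \<in> V. R v w})) \<longrightarrow>
    has_blocks R V {1..Suc q} (\<lambda>_. m)" by (elim exE)
  define \<alpha> where "\<alpha> = 1 - 1 / real q + \<epsilon> / 2"
  have "1 / real q \<le> 1" using q by simp
  hence \<alpha>: "\<alpha> > 0" using \<epsilon> unfolding \<alpha>_def by linarith
  show ?thesis
  proof (intro exI[of _ "nat \<lceil>4 * \<alpha> / \<epsilon>\<rceil> + nat \<lceil>4 * real N1 ^ 2 / \<epsilon>\<rceil> + 1"] allI impI)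
    fix V :: "'a set" and R
    assume V: "finite V" and R: "symp R" "irreflp R" and free: "\<not> has_blocks R V {1..Suc q} (\<lambda>_. m)"
      and n: "nat \<lceil>4 * \<alpha> / \<epsilon>\<rceil> + nat \<lceil>4 * real N1 ^ 2 / \<epsilon>\<rceil> + 1 \<le> card V"
    show "pair_count R V V \<le> (1 - 1 / real q + \<epsilon>) * real (card V) ^ 2"
    proof (rule ccontr)
      assume con: "\<not> pair_count R V V \<le> (1 - 1 / real q + \<epsilon>) * real (card V) ^ 2"
      obtain V' where V': "V' \<subseteq> V" "\<And>v. v \<in> V' \<Longrightarrow> \<alpha> * card V' \<le> card {w \<in> V'. R v w}"
        "pair_count R V V - \<alpha> * (real (card V) ^ 2 + card V) \<le> pair_count R V' V' - \<alpha> * (real (card V') ^ 2 + card V')"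
        using dense_core[OF V R] by blast
      have finV': "finite V'" using V'(1) V finite_subset by blast
      define n n' where "n = real (card V)" and "n' = real (card V')"
      have n1: "n \<ge> 1" "4 * \<alpha> / \<epsilon> \<le> n" "4 * real N1 ^ 2 / \<epsilon> \<le> n" using n unfolding n_def by linarith+
      have "pair_count R V' V' \<le> card V' * card V'" by (rule pair_count_le[OF finV'])
      hence "pair_count R V' V' \<le> n' ^ 2" unfolding n'_def power2_eq_square by (simp flip: of_nat_mult)
      moreover have "\<alpha> * (n' ^ 2 + n') \<ge> 0" using \<alpha> by (auto simp: n'_def)
      moreover have "(\<alpha> + \<epsilon> / 2) * n ^ 2 - \<alpha> * (n ^ 2 + n) = \<epsilon> / 2 * n ^ 2 - \<alpha> * n"
        by (simp add: algebra_simps)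
      moreover have "(\<alpha> + \<epsilon> / 2) * n ^ 2 < pair_count R V V"
      proof -
        have "\<alpha> + \<epsilon> / 2 = 1 - 1 / real q + \<epsilon>" by (simp add: \<alpha>_def)
        thus ?thesis using con unfolding n_def by simp
      qed
      ultimately have "\<epsilon> / 2 * n ^ 2 - \<alpha> * n \<le> n' ^ 2" using V'(3) con unfolding n_def n'_def by linarith
      moreover have "\<alpha> * n \<le> \<epsilon> / 4 * n ^ 2"
      proof -
        have "\<alpha> \<le> \<epsilon> / 4 * n" using n1(2) \<epsilon> by (simp add: field_simps)
        hence "\<alpha> * n \<le> \<epsilon> / 4 * n * n" using n1(1) by (intro mult_right_mono) auto
        thus ?thesis by (simp add: power2_eq_square)
      qed
      moreover have "real N1 ^ 2 \<le> \<epsilon> / 4 * n ^ 2"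
      proof -
        have "real N1 ^ 2 \<le> \<epsilon> / 4 * n" using n1(3) \<epsilon> by (simp add: field_simps)
        also have "\<dots> \<le> \<epsilon> / 4 * n ^ 2" using n1(1) \<epsilon> by (intro mult_left_mono) (auto simp: power2_eq_square)
        finally show ?thesis .
      qed
      ultimately have "real N1 ^ 2 \<le> n' ^ 2" by linarith
      hence "N1 \<le> card V'" unfolding n'_def by (simp flip: of_nat_power)
      hence "has_blocks R V' {1..Suc q} (\<lambda>_. m)" using V'(2)
        by (intro N1[THEN spec, THEN spec, THEN mp, THEN mp, THEN mp, THEN mp, THEN mp, OF finV' R]) (auto simp: \<alpha>_def)
      thus False using free has_blocks_mono V'(1) by blast
    qed
  qed
qed

section \<open>Stability in terms of monochromatic edges\<close>

definition mono_count :: "('a \<Rightarrow> 'a \<Rightarrow> bool) \<Rightarrow> 'a set \<Rightarrow> ('a \<Rightarrow> nat) \<Rightarrow> nat" where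
  "mono_count R V c = (\<Sum>v\<in>V. card {w \<in> V. c w = c v \<and> R v w})"

lemma mono_count_split:
  assumes "finite V" "\<And>v. v \<in> V \<Longrightarrow> c v \<in> {1..q}"
  shows "mono_count R V c = (\<Sum>i\<in>{1..q}. pair_count R {v \<in> V. c v = i} {v \<in> V. c v = i})"
proof -
  have "mono_count R V c = (\<Sum>i\<in>{1..q}. \<Sum>v\<in>{v \<in> V. c v = i}. card {w \<in> V. c w = c v \<and> R v w})"
    unfolding mono_count_def by (rule sum.group[symmetric]) (use assms in auto)
  also have "\<dots> = (\<Sum>i\<in>{1..q}. pair_count R {v \<in> V. c v = i} {v \<in> V. c v = i})"
    unfolding pair_count_def by (intro sum.cong refl arg_cong[of _ _ card]) auto
  finally show ?thesis .
qed

lemma card_subset_common: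
  fixes k :: real
  assumes "finite S" "finite P" "\<And>p. p \<in> P \<Longrightarrow> real (card {b \<in> S. \<not> R p b}) \<le> k"
  shows "real (card S) - card P * k \<le> real (card {b \<in> S. \<forall>p\<in>P. R p b})"
proof -
  have "S \<subseteq> {b \<in> S. \<forall>p\<in>P. R p b} \<union> (\<Union>p\<in>P. {b \<in> S. \<not> R p b})" by auto
  hence "card S \<le> card ({b \<in> S. \<forall>p\<in>P. R p b} \<union> (\<Union>p\<in>P. {b \<in> S. \<not> R p b}))"
    using assms(1,2) by (intro card_mono) auto
  also have "\<dots> \<le> card {b \<in> S. \<forall>p\<in>P. R p b} + card (\<Union>p\<in>P. {b \<in> S. \<not> R p b})" by (rule card_Un_le)
  also have "card (\<Union>p\<in>P. {b \<in> S. \<not> R p b}) \<le> (\<Sum>p\<in>P. card {b \<in> S. \<not> R p b})" by (rule card_UN_le[OF assms(2)])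
  finally have "real (card S) \<le> real (card {b \<in> S. \<forall>p\<in>P. R p b}) + (\<Sum>p\<in>P. real (card {b \<in> S. \<not> R p b}))"
    by (simp flip: of_nat_sum of_nat_add)
  also have "(\<Sum>p\<in>P. real (card {b \<in> S. \<not> R p b})) \<le> of_nat (card P) * k"
    by (rule sum_bounded_above) (rule assms(3))
  finally show ?thesis by simp
qed

text \<open>A vertex with few neighbours in the block \<open>B i\<close> and almost all of the other blocks as
  neighbours is put into class \<open>i\<close>; by the Kovari-Sos-Turan bound the classes span few edges.\<close>

lemma (in block_family) typical_class_sparse:
  fixes L :: real
  assumes m: "m > 0" "m \<le> K" "M = 6 * m * K" "real m \<le> L" and i: "i \<in> {1..p}"
    and free: "\<not> has_blocks R V {1..Suc p} (\<lambda>_. m)"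
    and T: "T \<subseteq> V" "\<And>x. x \<in> T \<Longrightarrow> g x i < m" "\<And>x. x \<in> T \<Longrightarrow> (p - 1) * M \<le> card {b \<in> W. R x b} + K"
  shows "real (pair_count R T T) \<le> L * card V + real m ^ m * m * real (card V) ^ m / L ^ (m - 1)"
proof -
  have finT: "finite T" using T(1) finV finite_subset by blast
  have L: "L > 0" using m by linarith
  have miss: "card {b \<in> B j. \<not> R x b} \<le> 2 * K" if x: "x \<in> T" and j: "j \<in> {1..p}" "j \<noteq> i" for x j
  proof -
    have "card {b \<in> B j. \<not> R x b} = M - g x j"
    proof -
      have "{b \<in> B j. \<not> R x b} = B j - {b \<in> B j. R x b}" by auto
      thus ?thesis using B_fin[OF j(1)] exact[OF j(1)] by (simp add: card_Diff_subset g_def)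
    qed
    moreover have "(\<Sum>l\<in>{1..p}. g x l) = g x i + (g x j + (\<Sum>l\<in>{1..p} - {i} - {j}. g x l))"
    proof -
      have "(\<Sum>l\<in>{1..p}. g x l) = g x i + (\<Sum>l\<in>{1..p} - {i}. g x l)" by (rule sum.remove) (use i in auto)
      moreover have "(\<Sum>l\<in>{1..p} - {i}. g x l) = g x j + (\<Sum>l\<in>{1..p} - {i} - {j}. g x l)"
        by (rule sum.remove) (use j in auto)
      ultimately show ?thesis by simp
    qed
    moreover have "(\<Sum>l\<in>{1..p} - {i} - {j}. g x l) \<le> of_nat (card ({1..p} - {i} - {j})) * M"
      by (rule sum_bounded_above) (use g_le in auto)
    moreover have "card ({1..p} - {i} - {j}) = p - 2" using i j by simp
    moreover have "(p - 1) * M = (p - 2) * M + M"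
    proof -
      have "p - 1 = Suc (p - 2)" using i j by auto
      thus ?thesis by simp
    qed
    ultimately show ?thesis using T(2)[OF x] T(3)[OF x] m(2) unfolding nb_W by simp
  qed
  have "real (pair_count R T T) \<le> L * card T + real m ^ m * m * real (card T) ^ m / L ^ (m - 1)"
  proof (rule kovari_sos_turan[OF finT finT m(1,4)], rule ccontr)
    fix P assume P: "P \<subseteq> T" "card P = m" and "\<not> card {x \<in> T. \<forall>p\<in>P. R x p} \<le> m"
    hence "m \<le> card {x \<in> T. \<forall>p\<in>P. R x p}" by simp
    from ex_subset_card[OF this] obtain Q where Q: "Q \<subseteq> {x \<in> T. \<forall>p\<in>P. R x p}" "card Q = m"
      by (elim exE conjE)
    define Y where "Y j = {b \<in> B j. \<forall>x\<in>P \<union> Q. R x b}" for j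
    have PQ: "finite (P \<union> Q)" "P \<union> Q \<subseteq> T" "card (P \<union> Q) \<le> 2 * m"
      using P Q finT finite_subset card_Un_le[of P Q] by (auto intro: finite_subset[of _ T])
    have Y: "m \<le> card (Y j)" if j: "j \<in> {1..p}" "j \<noteq> i" for j
    proof -
      \<comment> \<open>Each of the at most \<open>2 * m\<close> vertices of
        \<open>P \<union> Q\<close> misses at most \<open>2 * K\<close> vertices of
        \<open>B j\<close>; of the \<open>6 * m * K\<close> vertices at least
        \<open>2 * m * K \<ge> m\<close> remain.\<close>
      have "real (card (B j)) - card (P \<union> Q) * real (2 * K) \<le> card (Y j)" unfolding Y_def
        using PQ miss[OF _ j] by (intro card_subset_common B_fin[OF j(1)]) (auto simp only: of_nat_le_iff)
      moreover have "card (P \<union> Q) * real (2 * K) \<le> real (2 * m) * real (2 * K)"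
        using PQ(3) by (intro mult_right_mono of_nat_mono) auto
      moreover have "real (2 * m) * real (2 * K) = 4 * (real m * K)" "real (card (B j)) = 6 * (real m * K)"
        using exact[OF j(1)] m(3) by simp_all
      moreover have "real m * 1 \<le> real m * K" using m by (intro mult_left_mono) auto
      ultimately have "real m \<le> real (card (Y j))" by linarith
      thus ?thesis by simp
    qed
    have "has_blocks R V {1..Suc p} (\<lambda>_. m)"
    proof (rule has_blocksI[where A="\<lambda>j. if j = Suc p then P else if j = i then Q else Y j"])
      fix j assume j: "j \<in> {1..Suc p}"
      show "(if j = Suc p then P else if j = i then Q else Y j) \<subseteq> V"
        using P Q T(1) B_sub[of j] j by (auto simp: Y_def)
      show "m \<le> card (if j = Suc p then P else if j = i then Q else Y j)"
        using P Q Y[of j] j by auto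
    next
      fix j l u v assume jl: "j \<in> {1..Suc p}" "l \<in> {1..Suc p}" "j \<noteq> l"
        and u: "u \<in> (if j = Suc p then P else if j = i then Q else Y j)"
        and v: "v \<in> (if l = Suc p then P else if l = i then Q else Y l)"
      have QP: "R a b" "R b a" if "a \<in> Q" "b \<in> P" for a b
        using Q(1) that sympD[OF symR] by blast+
      have PY: "R a b" "R b a" if "a \<in> P \<union> Q" "b \<in> Y k" for a b k
        using that sympD[OF symR] unfolding Y_def by blast+
      have YY: "R u v" if "u \<in> Y j" "v \<in> Y l" "j \<in> {1..p}" "l \<in> {1..p}"
        using that is_blocksD(3)[OF blocks that(3,4) jl(3), of u v] by (auto simp: Y_def)
      show "R u v"
      proof (cases "j = Suc p \<or> j = i")
        case True
        thus ?thesis using u v jl QP PY(1)[of u v l] by (auto split: if_splits)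
      next
        case False
        hence j: "j \<in> {1..p}" "u \<in> Y j" using jl u by auto
        show ?thesis
        proof (cases "l = Suc p \<or> l = i")
          case True
          thus ?thesis using j v PY(2)[of v u j] by (auto split: if_splits)
        next
          case False
          hence "l \<in> {1..p}" "v \<in> Y l" using jl v by auto
          thus ?thesis using YY j by blast
        qed
      qed
    qed
    thus False using free by contradiction
  qed
  also have "\<dots> \<le> L * card V + real m ^ m * m * real (card V) ^ m / L ^ (m - 1)"
    using L card_mono[OF finV T(1)]
    by (intro add_mono mult_left_mono divide_right_mono power_mono) auto
  finally show ?thesis .
qed

text \<open>The core has minimum degree just below the Turan density for \<open>q\<close> classes,
  which is still above that for \<open>q - 1\<close> classes, so it contains \<open>q\<close> large
  blocks. Rich vertices are few, since they would give \<open>q + 1\<close> parts; then vertices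
  with a deficit of more than \<open>K\<close> towards the blocks are few as well, by counting
  edges. The others are typical for exactly one block.\<close>

lemma erdos_simonovits_stability:
  fixes \<eta> :: real
  assumes \<eta>: "\<eta> > 0" and m: "m > 0" and q: "q > 0"
  shows "\<exists>\<gamma>>0. \<exists>N0::nat. \<forall>(V::'a set) R. finite V \<longrightarrow> symp R \<longrightarrow> irreflp R \<longrightarrow> N0 \<le> card V \<longrightarrow>
    \<not> has_blocks R V {1..Suc q} (\<lambda>_. m) \<longrightarrow> (1 - 1 / real q - \<gamma>) * real (card V) ^ 2 \<le> pair_count R V V \<longrightarrow>
    (\<exists>c. (\<forall>v\<in>V. c v \<in> {1..q}) \<and> mono_count R V c \<le> \<eta> * real (card V) ^ 2)"
proof -
  \<comment> \<open>Each of the \<open>q\<close> classes will span at most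
    \<open>2 * h * n ^ 2\<close> ordered pairs, and at most \<open>6 * h * n\<close> vertices are
    not typical and contribute twice; hence \<open>2 * q + 12\<close>.\<close>
  define h where "h = min (\<eta> / (2 * real q + 12)) 1"
  have h: "h > 0" "h \<le> 1" "(2 * real q + 12) * h \<le> \<eta>"
  proof -
    show "h > 0" "h \<le> 1" using \<eta> by (auto simp: h_def)
    have "(2 * real q + 12) * h \<le> (2 * real q + 12) * (\<eta> / (2 * real q + 12))"
      by (intro mult_left_mono) (auto simp: h_def)
    thus "(2 * real q + 12) * h \<le> \<eta>" by simp
  qed
  \<comment> \<open>The first bound keeps the degree defect \<open>q * \<epsilon> * M\<close> below
    \<open>h * K\<close>. The second one gives
    \<open>1 - 1 / p + \<epsilon> \<le> 1 - 1 / q - \<epsilon>\<close> for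
    \<open>q = p + 1\<close>.\<close>
  define \<epsilon> where "\<epsilon> = min (h / (6 * m * q)) (min (1 / (2 * real q ^ 2)) (1 / 4))"
  have \<epsilon>: "\<epsilon> > 0" "6 * m * q * \<epsilon> \<le> h" "\<epsilon> \<le> 1 / (2 * real q ^ 2)" "\<epsilon> \<le> 1 / 4" "\<epsilon> \<le> h"
  proof -
    show "\<epsilon> > 0" "\<epsilon> \<le> 1 / (2 * real q ^ 2)" "\<epsilon> \<le> 1 / 4" using h m q by (auto simp: \<epsilon>_def)
    have mq: "real m * real q \<ge> 1" using m q by (metis One_nat_def Suc_leI nat_0_less_mult_iff of_nat_1 of_nat_le_iff of_nat_mult)
    have "\<epsilon> \<le> h / (6 * m * q)" by (simp add: \<epsilon>_def)
    thus *: "6 * m * q * \<epsilon> \<le> h" using m q by (simp add: field_simps)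
    have "1 * \<epsilon> \<le> 6 * (real m * real q) * \<epsilon>" using mq \<open>\<epsilon> > 0\<close> by (intro mult_right_mono) auto
    with * show "\<epsilon> \<le> h" by simp
  qed
  \<comment> \<open>So large that the slack \<open>m\<close> of a vertex that is not rich is at most
    \<open>h * K\<close>.\<close>
  define K where "K = m + nat \<lceil>m / h\<rceil>"
  have K: "m \<le> K" "m \<le> h * K" "K > 0"
  proof -
    have "m / h \<le> K" unfolding K_def by linarith
    thus "m \<le> h * K" using h by (simp add: field_simps)
  qed (use m in \<open>auto simp: K_def\<close>)
  define M where "M = 6 * m * K"
  have M: "M > 0" using m K by (simp add: M_def)
  define \<gamma> where "\<gamma> = \<epsilon> ^ 2 / 2"
  define \<alpha> where "\<alpha> = 1 - 1 / real q - \<epsilon>"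
  obtain p where p: "q = Suc p" using q by (cases q) auto
  from erdos_stone_min_degree[OF \<epsilon>(1) M, of p, folded p]
  obtain N1 where N1: "\<forall>(V::'a set) R. finite V \<longrightarrow> symp R \<longrightarrow> irreflp R \<longrightarrow> N1 \<le> card V \<longrightarrow>
    (p > 0 \<longrightarrow> (\<forall>v\<in>V. (1 - 1 / real p + \<epsilon>) * card V \<le> card {w \<in> V. R v w})) \<longrightarrow>
    has_blocks R V {1..q} (\<lambda>_. M)" by (elim exE)
  have "\<epsilon> ^ 2 > 0" using \<epsilon>(1) by simp
  from erdos_stone_edges[OF \<open>\<epsilon> ^ 2 > 0\<close> m q]
  obtain N2 where N2: "\<forall>(V::'a set) R. finite V \<longrightarrow> symp R \<longrightarrow> irreflp R \<longrightarrow> N2 \<le> card V \<longrightarrow>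
    \<not> has_blocks R V {1..Suc q} (\<lambda>_. m) \<longrightarrow> pair_count R V V \<le> (1 - 1 / real q + \<epsilon>\<^sup>2) * real (card V) ^ 2"
    by (elim exE)
  \<comment> \<open>For \<open>n \<ge> cX\<close> at most \<open>h / (6 * m) * n\<close> vertices
    are rich; for \<open>n \<ge> cK\<close> the second Kovari-Sos-Turan term with threshold
    \<open>h * n\<close> is at most \<open>h * n ^ 2\<close>.\<close>
  define cX where "cX = 6 * real m * (2 ^ (q * M) * m) / h"
  define cK where "cK = real m ^ m * m / h ^ m"
  define N0 where "N0 = nat \<lceil>4 / \<epsilon>\<^sup>2\<rceil> + nat \<lceil>6 * real (N1 + N2) ^ 2 / \<epsilon>\<rceil> + nat \<lceil>cX\<rceil> + nat \<lceil>cK\<rceil> + nat \<lceil>m / h\<rceil> + 1"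
  have \<gamma>0: "\<gamma> > 0" using \<epsilon>(1) by (simp add: \<gamma>_def)
  show ?thesis
  proof (intro exI[of _ \<gamma>] conjI exI[of _ N0] allI impI \<gamma>0)
    fix V :: "'a set" and R
    assume V: "finite V" and R: "symp R" "irreflp R" and N0: "N0 \<le> card V"
      and free: "\<not> has_blocks R V {1..Suc q} (\<lambda>_. m)"
      and dense: "(1 - 1 / real q - \<gamma>) * real (card V) ^ 2 \<le> pair_count R V V"
    define n where "n = real (card V)"
    have n: "n \<ge> 1" "4 / \<epsilon>\<^sup>2 \<le> n" "6 * real (N1 + N2) ^ 2 / \<epsilon> \<le> n" "cX \<le> n" "cK \<le> n" "m / h \<le> n"
      using N0 unfolding N0_def n_def by linarith+
    obtain V' where V': "V' \<subseteq> V" "\<And>v. v \<in> V' \<Longrightarrow> \<alpha> * card V' \<le> card {w \<in> V'. R v w}"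
      "pair_count R V V - \<alpha> * (real (card V) ^ 2 + card V) \<le> pair_count R V' V' - \<alpha> * (real (card V') ^ 2 + card V')"
      using dense_core[OF V R] by blast
    have finV': "finite V'" using V'(1) V finite_subset by blast
    have free': "\<not> has_blocks R V' {1..Suc q} (\<lambda>_. m)" using free has_blocks_mono V'(1) by blast
    define n' where "n' = real (card V')"
    have n'n: "n' \<le> n" "n' \<ge> 0" unfolding n_def n'_def using card_mono[OF V V'(1)] by auto
    have "1 / real q \<le> 1" "0 \<le> 1 / real q" using q by auto
    hence \<alpha>: "\<alpha> \<le> 1" "\<alpha> \<ge> -\<epsilon>" using \<epsilon>(1) unfolding \<alpha>_def by linarith+
    have core: "(\<epsilon> - \<gamma>) * n ^ 2 - n \<le> pair_count R V' V' - \<alpha> * (n' ^ 2 + n')"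
    proof -
      have "(\<alpha> + \<epsilon> - \<gamma>) * n ^ 2 - \<alpha> * (n ^ 2 + n) = (\<epsilon> - \<gamma>) * n ^ 2 - \<alpha> * n"
        by (simp add: algebra_simps)
      moreover have "(\<alpha> + \<epsilon> - \<gamma>) * n ^ 2 \<le> pair_count R V V" using dense by (simp add: \<alpha>_def n_def)
      moreover have "\<alpha> * n \<le> n" using \<alpha> n by simp
      ultimately show ?thesis using V'(3) unfolding n_def n'_def by linarith
    qed
    have \<epsilon>n: "2 * n \<le> \<epsilon>\<^sup>2 / 2 * n ^ 2"
    proof -
      have "4 \<le> \<epsilon>\<^sup>2 * n" using n(2) \<epsilon>(1) by (simp add: field_simps)
      hence "4 * n \<le> \<epsilon>\<^sup>2 * n * n" using n(1) by (intro mult_right_mono) auto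
      thus ?thesis by (simp add: power2_eq_square)
    qed
    have \<epsilon>2: "\<epsilon>\<^sup>2 \<le> \<epsilon> / 4" using \<epsilon>(1,4) by (simp add: power2_eq_square)
    have big: "N1 + N2 \<le> card V'"
    proof -
      have "pair_count R V' V' \<le> card V' * card V'" by (rule pair_count_le[OF finV'])
      hence "pair_count R V' V' \<le> n' ^ 2" unfolding n'_def power2_eq_square by (simp flip: of_nat_mult)
      moreover have "- \<alpha> * (n' ^ 2 + n') \<le> 1 * (n' ^ 2 + n')" using \<alpha>(2) \<epsilon>(4) n'n by (intro mult_right_mono) auto
      moreover have "n' \<le> n' ^ 2" unfolding n'_def by (cases "card V'") (auto simp: power2_eq_square)
      ultimately have 1: "(\<epsilon> - \<gamma>) * n ^ 2 - n \<le> 3 * n' ^ 2" using core by simp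
      have "(\<epsilon> / 2) * n ^ 2 \<le> (\<epsilon> - \<gamma> - \<epsilon>\<^sup>2 / 2) * n ^ 2"
        using \<epsilon>2 \<epsilon>(1) by (intro mult_right_mono) (auto simp: \<gamma>_def)
      hence "(\<epsilon> / 2) * n ^ 2 \<le> (\<epsilon> - \<gamma>) * n ^ 2 - n" using \<epsilon>n n(1) by (simp add: algebra_simps)
      moreover have "real (N1 + N2) ^ 2 \<le> \<epsilon> / 6 * n" using n(3) \<epsilon>(1) by (simp add: field_simps)
      moreover have "\<epsilon> / 6 * n \<le> \<epsilon> / 6 * n ^ 2" using n(1) \<epsilon>(1) by (intro mult_left_mono) (auto simp: power2_eq_square)
      ultimately have "real (N1 + N2) ^ 2 \<le> n' ^ 2" using 1 by linarith
      thus ?thesis unfolding n'_def by (simp flip: of_nat_power of_nat_add)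
    qed
    \<comment> \<open>The surplus over \<open>\<alpha> * n ^ 2\<close> is about
      \<open>\<epsilon> * n ^ 2\<close> in \<open>V\<close>, and by Erdos-Stone at most about
      \<open>\<epsilon> * n' ^ 2\<close> in the core, with relative errors of order
      \<open>\<epsilon>\<close>; so the core is almost everything.\<close>
    have "(1 - 2 * \<epsilon>) * n \<le> n'"
    proof -
      have "pair_count R V' V' \<le> (1 - 1 / real q + \<epsilon>\<^sup>2) * n' ^ 2"
        unfolding n'_def
        by (rule N2[THEN spec, THEN spec, THEN mp, THEN mp, THEN mp, THEN mp, THEN mp, OF finV' R _ free']) (use big in simp)
      moreover have "(1 - 1 / real q + \<epsilon>\<^sup>2) = \<alpha> + (\<epsilon> + \<epsilon>\<^sup>2)" by (simp add: \<alpha>_def)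
      ultimately have "pair_count R V' V' \<le> (\<alpha> + (\<epsilon> + \<epsilon>\<^sup>2)) * n' ^ 2" by simp
      hence "pair_count R V' V' - \<alpha> * (n' ^ 2 + n') \<le> (\<epsilon> + \<epsilon>\<^sup>2) * n' ^ 2 - \<alpha> * n'"
        by (simp add: algebra_simps)
      moreover have "- \<alpha> * n' \<le> 1 * n" using \<alpha>(2) \<epsilon>(4) n'n by (intro mult_mono) auto
      ultimately have "(\<epsilon> - \<gamma>) * n ^ 2 - 2 * n \<le> (\<epsilon> + \<epsilon>\<^sup>2) * n' ^ 2" using core by linarith
      hence "(\<epsilon> - \<epsilon>\<^sup>2) * n ^ 2 \<le> (\<epsilon> + \<epsilon>\<^sup>2) * n' ^ 2" using \<epsilon>n by (simp add: \<gamma>_def algebra_simps)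
      hence "\<epsilon> * ((1 - \<epsilon>) * n ^ 2) \<le> \<epsilon> * ((1 + \<epsilon>) * n' ^ 2)" by (simp add: algebra_simps power2_eq_square)
      hence 2: "(1 - \<epsilon>) * n ^ 2 \<le> (1 + \<epsilon>) * n' ^ 2" using \<epsilon>(1) by simp
      have "(1 + \<epsilon>) * (1 - 2 * \<epsilon>) ^ 2 \<le> 1 - \<epsilon>"
      proof -
        have "(1 + \<epsilon>) * (1 - 2 * \<epsilon>) ^ 2 = 1 - \<epsilon> - \<epsilon> * (2 - 4 * \<epsilon>\<^sup>2)"
          by (simp add: power2_eq_square algebra_simps)
        moreover have "\<epsilon> * (2 - 4 * \<epsilon>\<^sup>2) \<ge> 0" using \<epsilon> \<epsilon>2 by (intro mult_nonneg_nonneg) auto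
        ultimately show ?thesis by linarith
      qed
      hence "(1 + \<epsilon>) * (1 - 2 * \<epsilon>) ^ 2 * n ^ 2 \<le> (1 - \<epsilon>) * n ^ 2" by (intro mult_right_mono) auto
      hence "(1 + \<epsilon>) * ((1 - 2 * \<epsilon>) * n) ^ 2 \<le> (1 + \<epsilon>) * n' ^ 2" using 2 by (simp add: power_mult_distrib mult.assoc)
      hence "((1 - 2 * \<epsilon>) * n) ^ 2 \<le> n' ^ 2" using \<epsilon>(1) by simp
      thus ?thesis using n'n(2) by (rule power2_le_imp_le)
    qed
    hence nn': "n - n' \<le> 2 * h * n"
    proof -
      assume "(1 - 2 * \<epsilon>) * n \<le> n'"
      moreover have "2 * \<epsilon> * n \<le> 2 * h * n" using \<epsilon>(5) n(1) by (intro mult_right_mono) auto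
      ultimately show ?thesis by (simp add: algebra_simps)
    qed
    have "has_blocks R V' {1..q} (\<lambda>_. M)"
    proof (rule N1[THEN spec, THEN spec, THEN mp, THEN mp, THEN mp, THEN mp, THEN mp, OF finV' R])
      show "p > 0 \<longrightarrow> (\<forall>v\<in>V'. (1 - 1 / real p + \<epsilon>) * card V' \<le> card {w \<in> V'. R v w})"
      proof
      assume p0: "p > 0"
      have "1 - 1 / real p + \<epsilon> \<le> \<alpha>"
      proof -
        have "1 / real p - 1 / real q = 1 / (real p * real q)" using p0 q by (simp add: p field_simps)
        moreover have "1 / real q ^ 2 \<le> 1 / (real p * real q)"
          using p0 q by (intro divide_left_mono) (auto simp: p power2_eq_square)
        moreover have "2 * \<epsilon> \<le> 1 / real q ^ 2" using \<epsilon>(3) by (simp add: field_simps)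
        ultimately show ?thesis unfolding \<alpha>_def by linarith
      qed
      hence "(1 - 1 / real p + \<epsilon>) * card V' \<le> \<alpha> * card V'" by (intro mult_right_mono) auto
      thus "\<forall>v\<in>V'. (1 - 1 / real p + \<epsilon>) * card V' \<le> card {w \<in> V'. R v w}" using V'(2) order.trans by blast
      qed
    qed (use big in simp)
    then obtain B where B: "is_blocks R V' {1..q} (\<lambda>_. M) B" "\<forall>i\<in>{1..q}. card (B i) = M"
      by (rule blocks_exact)
    interpret block_family V' R q M B using finV' R B by unfold_locales auto
    have cardX: "real (card (rich m)) \<le> h / (6 * m) * n"
    proof -
      have "\<not> 2 ^ (q * M) * m \<le> card (rich m)" using extend[OF m] free' by blast
      hence "card (rich m) \<le> 2 ^ (q * M) * m" by simp
      hence "real (card (rich m)) \<le> real (2 ^ (q * M) * m)" by (simp only: of_nat_le_iff)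
      also have "\<dots> = cX * h / (6 * m)" using h m by (simp add: cX_def)
      also have "\<dots> \<le> n * h / (6 * m)" using n(4) h by (intro divide_right_mono mult_right_mono) auto
      finally show ?thesis by (simp add: mult.commute)
    qed
    \<comment> \<open>Vertices that fall short of full adjacency to \<open>q - 1\<close> blocks by
      more than \<open>K\<close>. Each reduces the degree count by \<open>K\<close>, which the
      nearly tight count affords for at most \<open>3 * h * n\<close> vertices.\<close>
    define A where "A = {x \<in> V' - rich m. card {b \<in> W. R x b} + K < (q - 1) * M}"
    have q1: "real (q - 1) = real q - 1" using q by simp
    have "real q * M * (\<alpha> * n') \<le> (\<Sum>x\<in>V'. real (card {b \<in> W. R x b}))"
      by (rule degree_count) (use V'(2) in \<open>simp add: n'_def\<close>)
    also have "\<dots> \<le> (\<Sum>x\<in>V'. ((real q - 1) * M + m) + (if x \<in> rich m then real M else 0) - (if x \<in> A then real K else 0))"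
    proof (rule sum_mono)
      fix x assume x: "x \<in> V'"
      consider "x \<in> rich m" "x \<notin> A" | "x \<notin> rich m" "x \<in> A" | "x \<notin> rich m" "x \<notin> A" by (auto simp: A_def)
      thus "real (card {b \<in> W. R x b}) \<le> ((real q - 1) * M + m) + (if x \<in> rich m then real M else 0) - (if x \<in> A then real K else 0)"
      proof cases
        case 1
        have "real (card {b \<in> W. R x b}) \<le> real (q * M)" using nb_W_le by (simp only: of_nat_le_iff)
        thus ?thesis using 1 by (simp add: algebra_simps)
      next
        case 2
        have "card {b \<in> W. R x b} + K \<le> (q - 1) * M" using 2 by (auto simp: A_def)
        hence "real (card {b \<in> W. R x b} + K) \<le> real ((q - 1) * M)" by (simp only: of_nat_le_iff)
        hence "real (card {b \<in> W. R x b}) + K \<le> (real q - 1) * M" by (simp only: of_nat_add of_nat_mult q1)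
        thus ?thesis using 2 by simp
      next
        case 3
        then obtain i where i: "i \<in> {1..q}" "g x i \<le> m" using x unfolding rich_def by force
        have "real (card {b \<in> W. R x b}) \<le> real ((q - 1) * M + g x i)" using nb_W_le'[OF i(1)] by (simp only: of_nat_le_iff)
        also have "\<dots> = (real q - 1) * M + g x i" by (simp only: of_nat_add of_nat_mult q1)
        finally show ?thesis using i(2) 3 by simp
      qed
    qed
    also have "\<dots> = ((real q - 1) * M + m) * n' + M * card (rich m) - K * card A"
    proof -
      have "(\<Sum>x\<in>V'. if x \<in> rich m then real M else 0) = M * card (rich m)"
        using finV' by (simp add: sum.If_cases rich_def Int_def)
      moreover have "(\<Sum>x\<in>V'. if x \<in> A then real K else 0) = K * card A"
      proof -
        have "V' \<inter> {x. x \<in> A} = A" by (auto simp: A_def)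
        thus ?thesis using finV' by (simp add: sum.If_cases)
      qed
      ultimately show ?thesis by (simp add: sum.distrib sum_subtractf n'_def algebra_simps)
    qed
    finally have "real q * M * (\<alpha> * n') \<le> ((real q - 1) * M + m) * n' + M * card (rich m) - K * card A" .
    moreover have "real q * M * (\<alpha> * n') = (real q - 1) * M * n' - q * \<epsilon> * M * n'"
      using q by (simp add: \<alpha>_def field_simps)
    ultimately have "real K * real (card A) \<le> q * \<epsilon> * M * n' + m * n' + M * real (card (rich m))" by (simp add: algebra_simps)
    also have "\<dots> \<le> h * K * n + h * K * n + h * K * n"
    proof (intro add_mono)
      have "q * \<epsilon> * M * n' = (6 * m * q * \<epsilon>) * (K * n')" by (simp add: M_def)
      also have "\<dots> \<le> h * (K * n)" using \<epsilon>(1,2) n'n h(1) by (intro mult_mono mult_left_mono) auto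
      finally show "q * \<epsilon> * M * n' \<le> h * K * n" by simp
      show "m * n' \<le> h * K * n" using K(2) n'n h(1) by (intro mult_mono) auto
      have "M * real (card (rich m)) \<le> M * (h / (6 * m) * n)" using cardX by (intro mult_left_mono) auto
      also have "\<dots> = h * K * n" using m by (simp add: M_def)
      finally show "M * real (card (rich m)) \<le> h * K * n" .
    qed
    finally have "K * real (card A) \<le> K * (3 * h * n)" by (simp add: algebra_simps)
    hence cardA: "card A \<le> 3 * h * n" using K(3) by simp
    define T where "T = V' - rich m - A"
    define other where "other = V - T"
    have "other \<subseteq> (V - V') \<union> (rich m \<union> A)" by (auto simp: other_def T_def)
    hence "card other \<le> card ((V - V') \<union> (rich m \<union> A))"
      using V finV' by (intro card_mono) (auto simp: A_def rich_def)
    also have "\<dots> \<le> card (V - V') + (card (rich m) + card A)"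
      by (intro order.trans[OF card_Un_le] add_left_mono card_Un_le)
    finally have "real (card other) \<le> real (card (V - V')) + (real (card (rich m)) + real (card A))"
      by (simp flip: of_nat_add)
    moreover have "real (card (V - V')) = n - n'"
      using V V'(1) finV' by (simp add: card_Diff_subset n_def n'_def of_nat_diff card_mono)
    moreover have "real (card (rich m)) \<le> h * n"
    proof -
      have "h / (6 * m) \<le> h / 1" using h(1) m by (intro divide_left_mono) auto
      hence "h / (6 * m) * n \<le> h * n" using n(1) by (intro mult_right_mono) auto
      thus ?thesis using cardX by linarith
    qed
    ultimately have other: "real (card other) \<le> 6 * h * n" using nn' cardA by (simp add: algebra_simps)
    have "\<exists>i\<in>{1..q}. g x i < m" if "x \<in> T" for x using that by (auto simp: T_def rich_def not_le)
    hence "\<forall>x\<in>T. \<exists>i. i \<in> {1..q} \<and> g x i < m" by blast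
    from bchoice[OF this] obtain cl where cl: "\<And>x. x \<in> T \<Longrightarrow> cl x \<in> {1..q} \<and> g x (cl x) < m" by blast
    define c where "c x = (if x \<in> T then cl x else 1)" for x
    have cq: "c v \<in> {1..q}" for v using cl q by (auto simp: c_def)
    have TV: "T \<subseteq> V" using V'(1) by (auto simp: T_def)
    have finT: "finite T" using TV V finite_subset by blast
    have class_bound: "real (pair_count R {x \<in> T. c x = i} {x \<in> T. c x = i}) \<le> 2 * h * n ^ 2" if i: "i \<in> {1..q}" for i
    proof -
      define L where "L = h * n"
      have L: "real m \<le> L" "L > 0" using n(1,6) h m by (auto simp: L_def field_simps)
      have "real (pair_count R {x \<in> T. c x = i} {x \<in> T. c x = i}) \<le>
          L * card V' + real m ^ m * m * real (card V') ^ m / L ^ (m - 1)"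
      proof (rule typical_class_sparse[OF m K(1) M_def L(1) i free'])
        show "{x \<in> T. c x = i} \<subseteq> V'" by (auto simp: T_def)
        show "g x i < m" if "x \<in> {x \<in> T. c x = i}" for x using that cl[of x] by (auto simp: c_def)
        show "(q - 1) * M \<le> card {b \<in> W. R x b} + K" if "x \<in> {x \<in> T. c x = i}" for x
          using that by (auto simp: T_def A_def)
      qed
      also have "L * card V' \<le> h * n ^ 2"
        using n'n n(1) h(1) unfolding L_def n'_def[symmetric] power2_eq_square mult.assoc
        by (intro mult_left_mono) auto
      also have "real m ^ m * m * real (card V') ^ m / L ^ (m - 1) \<le> real m ^ m * m * n ^ m / L ^ (m - 1)"
        using n'n L(2) unfolding n'_def[symmetric] by (intro divide_right_mono mult_left_mono power_mono) auto
      also have "\<dots> = h * (cK * n)"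
      proof -
        obtain k where k: "m = Suc k" using m by (cases m) auto
        show ?thesis using h n(1) by (simp add: cK_def L_def k power_mult_distrib field_simps)
      qed
      also have "\<dots> \<le> h * (n * n)" using n(1,5) h by (intro mult_left_mono mult_right_mono) auto
      finally show ?thesis by (simp add: power2_eq_square)
    qed
    have "mono_count R V c \<le> (\<Sum>v\<in>V. card {w \<in> T. c w = c v \<and> R v w} + card other)"
      unfolding mono_count_def
    proof (rule sum_mono)
      fix v assume "v \<in> V"
      have "card {w \<in> V. c w = c v \<and> R v w} \<le> card ({w \<in> T. c w = c v \<and> R v w} \<union> other)"
        using finT V by (intro card_mono) (auto simp: other_def)
      also have "\<dots> \<le> card {w \<in> T. c w = c v \<and> R v w} + card other" by (rule card_Un_le)
      finally show "card {w \<in> V. c w = c v \<and> R v w} \<le> card {w \<in> T. c w = c v \<and> R v w} + card other" .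
    qed
    also have "\<dots> = (\<Sum>v\<in>T. card {w \<in> T. c w = c v \<and> R v w}) + (\<Sum>v\<in>other. card {w \<in> T. c w = c v \<and> R v w}) + card V * card other"
      using TV V by (simp add: sum.distrib sum.subset_diff[OF TV] other_def)
    also have "(\<Sum>v\<in>other. card {w \<in> T. c w = c v \<and> R v w}) \<le> of_nat (card other) * card V"
      by (rule sum_bounded_above) (use V TV in \<open>auto intro!: card_mono\<close>)
    also have "(\<Sum>v\<in>T. card {w \<in> T. c w = c v \<and> R v w}) = mono_count R T c" by (simp add: mono_count_def)
    finally have "mono_count R V c \<le> mono_count R T c + 2 * (card V * card other)" by (simp add: mult.commute)
    hence "real (mono_count R V c) \<le> real (mono_count R T c + 2 * (card V * card other))" by (simp only: of_nat_le_iff)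
    also have "\<dots> = real (mono_count R T c) + 2 * (n * card other)" by (simp add: n_def)
    also have "n * card other \<le> n * (6 * h * n)" using other n(1) by (intro mult_left_mono) auto
    also have "real (mono_count R T c) = (\<Sum>i\<in>{1..q}. real (pair_count R {x \<in> T. c x = i} {x \<in> T. c x = i}))"
      using mono_count_split[OF finT, of c q R] cq by simp
    also have "\<dots> \<le> of_nat (card {1..q}) * (2 * h * n ^ 2)" by (rule sum_bounded_above) (rule class_bound)
    finally have "real (mono_count R V c) \<le> (2 * real q + 12) * h * n ^ 2"
      by (simp add: power2_eq_square algebra_simps)
    also have "\<dots> \<le> \<eta> * n ^ 2" using h(3) by (intro mult_right_mono) auto
    finally show "\<exists>c. (\<forall>v\<in>V. c v \<in> {1..q}) \<and> mono_count R V c \<le> \<eta> * real (card V) ^ 2"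
      using cq by (intro exI[of _ c]) (auto simp: n_def)
  qed
qed

section \<open>Structure of extremal graphs\<close>

locale host =
  fixes V :: "'a set" and R and q :: nat and r :: "nat \<Rightarrow> nat" and c :: "'a \<Rightarrow> nat"
  assumes finV: "finite V" and symR: "symp R" and irrR: "irreflp R"
    and q1: "q > 0" and rmono: "mono_on {1..Suc q} r"
    and free: "\<not> has_blocks R V {1..Suc q} r"
begin

definition S where "S i = {v \<in> V. c v = i}"
definition miss where "miss v j = card {w \<in> S j. \<not> R v w}"
definition good where "good b v \<longleftrightarrow> (\<forall>j\<in>{1..q}. j \<noteq> c v \<longrightarrow> real (miss v j) \<le> b)"
definition rmax where "rmax = r (Suc q)"

lemma finS: "finite (S i)" using finV by (simp add: S_def)
lemma S_sub: "S i \<subseteq> V" by (auto simp: S_def)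
lemma sym: "R u v \<Longrightarrow> R v u" using symR by (rule sympD)
lemma irr: "\<not> R u u" using irrR by (simp add: irreflp_def)

lemma r_le_rmax: "i \<in> {1..Suc q} \<Longrightarrow> r i \<le> rmax"
  unfolding rmax_def using rmono by (auto intro!: mono_onD[OF rmono])

lemma good_mono: "good b v \<Longrightarrow> b \<le> b' \<Longrightarrow> good b' v"
  unfolding good_def by (meson order.trans)

text \<open>There are \<open>q + 1\<close> parts but only \<open>q\<close> classes. Index 0 stands
  for the additional part, which has the smallest prescribed size; index \<open>i\<close> carries
  the second smallest size, and all others are filled with the largest one.\<close>

lemma no_block_family:
  assumes i: "i \<in> {1..q}"
    and A: "\<And>j. j \<in> {0..q} \<Longrightarrow> A j \<subseteq> V" "r 1 \<le> card (A 0)" "r 2 \<le> card (A i)"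
      "\<And>j. j \<in> {1..q} \<Longrightarrow> j \<noteq> i \<Longrightarrow> rmax \<le> card (A j)"
    and adj: "\<And>j l u v. j \<in> {0..q} \<Longrightarrow> l \<in> {0..q} \<Longrightarrow> j < l \<Longrightarrow> u \<in> A j \<Longrightarrow> v \<in> A l \<Longrightarrow> R u v"
  shows False
proof -
  let ?s = "\<lambda>j. if j = 0 then r 1 else if j = i then r 2 else rmax"
  have "has_blocks R V {0..q} ?s"
  proof (rule has_blocksI[where A=A])
    show "R u v" if "j \<in> {0..q}" "l \<in> {0..q}" "j \<noteq> l" "u \<in> A j" "v \<in> A l" for j l u v
      using adj[of j l u v] adj[of l j v u] sym[of v u] that by (cases "j < l") auto
  qed (use i A in auto)
  \<comment> \<open>A shift by one composed with the transposition of 1 and \<open>i\<close>, which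
    puts part 2 at index \<open>i\<close>.\<close>
  moreover define \<pi> where "\<pi> k = (if k = 1 then 0 else if k = 2 then i else if k = Suc i then 1 else k - 1)" for k :: nat
  have "bij_betw \<pi> {1..Suc q} {0..q}"
    by (rule bij_betw_byWitness[where f'="\<lambda>j. if j = 0 then 1 else if j = i then 2 else if j = 1 then Suc i else Suc j"])
       (use i in \<open>auto simp: \<pi>_def\<close>)
  moreover have "r k \<le> ?s (\<pi> k)" if "k \<in> {1..Suc q}" for k
    using r_le_rmax[OF that] i that by (auto simp: \<pi>_def numeral_2_eq_2)
  ultimately have "has_blocks R V {1..Suc q} r" by (intro has_blocks_reindex[of \<pi> _ "{0..q}" r ?s R V])
  thus False using free by contradiction
qed

text \<open>A chosen block consists of \<open>rmax\<close> good vertices and therefore excludes at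
  most \<open>rmax * b\<close> vertices of every other \<open>W j\<close>; the size assumption
  reserves this amount once for every class in \<open>J\<close>.\<close>

lemma greedy_blocks:
  fixes b :: real
  assumes "finite J" "J \<subseteq> {1..q}" "b \<ge> 0"
    and "\<And>j. j \<in> J \<Longrightarrow> W j \<subseteq> S j" "\<And>j w. j \<in> J \<Longrightarrow> w \<in> W j \<Longrightarrow> good b w"
    and "\<And>j. j \<in> J \<Longrightarrow> rmax + real (card J) * rmax * b \<le> card (W j)"
  shows "\<exists>A. (\<forall>j\<in>J. A j \<subseteq> W j \<and> card (A j) = rmax) \<and>
    (\<forall>j\<in>J. \<forall>l\<in>J. j \<noteq> l \<longrightarrow> (\<forall>u\<in>A j. \<forall>v\<in>A l. R u v))"
  using assms
proof (induction J arbitrary: W rule: finite_induct)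
  case (insert k J)
  have "real rmax \<le> rmax + real (card (insert k J)) * rmax * b" using insert.prems(2) by simp
  also have "\<dots> \<le> card (W k)" by (rule insert.prems(5)) simp
  finally have "rmax \<le> card (W k)" by simp
  from ex_subset_card[OF this] obtain A0 where A0: "A0 \<subseteq> W k" "card A0 = rmax" by (elim exE conjE)
  have Wk: "W k \<subseteq> S k" "\<And>w. w \<in> W k \<Longrightarrow> good b w" using insert.prems(3,4) by auto
  have finA0: "finite A0" by (rule finite_subset[OF order.trans[OF A0(1) Wk(1)] finS])
  define W' where "W' j = {w \<in> W j. \<forall>a\<in>A0. R a w}" for j
  have "\<exists>A. (\<forall>j\<in>J. A j \<subseteq> W' j \<and> card (A j) = rmax) \<and>
    (\<forall>j\<in>J. \<forall>l\<in>J. j \<noteq> l \<longrightarrow> (\<forall>u\<in>A j. \<forall>v\<in>A l. R u v))"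
  proof (rule insert.IH)
    show "W' j \<subseteq> S j" if "j \<in> J" for j using insert.prems(3)[of j] that by (auto simp: W'_def)
    show "good b w" if "j \<in> J" "w \<in> W' j" for j w using insert.prems(4)[of j w] that by (auto simp: W'_def)
    fix j assume j: "j \<in> J"
    have WS: "W j \<subseteq> S j" using insert.prems(3)[of j] j by auto
    have "real (card (W j)) - card A0 * b \<le> card (W' j)" unfolding W'_def
    proof (rule card_subset_common)
      show "finite (W j)" by (rule finite_subset[OF WS finS])
      fix p assume p: "p \<in> A0"
      hence "p \<in> S k" "good b p" using A0(1) Wk by auto
      moreover have "j \<in> {1..q}" "j \<noteq> k" using j insert.hyps(2) insert.prems(1) by auto
      ultimately have "real (miss p j) \<le> b" unfolding good_def S_def by auto
      moreover have "card {b \<in> W j. \<not> R p b} \<le> miss p j" unfolding miss_def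
        using WS finS by (intro card_mono) auto
      ultimately show "real (card {b \<in> W j. \<not> R p b}) \<le> b" by linarith
    qed (rule finA0)
    moreover have "rmax + real (card (insert k J)) * rmax * b \<le> card (W j)" by (rule insert.prems(5)) (use j in simp)
    moreover have "real (card (insert k J)) = real (card J) + 1" using insert.hyps by simp
    ultimately show "rmax + real (card J) * rmax * b \<le> card (W' j)" by (simp add: A0(2) algebra_simps)
  qed (use insert.prems in auto)
  then obtain A where A': "\<forall>j\<in>J. A j \<subseteq> W' j \<and> card (A j) = rmax"
    "\<forall>j\<in>J. \<forall>l\<in>J. j \<noteq> l \<longrightarrow> (\<forall>u\<in>A j. \<forall>v\<in>A l. R u v)" by (elim exE conjE)
  have A: "j \<in> J \<Longrightarrow> A j \<subseteq> W' j" "j \<in> J \<Longrightarrow> card (A j) = rmax"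
    "j \<in> J \<Longrightarrow> l \<in> J \<Longrightarrow> j \<noteq> l \<Longrightarrow> u \<in> A j \<Longrightarrow> v \<in> A l \<Longrightarrow> R u v" for j l u v
    using A'(1)[rule_format, of j] A'(2)[rule_format, of j l u v] by blast+
  have W'A0: "R a w" "R w a" if "w \<in> A j" "a \<in> A0" "j \<in> J" for a w j
    using A(1)[OF that(3)] that(1,2) sym unfolding W'_def by blast+
  have kJ: "k \<notin> J" by (rule insert.hyps)
  show ?case
  proof (intro exI[of _ "A(k := A0)"] conjI ballI impI)
    fix j assume j: "j \<in> insert k J"
    show "(A(k := A0)) j \<subseteq> W j" "card ((A(k := A0)) j) = rmax"
      using j A(1,2) A0 kJ by (auto simp: W'_def)
  next
    fix j l u v assume jl: "j \<in> insert k J" "l \<in> insert k J" "j \<noteq> l" "u \<in> (A(k := A0)) j" "v \<in> (A(k := A0)) l"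
    consider "j = k" "l \<in> J" "l \<noteq> k" | "l = k" "j \<in> J" "j \<noteq> k" | "j \<noteq> k" "l \<noteq> k" "j \<in> J" "l \<in> J" using jl by blast
    thus "R u v"
    proof cases
      case 1 thus ?thesis using jl W'A0(2)[of v l u] by (simp add: sym W'A0)
    next
      case 2 thus ?thesis using jl W'A0(2)[of u j v] by simp
    next
      case 3 thus ?thesis using jl A(3)[of j l u v] by simp
    qed
  qed
qed simp

text \<open>The delicate parts \<open>A\<close>, at index 0 and in the classes of \<open>F\<close>,
  are prescribed. The parts in all other classes are chosen greedily among good vertices adjacent to
  everything prescribed.\<close>

lemma no_embedding:
  fixes b :: real
  assumes i: "i \<in> {1..q}" and F: "F \<subseteq> {1..q}" and b: "b \<ge> 0"
    and A: "\<And>j. j \<in> insert 0 F \<Longrightarrow> A j \<subseteq> V" "r 1 \<le> card (A 0)" "i \<in> F \<Longrightarrow> r 2 \<le> card (A i)"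
      "\<And>j. j \<in> F \<Longrightarrow> j \<noteq> i \<Longrightarrow> rmax \<le> card (A j)"
    and adjA: "\<And>j l u v. j \<in> insert 0 F \<Longrightarrow> l \<in> insert 0 F \<Longrightarrow> j \<noteq> l \<Longrightarrow> u \<in> A j \<Longrightarrow> v \<in> A l \<Longrightarrow> R u v"
    and W: "\<And>j. j \<in> {1..q} - F \<Longrightarrow> W j \<subseteq> S j" "\<And>j w. j \<in> {1..q} - F \<Longrightarrow> w \<in> W j \<Longrightarrow> good b w"
      "\<And>j. j \<in> {1..q} - F \<Longrightarrow> rmax + real q * rmax * b \<le> card (W j)"
    and adjW: "\<And>j l u w. j \<in> {1..q} - F \<Longrightarrow> l \<in> insert 0 F \<Longrightarrow> w \<in> W j \<Longrightarrow> u \<in> A l \<Longrightarrow> R u w"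
  shows False
proof -
  let ?J = "{1..q} - F"
  have "\<exists>B. (\<forall>j\<in>?J. B j \<subseteq> W j \<and> card (B j) = rmax) \<and>
    (\<forall>j\<in>?J. \<forall>l\<in>?J. j \<noteq> l \<longrightarrow> (\<forall>u\<in>B j. \<forall>v\<in>B l. R u v))"
  proof (rule greedy_blocks[OF _ _ b])
    fix j assume j: "j \<in> ?J"
    have "card ?J \<le> card {1..q}" by (intro card_mono) auto
    hence "real (card ?J) * rmax * b \<le> real q * rmax * b" using b by (intro mult_right_mono) auto
    thus "rmax + real (card ?J) * rmax * b \<le> card (W j)" using W(3)[OF j] by linarith
  qed (use W(1,2) in auto)
  then obtain B where B': "\<forall>j\<in>?J. B j \<subseteq> W j \<and> card (B j) = rmax"
    "\<forall>j\<in>?J. \<forall>l\<in>?J. j \<noteq> l \<longrightarrow> (\<forall>u\<in>B j. \<forall>v\<in>B l. R u v)" by (elim exE conjE)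
  have B: "j \<in> ?J \<Longrightarrow> B j \<subseteq> W j" "j \<in> ?J \<Longrightarrow> card (B j) = rmax"
    "j \<in> ?J \<Longrightarrow> l \<in> ?J \<Longrightarrow> j \<noteq> l \<Longrightarrow> u \<in> B j \<Longrightarrow> v \<in> B l \<Longrightarrow> R u v" for j l u v
    using B'(1)[rule_format, of j] B'(2)[rule_format, of j l u v] by blast+
  define C where "C j = (if j \<in> insert 0 F then A j else B j)" for j
  have r2: "r 2 \<le> rmax" using r_le_rmax[of 2] q1 by auto
  show False
  proof (rule no_block_family[OF i, of C])
    show "C j \<subseteq> V" if "j \<in> {0..q}" for j
    proof (cases "j \<in> insert 0 F")
      case False
      hence "j \<in> ?J" using that by auto
      hence "B j \<subseteq> V" using B(1) W(1) S_sub by blast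
      thus ?thesis using False by (simp add: C_def)
    qed (use A(1) in \<open>simp add: C_def\<close>)
    show "r 1 \<le> card (C 0)" using A(2) by (simp add: C_def)
    show "r 2 \<le> card (C i)" using A(3) B(2)[of i] i r2 by (auto simp: C_def)
    show "rmax \<le> card (C j)" if "j \<in> {1..q}" "j \<noteq> i" for j
      using that A(4)[of j] B(2)[of j] by (auto simp: C_def)
    show "R u v" if jl: "j \<in> {0..q}" "l \<in> {0..q}" "j < l" and uv: "u \<in> C j" "v \<in> C l" for j l u v
    proof (cases "j \<in> insert 0 F")
      case j: True
      show ?thesis
      proof (cases "l \<in> insert 0 F")
        case True
        thus ?thesis using j uv jl adjA[of j l u v] by (simp add: C_def)
      next
        case False
        hence l: "l \<in> ?J" "v \<in> B l" using jl uv by (auto simp: C_def)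
        thus ?thesis using j uv adjW[OF l(1) j, of v u] B(1)[OF l(1)] by (auto simp: C_def)
      qed
    next
      case False
      hence j: "j \<in> ?J" "u \<in> B j" using jl uv by (auto simp: C_def)
      show ?thesis
      proof (cases "l \<in> insert 0 F")
        case True
        have "R v u" by (rule adjW[OF j(1) True]) (use j B(1)[OF j(1)] uv True in \<open>auto simp: C_def\<close>)
        thus ?thesis by (rule sym)
      next
        case False
        hence l: "l \<in> ?J" "v \<in> B l" using jl uv by (auto simp: C_def)
        thus ?thesis using j jl(3) B(3)[of j l u v] by auto
      qed
    qed
  qed
qed

lemma common_good:
  fixes b :: real
  assumes "finite P" "j \<in> {1..q}" "\<And>p. p \<in> P \<Longrightarrow> c p \<noteq> j" "\<And>p. p \<in> P \<Longrightarrow> good b p" "finite D" "W \<subseteq> S j"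
  shows "real (card W) - card D - card P * b \<le> card {w \<in> W - D. \<forall>p\<in>P. R p w}"
proof -
  have finW: "finite W" by (rule finite_subset[OF assms(6) finS])
  have "real (card (W - D)) - card P * b \<le> card {w \<in> W - D. \<forall>p\<in>P. R p w}"
  proof (rule card_subset_common)
    fix p assume p: "p \<in> P"
    have "card {b \<in> W - D. \<not> R p b} \<le> miss p j" unfolding miss_def
      using assms(6) finS by (intro card_mono) auto
    moreover have "real (miss p j) \<le> b" using assms(2) assms(3,4)[OF p] by (auto simp: good_def)
    ultimately show "real (card {b \<in> W - D. \<not> R p b}) \<le> b" by linarith
  qed (use finW assms(1) in auto)
  moreover have "card W \<le> card (W - D) + card D"
    using finW assms(5) by (metis card_Un_le card_mono finite_Diff finite_UnI Un_Diff_cancel2 Un_upper1 order.trans)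
  ultimately show ?thesis by linarith
qed

text \<open>\<open>W j\<close> is a set of possible neighbours of an exceptional vertex \<open>w\<close>; ordinary vertices outside
  \<open>D\<close> miss at most \<open>b\<close> vertices in each of the other classes.\<close>

lemma no_bip_with_exceptional_vertex:
  fixes b :: real
  assumes i: "i \<in> {1..q}" and b: "b \<ge> 0" and D: "finite D" and gd: "\<And>v. v \<in> V - D \<Longrightarrow> good b v"
    and w: "w \<in> V" "w \<notin> P" and P: "P \<subseteq> S i - D" "r 1 \<le> card P + 1" "card P \<le> r 1"
    and Q: "Q \<subseteq> S i - D" "card Q = r 2" "\<forall>u\<in>P. \<forall>v\<in>Q. R u v" "\<forall>v\<in>Q. R w v"
    and big: "\<And>j. j \<in> {1..q} \<Longrightarrow> j \<noteq> i \<Longrightarrow>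
      rmax + real q * rmax * b + card D + real (r 1 + r 2) * b \<le> card {x \<in> S j. R w x}"
  shows False
proof -
  have fin: "finite P" "finite Q"
    by (rule finite_subset[OF P(1) finite_Diff[OF finS]], rule finite_subset[OF Q(1) finite_Diff[OF finS]])
  define A where "A = (\<lambda>j::nat. if j = 0 then insert w P else Q)"
  define W where "W j = {x \<in> {x \<in> S j. R w x} - D. \<forall>p\<in>P \<union> Q. R p x}" for j
  have i0: "i \<noteq> 0" using i by auto
  show False
  proof (rule no_embedding[OF i, of "{i}" b A W])
    show "A j \<subseteq> V" if "j \<in> insert 0 {i}" for j using w P(1) Q(1) S_sub by (auto simp: A_def)
    show "r 1 \<le> card (A 0)" using fin w P by (simp add: A_def)
    show "R u v" if "j \<in> insert 0 {i}" "l \<in> insert 0 {i}" "j \<noteq> l" "u \<in> A j" "v \<in> A l" for j l u v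
      using that Q(3,4) i0 sym by (auto simp: A_def split: if_splits)
    show "W j \<subseteq> S j" if "j \<in> {1..q} - {i}" for j by (auto simp: W_def)
    show "good b x" if "j \<in> {1..q} - {i}" "x \<in> W j" for j x
      using that gd S_sub by (auto simp: W_def)
    show "rmax + real q * rmax * b \<le> card (W j)" if j: "j \<in> {1..q} - {i}" for j
    proof -
      have "real (card {x \<in> S j. R w x}) - card D - card (P \<union> Q) * b \<le> card (W j)"
        unfolding W_def by (rule common_good) (use j fin D P(1) Q(1) gd S_sub in \<open>auto simp: S_def\<close>)
      moreover have "card (P \<union> Q) \<le> r 1 + r 2" using card_Un_le[of P Q] P(3) Q(2) by linarith
      hence "card (P \<union> Q) * b \<le> real (r 1 + r 2) * b" using b by (intro mult_right_mono of_nat_mono)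
      moreover have "rmax + real q * rmax * b + card D + real (r 1 + r 2) * b \<le> card {x \<in> S j. R w x}"
        using big j by auto
      ultimately show ?thesis by linarith
    qed
    show "R u x" if "j \<in> {1..q} - {i}" "l \<in> insert 0 {i}" "x \<in> W j" "u \<in> A l" for j l u x
      using that i0 by (auto simp: A_def W_def split: if_splits)
  qed (use i b Q(2) i0 in \<open>auto simp: A_def\<close>)
qed

text \<open>An ordinary vertex \<open>w\<close> of the small side can play the role of the
  exceptional vertex, since it misses at most \<open>b\<close> vertices of each other class.\<close>

lemma class_bip_free:
  fixes b :: real
  assumes i: "i \<in> {1..q}" and b: "b \<ge> 0" and D: "finite D" and gd: "\<And>v. v \<in> V - D \<Longrightarrow> good b v"
    and r1: "r 1 > 0"
    and big: "\<And>j. j \<in> {1..q} \<Longrightarrow> j \<noteq> i \<Longrightarrow>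
      rmax + real q * rmax * b + card D + real (r 1 + r 2) * b + b \<le> card (S j)"
  shows "\<not> has_bip R (S i - D) (r 1) (r 2)"
proof
  assume "has_bip R (S i - D) (r 1) (r 2)"
  then obtain A B where AB: "A \<subseteq> S i - D" "B \<subseteq> S i - D" "r 1 \<le> card A" "r 2 \<le> card B" "\<forall>u\<in>A. \<forall>v\<in>B. R u v"
    unfolding has_bip_def by (elim exE conjE)
  from ex_subset_card[OF AB(3)] obtain P where P: "P \<subseteq> A" "card P = r 1" by (elim exE conjE)
  from ex_subset_card[OF AB(4)] obtain Q where Q: "Q \<subseteq> B" "card Q = r 2" by (elim exE conjE)
  from P(2) r1 obtain w where w: "w \<in> P" by fastforce
  hence wS: "w \<in> S i" "w \<in> V" "good b w" using P(1) AB(1) S_sub gd by blast+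
  have finP: "finite P" by (rule finite_subset[OF order.trans[OF P(1) AB(1)] finite_Diff[OF finS]])
  have PQ: "\<forall>u\<in>P. \<forall>v\<in>Q. R u v" using AB(5) P(1) Q(1) by blast
  show False
  proof (rule no_bip_with_exceptional_vertex[OF i b D gd wS(2), of "P - {w}" Q])
    show "rmax + real q * rmax * b + card D + real (r 1 + r 2) * b \<le> card {x \<in> S j. R w x}"
      if j: "j \<in> {1..q}" "j \<noteq> i" for j
    proof -
      have "real (miss w j) \<le> b" using wS(1,3) j by (auto simp: good_def S_def)
      moreover have "card (S j) = card {x \<in> S j. R w x} + miss w j"
      proof -
        have "S j = {x \<in> S j. R w x} \<union> {x \<in> S j. \<not> R w x}" by auto
        thus ?thesis unfolding miss_def using finS
          by (subst card_Un_disjoint[symmetric]) auto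
      qed
      ultimately show ?thesis using big[OF j] by linarith
    qed
    show "\<forall>u\<in>P - {w}. \<forall>v\<in>Q. R u v" "\<forall>v\<in>Q. R w v" using PQ w by blast+
  qed (use AB(1,2) P Q w finP in \<open>auto simp: card_Diff_singleton\<close>)
qed

text \<open>The star centre \<open>z\<close> joins \<open>P\<close> from class \<open>a\<close> to
  form the part of size \<open>r 1\<close>; its leaves \<open>B\<close> form the part of size
  \<open>r 2\<close> in class \<open>j\<close>, and \<open>Q\<close> is a part in class
  \<open>a\<close>. The bound \<open>b'\<close> for \<open>z\<close> may be weaker than the bound
  \<open>b\<close> for ordinary vertices, as no greedy choice involves \<open>z\<close>.\<close>

lemma no_star_and_bip:
  fixes b b' :: real
  assumes a: "a \<in> {1..q}" and j: "j \<in> {1..q}" "j \<noteq> a" and b: "b \<ge> 0" "b \<le> b'" and D: "finite D"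
    and gd: "\<And>v. v \<in> V - D \<Longrightarrow> good b v"
    and z: "z \<in> S j" "good b' z" and B: "B \<subseteq> S j - D" "card B = r 2" "\<forall>v\<in>B. R z v"
    and bip: "has_bip R {x \<in> S a - D. \<forall>p\<in>insert z B. R p x} (r 1 - 1) rmax" and r1: "r 1 > 0"
    and big: "\<And>l. l \<in> {1..q} \<Longrightarrow> rmax + real q * rmax * b + card D + real (r 1 + r 2 + rmax + 1) * b' \<le> card (S l)"
  shows False
proof -
  let ?T = "{x \<in> S a - D. \<forall>p\<in>insert z B. R p x}"
  obtain P0 Q0 where PQ0: "P0 \<subseteq> ?T" "Q0 \<subseteq> ?T" "r 1 - 1 \<le> card P0" "rmax \<le> card Q0" "\<forall>u\<in>P0. \<forall>v\<in>Q0. R u v"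
    using bip unfolding has_bip_def by (elim exE conjE)
  from ex_subset_card[OF PQ0(3)] obtain P where P: "P \<subseteq> P0" "card P = r 1 - 1" by (elim exE conjE)
  from ex_subset_card[OF PQ0(4)] obtain Q where Q: "Q \<subseteq> Q0" "card Q = rmax" by (elim exE conjE)
  have PT: "P \<subseteq> ?T" "Q \<subseteq> ?T" using P Q PQ0 by blast+
  have PS: "P \<subseteq> S a - D" "Q \<subseteq> S a - D" using PT by auto
  have fin: "finite P" "finite Q" "finite B"
    by (rule finite_subset[OF PS(1) finite_Diff[OF finS]], rule finite_subset[OF PS(2) finite_Diff[OF finS]],
        rule finite_subset[OF B(1) finite_Diff[OF finS]])
  have inV: "z \<in> V" "P \<subseteq> V" "Q \<subseteq> V" "B \<subseteq> V" using PS B(1) z(1) by (auto simp: S_def)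
  have zP: "z \<notin> P" using z(1) PS(1) j(2) by (auto simp: S_def)
  have PQ: "\<forall>u\<in>P. \<forall>v\<in>Q. R u v" using PQ0(5) P(1) Q(1) by blast
  have zBT: "\<forall>p\<in>insert z B. \<forall>x\<in>P \<union> Q. R p x" using PT by blast
  define A where "A = (\<lambda>l::nat. if l = 0 then insert z P else if l = j then B else Q)"
  define W where "W l = {x \<in> S l - D. \<forall>p\<in>insert z (P \<union> Q \<union> B). R p x}" for l
  have ne: "a \<noteq> 0" "j \<noteq> 0" using a j by auto
  show False
  proof (rule no_embedding[OF j(1), of "{a, j}" b A W])
    show "A l \<subseteq> V" if "l \<in> insert 0 {a, j}" for l
      using inV by (auto simp: A_def)
    show "r 1 \<le> card (A 0)" using fin zP P(2) r1 by (simp add: A_def)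
    show "R u v" if "k \<in> insert 0 {a, j}" "l \<in> insert 0 {a, j}" "k \<noteq> l" "u \<in> A k" "v \<in> A l" for k l u v
    proof -
      have PB: "R x y" "R y x" if "x \<in> insert z P" "y \<in> B" for x y using that B(3) zBT sym by blast+
      have zPQ: "R x y" "R y x" if "x \<in> insert z P" "y \<in> Q" for x y using that PQ zBT sym by blast+
      have BQ: "R x y" "R y x" if "x \<in> B" "y \<in> Q" for x y using that zBT sym by blast+
      have A0: "A 0 = insert z P" "A j = B" "A a = Q" using ne j(2) by (auto simp: A_def)
      have "k = 0 \<or> k = a \<or> k = j" "l = 0 \<or> l = a \<or> l = j" using that by auto
      then consider "k = 0" "l = j" | "k = j" "l = 0" | "k = 0" "l = a" | "k = a" "l = 0" | "k = j" "l = a" | "k = a" "l = j"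
        using \<open>k \<noteq> l\<close> by blast
      thus ?thesis
      proof cases
        case 1 thus ?thesis using that(4,5) A0 PB(1)[of u v] by simp
      next
        case 2 thus ?thesis using that(4,5) A0 PB(2)[of v u] by simp
      next
        case 3 thus ?thesis using that(4,5) A0 zPQ(1)[of u v] by simp
      next
        case 4 thus ?thesis using that(4,5) A0 zPQ(2)[of v u] by simp
      next
        case 5 thus ?thesis using that(4,5) A0 BQ(1)[of u v] by simp
      next
        case 6 thus ?thesis using that(4,5) A0 BQ(2)[of v u] by simp
      qed
    qed
    show "W l \<subseteq> S l" if "l \<in> {1..q} - {a, j}" for l by (auto simp: W_def)
    show "good b x" if "l \<in> {1..q} - {a, j}" "x \<in> W l" for l x using that gd S_sub by (auto simp: W_def)
    show "rmax + real q * rmax * b \<le> card (W l)" if l: "l \<in> {1..q} - {a, j}" for l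
    proof -
      let ?P = "insert z (P \<union> Q \<union> B)"
      have gdP: "good b' p" if "p \<in> ?P" for p
      proof (cases "p = z")
        case False
        hence "p \<in> V - D" using that PS B(1) inV by blast
        thus ?thesis using gd good_mono b(2) by blast
      qed (use z in simp)
      have cP: "c p \<noteq> l" if "p \<in> ?P" for p using that PS B(1) z(1) l by (auto simp: S_def)
      have "real (card (S l)) - card D - card ?P * b' \<le> card (W l)"
        unfolding W_def using l fin D gdP cP by (intro common_good) auto
      moreover have "card ?P \<le> r 1 + r 2 + rmax + 1"
      proof -
        have "card ?P \<le> Suc (card (P \<union> Q \<union> B))" by (rule card_insert_le_m1) simp_all
        thus ?thesis using card_Un_le[of "P \<union> Q" B] card_Un_le[of P Q] P(2) Q(2) B(2) by linarith
      qed
      hence "card ?P * b' \<le> real (r 1 + r 2 + rmax + 1) * b'" using b by (intro mult_right_mono of_nat_mono) auto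
      ultimately show ?thesis using big[of l] l by auto
    qed
    show "R u x" if "k \<in> {1..q} - {a, j}" "l \<in> insert 0 {a, j}" "x \<in> W k" "u \<in> A l" for k l u x
      using that by (auto simp: A_def W_def split: if_splits)
  qed (use a j b B(2) Q(2) ne in \<open>auto simp: A_def\<close>)
qed

end

section \<open>Optimal colourings and exceptional vertices\<close>

lemma minimal_colouring:
  assumes V: "finite V" and R: "symp R" "irreflp R" and c0: "\<forall>v\<in>V. c0 v \<in> {1..q}"
  obtains c :: "'a \<Rightarrow> nat" where "\<forall>v\<in>V. c v \<in> {1..q}" "mono_count R V c \<le> mono_count R V c0"
    "\<forall>v\<in>V. \<forall>j\<in>{1..q}. card {w \<in> V. c w = c v \<and> R v w} \<le> card {w \<in> V. c w = j \<and> R v w}"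
proof -
  obtain c where c: "\<forall>v\<in>V. c v \<in> {1..q}"
    and min: "\<forall>c'. (\<forall>v\<in>V. c' v \<in> {1..q}) \<longrightarrow> mono_count R V c \<le> mono_count R V c'"
    using ex_has_least_nat[of "\<lambda>c. \<forall>v\<in>V. c v \<in> {1..q}" c0 "mono_count R V"] c0 by blast
  \<comment> \<open>Moving \<open>v\<close> to another class leaves the pairs among the other
    vertices alone, so it changes the count by twice the difference of the degrees of
    \<open>v\<close> into the two classes.\<close>
  have rem: "mono_count R V c' = mono_count R (V - {v}) c' + 2 * card {w \<in> V. c' w = c' v \<and> R v w}"
    if "v \<in> V" for c' :: "'a \<Rightarrow> nat" and v
  proof -
    let ?R = "\<lambda>u w. c' w = c' u \<and> R u w"
    have "symp ?R" "irreflp ?R" using R by (auto simp: symp_def irreflp_def)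
    from pair_count_remove[OF V that this] show ?thesis by (simp add: pair_count_def mono_count_def)
  qed
  have "card {w \<in> V. c w = c v \<and> R v w} \<le> card {w \<in> V. c w = j \<and> R v w}" if v: "v \<in> V" and j: "j \<in> {1..q}" for v j
  proof -
    let ?c = "c(v := j)"
    have irr: "\<not> R v v" using R(2) by (simp add: irreflp_def)
    have "mono_count R V c \<le> mono_count R V ?c" using min c j by simp
    moreover have "mono_count R (V - {v}) ?c = mono_count R (V - {v}) c"
      unfolding mono_count_def by (intro sum.cong arg_cong[of _ _ card]) auto
    moreover have "{w \<in> V. ?c w = ?c v \<and> R v w} = {w \<in> V. c w = j \<and> R v w}" using irr by auto
    ultimately show ?thesis using rem[OF v, of c] rem[OF v, of ?c] by simp
  qed
  thus thesis using c min c0 by (intro that[of c]) auto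
qed

context host
begin

lemma card_nb_miss: "card {w \<in> S j. R v w} + miss v j = card (S j)"
proof -
  have "S j = {w \<in> S j. R v w} \<union> {w \<in> S j. \<not> R v w}" by auto
  thus ?thesis unfolding miss_def using finS by (subst card_Un_disjoint[symmetric]) auto
qed

text \<open>Symmetrization: give \<open>v\<close> the neighbourhood \<open>Y\<close> instead. If
  this creates the forbidden graph, then \<open>v\<close> occurs in it and can be replaced by a
  vertex of \<open>S i\<close> that is adjacent to the finitely many vertices of \<open>Y\<close>
  involved. So the modified graph is still free, and maximality bounds the degree of
  \<open>v\<close> from below.\<close>

lemma min_degree:
  fixes \<mu> :: real
  assumes max: "\<And>R'. symp R' \<Longrightarrow> irreflp R' \<Longrightarrow> \<not> has_blocks R' V {1..Suc q} r \<Longrightarrow>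
      pair_count R' V V \<le> pair_count R V V"
    and v: "v \<in> V" and Y: "Y \<subseteq> V - S i - {v}" and \<mu>: "\<mu> \<ge> 0" "\<And>x. x \<in> Y \<Longrightarrow> real (miss x i) \<le> \<mu>"
    and big: "(\<Sum>j\<in>{1..Suc q}. real (r j)) * (\<mu> + 1) + 1 < card (S i)"
  shows "card Y \<le> card {w \<in> V. R v w}"
proof -
  define R' where "R' = (\<lambda>x y. if x = v then y \<in> Y else if y = v then x \<in> Y else R x y)"
  have vY: "v \<notin> Y" using Y by auto
  have R': "symp R'" "irreflp R'" using vY sym irr by (auto simp: R'_def symp_def irreflp_def)
  have "\<not> has_blocks R' V {1..Suc q} r"
  proof
    assume "has_blocks R' V {1..Suc q} r"
    then obtain A0 where A0: "is_blocks R' V {1..Suc q} r A0" unfolding has_blocks_def by blast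
    have "\<forall>j. \<exists>B. j \<in> {1..Suc q} \<longrightarrow> B \<subseteq> A0 j \<and> card B = r j"
      using is_blocksD(2)[OF A0] ex_subset_card by blast
    from choice[OF this] obtain A where A: "\<And>j. j \<in> {1..Suc q} \<Longrightarrow> A j \<subseteq> A0 j \<and> card (A j) = r j" by blast
    have AV: "A j \<subseteq> V" if "j \<in> {1..Suc q}" for j using A[OF that] is_blocksD(1)[OF A0 that] by blast
    have finA: "finite (A j)" if "j \<in> {1..Suc q}" for j using AV[OF that] finV finite_subset by blast
    have adjA: "R' x y" if "j \<in> {1..Suc q}" "l \<in> {1..Suc q}" "j \<noteq> l" "x \<in> A j" "y \<in> A l" for j l x y
      using is_blocksD(3)[OF A0 that(1-3), of x y] A[OF that(1)] A[OF that(2)] that(4,5) by blast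
    define U where "U = (\<Union>j\<in>{1..Suc q}. A j)"
    have finU: "finite U" using finA unfolding U_def by blast
    have "card U \<le> (\<Sum>j\<in>{1..Suc q}. card (A j))" unfolding U_def by (rule card_UN_le) simp
    also have "\<dots> = (\<Sum>j\<in>{1..Suc q}. r j)" by (intro sum.cong) (use A in auto)
    finally have cU: "real (card U) \<le> (\<Sum>j\<in>{1..Suc q}. real (r j))" by (simp flip: of_nat_sum)
    show False
    proof (cases "v \<in> U")
      case False
      have "has_blocks R V {1..Suc q} r"
      proof (rule has_blocksI[where A=A])
        show "R x y" if jl: "j \<in> {1..Suc q}" "l \<in> {1..Suc q}" "j \<noteq> l" "x \<in> A j" "y \<in> A l" for j l x y
        proof -
          have "x \<noteq> v" "y \<noteq> v" using False jl unfolding U_def by blast+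
          thus ?thesis using adjA[OF jl] by (simp add: R'_def)
        qed
        show "r j \<le> card (A j)" if "j \<in> {1..Suc q}" for j using A[OF that] by simp
      qed (rule AV)
      thus False using free by contradiction
    next
      case True
      then obtain i0 where i0: "i0 \<in> {1..Suc q}" "v \<in> A i0" unfolding U_def by blast
      have vA: "v \<notin> A j" if "j \<in> {1..Suc q}" "j \<noteq> i0" for j
        using adjA[OF that(1) i0(1) that(2) _ i0(2)] R'(2) by (auto simp: irreflp_def)
      let ?N = "{b \<in> S i. \<forall>p\<in>U \<inter> Y. R p b}"
      have "real (card (S i)) - card (U \<inter> Y) * \<mu> \<le> card ?N"
      proof (rule card_subset_common)
        fix p assume "p \<in> U \<inter> Y"
        thus "real (card {b \<in> S i. \<not> R p b}) \<le> \<mu>" using \<mu>(2)[of p] by (simp add: miss_def)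
      qed (use finS finU in auto)
      moreover have "real (card (U \<inter> Y)) * \<mu> \<le> (\<Sum>j\<in>{1..Suc q}. real (r j)) * \<mu>"
      proof (rule mult_right_mono[OF _ \<mu>(1)])
        have "card (U \<inter> Y) \<le> card U" using finU by (intro card_mono) auto
        thus "real (card (U \<inter> Y)) \<le> (\<Sum>j\<in>{1..Suc q}. real (r j))" using cU by linarith
      qed
      ultimately have "real (card U) + 1 < card ?N" using big cU by (simp add: algebra_simps)
      moreover have "card (insert v U) \<le> card U + 1" using finU by (simp add: card_insert_if)
      ultimately have "card (insert v U) < card ?N" by linarith
      hence "\<not> ?N \<subseteq> insert v U" using finU card_mono[of "insert v U" ?N] by auto
      \<comment> \<open>The substitute for \<open>v\<close>. It must avoid the whole copy
        \<open>U\<close>, so that exchanging it for \<open>v\<close> in \<open>A i0\<close> keeps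
        the size of that part.\<close>
      then obtain w where w: "w \<in> S i" "\<forall>p\<in>U \<inter> Y. R p w" "w \<noteq> v" "w \<notin> U" by blast
      define A' where "A' = A(i0 := insert w (A i0 - {v}))"
      have "has_blocks R V {1..Suc q} r"
      proof (rule has_blocksI[where A=A'])
        show "A' j \<subseteq> V" if "j \<in> {1..Suc q}" for j
          using AV[OF that] w(1) S_sub by (auto simp: A'_def)
        show "r j \<le> card (A' j)" if j: "j \<in> {1..Suc q}" for j
        proof (cases "j = i0")
          case True
          have "w \<notin> A i0 - {v}" using w(4) i0(1) unfolding U_def by blast
          hence "card (A' j) = Suc (card (A i0 - {v}))" using True finA[OF i0(1)] by (simp add: A'_def)
          also have "\<dots> = card (A i0)" by (rule card_Suc_Diff1[OF finA[OF i0(1)] i0(2)])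
          finally show ?thesis using A[OF i0(1)] True by simp
        qed (use A[OF j] in \<open>simp add: A'_def\<close>)
        have old: "R x y" if jl: "j \<in> {1..Suc q}" "l \<in> {1..Suc q}" "j \<noteq> l" "x \<in> A j" "y \<in> A l" "x \<noteq> v" "y \<noteq> v" for j l x y
          using adjA[OF jl(1-5)] jl(6,7) by (simp add: R'_def)
        have new: "R w y" "R y w" if "l \<in> {1..Suc q}" "l \<noteq> i0" "y \<in> A l" for l y
        proof -
          have "R' v y" using adjA[OF i0(1) that(1) _ i0(2) that(3)] that(2) by simp
          hence "y \<in> U \<inter> Y" using that unfolding U_def by (auto simp: R'_def)
          thus "R y w" using w(2) by blast
          thus "R w y" by (rule sym)
        qed
        show "R x y" if jl: "j \<in> {1..Suc q}" "l \<in> {1..Suc q}" "j \<noteq> l" "x \<in> A' j" "y \<in> A' l" for j l x y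
        proof (cases "j = i0")
          case True
          hence l: "l \<noteq> i0" "y \<in> A l" using jl by (auto simp: A'_def)
          hence "y \<noteq> v" using vA jl(2) by blast
          show ?thesis
          proof (cases "x = w")
            case False
            hence "x \<in> A i0" "x \<noteq> v" using jl(4) True by (auto simp: A'_def)
            thus ?thesis using old[of i0 l x y] True jl l \<open>y \<noteq> v\<close> by simp
          qed (use new l jl(2) in simp)
        next
          case False
          hence j: "x \<in> A j" using jl by (auto simp: A'_def)
          hence "x \<noteq> v" using vA jl(1) False by blast
          show ?thesis
          proof (cases "l = i0 \<and> y = w")
            case True
            thus ?thesis using new(2)[OF jl(1) False j] by simp
          next
            case F: False
            hence "y \<in> A l" using jl(5) by (auto simp: A'_def split: if_splits)
            moreover have "y \<noteq> v" using F jl(5) vA[OF jl(2)] w(3) by (auto simp: A'_def split: if_splits)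
            ultimately show ?thesis using old[of j l x y] jl j \<open>x \<noteq> v\<close> by simp
          qed
        qed
      qed
      thus False using free by contradiction
    qed
  qed
  from max[OF R' this] have "pair_count R' V V \<le> pair_count R V V" .
  moreover have "pair_count R' (V - {v}) (V - {v}) = pair_count R (V - {v}) (V - {v})"
    unfolding pair_count_def by (intro sum.cong arg_cong[of _ _ card]) (auto simp: R'_def)
  moreover have "{w \<in> V. R' v w} = Y" using Y by (auto simp: R'_def)
  ultimately show ?thesis
    using pair_count_remove[OF finV v R'] pair_count_remove[OF finV v symR irrR] by simp
qed

end

text \<open>One class is treated at a time. Averaging shows that many vertices of the class see the
  proportion \<open>\<theta> / 2\<close> of the current subset of \<open>D\<close>, and
  \<open>m\<close> of them have the same trace on it; this trace is the next subset.\<close>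

lemma common_pigeonhole:
  fixes \<theta> n :: real
  assumes D: "finite D" "D \<noteq> {}" and \<theta>: "\<theta> > 0" "n > 0" and m: "m > 0" "2 ^ card D * real m \<le> \<theta> / 2 * n"
    and S: "\<And>j. j \<in> {1..k} \<Longrightarrow> finite (S j)" "\<And>j. j \<in> {1..k} \<Longrightarrow> card (S j) \<le> n"
      "\<And>j d. j \<in> {1..k} \<Longrightarrow> d \<in> D \<Longrightarrow> \<theta> * n \<le> card {x \<in> S j. R d x}"
    and sym: "symp R"
  shows "\<exists>D'. D' \<subseteq> D \<and> (\<theta> / 2) ^ k * card D \<le> card D' \<and> (\<forall>j\<in>{1..k}. m \<le> card {x \<in> S j. \<forall>d\<in>D'. R d x})"
  using S
proof (induction k)
  case 0
  show ?case by (intro exI[of _ D]) auto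
next
  case (Suc k)
  have "\<exists>D'. D' \<subseteq> D \<and> (\<theta> / 2) ^ k * card D \<le> card D' \<and> (\<forall>j\<in>{1..k}. m \<le> card {x \<in> S j. \<forall>d\<in>D'. R d x})"
    by (rule Suc.IH) (use Suc.prems in auto)
  then obtain E where E: "E \<subseteq> D" "(\<theta> / 2) ^ k * card D \<le> card E" "\<forall>j\<in>{1..k}. m \<le> card {x \<in> S j. \<forall>d\<in>E. R d x}"
    by (elim exE conjE)
  have finE: "finite E" using E(1) D(1) finite_subset by blast
  have Ds: "card D > 0" using D by (simp add: card_gt_0_iff)
  have cE: "real (card E) > 0" using E(2) \<theta> Ds by (smt (verit) divide_pos_pos mult_pos_pos of_nat_0_less_iff zero_less_power)
  let ?S = "S (Suc k)"
  have finS: "finite ?S" and cS: "card ?S \<le> n" using Suc.prems by auto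
  define d where "d x = real (card {e \<in> E. R x e})" for x
  \<comment> \<open>Vertices outside \<open>H\<close> account for at most half of the pairs, so
    \<open>H\<close> still contains at least \<open>\<theta> / 2 * n\<close> vertices.\<close>
  define H where "H = {x \<in> ?S. \<theta> / 2 * card E \<le> d x}"
  have finH: "finite H" using finS by (simp add: H_def)
  have "card E * (\<theta> * n) \<le> (\<Sum>e\<in>E. real (card {x \<in> ?S. R e x}))"
    using sum_bounded_below[of E "\<theta> * n" "\<lambda>e. real (card {x \<in> ?S. R e x})"] Suc.prems(3)[of "Suc k"] E(1) by auto
  also have "\<dots> = real (pair_count R E ?S)" by (simp add: pair_count_def)
  also have "\<dots> = (\<Sum>x\<in>?S. d x)" using pair_count_swap[OF sym finE finS] by (simp add: pair_count_def d_def)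
  also have "\<dots> \<le> (\<Sum>x\<in>?S. (if x \<in> H then real (card E) else 0) + \<theta> / 2 * card E)"
  proof (rule sum_mono)
    fix x assume x: "x \<in> ?S"
    have "d x \<le> card E" using finE by (auto simp: d_def intro!: card_mono)
    moreover have "\<theta> / 2 * card E \<ge> 0" using \<theta> by simp
    ultimately show "d x \<le> (if x \<in> H then real (card E) else 0) + \<theta> / 2 * card E" using x by (auto simp: H_def)
  qed
  also have "\<dots> = card E * card H + card ?S * (\<theta> / 2 * card E)"
  proof -
    have "?S \<inter> {x. x \<in> H} = H" by (auto simp: H_def)
    thus ?thesis using finS by (simp add: sum.distrib sum.If_cases)
  qed
  also have "\<dots> \<le> card E * card H + n * (\<theta> / 2 * card E)" using cS \<theta> by (intro add_left_mono mult_right_mono) auto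
  finally have "card E * (\<theta> / 2 * n) \<le> card E * real (card H)" by (simp add: algebra_simps)
  hence cH: "\<theta> / 2 * n \<le> card H" using cE by simp
  have "card E \<le> card D" using E(1) D(1) by (rule card_mono[rotated])
  hence "(2::real) ^ card E * real m \<le> 2 ^ card D * real m" by (intro mult_right_mono power_increasing) auto
  hence "real (2 ^ card E * m) \<le> real (card H)" using m(2) cH by simp
  hence "2 ^ card E * m \<le> card H" by (simp only: of_nat_le_iff)
  from common_neighbourhood[OF finH finE this, of R] obtain Z W where
    Z: "Z \<subseteq> H" "card Z = m" "W \<subseteq> E" "\<And>z. z \<in> Z \<Longrightarrow> {b \<in> E. R z b} = W" by metis
  obtain z where z: "z \<in> Z" using Z(2) m(1) by fastforce
  have finZ: "finite Z" using Z(2) m(1) card_ge_0_finite by blast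
  show ?case
  proof (intro exI[of _ W] conjI ballI)
    show "W \<subseteq> D" using Z(3) E(1) by blast
    have "\<theta> / 2 * card E \<le> card W" using Z(1) z Z(4)[OF z] by (auto simp: H_def d_def)
    moreover have "(\<theta> / 2) ^ Suc k * card D \<le> \<theta> / 2 * card E"
      using mult_left_mono[OF E(2), of "\<theta> / 2"] \<theta> by (simp add: mult.assoc)
    ultimately show "(\<theta> / 2) ^ Suc k * card D \<le> card W" by linarith
    fix j assume j: "j \<in> {1..Suc k}"
    show "m \<le> card {x \<in> S j. \<forall>d\<in>W. R d x}"
    proof (cases "j = Suc k")
      case True
      have "Z \<subseteq> {x \<in> ?S. \<forall>d\<in>W. R d x}"
      proof
        fix x assume x: "x \<in> Z"
        have "R d x" if "d \<in> W" for d using Z(4)[OF x] that sympD[OF sym, of x d] by blast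
        thus "x \<in> {x \<in> ?S. \<forall>d\<in>W. R d x}" using x Z(1) by (auto simp: H_def)
      qed
      hence "card Z \<le> card {x \<in> ?S. \<forall>d\<in>W. R d x}" using finS by (intro card_mono) auto
      thus ?thesis using Z(2) True by simp
    next
      case False
      hence j': "j \<in> {1..k}" using j by auto
      have "card {x \<in> S j. \<forall>d\<in>E. R d x} \<le> card {x \<in> S j. \<forall>d\<in>W. R d x}"
        using Z(3) Suc.prems(1)[OF j] by (intro card_mono) auto
      thus ?thesis using E(3) j' le_trans by blast
    qed
  qed
qed

context host
begin

text \<open>Among \<open>C\<close> vertices with many neighbours in all classes, some
  \<open>rmax\<close> have at least \<open>m\<close> common neighbours in every class. Without the
  at most \<open>h\<close> vertices that are not good, enough remain for a greedy embedding with
  these \<open>rmax\<close> vertices as the additional part.\<close>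

lemma few_bad_vertices:
  fixes \<theta> b h :: real
  assumes D: "D \<subseteq> V" and \<theta>: "\<theta> > 0" and V0: "V \<noteq> {}"
    and deg: "\<And>j d. j \<in> {1..q} \<Longrightarrow> d \<in> D \<Longrightarrow> \<theta> * card V \<le> card {x \<in> S j. R d x}"
    and b: "b \<ge> 0" "real (card {v \<in> V. \<not> good b v}) \<le> h"
    and C: "C > 0" "rmax \<le> (\<theta> / 2) ^ q * C"
    and m: "m > 0" "2 ^ C * real m \<le> \<theta> / 2 * card V" "h + rmax + real q * rmax * b \<le> m"
  shows "card D < C"
proof (rule ccontr)
  assume "\<not> card D < C"
  hence "C \<le> card D" by simp
  from ex_subset_card[OF this] obtain D0 where D0: "D0 \<subseteq> D" "card D0 = C" by (elim exE conjE)
  have fin0: "finite D0" "D0 \<noteq> {}"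
    using finite_subset[OF order.trans[OF D0(1) D] finV] D0(2) C(1) by auto
  have "card V > 0" using V0 finV by (simp add: card_gt_0_iff)
  hence "\<exists>D'. D' \<subseteq> D0 \<and> (\<theta> / 2) ^ q * card D0 \<le> card D' \<and> (\<forall>j\<in>{1..q}. m \<le> card {x \<in> S j. \<forall>d\<in>D'. R d x})"
    using D0 m(1,2) finS symR deg \<theta> card_mono[OF finV S_sub]
    by (intro common_pigeonhole[OF fin0, of \<theta> "real (card V)"]) auto
  then obtain E where E: "E \<subseteq> D0" "(\<theta> / 2) ^ q * card D0 \<le> card E" "\<forall>j\<in>{1..q}. m \<le> card {x \<in> S j. \<forall>d\<in>E. R d x}"
    by (elim exE conjE)
  have cE: "rmax \<le> card E" using E(2) C(2) D0(2) by simp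
  define W where "W j = {x \<in> {x \<in> S j. \<forall>d\<in>E. R d x}. good b x}" for j
  have finB: "finite {v \<in> V. \<not> good b v}" using finV by simp
  show False
  proof (rule no_embedding[of 1 "{}" b "\<lambda>_. E" W])
    show "rmax + real q * rmax * b \<le> card (W j)" if j: "j \<in> {1..q} - {}" for j
    proof -
      have "{x \<in> S j. \<forall>d\<in>E. R d x} \<subseteq> W j \<union> {v \<in> V. \<not> good b v}" using S_sub by (auto simp: W_def)
      hence "card {x \<in> S j. \<forall>d\<in>E. R d x} \<le> card (W j \<union> {v \<in> V. \<not> good b v})"
        using finS finB by (intro card_mono) (auto simp: W_def)
      also have "\<dots> \<le> card (W j) + card {v \<in> V. \<not> good b v}" by (rule card_Un_le)
      finally have "m \<le> card (W j) + card {v \<in> V. \<not> good b v}" using E(3) j le_trans by blast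
      hence "real m \<le> real (card (W j)) + real (card {v \<in> V. \<not> good b v})" by (simp flip: of_nat_add)
      thus ?thesis using m(3) b(2) by linarith
    qed
    show "r 1 \<le> card E" using cE r_le_rmax[of 1] by auto
    show "E \<subseteq> V" for j using E(1) D0(1) D by blast
    show "R u w" if "j \<in> {1..q} - {}" "l \<in> insert 0 {}" "w \<in> W j" "u \<in> E" for j l u w
      using that by (auto simp: W_def)
  qed (use q1 b W_def in auto)
qed

end

section \<open>Counting missing pairs between the classes\<close>

context host
begin

lemma degree_split:
  assumes cV: "\<forall>v\<in>V. c v \<in> {1..q}" and v: "v \<in> V"
  shows "card {w \<in> V. R v w} = (\<Sum>j\<in>{1..q}. card {w \<in> S j. R v w})"
proof -
  have "{w \<in> V. R v w} = (\<Union>j\<in>{1..q}. {w \<in> S j. R v w})" using cV by (auto simp: S_def)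
  also have "card \<dots> = (\<Sum>j\<in>{1..q}. card {w \<in> S j. R v w})"
    using finV by (intro card_UN_disjoint) (auto simp: S_def)
  finally show ?thesis .
qed

lemma card_V_split:
  assumes cV: "\<forall>v\<in>V. c v \<in> {1..q}"
  shows "card V = (\<Sum>j\<in>{1..q}. card (S j))"
proof -
  have "V = (\<Union>j\<in>{1..q}. S j)" using cV by (auto simp: S_def)
  also have "card \<dots> = (\<Sum>j\<in>{1..q}. card (S j))"
    using finV by (intro card_UN_disjoint) (auto simp: S_def)
  finally show ?thesis .
qed

definition total_miss where "total_miss v = (\<Sum>j\<in>{1..q} - {c v}. miss v j)"

lemma total_miss_eq:
  assumes cV: "\<forall>v\<in>V. c v \<in> {1..q}" and v: "v \<in> V"
  shows "total_miss v + card {w \<in> V. R v w} + card (S (c v)) = card V + card {w \<in> S (c v). R v w}"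
proof -
  have cv: "c v \<in> {1..q}" using cV v by blast
  have "card V = card (S (c v)) + (\<Sum>j\<in>{1..q} - {c v}. card (S j))"
    unfolding card_V_split[OF cV] by (rule sum.remove) (use cv in auto)
  also have "(\<Sum>j\<in>{1..q} - {c v}. card (S j)) = (\<Sum>j\<in>{1..q} - {c v}. card {w \<in> S j. R v w}) + total_miss v"
    unfolding total_miss_def sum.distrib[symmetric] by (simp only: card_nb_miss)
  finally have 1: "card V = card (S (c v)) + ((\<Sum>j\<in>{1..q} - {c v}. card {w \<in> S j. R v w}) + total_miss v)" .
  have "card {w \<in> V. R v w} = card {w \<in> S (c v). R v w} + (\<Sum>j\<in>{1..q} - {c v}. card {w \<in> S j. R v w})"
    unfolding degree_split[OF cV v] by (rule sum.remove) (use cv in auto)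
  with 1 show ?thesis by simp
qed

text \<open>An exact identity. It yields the approximate structure from near-maximality, and finally
  the join structure: once the bounds agree, the first sum must be 0.\<close>

lemma sum_total_miss:
  assumes cV: "\<forall>v\<in>V. c v \<in> {1..q}"
  shows "(\<Sum>v\<in>V. total_miss v) + pair_count R V V + (\<Sum>j\<in>{1..q}. card (S j) ^ 2) = card V ^ 2 + mono_count R V c"
proof -
  have "(\<Sum>v\<in>V. total_miss v + card {w \<in> V. R v w} + card (S (c v))) = (\<Sum>v\<in>V. card V + card {w \<in> S (c v). R v w})"
    by (rule sum.cong[OF refl total_miss_eq[OF cV]])
  moreover have "(\<Sum>v\<in>V. card {w \<in> S (c v). R v w}) = mono_count R V c"
    unfolding mono_count_def S_def by (intro sum.cong arg_cong[of _ _ card]) auto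
  moreover have "(\<Sum>v\<in>V. card (S (c v))) = (\<Sum>j\<in>{1..q}. card (S j) ^ 2)"
  proof -
    have "(\<Sum>v\<in>V. card (S (c v))) = (\<Sum>j\<in>{1..q}. \<Sum>v\<in>{v \<in> V. c v = j}. card (S (c v)))"
      by (rule sum.group[symmetric]) (use finV cV in auto)
    also have "\<dots> = (\<Sum>j\<in>{1..q}. card (S j) ^ 2)"
    proof (rule sum.cong[OF refl])
      fix j
      have "(\<Sum>v\<in>{v \<in> V. c v = j}. card (S (c v))) = (\<Sum>v\<in>S j. card (S j))"
        unfolding S_def by (intro sum.cong) auto
      thus "(\<Sum>v\<in>{v \<in> V. c v = j}. card (S (c v))) = card (S j) ^ 2" by (simp add: power2_eq_square)
    qed
    finally show ?thesis .
  qed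
  ultimately show ?thesis by (simp add: sum.distrib pair_count_def power2_eq_square)
qed

lemma sum_square_deviation:
  assumes cV: "\<forall>v\<in>V. c v \<in> {1..q}"
  shows "(\<Sum>j\<in>{1..q}. (real (card (S j)) - card V / q) ^ 2) = (\<Sum>j\<in>{1..q}. real (card (S j)) ^ 2) - real (card V) ^ 2 / q"
proof -
  have "(\<Sum>j\<in>{1..q}. (real (card (S j)) - card V / q) ^ 2) =
     (\<Sum>j\<in>{1..q}. real (card (S j)) ^ 2 - 2 * (card V / q) * card (S j) + (card V / q) ^ 2)"
    by (intro sum.cong refl) (simp add: power2_diff)
  also have "\<dots> = (\<Sum>j\<in>{1..q}. real (card (S j)) ^ 2) - 2 * (card V / q) * (\<Sum>j\<in>{1..q}. real (card (S j))) + q * (card V / q) ^ 2"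
    by (simp add: sum.distrib sum_subtractf sum_distrib_left)
  also have "(\<Sum>j\<in>{1..q}. real (card (S j))) = real (card V)" unfolding card_V_split[OF cV] by simp
  also have "(\<Sum>j\<in>{1..q}. real (card (S j)) ^ 2) - 2 * (card V / q) * card V + q * (card V / q) ^ 2
     = (\<Sum>j\<in>{1..q}. real (card (S j)) ^ 2) - real (card V) ^ 2 / q"
    using q1 by (simp add: power2_eq_square field_simps)
  finally show ?thesis .
qed

lemma class_size_deviation:
  assumes cV: "\<forall>v\<in>V. c v \<in> {1..q}" and j: "j \<in> {1..q}" and B: "B \<ge> 0"
    and le: "(\<Sum>j\<in>{1..q}. real (card (S j)) ^ 2) - real (card V) ^ 2 / q \<le> B ^ 2"
  shows "\<bar>real (card (S j)) - card V / q\<bar> \<le> B"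
proof -
  have "(real (card (S j)) - card V / q) ^ 2 \<le> (\<Sum>j\<in>{1..q}. (real (card (S j)) - card V / q) ^ 2)"
    by (rule member_le_sum) (use j in auto)
  also have "\<dots> \<le> B ^ 2" using le sum_square_deviation[OF cV] by simp
  finally show ?thesis using B by (simp add: abs_le_square_iff[symmetric])
qed

end

text \<open>The interface between stability and the exact argument: balanced classes, local
  optimality of the colouring, few missing neighbours relative to the inner degree, and a number of
  exceptional vertices bounded independently of the graph.\<close>

definition good_colouring :: "'a set \<Rightarrow> ('a \<Rightarrow> 'a \<Rightarrow> bool) \<Rightarrow> nat \<Rightarrow> (nat \<Rightarrow> nat) \<Rightarrow> real \<Rightarrow> real \<Rightarrow> nat \<Rightarrow>
    ('a \<Rightarrow> nat) \<Rightarrow> bool" where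
  "good_colouring V R q r t x C c \<longleftrightarrow> host V R q r \<and> (\<forall>v\<in>V. c v \<in> {1..q}) \<and>
      (\<forall>j\<in>{1..q}. \<bar>real (card (host.S V c j)) - real (card V) / real q\<bar> \<le> x * real (card V)) \<and>
      (\<forall>v\<in>V. \<forall>j\<in>{1..q}. card {w \<in> host.S V c (c v). R v w} \<le> card {w \<in> host.S V c j. R v w}) \<and>
      (\<forall>v\<in>V. \<forall>j\<in>{1..q}. j \<noteq> c v \<longrightarrow>
         real (host.miss V R c v j) \<le> card {w \<in> host.S V c (c v). R v w} + t * real (card V)) \<and>
      card {v \<in> V. t * real (card V) < card {w \<in> host.S V c (c v). R v w}} < C"

text \<open>Minimum degree and balance bound the missing neighbours of a vertex by its inner degree
  plus a small multiple of \<open>n\<close>. A vertex of large inner degree has as many neighbours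
  in every class, by optimality of the colouring, so there are fewer than \<open>C\<close> of
  these.\<close>

lemma structure_setup:
  fixes \<theta> \<xi> :: real and q :: nat and r :: "nat \<Rightarrow> nat"
  assumes q: "q > 0" and rpos: "\<forall>i\<in>{1..Suc q}. r i > 0" and rmono: "mono_on {1..Suc q} r"
    and \<theta>: "0 < \<theta>" "\<theta> \<le> 1" and \<xi>: "0 < \<xi>"
  shows "\<exists>C N0::nat. \<forall>(V::'a set) R. finite V \<longrightarrow> symp R \<longrightarrow> irreflp R \<longrightarrow> N0 \<le> card V \<longrightarrow>
    \<not> has_blocks R V {1..Suc q} r \<longrightarrow>
    (\<forall>R'. symp R' \<longrightarrow> irreflp R' \<longrightarrow> \<not> has_blocks R' V {1..Suc q} r \<longrightarrow> pair_count R' V V \<le> pair_count R V V) \<longrightarrow>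
    (1 - 1 / real q) * real (card V) ^ 2 - q \<le> pair_count R V V \<longrightarrow>
    (\<exists>c. good_colouring V R q r \<theta> \<xi> C c)"
proof -
  define \<rho> where "\<rho> = r (Suc q)"
  have \<rho>: "\<rho> > 0" using rpos by (simp add: \<rho>_def)
  define kk where "kk = (\<Sum>j\<in>{1..Suc q}. real (r j))"
  have kk: "kk \<ge> 0" unfolding kk_def by (rule sum_nonneg) simp
  \<comment> \<open>The fraction \<open>(\<theta> / 2) ^ q\<close> that survives the pigeonhole
    argument must still contain the largest part.\<close>
  define C where "C = nat \<lceil>\<rho> * (2 / \<theta>) ^ q\<rceil> + 1"
  have C: "C > 0" "\<rho> \<le> (\<theta> / 2) ^ q * C"
  proof -
    have "\<rho> * (2 / \<theta>) ^ q \<le> C" unfolding C_def by linarith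
    hence "(\<theta> / 2) ^ q * (\<rho> * (2 / \<theta>) ^ q) \<le> (\<theta> / 2) ^ q * C" using \<theta> by (intro mult_left_mono) auto
    moreover have "(\<theta> / 2) ^ q * (\<rho> * (2 / \<theta>) ^ q) = \<rho> * ((\<theta> / 2) * (2 / \<theta>)) ^ q" by (simp only: power_mult_distrib mult_ac)
    moreover have "(\<theta> / 2) * (2 / \<theta>) = 1" using \<theta> by simp
    ultimately show "\<rho> \<le> (\<theta> / 2) ^ q * C" by simp
  qed (simp add: C_def)
  \<comment> \<open>The required common neighbourhoods have about \<open>\<tau> * n\<close>
    vertices, the largest size for which all \<open>2 ^ C\<close> traces can be afforded.\<close>
  define \<tau> where "\<tau> = \<theta> / (2 * 2 ^ C)"
  have \<tau>: "\<tau> > 0" using \<theta> by (simp add: \<tau>_def)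
  define \<beta> where "\<beta> = \<tau> / (4 * q * \<rho>)"
  have \<beta>: "\<beta> > 0" "q * \<rho> * \<beta> = \<tau> / 4" using \<tau> q \<rho> by (auto simp: \<beta>_def)
  \<comment> \<open>\<open>kk\<close> bounds the order of a copy of the forbidden graph; with this
    choice its vertices together miss at most half of the lower bound \<open>n / (2 * q)\<close> for
    a class.\<close>
  define \<mu> where "\<mu> = 1 / (4 * real q * (kk + 1))"
  have \<mu>: "\<mu> > 0" "kk * \<mu> \<le> 1 / (4 * real q)"
  proof -
    show "\<mu> > 0" using kk q by (simp add: \<mu>_def)
    have "kk * \<mu> \<le> (kk + 1) * \<mu>" using \<open>\<mu> > 0\<close> by (intro mult_right_mono) auto
    also have "\<dots> = 1 / (4 * real q)" using kk q by (simp add: \<mu>_def)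
    finally show "kk * \<mu> \<le> 1 / (4 * real q)" .
  qed
  define \<xi>' where "\<xi>' = min \<xi> (min (\<theta> / 8) (1 / (2 * real q)))"
  have \<xi>': "\<xi>' > 0" "\<xi>' \<le> \<xi>" "\<xi>' \<le> \<theta> / 8" "\<xi>' \<le> 1 / (2 * real q)" using \<xi> \<theta> q by (auto simp: \<xi>'_def)
  \<comment> \<open>The three bounds serve the class sizes, the number of vertices missing more than
    \<open>\<mu> * n\<close>, and the number missing more than \<open>\<beta> * n\<close>.\<close>
  define \<eta> where "\<eta> = min (\<xi>'\<^sup>2 / 2) (min (\<theta> * \<mu> / 16) (\<tau> * \<beta> / 8))"
  have \<eta>: "\<eta> > 0" "2 * \<eta> \<le> \<xi>'\<^sup>2" "2 * \<eta> / \<mu> \<le> \<theta> / 8" "2 * \<eta> / \<beta> \<le> \<tau> / 4"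
  proof -
    show "\<eta> > 0" using \<xi>' \<theta> \<mu> \<tau> \<beta> by (auto simp: \<eta>_def)
    have "\<eta> \<le> \<xi>'\<^sup>2 / 2" "\<eta> \<le> \<theta> * \<mu> / 16" "\<eta> \<le> \<tau> * \<beta> / 8" by (auto simp: \<eta>_def)
    thus "2 * \<eta> \<le> \<xi>'\<^sup>2" "2 * \<eta> / \<mu> \<le> \<theta> / 8" "2 * \<eta> / \<beta> \<le> \<tau> / 4" using \<mu> \<beta> by (auto simp: field_simps)
  qed
  from erdos_simonovits_stability[OF \<eta>(1) \<rho> q]
  obtain \<gamma> N1 where \<gamma>: "\<gamma> > 0" and N1: "\<forall>(V::'a set) R. finite V \<longrightarrow> symp R \<longrightarrow> irreflp R \<longrightarrow> N1 \<le> card V \<longrightarrow>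
    \<not> has_blocks R V {1..Suc q} (\<lambda>_. \<rho>) \<longrightarrow> (1 - 1 / real q - \<gamma>) * real (card V) ^ 2 \<le> pair_count R V V \<longrightarrow>
    (\<exists>c. (\<forall>v\<in>V. c v \<in> {1..q}) \<and> mono_count R V c \<le> \<eta> * real (card V) ^ 2)" by (elim exE conjE)
  define N0 where "N0 = N1 + nat \<lceil>q / \<gamma>\<rceil> + nat \<lceil>q / \<eta>\<rceil> + nat \<lceil>4 * real q * (kk + 1)\<rceil> + nat \<lceil>8 / \<theta>\<rceil> +
    nat \<lceil>2 * (\<rho> + 2) / \<tau>\<rceil> + 1"
  show ?thesis
  proof (rule exI[of _ C], rule exI[of _ N0], intro allI impI)
    fix V :: "'a set" and R
    assume V: "finite V" and R: "symp R" "irreflp R" and N0: "N0 \<le> card V"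
      and free: "\<not> has_blocks R V {1..Suc q} r"
      and max: "\<forall>R'. symp R' \<longrightarrow> irreflp R' \<longrightarrow> \<not> has_blocks R' V {1..Suc q} r \<longrightarrow> pair_count R' V V \<le> pair_count R V V"
      and dense: "(1 - 1 / real q) * real (card V) ^ 2 - q \<le> pair_count R V V"
    define n where "n = real (card V)"
    have n: "n \<ge> 1" "q / \<gamma> \<le> n" "q / \<eta> \<le> n" "4 * real q * (kk + 1) < n" "8 / \<theta> \<le> n" "2 * (\<rho> + 2) / \<tau> \<le> n"
      using N0 unfolding N0_def n_def by linarith+
    have q\<gamma>: "q \<le> \<gamma> * n ^ 2" and q\<eta>: "q \<le> \<eta> * n ^ 2"
    proof -
      have nn: "n \<le> n ^ 2" using n(1) by (simp add: power2_eq_square)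
      have "q \<le> \<gamma> * n" using n(2) \<gamma> by (simp add: field_simps)
      thus "q \<le> \<gamma> * n ^ 2" using mult_left_mono[OF nn, of \<gamma>] \<gamma> by linarith
      have "q \<le> \<eta> * n" using n(3) \<eta>(1) by (simp add: field_simps)
      thus "q \<le> \<eta> * n ^ 2" using mult_left_mono[OF nn, of \<eta>] \<eta>(1) by linarith
    qed
    interpret H0: host V R q r "\<lambda>_. 1" using V R q rmono free by unfold_locales auto
    have "\<not> has_blocks R V {1..Suc q} (\<lambda>_. \<rho>)"
    proof
      assume "has_blocks R V {1..Suc q} (\<lambda>_. \<rho>)"
      hence "has_blocks R V {1..Suc q} r"
        by (rule has_blocks_reindex[of id _ _ r, rotated 2]) (use H0.r_le_rmax in \<open>auto simp: \<rho>_def H0.rmax_def\<close>)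
      thus False using free by contradiction
    qed
    moreover have "(1 - 1 / real q - \<gamma>) * n ^ 2 \<le> pair_count R V V"
      using dense q\<gamma> unfolding n_def[symmetric] by (simp add: left_diff_distrib)
    ultimately have "\<exists>c0. (\<forall>v\<in>V. c0 v \<in> {1..q}) \<and> mono_count R V c0 \<le> \<eta> * real (card V) ^ 2"
      using N0 unfolding n_def by (intro N1[THEN spec, THEN spec, THEN mp, THEN mp, THEN mp, THEN mp, THEN mp, THEN mp, OF V R])
        (auto simp: N0_def)
    then obtain c0 where c0: "\<forall>v\<in>V. c0 v \<in> {1..q}" "mono_count R V c0 \<le> \<eta> * n ^ 2" unfolding n_def by (elim exE conjE)
    obtain c :: "'a \<Rightarrow> nat" where cV: "\<forall>v\<in>V. c v \<in> {1..q}"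
      and "mono_count R V c \<le> mono_count R V c0"
      and cmin: "\<forall>v\<in>V. \<forall>j\<in>{1..q}. card {w \<in> V. c w = c v \<and> R v w} \<le> card {w \<in> V. c w = j \<and> R v w}"
      by (rule minimal_colouring[OF V R c0(1)])
    hence mono: "mono_count R V c \<le> \<eta> * n ^ 2" using c0(2) by linarith
    interpret host V R q r c using V R q rmono free by unfold_locales auto
    have rmax: "rmax = \<rho>" by (simp add: rmax_def \<rho>_def)
    define T where "T = (\<Sum>v\<in>V. real (total_miss v))"
    define P2 where "P2 = (\<Sum>j\<in>{1..q}. real (card (S j)) ^ 2)"
    have eq: "T + pair_count R V V + P2 = n ^ 2 + mono_count R V c"
    proof -
      have "real ((\<Sum>v\<in>V. total_miss v) + pair_count R V V + (\<Sum>j\<in>{1..q}. card (S j) ^ 2)) =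
        real (card V ^ 2 + mono_count R V c)" by (simp only: sum_total_miss[OF cV])
      thus ?thesis by (simp add: T_def P2_def n_def)
    qed
    have T0: "T \<ge> 0" unfolding T_def by (intro sum_nonneg) auto
    have dev0: "P2 - n ^ 2 / q \<ge> 0"
      using sum_square_deviation[OF cV] sum_nonneg[of "{1..q}" "\<lambda>j. (real (card (S j)) - card V / q) ^ 2"]
      by (simp add: P2_def n_def)
    have dense': "n ^ 2 - n ^ 2 / q - q \<le> pair_count R V V" using dense unfolding n_def by (simp add: left_diff_distrib)
    have T2: "T \<le> 2 * \<eta> * n ^ 2" and dev: "P2 - n ^ 2 / q \<le> 2 * \<eta> * n ^ 2"
      using eq T0 dev0 dense' mono q\<eta> by linarith+
    have size: "\<bar>real (card (S j)) - n / q\<bar> \<le> \<xi>' * n" if "j \<in> {1..q}" for j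
      unfolding n_def
    proof (rule class_size_deviation[OF cV that])
      have "2 * \<eta> * n ^ 2 \<le> \<xi>'\<^sup>2 * n ^ 2" using \<eta>(2) by (intro mult_right_mono) auto
      thus "(\<Sum>j\<in>{1..q}. real (card (S j)) ^ 2) - real (card V) ^ 2 / q \<le> (\<xi>' * card V) ^ 2"
        using dev unfolding P2_def n_def power_mult_distrib by linarith
    qed (use \<xi>' in auto)
    \<comment> \<open>Markov's inequality for the total number of missing pairs, which is at most
      \<open>2 * \<eta> * n ^ 2\<close>.\<close>
    have few: "real (card {v \<in> V. \<exists>j\<in>{1..q}. j \<noteq> c v \<and> b * n < miss v j}) \<le> 2 * \<eta> / b * n" if b: "b > 0" for b
    proof -
      let ?B = "{v \<in> V. \<exists>j\<in>{1..q}. j \<noteq> c v \<and> b * n < miss v j}"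
      have "real (card ?B) * (b * n) \<le> (\<Sum>v\<in>?B. real (total_miss v))"
      proof (rule sum_bounded_below)
        fix v assume "v \<in> ?B"
        then obtain j where j: "j \<in> {1..q} - {c v}" "b * n < miss v j" by auto
        have "miss v j \<le> total_miss v" unfolding total_miss_def by (rule member_le_sum) (use j in auto)
        thus "b * n \<le> real (total_miss v)" using j(2) by linarith
      qed
      also have "\<dots> \<le> T" unfolding T_def using V by (intro sum_mono2) auto
      also have "T \<le> 2 * \<eta> * n * n" using T2 by (simp add: power2_eq_square)
      finally have "n * (real (card ?B) * b) \<le> n * (2 * \<eta> * n)" by (simp add: mult_ac)
      hence "real (card ?B) * b \<le> 2 * \<eta> * n" using n(1) by simp
      thus ?thesis using b by (simp add: field_simps)
    qed
    have big1: "n / (2 * q) \<le> card (S j)" if "j \<in> {1..q}" for j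
    proof -
      have "\<xi>' * n \<le> 1 / (2 * real q) * n" using \<xi>'(4) n(1) by (intro mult_right_mono) auto
      moreover have "n / q = n / (2 * q) + 1 / (2 * real q) * n" using q by (simp add: field_simps)
      ultimately show ?thesis using size[OF that] by linarith
    qed
    \<comment> \<open>Class 1 supplies the substitutes for every \<open>v\<close>, whatever the
      class of \<open>v\<close>, since all classes have almost the same size.\<close>
    have deg: "n - n / q - \<theta> / 2 * n \<le> card {w \<in> V. R v w}" if v: "v \<in> V" for v
    proof -
      have one: "1 \<in> {1..q}" using q by auto
      let ?B = "{v \<in> V. \<exists>j\<in>{1..q}. j \<noteq> c v \<and> \<mu> * n < miss v j}"
      define Y where "Y = V - S 1 - {v} - ?B"
      have "card Y \<le> card {w \<in> V. R v w}"
      proof (rule min_degree[of v Y 1 "\<mu> * n"])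
        show "real (miss x 1) \<le> \<mu> * n" if "x \<in> Y" for x
        proof -
          have "x \<in> V" "x \<notin> S 1" "x \<notin> ?B" using that unfolding Y_def by blast+
          moreover from this have "1 \<noteq> c x" by (auto simp: S_def)
          moreover have "x \<in> ?B" if "x \<in> V" "1 \<noteq> c x" "\<mu> * n < miss x 1"
            by (intro CollectI conjI bexI[of _ 1] one) (use that in auto)
          ultimately show ?thesis using not_le by blast
        qed
        have "(kk * \<mu>) * n \<le> 1 / (4 * real q) * n" using \<mu>(2) n(1) by (intro mult_right_mono) auto
        moreover have "kk + 1 < 1 / (4 * real q) * n" using n(4) q by (simp add: field_simps)
        moreover have "n / (2 * q) = 1 / (4 * real q) * n + 1 / (4 * real q) * n" using q by (simp add: field_simps)
        ultimately show "(\<Sum>j\<in>{1..Suc q}. real (r j)) * (\<mu> * n + 1) + 1 < card (S 1)"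
          using big1[OF one] unfolding kk_def[symmetric] by (simp add: algebra_simps)
      qed (use max v \<mu> n Y_def in auto)
      moreover have "V \<subseteq> Y \<union> S 1 \<union> {v} \<union> ?B" by (auto simp: Y_def)
      hence "card V \<le> card (Y \<union> S 1 \<union> {v} \<union> ?B)" using V finS by (intro card_mono) (auto simp: Y_def)
      hence "card V \<le> card Y + card (S 1) + 1 + card ?B"
        using card_Un_le[of "Y \<union> S 1 \<union> {v}" ?B] card_Un_le[of "Y \<union> S 1" "{v}"] card_Un_le[of Y "S 1"] by simp
      hence "n \<le> card Y + real (card (S 1)) + 1 + real (card ?B)" unfolding n_def by linarith
      moreover have "real (card ?B) \<le> \<theta> / 8 * n"
        using few[OF \<mu>(1)] mult_right_mono[OF \<eta>(3), of n] n(1) by linarith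
      moreover have "real (card (S 1)) \<le> n / q + \<theta> / 8 * n"
        using size[OF one] mult_right_mono[OF \<xi>'(3), of n] n(1) by linarith
      moreover have "1 \<le> \<theta> / 8 * n" using n(5) \<theta> by (simp add: field_simps)
      ultimately show ?thesis using n(1) \<theta> by (simp add: algebra_simps)
    qed
    have missb: "real (miss v j) \<le> card {w \<in> S (c v). R v w} + \<theta> * n" if v: "v \<in> V" and j: "j \<in> {1..q}" "j \<noteq> c v" for v j
    proof -
      have "miss v j \<le> total_miss v" unfolding total_miss_def by (rule member_le_sum) (use j in auto)
      moreover have "real (total_miss v) + card {w \<in> V. R v w} + card (S (c v)) = n + card {w \<in> S (c v). R v w}"
      proof -
        have "real (total_miss v + card {w \<in> V. R v w} + card (S (c v))) = real (card V + card {w \<in> S (c v). R v w})"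
          by (simp only: total_miss_eq[OF cV v])
        thus ?thesis by (simp add: n_def)
      qed
      moreover have "n / q - \<xi>' * n \<le> card (S (c v))" using size[OF cV[rule_format, OF v]] by linarith
      moreover have "\<xi>' * n \<le> \<theta> / 8 * n" using mult_right_mono[OF \<xi>'(3), of n] n(1) by simp
      moreover have "\<theta> / 8 * n + \<theta> / 2 * n \<le> \<theta> * n" using \<theta> n(1) by (simp add: algebra_simps)
      ultimately show ?thesis using deg[OF v] by linarith
    qed
    have cmin': "card {w \<in> S (c v). R v w} \<le> card {w \<in> S j. R v w}" if "v \<in> V" "j \<in> {1..q}" for v j
    proof -
      have "{w \<in> S i. R v w} = {w \<in> V. c w = i \<and> R v w}" for i by (auto simp: S_def)
      thus ?thesis using cmin that by simp
    qed
    define D where "D = {v \<in> V. \<theta> * n < card {w \<in> S (c v). R v w}}"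
    have "card D < C"
    proof -
      define m where "m = nat \<lfloor>\<tau> * n\<rfloor>"
      have \<tau>n: "2 * (\<rho> + 2) \<le> \<tau> * n" using n(6) \<tau> by (simp add: field_simps)
      have m: "real m \<le> \<tau> * n" "\<tau> * n - 1 \<le> real m" unfolding m_def using \<tau> n(1) by auto
      show ?thesis
      proof (rule few_bad_vertices[of D \<theta> "\<beta> * n" "\<tau> / 4 * n" C m])
        show "V \<noteq> {}" using n(1) by (auto simp: n_def)
        show "\<theta> * card V \<le> card {x \<in> S j. R d x}" if "j \<in> {1..q}" "d \<in> D" for j d
          using that cmin'[of d j] unfolding D_def n_def by force
        have "{v \<in> V. \<not> good (\<beta> * n) v} \<subseteq> {v \<in> V. \<exists>j\<in>{1..q}. j \<noteq> c v \<and> \<beta> * n < miss v j}"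
          by (auto simp: good_def not_le)
        hence "card {v \<in> V. \<not> good (\<beta> * n) v} \<le> card {v \<in> V. \<exists>j\<in>{1..q}. j \<noteq> c v \<and> \<beta> * n < miss v j}"
          using V by (intro card_mono) auto
        thus "real (card {v \<in> V. \<not> good (\<beta> * n) v}) \<le> \<tau> / 4 * n"
          using few[OF \<beta>(1)] mult_right_mono[OF \<eta>(4), of n] n(1) by linarith
        have "2 ^ C * real m \<le> 2 ^ C * (\<tau> * n)" using m by (intro mult_left_mono) auto
        also have "\<dots> = \<theta> / 2 * n" by (simp add: \<tau>_def)
        finally show "2 ^ C * real m \<le> \<theta> / 2 * card V" by (simp add: n_def)
        have "real q * rmax * (\<beta> * n) = (q * \<rho> * \<beta>) * n" by (simp add: rmax)
        also have "\<dots> = \<tau> / 4 * n" by (simp only: \<beta>(2))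
        finally have E: "real q * rmax * (\<beta> * n) = \<tau> / 4 * n" .
        have "2 * real rmax + 4 \<le> \<tau> * n" using \<tau>n by (simp add: rmax)
        moreover have "\<tau> / 4 * n = \<tau> * n / 4" by simp
        ultimately show "\<tau> / 4 * n + rmax + real q * rmax * (\<beta> * n) \<le> m" using m E by linarith
        show "0 < m" using m \<tau>n \<rho> by (cases m) auto
      qed (use \<theta> \<beta> n C in \<open>auto simp: D_def rmax\<close>)
    qed
    moreover have "\<bar>real (card (S j)) - card V / q\<bar> \<le> \<xi> * card V" if "j \<in> {1..q}" for j
      using size[OF that] mult_right_mono[OF \<xi>'(2), of n] n(1) unfolding n_def by linarith
    ultimately show "\<exists>c. good_colouring V R q r \<theta> \<xi> C c"
      using cV cmin' missb host_axioms unfolding D_def n_def good_colouring_def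
      by (intro exI[of _ c] conjI ballI impI) auto
  qed
qed

section \<open>Lower bounds from joins\<close>

lemma join_no_blocks:
  assumes q: "q > 0" and rmono: "mono_on {1..Suc q} r" and fin: "\<And>i. i \<in> {1..q} \<Longrightarrow> finite (U i)"
    and R: "symp R" "irreflp R" and V: "V \<subseteq> (\<Union>i\<in>{1..q}. U i)"
    and U1: "\<not> has_bip R (U 1) (r 1) (r 2)"
    and U2: "\<And>i. i \<in> {2..q} \<Longrightarrow> \<not> has_bip R (U i) 1 (r 2)" "\<And>i. i \<in> {2..q} \<Longrightarrow> \<not> has_bip R (U i) 2 2"
      "\<And>i. i \<in> {2..q} \<Longrightarrow> \<not> (\<exists>u\<in>U i. \<exists>v\<in>U i. \<exists>w\<in>U i. R u v \<and> R v w \<and> R u w)"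
  shows "\<not> has_blocks R V {1..Suc q} r"
proof
  assume "has_blocks R V {1..Suc q} r"
  then obtain A where A: "is_blocks R V {1..Suc q} r A" unfolding has_blocks_def by blast
  have le: "r i \<le> r j" if "i \<in> {1..Suc q}" "j \<in> {1..Suc q}" "i \<le> j" for i j
    by (rule mono_onD[OF rmono that])
  have "has_bip R (U 1) (r 1) (r 2)"
  proof (rule join_bip[of "{2..q}" "{1..Suc q}" 1 "r 1" "r 2" "U 1" R U A])
    have V': "V \<subseteq> U 1 \<union> (\<Union>c\<in>{2..q}. U c)"
    proof
      fix x assume "x \<in> V"
      then obtain i where i: "i \<in> {1..q}" "x \<in> U i" using V by blast
      show "x \<in> U 1 \<union> (\<Union>c\<in>{2..q}. U c)"
      proof (cases "i = 1")
        case False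
        hence "i \<in> {2..q}" using i(1) by auto
        thus ?thesis using i(2) by blast
      qed (use i in simp)
    qed
    show "A i \<subseteq> U 1 \<union> (\<Union>c\<in>{2..q}. U c)" if "i \<in> {1..Suc q}" for i
      using is_blocksD(1)[OF A that] V' by blast
    show "r 1 \<le> card (A 1)" using is_blocksD(2)[OF A, of 1] by auto
    show "r 2 \<le> card (A i)" if "i \<in> {1..Suc q} - {1}" for i
      using is_blocksD(2)[OF A, of i] le[of 2 i] that q by fastforce
    show "R u v" if "i \<in> {1..Suc q}" "j \<in> {1..Suc q}" "i \<noteq> j" "u \<in> A i" "v \<in> A j" for i j u v
      by (rule is_blocksD(3)[OF A that])
    show "r 1 \<le> r 2" using le[of 1 2] q by auto
    show "finite (U 1)" using fin[of 1] q by auto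
    show "finite (U c)" if "c \<in> {2..q}" for c using fin[of c] that by auto
    show "card {2..q} + 2 \<le> card {1..Suc q}" using q by simp
    show "\<not> has_bip R (U c) 1 (r 2)" "\<not> has_bip R (U c) 2 2"
      "\<not> (\<exists>u\<in>U c. \<exists>v\<in>U c. \<exists>w\<in>U c. R u v \<and> R v w \<and> R u w)" if "c \<in> {2..q}" for c
      by (rule U2[OF that])+
  qed (rule R | simp)+
  thus False using U1 by contradiction
qed

lemma free_K_iff:
  assumes "finite V" "symp R" "irreflp R"
  shows "free_of (graph_of V R) {complete_multipartite (map r [1..<q+2])} \<longleftrightarrow> \<not> has_blocks R V {1..Suc q} r"
proof -
  let ?rs = "map r [1..<q+2]"
  have nth: "?rs ! i = r (Suc i)" if "i < Suc q" for i using that by (simp del: upt_Suc)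
  have len: "length ?rs = Suc q" by simp
  have b1: "bij_betw Suc {..<length ?rs} {1..Suc q}" unfolding len
    by (rule bij_betw_byWitness[where f'="\<lambda>i. i - 1"]) auto
  have b2: "bij_betw (\<lambda>i. i - 1) {1..Suc q} {..<length ?rs}" unfolding len
    by (rule bij_betw_byWitness[where f'=Suc]) auto
  have "has_blocks R V {..<length ?rs} (\<lambda>i. ?rs ! i) \<longleftrightarrow> has_blocks R V {1..Suc q} r"
  proof
    assume h: "has_blocks R V {..<length ?rs} (\<lambda>i. ?rs ! i)"
    show "has_blocks R V {1..Suc q} r"
    proof (rule has_blocks_reindex[OF b2 _ h])
      fix i assume "i \<in> {1..Suc q}"
      hence "i - 1 < Suc q" "Suc (i - 1) = i" by auto
      thus "r i \<le> ?rs ! (i - 1)" by (simp only: nth order_refl)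
    qed
  next
    assume h: "has_blocks R V {1..Suc q} r"
    show "has_blocks R V {..<length ?rs} (\<lambda>i. ?rs ! i)"
      by (rule has_blocks_reindex[OF b1 _ h]) (simp only: len lessThan_iff nth order_refl)
  qed
  thus ?thesis using free_multipartite_iff[OF assms] by metis
qed

text \<open>At every vertex, the neighbourhood and the own class cover \<open>V\<close> and overlap
  in the inner neighbours. Written with sums on both sides to avoid subtraction.\<close>

lemma complete_join_pair_count:
  fixes c :: "'a \<Rightarrow> nat"
  assumes V: "finite V" and cV: "\<forall>v\<in>V. c v \<in> {1..q}"
    and full: "\<And>u v. u \<in> V \<Longrightarrow> v \<in> V \<Longrightarrow> c u \<noteq> c v \<Longrightarrow> R u v"
  shows "pair_count R V V + (\<Sum>i\<in>{1..q}. card {v \<in> V. c v = i} ^ 2) =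
     card V ^ 2 + (\<Sum>i\<in>{1..q}. pair_count R {v \<in> V. c v = i} {v \<in> V. c v = i})"
proof -
  define U where "U i = {v \<in> V. c v = i}" for i
  have "pair_count R V V + (\<Sum>v\<in>V. card (U (c v))) = (\<Sum>v\<in>V. card V + card {w \<in> V. c w = c v \<and> R v w})"
    unfolding pair_count_def sum.distrib[symmetric]
  proof (rule sum.cong[OF refl])
    fix v assume v: "v \<in> V"
    have "{w \<in> V. R v w} \<union> U (c v) = V" "{w \<in> V. R v w} \<inter> U (c v) = {w \<in> V. c w = c v \<and> R v w}"
      using full[OF v] by (auto simp: U_def)
    moreover have "finite {w \<in> V. R v w}" "finite (U (c v))" using V by (auto simp: U_def)
    ultimately show "card {w \<in> V. R v w} + card (U (c v)) = card V + card {w \<in> V. c w = c v \<and> R v w}"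
      by (metis card_Un_Int)
  qed
  also have "\<dots> = card V ^ 2 + mono_count R V c" by (simp add: sum.distrib mono_count_def power2_eq_square)
  also have "mono_count R V c = (\<Sum>i\<in>{1..q}. pair_count R (U i) (U i))"
    unfolding U_def by (rule mono_count_split) (use V cV in auto)
  also have "(\<Sum>v\<in>V. card (U (c v))) = (\<Sum>i\<in>{1..q}. card (U i) ^ 2)"
  proof -
    have "(\<Sum>v\<in>V. card (U (c v))) = (\<Sum>j\<in>{1..q}. \<Sum>v\<in>{v \<in> V. c v = j}. card (U (c v)))"
      by (rule sum.group[symmetric]) (use V cV in auto)
    also have "\<dots> = (\<Sum>j\<in>{1..q}. card (U j) ^ 2)"
    proof (rule sum.cong[OF refl])
      fix j
      have "(\<Sum>v\<in>{v \<in> V. c v = j}. card (U (c v))) = (\<Sum>v\<in>U j. card (U j))"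
        unfolding U_def by (intro sum.cong) auto
      thus "(\<Sum>v\<in>{v \<in> V. c v = j}. card (U (c v))) = card (U j) ^ 2" by (simp add: power2_eq_square)
    qed
    finally show ?thesis .
  qed
  finally show ?thesis unfolding U_def .
qed

abbreviation (input) ex_K :: "nat \<Rightarrow> (nat \<Rightarrow> nat) \<Rightarrow> nat \<Rightarrow> nat" where
  "ex_K q r n \<equiv> ex_number n {complete_multipartite (map r [1..<q+2])}"

abbreviation (input) ex_bip :: "nat \<Rightarrow> nat \<Rightarrow> nat \<Rightarrow> nat" where
  "ex_bip a b n \<equiv> ex_number n {complete_multipartite [a, b]}"

text \<open>The parameters \<open>m\<close> are arbitrary: balanced parts give the Turan-type bound,
  and the class sizes of an extremal graph give the tight comparison.\<close>

lemma join_lower_bound: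
  fixes m :: "nat \<Rightarrow> nat"
  assumes q: "q > 0" and rpos: "\<forall>i\<in>{1..Suc q}. r i > 0" and rmono: "mono_on {1..Suc q} r"
    and n: "n = (\<Sum>i\<in>{1..q}. m i)"
  shows "n ^ 2 + 2 * ex_bip (r 1) (r 2) (m 1) + (\<Sum>i\<in>{2..q}. 2 * ex_number (m i) (girth5_family (r 2))) \<le>
     2 * ex_K q r n + (\<Sum>i\<in>{1..q}. m i ^ 2)"
proof -
  define U where "U i = {i} \<times> {..<m i}" for i :: nat
  define V where "V = (\<Union>i\<in>{1..q}. U i)"
  define F where "F i = (if i = 1 then {complete_multipartite [r 1, r 2]} else girth5_family (r 2))" for i :: nat
  have r12: "r 1 > 0" "r 2 > 0" using rpos q by auto
  have finU: "finite (U i)" for i by (simp add: U_def)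
  have Fne: "\<forall>H\<in>F i. edges H \<noteq> {}" for i
    using edges_bip_nonempty[OF r12] girth5_edges_nonempty[OF r12(2)] by (simp add: F_def)
  have "\<forall>i. \<exists>R. symp R \<and> irreflp R \<and> free_of (graph_of (U i) R) (F i) \<and>
      pair_count R (U i) (U i) = 2 * ex_number (card (U i)) (F i)"
  proof
    fix i
    show "\<exists>R. symp R \<and> irreflp R \<and> free_of (graph_of (U i) R) (F i) \<and>
      pair_count R (U i) (U i) = 2 * ex_number (card (U i)) (F i)"
      by (rule ex_number_attained[OF finU[of i] Fne[of i]]) blast
  qed
  from choice[OF this] obtain Rc where Rc:
    "\<And>i. symp (Rc i) \<and> irreflp (Rc i) \<and> free_of (graph_of (U i) (Rc i)) (F i) \<and>
       pair_count (Rc i) (U i) (U i) = 2 * ex_number (card (U i)) (F i)" by blast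
  define R where "R = (\<lambda>u v :: nat \<times> nat. if fst u = fst v then Rc (fst u) u v else True)"
  have RU: "R u v \<longleftrightarrow> Rc i u v" if "u \<in> U i" "v \<in> U i" for i u v using that by (auto simp: R_def U_def)
  have R: "symp R" "irreflp R" using Rc by (auto simp: R_def symp_def irreflp_def)
  have finV: "finite V" by (simp add: V_def finU)
  have Ui: "{v \<in> V. fst v = i} = U i" if "i \<in> {1..q}" for i using that by (auto simp: V_def U_def)
  have bip: "has_bip R (U i) a b \<longleftrightarrow> has_bip (Rc i) (U i) a b" for i a b
    unfolding has_bip_def using RU by (intro ex_cong1) (meson subsetD)
  have pcU: "pair_count R (U i) (U i) = 2 * ex_number (m i) (F i)" for i
  proof -
    have "pair_count R (U i) (U i) = pair_count (Rc i) (U i) (U i)" unfolding pair_count_def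
      by (intro sum.cong arg_cong[of _ _ card]) (auto simp: RU)
    thus ?thesis using Rc[of i] by (simp add: U_def card_cartesian_product)
  qed
  have "\<not> has_blocks R V {1..Suc q} r"
  proof (rule join_no_blocks[OF q rmono finU R])
    show "\<not> has_bip R (U 1) (r 1) (r 2)"
      unfolding bip using Rc[of 1] free_bip_iff[OF finU[of 1], of "Rc 1" "r 1" "r 2"] by (simp add: F_def)
    fix i assume i: "i \<in> {2..q}"
    have g: "\<not> has_bip (Rc i) (U i) 1 (r 2) \<and> \<not> has_bip (Rc i) (U i) 2 2 \<and>
        \<not> (\<exists>u\<in>U i. \<exists>v\<in>U i. \<exists>w\<in>U i. Rc i u v \<and> Rc i v w \<and> Rc i u w)"
    proof -
      have "F i = girth5_family (r 2)" using i by (simp add: F_def)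
      hence "free_of (graph_of (U i) (Rc i)) (girth5_family (r 2))" using Rc[of i] by (simp only:)
      thus ?thesis using Rc[of i] free_girth5_iff[OF finU[of i]] by blast
    qed
    show "\<not> has_bip R (U i) 1 (r 2)" unfolding bip by (rule g[THEN conjunct1])
    show "\<not> has_bip R (U i) 2 2" unfolding bip by (rule g[THEN conjunct2, THEN conjunct1])
    show "\<not> (\<exists>u\<in>U i. \<exists>v\<in>U i. \<exists>w\<in>U i. R u v \<and> R v w \<and> R u w)"
    proof
      assume "\<exists>u\<in>U i. \<exists>v\<in>U i. \<exists>w\<in>U i. R u v \<and> R v w \<and> R u w"
      then obtain u v w where "u \<in> U i" "v \<in> U i" "w \<in> U i" "R u v" "R v w" "R u w" by (elim bexE conjE)
      thus False using g[THEN conjunct2, THEN conjunct2] RU[of u i v] RU[of v i w] RU[of u i w] by blast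
    qed
  qed (simp add: V_def)
  hence "free_of (graph_of V R) {complete_multipartite (map r [1..<q+2])}"
    using free_K_iff[OF finV R] by blast
  hence le: "pair_count R V V \<le> 2 * ex_K q r (card V)" by (rule pair_count_le_ex_number[OF finV R])
  have cardV: "card V = n"
  proof -
    have "card V = (\<Sum>i\<in>{1..q}. card (U i))" unfolding V_def
      by (intro card_UN_disjoint) (auto simp: U_def)
    thus ?thesis by (simp add: U_def card_cartesian_product n)
  qed
  have "pair_count R V V + (\<Sum>i\<in>{1..q}. card {v \<in> V. fst v = i} ^ 2) =
     card V ^ 2 + (\<Sum>i\<in>{1..q}. pair_count R {v \<in> V. fst v = i} {v \<in> V. fst v = i})"
    by (rule complete_join_pair_count[OF finV]) (auto simp: V_def U_def R_def)
  moreover have "(\<Sum>i\<in>{1..q}. card {v \<in> V. fst v = i} ^ 2) = (\<Sum>i\<in>{1..q}. m i ^ 2)"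
    by (intro sum.cong refl) (simp only: Ui, simp add: U_def card_cartesian_product)
  moreover have "(\<Sum>i\<in>{1..q}. pair_count R {v \<in> V. fst v = i} {v \<in> V. fst v = i}) = (\<Sum>i\<in>{1..q}. 2 * ex_number (m i) (F i))"
    by (intro sum.cong refl) (simp only: Ui pcU)
  moreover have "(\<Sum>i\<in>{1..q}. 2 * ex_number (m i) (F i)) = 2 * ex_number (m 1) (F 1) + (\<Sum>i\<in>{1..q} - {1}. 2 * ex_number (m i) (F i))"
    by (rule sum.remove) (use q in auto)
  moreover have "{1..q} - {1} = {2..q}" by auto
  moreover have "(\<Sum>i\<in>{2..q}. 2 * ex_number (m i) (F i)) = (\<Sum>i\<in>{2..q}. 2 * ex_number (m i) (girth5_family (r 2)))"
    by (intro sum.cong) (auto simp: F_def)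
  ultimately show ?thesis using le by (simp add: cardV F_def)
qed

text \<open>The error term \<open>q\<close> absorbs the rounding: the balanced sum of squares
  exceeds \<open>n ^ 2 / q\<close> by less than \<open>q\<close>.\<close>

lemma turan_lower_bound:
  assumes q: "q > 0" and rpos: "\<forall>i\<in>{1..Suc q}. r i > 0" and rmono: "mono_on {1..Suc q} r"
  shows "(1 - 1 / real q) * real n ^ 2 - q + 2 * ex_bip (r 1) (r 2) (n div q) \<le> 2 * real (ex_K q r n)"
proof -
  define s \<rho> where "s = n div q" and "\<rho> = n mod q"
  have \<rho>: "\<rho> < q" using q by (simp add: \<rho>_def)
  have nq: "n = q * s + \<rho>" by (simp add: s_def \<rho>_def)
  \<comment> \<open>The larger parts come last, so that the first part has size
    \<open>n div q\<close> exactly.\<close>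
  define m where "m i = s + (if q - \<rho> < i then 1 else 0)" for i
  have cnt: "(\<Sum>i\<in>{1..q}. if q - \<rho> < i then k else 0) = \<rho> * k" for k :: nat
  proof -
    have "{1..q} \<inter> {i. q - \<rho> < i} = {Suc (q - \<rho>)..q}" by auto
    thus ?thesis using \<rho> by (simp add: sum.If_cases)
  qed
  have n: "n = (\<Sum>i\<in>{1..q}. m i)" unfolding m_def sum.distrib cnt by (simp add: nq)
  have "(\<Sum>i\<in>{1..q}. m i ^ 2) = (\<Sum>i\<in>{1..q}. s ^ 2 + (if q - \<rho> < i then 2 * s + 1 else 0))"
    by (intro sum.cong) (auto simp: m_def power2_eq_square)
  also have "\<dots> = q * s ^ 2 + \<rho> * (2 * s + 1)" unfolding sum.distrib cnt by simp
  finally have sq: "real (\<Sum>i\<in>{1..q}. m i ^ 2) = q * real s ^ 2 + \<rho> * (2 * s + 1)" by simp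
  have "real n ^ 2 / q = q * real s ^ 2 + 2 * s * \<rho> + real \<rho> ^ 2 / q"
    using q by (simp add: nq power2_eq_square field_simps)
  hence "real (\<Sum>i\<in>{1..q}. m i ^ 2) \<le> real n ^ 2 / q + q"
    unfolding sq using \<rho> by (simp add: algebra_simps) (smt (verit) divide_nonneg_nonneg of_nat_0_le_iff of_nat_mono zero_le_power2 less_imp_le)
  moreover have "real (n ^ 2 + 2 * ex_bip (r 1) (r 2) (m 1)) \<le> real (2 * ex_K q r n + (\<Sum>i\<in>{1..q}. m i ^ 2))"
    using join_lower_bound[OF q rpos rmono n] unfolding of_nat_le_iff by linarith
  moreover have "m 1 = n div q" using \<rho> by (simp add: m_def s_def)
  ultimately show ?thesis by (simp add: left_diff_distrib)
qed

section \<open>Exceptional vertices and the heavy class\<close>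

lemma pair_count_diff:
  assumes "finite W" "symp R"
  shows "pair_count R W W \<le> pair_count R (W - T) (W - T) + 2 * pair_count R (W \<inter> T) W"
proof -
  have 1: "pair_count R W Y = pair_count R (W - T) Y + pair_count R (W \<inter> T) Y" for Y
    unfolding pair_count_def using assms(1) by (subst sum.Int_Diff[of W _ T]) (auto simp: add.commute)
  have "pair_count R (W - T) W = pair_count R W (W - T)"
    using assms by (intro pair_count_swap) auto
  also have "\<dots> = pair_count R (W - T) (W - T) + pair_count R (W \<inter> T) (W - T)" by (rule 1)
  also have "pair_count R (W \<inter> T) (W - T) \<le> pair_count R (W \<inter> T) W"
    using assms(1) by (intro pair_count_mono) auto
  finally show ?thesis using 1[of W] by simp
qed

lemma eventually_powr_dominates:
  fixes \<alpha> \<beta> K c :: real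
  assumes "\<alpha> < \<beta>" "c > 0" "K > 0"
  obtains N :: nat where "\<And>n. n \<ge> N \<Longrightarrow> K * real n powr \<alpha> \<le> c * real n powr \<beta>"
proof
  fix n :: nat
  assume n: "n \<ge> nat \<lceil>(K / c) powr (1 / (\<beta> - \<alpha>))\<rceil> + 1"
  have n0: "real n > 0" using n by simp
  have "(K / c) powr (1 / (\<beta> - \<alpha>)) \<le> n" using n by linarith
  hence "((K / c) powr (1 / (\<beta> - \<alpha>))) powr (\<beta> - \<alpha>) \<le> real n powr (\<beta> - \<alpha>)"
    using assms by (intro powr_mono2) auto
  hence "K / c \<le> real n powr (\<beta> - \<alpha>)" using assms by (simp add: powr_powr)
  hence "K \<le> c * real n powr (\<beta> - \<alpha>)" using assms by (simp add: field_simps)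
  hence "K * real n powr \<alpha> \<le> c * real n powr (\<beta> - \<alpha>) * real n powr \<alpha>" by (intro mult_right_mono) auto
  also have "\<dots> = c * real n powr \<beta>" using n0 by (simp add: mult.assoc flip: powr_add)
  finally show "K * real n powr \<alpha> \<le> c * real n powr \<beta>" .
qed

text \<open>The threshold \<open>\<theta>2\<close> is much smaller than \<open>\<theta>1\<close>: vertices of inner degree at most \<open>\<theta>2 * n\<close> are
  ordinary, vertices of inner degree more than \<open>\<theta>1 * n\<close> have many neighbours in every class, and the
  remaining ones are still adjacent to almost all vertices of the other classes.\<close>

locale coloured_host = host +
  fixes \<theta>1 \<theta>2 n :: real and C :: nat
  assumes n_eq: "n = card V" and cV: "\<forall>v\<in>V. c v \<in> {1..q}"
    and rpos: "r 1 > 0"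
    and size: "\<And>j. j \<in> {1..q} \<Longrightarrow> \<bar>real (card (S j)) - n / q\<bar> \<le> n / (8 * q)"
    and inner_min: "\<And>v j. v \<in> V \<Longrightarrow> j \<in> {1..q} \<Longrightarrow> card {w \<in> S (c v). R v w} \<le> card {w \<in> S j. R v w}"
    and miss_le: "\<And>v j. v \<in> V \<Longrightarrow> j \<in> {1..q} \<Longrightarrow> j \<noteq> c v \<Longrightarrow>
      real (miss v j) \<le> card {w \<in> S (c v). R v w} + \<theta>2 * n"
    and few: "card {v \<in> V. \<theta>2 * n < card {w \<in> S (c v). R v w}} < C"
    and \<theta>: "0 < \<theta>2" "\<theta>2 \<le> \<theta>1"
      "8 * real q * (real q * rmax + r 1 + r 2 + rmax + 2) * \<theta>1 \<le> 1"
      "4 * (real q * rmax + r 1 + r 2 + rmax + 2) * \<theta>2 \<le> \<theta>1"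
    and n_large: "4 * (real rmax + r 2 + C) \<le> \<theta>2 * n"
begin

definition D where "D = {v \<in> V. \<theta>2 * n < card {w \<in> S (c v). R v w}}"
definition M where "M = real q * rmax + r 1 + r 2 + rmax + 2"

lemma M2: "M \<ge> 2" by (simp add: M_def)
lemma n0: "n \<ge> 0" by (simp add: n_eq)
lemma qr: "real q \<ge> 1" using q1 by simp
lemma \<theta>10: "\<theta>1 > 0" using \<theta> by linarith
lemma \<theta>1q: "8 * real q * (M * \<theta>1) \<le> 1" using \<theta>(3) unfolding M_def by (simp only: mult.assoc)
lemma \<theta>2M: "4 * (M * \<theta>2) \<le> \<theta>1" using \<theta>(4) unfolding M_def by (simp only: mult.assoc)

lemma M\<theta>1n: "M * \<theta>1 * n \<le> n / (8 * q)"
proof -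
  have "M * \<theta>1 \<le> 1 / (8 * q)" using \<theta>1q qr by (simp add: field_simps)
  from mult_right_mono[OF this n0] show ?thesis by simp
qed

lemma M\<theta>2n: "4 * (M * \<theta>2 * n) \<le> \<theta>1 * n"
  using mult_right_mono[OF \<theta>2M n0] by (simp add: mult.assoc)

lemma \<theta>1n: "2 * (\<theta>1 * n) \<le> M * \<theta>1 * n"
  using M2 \<theta>10 n0 mult_right_mono[of 2 M "\<theta>1 * n"] by (simp add: mult.assoc)

lemma \<theta>2n: "\<theta>2 * n \<le> \<theta>1 * n" using \<theta>(2) n0 by (intro mult_right_mono)

lemma finD: "finite D" using finV by (simp add: D_def)
lemma cardD: "card D < C" using few by (simp add: D_def)

lemma small: "4 * (real rmax + r 2 + card D) \<le> \<theta>2 * n"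
proof -
  have "real (card D) \<le> real C" using cardD by simp
  hence "4 * (real rmax + r 2 + card D) \<le> 4 * (real rmax + r 2 + C)" by simp
  thus ?thesis using n_large by (rule order.trans)
qed

lemma inner_good:
  assumes "v \<in> V" "card {w \<in> S (c v). R v w} \<le> \<theta>1 * n"
  shows "good (2 * (\<theta>1 * n)) v"
  unfolding good_def
proof (intro ballI impI)
  fix j assume "j \<in> {1..q}" "j \<noteq> c v"
  from miss_le[OF assms(1) this] assms(2) \<theta>2n show "real (miss v j) \<le> 2 * (\<theta>1 * n)" by linarith
qed

lemma ordinary_good: "v \<in> V - D \<Longrightarrow> good (2 * (\<theta>2 * n)) v"
  unfolding good_def
proof (intro ballI impI)
  fix j assume v: "v \<in> V - D" and j: "j \<in> {1..q}" "j \<noteq> c v"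
  have "card {w \<in> S (c v). R v w} \<le> \<theta>2 * n" using v unfolding D_def by (simp add: not_less)
  with miss_le[of v j] v j show "real (miss v j) \<le> 2 * (\<theta>2 * n)" by auto
qed

lemma size_lower: "j \<in> {1..q} \<Longrightarrow> n / (2 * q) \<le> card (S j)"
proof -
  assume j: "j \<in> {1..q}"
  have "n / q - n / (8 * q) = 7 * (n / (8 * q))" "n / (2 * q) = 4 * (n / (8 * q))" using qr by (auto simp: field_simps)
  moreover have "0 \<le> n / (8 * q)" using n0 by simp
  moreover have "n / q - n / (8 * q) \<le> card (S j)" using size[OF j] by (simp add: abs_le_iff)
  ultimately show ?thesis by linarith
qed

text \<open>The left side is the room that the embedding lemmas ask for when all greedily chosen
  vertices are ordinary. Hence \<open>\<theta>1 * n\<close> neighbours of an exceptional vertex in a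
  class are sufficient.\<close>

lemma ordinary_requirement:
  "rmax + real q * rmax * (2 * (\<theta>2 * n)) + card D + real (r 1 + r 2) * (2 * (\<theta>2 * n)) + 2 * (\<theta>2 * n) \<le> \<theta>1 * n"
proof -
  have "real q * rmax * (2 * (\<theta>2 * n)) + real (r 1 + r 2) * (2 * (\<theta>2 * n)) + 2 * (\<theta>2 * n) =
     2 * ((real q * rmax + real (r 1 + r 2) + 1) * (\<theta>2 * n))" by (simp add: algebra_simps)
  also have "\<dots> \<le> 2 * (M * (\<theta>2 * n))" using \<theta>(1) n0 by (intro mult_left_mono mult_right_mono) (auto simp: M_def)
  finally have "real q * rmax * (2 * (\<theta>2 * n)) + real (r 1 + r 2) * (2 * (\<theta>2 * n)) + 2 * (\<theta>2 * n) \<le> 2 * (M * (\<theta>2 * n))" .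
  moreover have "4 * (M * (\<theta>2 * n)) \<le> \<theta>1 * n" using M\<theta>2n by (simp add: mult.assoc)
  moreover have "2 * (\<theta>2 * n) \<le> M * (\<theta>2 * n)" using M2 \<theta>(1) n0 by (intro mult_right_mono) auto
  moreover have "0 \<le> \<theta>2 * n" using \<theta>(1) n0 by simp
  ultimately show ?thesis using small by simp
qed

lemma \<theta>1_size: "\<theta>1 * n \<le> n / (8 * q)"
  using M\<theta>1n \<theta>1n \<theta>10 n0 mult_nonneg_nonneg[of \<theta>1 n] by linarith

lemma \<theta>1_size': "j \<in> {1..q} \<Longrightarrow> \<theta>1 * n \<le> card (S j)"
proof -
  assume j: "j \<in> {1..q}"
  have "n / (8 * q) \<le> n / (2 * q)" using qr n0 by (intro divide_left_mono) auto
  thus ?thesis using \<theta>1_size size_lower[OF j] by linarith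
qed

text \<open>Either the inner degree is at most \<open>\<theta>1 * n\<close>, and \<open>v\<close>
  misses little of the other classes, or it is larger, and optimality of the colouring gives as many
  neighbours in every class.\<close>

lemma many_neighbours:
  assumes v: "v \<in> V" and j: "j \<in> {1..q}" "j \<noteq> c v"
  shows "\<theta>1 * n \<le> card {w \<in> S j. R v w}"
proof (cases "card {w \<in> S (c v). R v w} \<le> \<theta>1 * n")
  case True
  hence "real (miss v j) \<le> 2 * (\<theta>1 * n)" using inner_good[OF v] j by (auto simp: good_def)
  moreover have "real (card {w \<in> S j. R v w}) + miss v j = card (S j)" using card_nb_miss[of j v] by (simp flip: of_nat_add)
  moreover have "2 * (\<theta>1 * n) + \<theta>1 * n \<le> n / (2 * q)"
  proof -
    have "n / (2 * q) = 4 * (n / (8 * q))" by simp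
    thus ?thesis using \<theta>1_size n0 qr by (simp add: field_simps)
  qed
  ultimately show ?thesis using size_lower[OF j(1)] by linarith
next
  case False
  thus ?thesis using inner_min[OF v j(1)] by linarith
qed

lemma class_free: "i \<in> {1..q} \<Longrightarrow> \<not> has_bip R (S i - D) (r 1) (r 2)"
proof (rule class_bip_free[where b="2 * (\<theta>2 * n)"])
  show "0 \<le> 2 * (\<theta>2 * n)" using \<theta>(1) n0 by simp
  show "rmax + real q * rmax * (2 * (\<theta>2 * n)) + card D + real (r 1 + r 2) * (2 * (\<theta>2 * n)) + 2 * (\<theta>2 * n) \<le> card (S j)"
    if "j \<in> {1..q}" for j using ordinary_requirement \<theta>1_size'[OF that] by linarith
qed (use finD ordinary_good rpos in auto)

text \<open>Otherwise \<open>w\<close> together with \<open>P\<close> and the common neighbours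
  would be a \<open>K(r 1, r 2)\<close> that extends to the forbidden graph.\<close>

lemma exceptional_no_bip:
  assumes a: "a \<in> {1..q}" and w: "w \<in> D"
    and nb: "\<And>j. j \<in> {1..q} \<Longrightarrow> j \<noteq> a \<Longrightarrow> \<theta>1 * n \<le> card {x \<in> S j. R w x}"
    and P: "P \<subseteq> S a - D" "card P = r 1 - 1"
  shows "card {x \<in> {x \<in> S a - D. R w x}. \<forall>p\<in>P. R x p} < r 2"
proof (rule ccontr)
  assume "\<not> card {x \<in> {x \<in> S a - D. R w x}. \<forall>p\<in>P. R x p} < r 2"
  hence "r 2 \<le> card {x \<in> {x \<in> S a - D. R w x}. \<forall>p\<in>P. R x p}" by simp
  from ex_subset_card[OF this] obtain Q where Q: "Q \<subseteq> {x \<in> {x \<in> S a - D. R w x}. \<forall>p\<in>P. R x p}" "card Q = r 2"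
    by (elim exE conjE)
  show False
  proof (rule no_bip_with_exceptional_vertex[OF a _ finD ordinary_good, of w P Q])
    show "0 \<le> 2 * (\<theta>2 * n)" using \<theta>(1) n0 by simp
    show "w \<in> V" using w by (simp add: D_def)
    show "w \<notin> P" using w P by auto
    show "\<forall>u\<in>P. \<forall>v\<in>Q. R u v"
    proof (intro ballI)
      fix u v assume "u \<in> P" "v \<in> Q"
      hence "R v u" using Q(1) by blast
      thus "R u v" by (rule sym)
    qed
    show "\<forall>v\<in>Q. R w v" "Q \<subseteq> S a - D" using Q(1) by auto
    show "rmax + real q * rmax * (2 * (\<theta>2 * n)) + card D + real (r 1 + r 2) * (2 * (\<theta>2 * n)) \<le> card {x \<in> S j. R w x}"
      if "j \<in> {1..q}" "j \<noteq> a" for j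
    proof -
      have "0 \<le> 2 * (\<theta>2 * n)" using \<theta>(1) n0 by simp
      thus ?thesis using nb[OF that] ordinary_requirement by linarith
    qed
  qed (use P Q in auto)
qed

lemma inner_large:
  assumes "w \<in> D"
  shows "r 2 \<le> card {x \<in> S (c w) - D. R w x}"
proof -
  have "{x \<in> S (c w). R w x} \<subseteq> {x \<in> S (c w) - D. R w x} \<union> D" by auto
  hence "card {x \<in> S (c w). R w x} \<le> card ({x \<in> S (c w) - D. R w x} \<union> D)"
    using finS finD by (intro card_mono) auto
  also have "\<dots> \<le> card {x \<in> S (c w) - D. R w x} + card D" by (rule card_Un_le)
  finally have "real (card {x \<in> S (c w). R w x}) \<le> card {x \<in> S (c w) - D. R w x} + real (card D)" by (simp flip: of_nat_add)
  moreover have "\<theta>2 * n < card {x \<in> S (c w). R w x}" using assms by (simp add: D_def)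
  moreover have "0 \<le> real rmax" "0 \<le> real (card D)" "0 \<le> real (r 2)" by simp_all
  ultimately have "real (r 2) \<le> card {x \<in> S (c w) - D. R w x}" using small
    unfolding distrib_left by linarith
  thus ?thesis by simp
qed

text \<open>With \<open>P = {}\<close> the previous bound says that \<open>w\<close> has fewer than
  \<open>r 2\<close> neighbours in its own class outside \<open>D\<close>, but an exceptional vertex
  has more.\<close>

lemma D_empty_1:
  assumes "r 1 = 1"
  shows "D = {}"
proof (rule ccontr)
  assume "D \<noteq> {}"
  then obtain w where w: "w \<in> D" by blast
  have wV: "w \<in> V" using w by (simp add: D_def)
  have "card {x \<in> {x \<in> S (c w) - D. R w x}. \<forall>p\<in>{}. R x p} < r 2"
    by (rule exceptional_no_bip[OF _ w]) (use cV wV many_neighbours[OF wV] assms in auto)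
  thus False using inner_large[OF w] by simp
qed

text \<open>The centre \<open>z\<close> may itself lie in \<open>D\<close>, as long as its inner
  degree is at most \<open>\<theta>1 * n\<close>; the argument against exceptional vertices relies
  on this.\<close>

lemma star_bound:
  assumes a: "a \<in> {1..q}" and j: "j \<in> {1..q}" "j \<noteq> a"
    and z: "z \<in> S j" "card {w \<in> S j. R z w} \<le> \<theta>1 * n"
    and bip: "\<And>B. B \<subseteq> S j - D \<Longrightarrow> card B = r 2 \<Longrightarrow>
      has_bip R {x \<in> S a - D. \<forall>p\<in>insert z B. R p x} (r 1 - 1) rmax"
  shows "card {x \<in> S j - D. R z x} < r 2"
proof (rule ccontr)
  assume "\<not> card {x \<in> S j - D. R z x} < r 2"
  hence "r 2 \<le> card {x \<in> S j - D. R z x}" by simp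
  from ex_subset_card[OF this] obtain B where B: "B \<subseteq> {x \<in> S j - D. R z x}" "card B = r 2" by (elim exE conjE)
  have BS: "B \<subseteq> S j - D" using B(1) by auto
  have zV: "z \<in> V" "c z = j" using z(1) by (auto simp: S_def)
  show False
  proof (rule no_star_and_bip[OF a j _ _ finD ordinary_good z(1) _ BS B(2) _ bip[OF BS B(2)] rpos])
    show "0 \<le> 2 * (\<theta>2 * n)" using \<theta>(1) n0 by simp
    show "2 * (\<theta>2 * n) \<le> 2 * (\<theta>1 * n)" using \<theta>2n by simp
    show "good (2 * (\<theta>1 * n)) z" using inner_good zV z(2) by auto
    show "\<forall>v\<in>B. R z v" using B(1) by auto
    show "rmax + real q * rmax * (2 * (\<theta>2 * n)) + card D + real (r 1 + r 2 + rmax + 1) * (2 * (\<theta>1 * n)) \<le> card (S l)"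
      if l: "l \<in> {1..q}" for l
    proof -
      have "real q * rmax * (2 * (\<theta>2 * n)) \<le> real q * rmax * (2 * (\<theta>1 * n))" using \<theta>2n by (intro mult_left_mono) auto
      moreover have "real q * rmax * (2 * (\<theta>1 * n)) + real (r 1 + r 2 + rmax + 1) * (2 * (\<theta>1 * n)) + 2 * (\<theta>1 * n) = 2 * (M * \<theta>1 * n)"
        by (simp add: M_def algebra_simps)
      moreover have "n / (2 * q) = 4 * (n / (8 * q))" by simp
      moreover have "0 \<le> n / (8 * q)" using n0 by simp
      moreover have "0 \<le> \<theta>2 * n" using \<theta>(1) n0 by simp
      moreover have "0 \<le> \<theta>1 * n" using \<theta>10 n0 by simp
      moreover have "4 * real rmax + 4 * real (card D) \<le> \<theta>2 * n" using small by simp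
      moreover have "2 * (\<theta>2 * n) \<le> 2 * (M * \<theta>1 * n)" using \<theta>1n \<theta>2n \<open>0 \<le> \<theta>1 * n\<close> by linarith
      ultimately show ?thesis using size_lower[OF l] M\<theta>1n by linarith
    qed
  qed
qed

end

text \<open>The classes contain many edges only if one of them is close to extremal for \<open>K(r 1, r 2)\<close>;
  this class is \<open>a\<close>. Both exceptional vertices and stars in the other classes then contradict the
  lower bound \<open>c0 * m powr (2 - 1 / r 1)\<close> for the number of edges of the extremal graphs.\<close>

locale coloured_host2 = coloured_host +
  fixes c0 c1 \<mu> :: real and N :: nat and K1 K2 :: real
  assumes r1: "r 1 \<ge> 2" and r2pos: "r 2 > 0"
    and c0: "c0 > 0" "\<And>m. m \<ge> N \<Longrightarrow> c0 * real m powr (2 - 1 / r 1) \<le> ex_bip (r 1) (r 2) m"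
    and c1: "c1 = c0 * (1 / (2 * q)) powr (2 - 1 / r 1) / q"
    and \<mu>: "real (r 1) \<le> \<mu>" "8 * real (r 1) ^ r 1 * r 2 \<le> c1 * \<mu> ^ (r 1 - 1)"
    and \<theta>1\<mu>: "16 * \<mu> * (r 2 + 1) * \<theta>1 \<le> c1"
    and K1: "K1 = real (r 1 - 1) + real (r 1 - 1) ^ (r 1 - 1) * rmax / real (r 1 - 1) ^ (r 1 - 2)"
    and n_powr: "(real q + 2 * real q * C + real q * r 2 + 2 * K1 + 1) * n powr (2 - 1 / real (r 1 - 1)) \<le>
        K2 * n powr (2 - 1 / r 1)"
    and K2: "K2 \<le> c1" "4 * K2 \<le> c1" "K2 \<le> c0 * (\<theta>2 / 4) powr (2 - 1 / r 1)"
    and nN: "4 * real N \<le> \<theta>2 * n" "8 \<le> \<theta>2 * n" "2 * real q * (N + 1) \<le> n"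
    and size2: "\<And>j. j \<in> {1..q} \<Longrightarrow> card (S j) \<le> n / q + \<theta>2 * n / 8"
    and dense: "(1 - 1 / real q) * n ^ 2 - q + 2 * ex_bip (r 1) (r 2) (nat \<lfloor>n\<rfloor> div q) \<le> pair_count R V V"
begin

abbreviation "e \<equiv> 2 - 1 / real (r 1)"
abbreviation "e' \<equiv> 2 - 1 / real (r 1 - 1)"
abbreviation "exq \<equiv> real (ex_bip (r 1) (r 2) (card V div q))"

lemma nV: "nat \<lfloor>n\<rfloor> = card V" by (simp add: n_eq)
lemma n2q: "2 * real q \<le> n"
proof -
  have "2 * real q * 1 \<le> 2 * real q * (N + 1)" by (intro mult_left_mono) auto
  thus ?thesis using nN(3) by linarith
qed
lemma n1: "n \<ge> 1" using n2q qr by linarith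
lemma e'1: "e' \<ge> 1"
proof -
  have "1 / real (r 1 - 1) \<le> 1" using r1 by simp
  thus ?thesis by simp
qed
lemma n_le: "n \<le> n powr e'" using powr_mono[OF e'1 n1] n1 by simp
lemma K10: "K1 \<ge> 0" by (simp add: K1)

lemma div_q: "n / q - 1 \<le> real (card V div q)"
proof -
  have "card V = q * (card V div q) + card V mod q" by simp
  moreover have "card V mod q < q" using q1 by simp
  ultimately have "card V \<le> q * (card V div q) + q" by linarith
  hence "real (card V) \<le> real (q * (card V div q) + q)" by (simp only: of_nat_le_iff)
  hence "n \<le> q * (real (card V div q) + 1)" by (simp add: n_eq algebra_simps)
  thus ?thesis using qr by (simp add: field_simps)
qed

text \<open>\<open>K2 * n powr e\<close> is the common budget for all error terms. They have order
  at most \<open>n powr e'\<close>, and \<open>e' < e\<close> because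
  \<open>r 1 - 1 < r 1\<close>.\<close>

lemma absorb: "real q + 2 * real q * C * n + real q * r 2 * n + 2 * K1 * n powr e' < K2 * n powr e"
proof -
  have one: "1 \<le> n powr e'" using n_le n1 by linarith
  have "real q \<le> real q * n powr e'" using one by (simp add: mult_le_cancel_left1)
  moreover have "2 * real q * C * n \<le> 2 * real q * C * n powr e'" using n_le by (intro mult_left_mono) auto
  moreover have "real q * r 2 * n \<le> real q * r 2 * n powr e'" using n_le by (intro mult_left_mono) auto
  moreover have "0 < n powr e'" using one by linarith
  moreover have "(real q + 2 * real q * C + real q * r 2 + 2 * K1 + 1) * n powr e' =
      real q * n powr e' + 2 * real q * C * n powr e' + real q * r 2 * n powr e' + 2 * K1 * n powr e' + n powr e'"
    by (simp only: distrib_right mult_1)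
  ultimately show ?thesis using n_powr by linarith
qed

lemma absorb_parts:
  "real q + 2 * real q * C * n \<le> K2 * n powr e" "2 * K1 * n powr e' < K2 * n powr e"
proof -
  have "0 \<le> 2 * real q * C * n" "0 \<le> real q * r 2 * n" "0 \<le> 2 * K1 * n powr e'" "0 \<le> real q"
    using n0 K10 by simp_all
  thus "real q + 2 * real q * C * n \<le> K2 * n powr e" "2 * K1 * n powr e' < K2 * n powr e"
    using absorb by linarith+
qed

text \<open>The value of \<open>c1\<close> comes from \<open>n div q \<ge> n / (2 * q)\<close>; the
  division by \<open>q\<close> in it anticipates averaging over the classes.\<close>

lemma exq_lower: "c1 * q * n powr e \<le> exq"
proof -
  have d: "n / (2 * q) \<le> real (card V div q)"
  proof -
    have "2 \<le> n / q" using n2q qr by (simp add: field_simps)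
    moreover have "n / (2 * q) = (n / q) / 2" by simp
    ultimately show ?thesis using div_q by linarith
  qed
  have "real N \<le> n / (2 * q)" using nN(3) qr by (simp add: field_simps)
  hence "N \<le> card V div q" using d by linarith
  from c0(2)[OF this] have "c0 * real (card V div q) powr e \<le> exq" .
  moreover have "c0 * (n / (2 * q)) powr e \<le> c0 * real (card V div q) powr e"
  proof (intro mult_left_mono powr_mono2)
    have "1 / real (r 1) \<le> 1" using r1 by simp
    thus "0 \<le> e" by linarith
  qed (use d c0(1) n0 in auto)
  moreover have "c0 * (n / (2 * q)) powr e = c1 * q * n powr e"
  proof -
    have "n / (2 * q) = n * (1 / (2 * q))" by simp
    hence "(n / (2 * q)) powr e = n powr e * (1 / (2 * q)) powr e" using n0 by (simp only: powr_mult)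
    thus ?thesis using qr by (simp add: c1)
  qed
  ultimately show ?thesis by linarith
qed

lemma c1_pos: "c1 > 0" using c0(1) qr by (simp add: c1)

text \<open>By convexity of squares, the pairs beyond the Turan density must lie inside the classes,
  and removing \<open>D\<close> costs each class at most \<open>2 * C * n\<close> of them.\<close>

lemma class_edge_sum: "2 * exq - q - 2 * real q * C * n \<le> (\<Sum>j\<in>{1..q}. real (pair_count R (S j - D) (S j - D)))"
proof -
  have "mono_count R V c = (\<Sum>j\<in>{1..q}. pair_count R (S j) (S j))"
    unfolding S_def by (rule mono_count_split[OF finV]) (use cV in auto)
  moreover have "pair_count R (S j) (S j) \<le> pair_count R (S j - D) (S j - D) + 2 * (C * card V)" for j
  proof -
    have "pair_count R (S j \<inter> D) (S j) \<le> card (S j \<inter> D) * card (S j)" by (rule pair_count_le[OF finS])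
    also have "\<dots> \<le> C * card V"
    proof (rule mult_mono)
      have "card (S j \<inter> D) \<le> card D" using finD by (intro card_mono) auto
      thus "card (S j \<inter> D) \<le> C" using cardD by linarith
      show "card (S j) \<le> card V" using finV S_sub by (intro card_mono)
    qed auto
    finally show ?thesis using pair_count_diff[OF finS symR, of j D] by linarith
  qed
  hence "(\<Sum>j\<in>{1..q}. pair_count R (S j) (S j)) \<le> (\<Sum>j\<in>{1..q}. pair_count R (S j - D) (S j - D) + 2 * (C * card V))"
    by (intro sum_mono)
  ultimately have "mono_count R V c \<le> (\<Sum>j\<in>{1..q}. pair_count R (S j - D) (S j - D)) + q * (2 * (C * card V))"
    by (simp add: sum.distrib)
  hence "real (mono_count R V c) \<le> real ((\<Sum>j\<in>{1..q}. pair_count R (S j - D) (S j - D)) + q * (2 * (C * card V)))"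
    by (simp only: of_nat_le_iff)
  hence 1: "real (mono_count R V c) \<le> (\<Sum>j\<in>{1..q}. real (pair_count R (S j - D) (S j - D))) + 2 * real q * C * n"
    by (simp add: n_eq)
  have "real ((\<Sum>v\<in>V. total_miss v) + pair_count R V V + (\<Sum>j\<in>{1..q}. card (S j) ^ 2)) = real (card V ^ 2 + mono_count R V c)"
    by (simp only: sum_total_miss[OF cV])
  hence 2: "real (\<Sum>v\<in>V. total_miss v) + pair_count R V V + (\<Sum>j\<in>{1..q}. real (card (S j)) ^ 2) = n ^ 2 + mono_count R V c"
    by (simp add: n_eq)
  have "0 \<le> (\<Sum>j\<in>{1..q}. (real (card (S j)) - card V / q) ^ 2)" by (intro sum_nonneg) simp
  hence "n ^ 2 / q \<le> (\<Sum>j\<in>{1..q}. real (card (S j)) ^ 2)" using sum_square_deviation[OF cV] by (simp add: n_eq)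
  moreover have "n ^ 2 - n ^ 2 / q - q + 2 * exq \<le> pair_count R V V" using dense unfolding nV by (simp add: left_diff_distrib)
  moreover have "0 \<le> real (\<Sum>v\<in>V. total_miss v)" by (rule of_nat_0_le_iff)
  ultimately have "2 * exq - q \<le> mono_count R V c" using 2 by linarith
  thus ?thesis using 1 by linarith
qed

text \<open>Averaging over the classes: the sum is at least \<open>2 * q * c1 * n powr e\<close> up
  to an error of at most half of it.\<close>

lemma heavy_class:
  obtains a where "a \<in> {1..q}" "c1 * n powr e \<le> pair_count R (S a - D) (S a - D)"
proof (rule ccontr)
  assume "\<not> thesis"
  hence lt: "real (pair_count R (S a - D) (S a - D)) < c1 * n powr e" if "a \<in> {1..q}" for a
    using that \<open>\<And>a. a \<in> {1..q} \<Longrightarrow> c1 * n powr e \<le> real (pair_count R (S a - D) (S a - D)) \<Longrightarrow> thesis\<close> not_le by blast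
  have "(\<Sum>j\<in>{1..q}. real (pair_count R (S j - D) (S j - D))) < (\<Sum>j\<in>{1..q}. c1 * n powr e)"
    by (rule sum_strict_mono) (use q1 lt in auto)
  hence "2 * exq - q - 2 * real q * C * n < q * (c1 * n powr e)" using class_edge_sum by simp
  moreover have "K2 * n powr e \<le> c1 * n powr e" using K2(1) by (intro mult_right_mono) auto
  moreover have "1 * (c1 * n powr e) \<le> q * (c1 * n powr e)" using qr c1_pos by (intro mult_right_mono) auto
  moreover have "c1 * q * n powr e = q * (c1 * n powr e)" by simp
  ultimately show False using absorb_parts(1) exq_lower by linarith
qed

text \<open>Dropping one vertex of the small side lowers the exponent to \<open>e'\<close>.
  \<open>K1\<close> is the Kovari-Sos-Turan constant for \<open>s = \<mu> = r 1 - 1\<close> and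
  \<open>\<kappa> = 1\<close>.\<close>

lemma free_pair_count:
  assumes W: "W \<subseteq> V" and T: "T \<subseteq> V" and t: "t \<le> rmax"
    and few: "\<And>P. P \<subseteq> W \<Longrightarrow> card P = r 1 - 1 \<Longrightarrow> card {x \<in> T. \<forall>p\<in>P. R x p} \<le> t"
  shows "real (pair_count R T W) \<le> K1 * n powr e'"
proof -
  have fin: "finite W" "finite T" using W T finV finite_subset by blast+
  let ?s = "r 1 - 1"
  have "real (pair_count R T W) \<le> (real ?s * 1 + real ?s ^ ?s * rmax / real ?s ^ (?s - 1)) * n powr (2 - 1 / ?s)"
  proof (rule kovari_sos_turan_powr[OF fin(2,1)])
    show "card {x \<in> T. \<forall>p\<in>P. R x p} \<le> rmax" if "P \<subseteq> W" "card P = ?s" for P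
      using few[OF that] t by linarith
    show "real (card T) \<le> 1 * n" "real (card W) \<le> n" using card_mono[OF finV T] card_mono[OF finV W] by (simp_all add: n_eq)
  qed (use r1 n1 in auto)
  thus ?thesis by (simp add: K1 numeral_2_eq_2)
qed

text \<open>If a star has centre \<open>z\<close> and leaves \<open>B\<close> in class
  \<open>j\<close>, then the common neighbourhood of these vertices in the heavy class contains no
  \<open>K(r 1 - 1, rmax)\<close> and so spans few edges. It is nearly the whole class, and the
  small remainder meets few edges by the bound with small \<open>\<kappa>\<close>; so the class
  would not be heavy.\<close>

lemma star_free:
  assumes a: "a \<in> {1..q}" "c1 * n powr e \<le> pair_count R (S a - D) (S a - D)" and j: "j \<in> {1..q}" "j \<noteq> a"
    and z: "z \<in> S j" "card {w \<in> S j. R z w} \<le> \<theta>1 * n"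
  shows "card {x \<in> S j - D. R z x} < r 2"
proof (rule star_bound[OF a(1) j z], rule ccontr)
  fix B assume B: "B \<subseteq> S j - D" "card B = r 2"
  let ?A = "S a - D" and ?T = "{x \<in> S a - D. \<forall>p\<in>insert z B. R p x}"
  assume nb: "\<not> has_bip R ?T (r 1 - 1) rmax"
  have finA: "finite ?A" using finS by simp
  have finB: "finite B" using B(1) finS finite_subset[OF B(1)] by simp
  have "real (pair_count R ?T ?T) \<le> K1 * n powr e'"
  proof (rule free_pair_count)
    show "card {x \<in> ?T. \<forall>p\<in>P. R x p} \<le> rmax" if P: "P \<subseteq> ?T" "card P = r 1 - 1" for P
    proof (rule ccontr)
      assume "\<not> card {x \<in> ?T. \<forall>p\<in>P. R x p} \<le> rmax"
      hence "has_bip R ?T (r 1 - 1) rmax" unfolding has_bip_def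
        using P sym by (intro exI[of _ P] exI[of _ "{x \<in> ?T. \<forall>p\<in>P. R x p}"]) auto
      thus False using nb by contradiction
    qed
  qed (use S_sub in auto)
  \<comment> \<open>Each of the \<open>r 2 + 1\<close> vertices of the star misses at most
    \<open>2 * \<theta>1 * n\<close> vertices of the heavy class; this gives
    \<open>\<kappa>\<close>.\<close>
  moreover have "real (pair_count R (?A \<inter> (?A - ?T)) ?A) \<le> (\<mu> * ((r 2 + 1) * (2 * \<theta>1)) + real (r 1) ^ r 1 * r 2 / \<mu> ^ (r 1 - 1)) * n powr e"
  proof (rule kovari_sos_turan_powr[OF _ finA _ \<mu>(1) n1])
    have "real (card ?A) - card (insert z B) * (2 * (\<theta>1 * n)) \<le> card ?T"
    proof (rule card_subset_common[OF finA])
      fix p assume p: "p \<in> insert z B"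
      have pS: "p \<in> S j" using p z(1) B(1) by auto
      hence pV: "p \<in> V" "c p = j" by (auto simp: S_def)
      have "good (2 * (\<theta>1 * n)) p"
      proof (cases "p = z")
        case True
        thus ?thesis using inner_good z pV by auto
      next
        case False
        hence "p \<in> V - D" using p B(1) pV by auto
        thus ?thesis using ordinary_good good_mono \<theta>2n by (metis mult_le_cancel_left_pos zero_less_numeral)
      qed
      hence "real (miss p a) \<le> 2 * (\<theta>1 * n)" using a(1) j(2) pV by (auto simp: good_def)
      moreover have "card {b \<in> ?A. \<not> R p b} \<le> miss p a" unfolding miss_def using finS by (intro card_mono) auto
      ultimately show "real (card {b \<in> ?A. \<not> R p b}) \<le> 2 * (\<theta>1 * n)" by linarith
    qed (use finB in simp)
    moreover have "real (card (?A - ?T)) = real (card ?A) - card ?T"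
    proof -
      have sub: "?T \<subseteq> ?A" by auto
      show ?thesis unfolding card_Diff_subset[OF finite_subset[OF sub finA] sub]
        by (rule of_nat_diff[OF card_mono[OF finA sub]])
    qed
    moreover have "?A \<inter> (?A - ?T) = ?A - ?T" by auto
    moreover have "card (insert z B) * (2 * (\<theta>1 * n)) \<le> real (r 2 + 1) * (2 * (\<theta>1 * n))"
    proof (rule mult_right_mono)
      have "card (insert z B) \<le> r 2 + 1" using B(2) finB by (simp add: card_insert_if)
      thus "real (card (insert z B)) \<le> real (r 2 + 1)" by (simp only: of_nat_le_iff)
    qed (use \<theta>10 n0 in simp)
    ultimately show "real (card (?A \<inter> (?A - ?T))) \<le> (r 2 + 1) * (2 * \<theta>1) * n" by (simp add: mult.assoc)
    show "real (card ?A) \<le> n" using S_sub by (auto simp: n_eq intro!: card_mono finV)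
    show "card {x \<in> ?A \<inter> (?A - ?T). \<forall>p\<in>P. R x p} \<le> r 2" if P: "P \<subseteq> ?A" "card P = r 1" for P
    proof (rule ccontr)
      assume "\<not> card {x \<in> ?A \<inter> (?A - ?T). \<forall>p\<in>P. R x p} \<le> r 2"
      hence "has_bip R ?A (r 1) (r 2)" unfolding has_bip_def
        using P sym by (intro exI[of _ P] exI[of _ "{x \<in> ?A \<inter> (?A - ?T). \<forall>p\<in>P. R x p}"]) auto
      thus False using class_free[OF a(1)] by contradiction
    qed
  qed (use finS r1 in auto)
  moreover have "pair_count R ?A ?A \<le> pair_count R ?T ?T + 2 * pair_count R (?A \<inter> (?A - ?T)) ?A"
  proof -
    have "?A - (?A - ?T) = ?T" by auto
    thus ?thesis using pair_count_diff[OF finA symR, of "?A - ?T"] by simp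
  qed
  hence "real (pair_count R ?A ?A) \<le> real (pair_count R ?T ?T) + 2 * real (pair_count R (?A \<inter> (?A - ?T)) ?A)"
    by (simp flip: of_nat_add of_nat_mult)
  moreover have "(\<mu> * ((r 2 + 1) * (2 * \<theta>1)) + real (r 1) ^ r 1 * r 2 / \<mu> ^ (r 1 - 1)) * n powr e \<le> (c1 / 4) * n powr e"
  proof (rule mult_right_mono)
    have m0: "\<mu> > 0" using \<mu>(1) r1 by linarith
    have "real (r 1) ^ r 1 * r 2 / \<mu> ^ (r 1 - 1) \<le> c1 / 8" using \<mu>(2) m0 by (simp add: field_simps)
    moreover have "\<mu> * ((r 2 + 1) * (2 * \<theta>1)) \<le> c1 / 8" using \<theta>1\<mu> by (simp add: algebra_simps)
    ultimately show "\<mu> * ((r 2 + 1) * (2 * \<theta>1)) + real (r 1) ^ r 1 * r 2 / \<mu> ^ (r 1 - 1) \<le> c1 / 4" by linarith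
  qed simp
  moreover have "4 * (K2 * n powr e) \<le> c1 * n powr e" using mult_right_mono[OF K2(2), of "n powr e"] by simp
  moreover have "0 < c1 * n powr e" using c1_pos n1 by simp
  moreover have "0 \<le> K1 * n powr e'" using K10 by simp
  ultimately show False using a(2) absorb_parts(2) by linarith
qed

text \<open>All other classes span only linearly many edges, so the heavy class needs almost
  \<open>exq\<close> edges. Few of them meet the neighbourhood of an exceptional \<open>w\<close>,
  so almost all lie in the rest \<open>Y\<close> of the class. But \<open>Y\<close> is smaller than
  \<open>n div q\<close> by a linear amount, and superadditivity turns this gap into a loss of order
  \<open>n powr e\<close>.\<close>

lemma D_empty_2: "D = {}"
proof (rule ccontr)
  assume "D \<noteq> {}"
  then obtain w where w: "w \<in> D" by blast
  have wV: "w \<in> V" using w by (simp add: D_def)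
  have cw: "c w \<in> {1..q}" using cV wV by blast
  obtain a where a: "a \<in> {1..q}" "c1 * n powr e \<le> pair_count R (S a - D) (S a - D)" by (rule heavy_class)
  have light: "real (pair_count R (S j - D) (S j - D)) \<le> r 2 * n" if j: "j \<in> {1..q}" "j \<noteq> a" for j
  proof -
    have "card {x \<in> S j - D. R z x} \<le> r 2" if z: "z \<in> S j - D" for z
    proof -
      have "z \<in> V" "c z = j" "z \<notin> D" using z by (auto simp: S_def)
      hence "card {w \<in> S j. R z w} \<le> \<theta>1 * n" using \<theta>2n unfolding D_def by fastforce
      thus ?thesis using star_free[OF a j _] z by fastforce
    qed
    hence "pair_count R (S j - D) (S j - D) \<le> of_nat (card (S j - D)) * r 2"
      unfolding pair_count_def by (rule sum_bounded_above)
    also have "\<dots> \<le> card V * r 2" using S_sub by (auto intro!: mult_right_mono card_mono finV)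
    finally have "real (pair_count R (S j - D) (S j - D)) \<le> real (card V * r 2)" by (simp only: of_nat_le_iff)
    thus ?thesis by (simp add: n_eq mult.commute)
  qed
  have heavy: "2 * exq - q - 2 * real q * C * n - q * (r 2 * n) \<le> pair_count R (S a - D) (S a - D)"
  proof -
    have "(\<Sum>j\<in>{1..q}. real (pair_count R (S j - D) (S j - D))) =
       real (pair_count R (S a - D) (S a - D)) + (\<Sum>j\<in>{1..q} - {a}. real (pair_count R (S j - D) (S j - D)))"
      by (rule sum.remove) (use a in auto)
    moreover have "(\<Sum>j\<in>{1..q} - {a}. real (pair_count R (S j - D) (S j - D))) \<le> of_nat (card ({1..q} - {a})) * (r 2 * n)"
      by (rule sum_bounded_above) (use light in auto)
    moreover have "real (card ({1..q} - {a})) * (r 2 * n) \<le> q * (r 2 * n)"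
      using n0 card_mono[of "{1..q}" "{1..q} - {a}"] by (intro mult_right_mono) auto
    ultimately show ?thesis using class_edge_sum by linarith
  qed
  have nb: "\<theta>1 * n \<le> card {x \<in> S j. R w x}" if j: "j \<in> {1..q}" "j \<noteq> a" for j
  proof (cases "j = c w")
    case False
    thus ?thesis using many_neighbours[OF wV j(1)] by simp
  next
    case True
    show ?thesis
    proof (rule ccontr)
      assume "\<not> \<theta>1 * n \<le> card {x \<in> S j. R w x}"
      hence "card {x \<in> S j - D. R w x} < r 2"
        using wV True by (intro star_free[OF a j]) (auto simp: S_def)
      thus False using inner_large[OF w] True by simp
    qed
  qed
  have nba: "\<theta>2 * n < card {x \<in> S a. R w x}"
  proof (cases "a = c w")
    case True
    thus ?thesis using w by (simp add: D_def)
  next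
    case False
    have "\<theta>2 * n < card {x \<in> S (c w). R w x}" using w by (simp add: D_def)
    thus ?thesis using inner_min[OF wV a(1)] by linarith
  qed
  let ?A = "S a - D" and ?N = "{x \<in> S a - D. R w x}"
  have finA: "finite ?A" using finS by simp
  have pcN: "real (pair_count R ?N ?A) \<le> K1 * n powr e'"
  proof (rule free_pair_count)
    show "card {x \<in> ?N. \<forall>p\<in>P. R x p} \<le> r 2" if "P \<subseteq> ?A" "card P = r 1 - 1" for P
      using exceptional_no_bip[OF a(1) w nb that] by simp
    show "r 2 \<le> rmax" using r_le_rmax[of 2] q1 by auto
  qed (use S_sub in auto)
  define Y where "Y = ?A - ?N"
  have pcA: "real (pair_count R ?A ?A) \<le> real (pair_count R Y Y) + 2 * real (pair_count R ?N ?A)"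
  proof -
    have "?A \<inter> ?N = ?N" by auto
    hence "pair_count R ?A ?A \<le> pair_count R Y Y + 2 * pair_count R ?N ?A"
      using pair_count_diff[OF finA symR, of ?N] by (simp add: Y_def)
    thus ?thesis by (simp flip: of_nat_add of_nat_mult)
  qed
  have finY: "finite Y" using finA by (simp add: Y_def)
  have "\<not> has_bip R Y (r 1) (r 2)"
  proof
    assume "has_bip R Y (r 1) (r 2)"
    then obtain A B where AB: "A \<subseteq> Y" "B \<subseteq> Y" "r 1 \<le> card A" "r 2 \<le> card B" "\<forall>u\<in>A. \<forall>v\<in>B. R u v"
      unfolding has_bip_def by (elim exE conjE)
    have "has_bip R ?A (r 1) (r 2)" unfolding has_bip_def
      by (rule exI[of _ A], rule exI[of _ B]) (use AB in \<open>auto simp: Y_def\<close>)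
    thus False using class_free[OF a(1)] by contradiction
  qed
  hence "pair_count R Y Y \<le> 2 * ex_bip (r 1) (r 2) (card Y)"
    using free_bip_iff[OF finY symR irrR] by (intro pair_count_le_ex_number[OF finY symR irrR]) simp
  hence pcY: "real (pair_count R Y Y) \<le> 2 * real (ex_bip (r 1) (r 2) (card Y))" by simp
  \<comment> \<open>Half of the neighbours of \<open>w\<close> in class \<open>a\<close>: the other
    half pays for the imbalance \<open>\<theta>2 * n / 8\<close> of the class, for rounding, and for
    the floor in \<open>n div q\<close>.\<close>
  define k where "k = nat \<lfloor>\<theta>2 * n / 2\<rfloor>"
  have "0 \<le> \<theta>2 * n / 2" using \<theta>(1) n0 by simp
  hence k: "real k \<le> \<theta>2 * n / 2" "\<theta>2 * n / 2 - 1 \<le> real k" unfolding k_def by linarith+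
  have "Y \<subseteq> {x \<in> S a. \<not> R w x}" by (auto simp: Y_def)
  hence "card Y \<le> miss w a" unfolding miss_def using finS by (intro card_mono) auto
  moreover have "real (card {x \<in> S a. R w x}) + miss w a = card (S a)" using card_nb_miss[of a w] by (simp flip: of_nat_add)
  ultimately have "real (card Y) + \<theta>2 * n \<le> n / q + \<theta>2 * n / 8" using size2[OF a(1)] nba by linarith
  hence "real (card Y + k) \<le> n / q - 1" using k(1) nN(2) by simp
  also have "\<dots> \<le> real (card V div q)" by (rule div_q)
  finally have "card Y + k \<le> card V div q" by (simp only: of_nat_le_iff)
  hence "ex_bip (r 1) (r 2) (card Y + k) \<le> ex_bip (r 1) (r 2) (card V div q)"
    using r1 r2pos by (intro ex_number_bip_mono) auto
  moreover have "ex_bip (r 1) (r 2) (card Y) + ex_bip (r 1) (r 2) k \<le> ex_bip (r 1) (r 2) (card Y + k)"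
    using r1 r2pos by (intro ex_number_bip_superadditive) auto
  ultimately have sup: "real (ex_bip (r 1) (r 2) (card Y)) + real (ex_bip (r 1) (r 2) k) \<le> exq"
    by (simp flip: of_nat_add)
  have kn: "\<theta>2 / 4 * n \<le> k" using k(2) nN(2) by simp
  hence "N \<le> k" using nN(1) by simp
  from c0(2)[OF this] have "c0 * real k powr e \<le> ex_bip (r 1) (r 2) k" .
  moreover have "c0 * (\<theta>2 / 4 * n) powr e \<le> c0 * real k powr e"
  proof (intro mult_left_mono powr_mono2)
    have "1 / real (r 1) \<le> 1" using r1 by simp
    thus "0 \<le> e" by linarith
  qed (use kn c0(1) n0 \<theta>(1) in auto)
  moreover have "K2 * n powr e \<le> c0 * (\<theta>2 / 4 * n) powr e"
  proof -
    have "(\<theta>2 / 4 * n) powr e = (\<theta>2 / 4) powr e * n powr e" using n0 \<theta>(1) by (simp only: powr_mult)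
    thus ?thesis using mult_right_mono[OF K2(3), of "n powr e"] by (simp add: mult.assoc)
  qed
  ultimately have exk: "K2 * n powr e \<le> ex_bip (r 1) (r 2) k" by linarith
  have "q * (r 2 * n) = real q * r 2 * n" by simp
  moreover have "0 \<le> K2 * n powr e" using absorb_parts(2) K10 by (smt (verit) mult_nonneg_nonneg powr_ge_zero)
  ultimately show False using absorb pcA pcY pcN heavy sup exk by linarith
qed

lemma structure_2:
  "\<exists>a\<in>{1..q}. \<not> has_bip R (S a) (r 1) (r 2) \<and> (\<forall>j\<in>{1..q}. j \<noteq> a \<longrightarrow> \<not> has_bip R (S j) 1 (r 2))"
proof -
  obtain a where a: "a \<in> {1..q}" "c1 * n powr e \<le> pair_count R (S a - D) (S a - D)" by (rule heavy_class)
  show ?thesis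
  proof (intro bexI[of _ a] conjI ballI impI)
    show "\<not> has_bip R (S a) (r 1) (r 2)" using class_free[OF a(1)] D_empty_2 by simp
    fix j assume j: "j \<in> {1..q}" "j \<noteq> a"
    show "\<not> has_bip R (S j) 1 (r 2)" unfolding has_bip_1_iff[OF finS]
    proof
      assume "\<exists>u\<in>S j. r 2 \<le> card {w \<in> S j. R u w}"
      then obtain z where z: "z \<in> S j" "r 2 \<le> card {w \<in> S j. R z w}" by blast
      have "z \<in> V" "c z = j" "z \<notin> D" using z D_empty_2 by (auto simp: S_def)
      hence "card {w \<in> S j. R z w} \<le> \<theta>1 * n" using \<theta>2n unfolding D_def by fastforce
      from star_free[OF a j z(1) this] show False using z(2) D_empty_2 by simp
    qed
  qed (rule a)
qed

end

section \<open>The structure theorem: choice of constants\<close>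

definition structured :: "'a set \<Rightarrow> ('a \<Rightarrow> 'a \<Rightarrow> bool) \<Rightarrow> nat \<Rightarrow> (nat \<Rightarrow> nat) \<Rightarrow> real \<Rightarrow> ('a \<Rightarrow> nat) \<Rightarrow> bool" where
  "structured V R q r x c \<longleftrightarrow> (\<forall>v\<in>V. c v \<in> {1..q}) \<and>
     (\<forall>j\<in>{1..q}. \<bar>real (card {v \<in> V. c v = j}) - real (card V) / real q\<bar> \<le> x * real (card V)) \<and>
     \<not> has_bip R {v \<in> V. c v = 1} (r 1) (r 2) \<and> (\<forall>j\<in>{2..q}. \<not> has_bip R {v \<in> V. c v = j} 1 (r 2))"

definition extremal_K :: "'a set \<Rightarrow> ('a \<Rightarrow> 'a \<Rightarrow> bool) \<Rightarrow> nat \<Rightarrow> (nat \<Rightarrow> nat) \<Rightarrow> bool" where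
  "extremal_K V R q r \<longleftrightarrow> finite V \<and> symp R \<and> irreflp R \<and> \<not> has_blocks R V {1..Suc q} r \<and>
     pair_count R V V = 2 * ex_K q r (card V)"

text \<open>Interchanges colours 1 and \<open>a\<close>, so that the distinguished class gets number
  1.\<close>

lemma structuredI:
  assumes cV: "\<forall>v\<in>V. c v \<in> {1..q}" and a: "a \<in> {1..q}"
    and size: "\<And>j. j \<in> {1..q} \<Longrightarrow> \<bar>real (card {v \<in> V. c v = j}) - real (card V) / real q\<bar> \<le> x * real (card V)"
    and fa: "\<not> has_bip R {v \<in> V. c v = a} (r 1) (r 2)"
    and fj: "\<And>j. j \<in> {1..q} \<Longrightarrow> j \<noteq> a \<Longrightarrow> \<not> has_bip R {v \<in> V. c v = j} 1 (r 2)"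
  shows "\<exists>c. structured V R q r x c"
proof -
  define \<pi> where "\<pi> j = (if j = 1 then a else if j = a then 1 else j)" for j
  have \<pi>: "{v \<in> V. \<pi> (c v) = j} = {v \<in> V. c v = \<pi> j}" for j by (auto simp: \<pi>_def)
  have \<pi>q: "\<pi> j \<in> {1..q}" if "j \<in> {1..q}" for j using that a by (auto simp: \<pi>_def)
  have "structured V R q r x (\<lambda>v. \<pi> (c v))"
    unfolding structured_def \<pi>
  proof (intro conjI ballI)
    show "\<pi> (c v) \<in> {1..q}" if "v \<in> V" for v using that cV \<pi>q by blast
    show "\<bar>real (card {v \<in> V. c v = \<pi> j}) - real (card V) / real q\<bar> \<le> x * real (card V)" if "j \<in> {1..q}" for j
      using size[OF \<pi>q[OF that]] .
    show "\<not> has_bip R {v \<in> V. c v = \<pi> 1} (r 1) (r 2)" using fa by (simp add: \<pi>_def)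
    show "\<not> has_bip R {v \<in> V. c v = \<pi> j} 1 (r 2)" if j: "j \<in> {2..q}" for j
      by (rule fj[OF \<pi>q]) (use j in \<open>auto simp: \<pi>_def\<close>)
  qed
  thus ?thesis by blast
qed

lemma extremal_good_colouring:
  fixes \<theta> \<xi> :: real
  assumes q: "q > 0" and rpos: "\<forall>i\<in>{1..Suc q}. r i > 0" and rmono: "mono_on {1..Suc q} r"
    and \<theta>: "0 < \<theta>" "\<theta> \<le> 1" and \<xi>: "0 < \<xi>"
  shows "\<exists>C N0::nat. \<forall>(V::'a set) R. extremal_K V R q r \<longrightarrow> N0 \<le> card V \<longrightarrow> (\<exists>c. good_colouring V R q r \<theta> \<xi> C c)"
proof -
  from structure_setup[OF q rpos rmono \<theta> \<xi>, where ?'a = 'a]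
  obtain C N0 :: nat where C: "\<forall>(V::'a set) R. finite V \<longrightarrow> symp R \<longrightarrow> irreflp R \<longrightarrow> N0 \<le> card V \<longrightarrow>
    \<not> has_blocks R V {1..Suc q} r \<longrightarrow>
    (\<forall>R'. symp R' \<longrightarrow> irreflp R' \<longrightarrow> \<not> has_blocks R' V {1..Suc q} r \<longrightarrow> pair_count R' V V \<le> pair_count R V V) \<longrightarrow>
    (1 - 1 / real q) * real (card V) ^ 2 - q \<le> pair_count R V V \<longrightarrow>
    (\<exists>c. good_colouring V R q r \<theta> \<xi> C c)" by (elim exE)
  show ?thesis
  proof (rule exI[of _ C], rule exI[of _ N0], intro allI impI)
    fix V :: "'a set" and R
    assume "extremal_K V R q r" and N0: "N0 \<le> card V"
    hence V: "finite V" and R: "symp R" "irreflp R" "\<not> has_blocks R V {1..Suc q} r"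
      and pc: "pair_count R V V = 2 * ex_K q r (card V)" by (auto simp: extremal_K_def)
    have mx: "\<forall>R'. symp R' \<longrightarrow> irreflp R' \<longrightarrow> \<not> has_blocks R' V {1..Suc q} r \<longrightarrow> pair_count R' V V \<le> pair_count R V V"
    proof (intro allI impI)
      fix R' assume R': "symp R'" "irreflp R'" "\<not> has_blocks R' V {1..Suc q} r"
      from free_K_iff[OF V R'(1,2)] R'(3)
      have "free_of (graph_of V R') {complete_multipartite (map r [1..<q+2])}" by blast
      from pair_count_le_ex_number[OF V R'(1,2) this] show "pair_count R' V V \<le> pair_count R V V" by (simp only: pc)
    qed
    have "0 \<le> 2 * real (ex_bip (r 1) (r 2) (card V div q))" by simp
    hence den: "(1 - 1 / real q) * real (card V) ^ 2 - q \<le> pair_count R V V"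
      using turan_lower_bound[OF q rpos rmono, of "card V"] unfolding pc of_nat_mult of_nat_numeral by linarith
    show "\<exists>c. good_colouring V R q r \<theta> \<xi> C c"
      by (rule C[THEN spec, THEN spec, THEN mp, THEN mp, THEN mp, THEN mp, THEN mp, THEN mp, THEN mp, OF V R(1,2) N0 R(3) mx den])
  qed
qed

lemma coloured_hostI:
  fixes \<theta>1 \<theta>2 x :: real
  assumes g: "good_colouring V R q r \<theta>2 x C c" and x: "x \<le> 1 / (8 * q)" and r1: "r 1 > 0"
    and \<theta>: "0 < \<theta>2" "\<theta>2 \<le> \<theta>1"
      "8 * real q * (real q * r (Suc q) + r 1 + r 2 + r (Suc q) + 2) * \<theta>1 \<le> 1"
      "4 * (real q * r (Suc q) + r 1 + r 2 + r (Suc q) + 2) * \<theta>2 \<le> \<theta>1"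
    and large: "4 * (real (r (Suc q)) + r 2 + C) \<le> \<theta>2 * card V"
  shows "coloured_host V R q r c \<theta>1 \<theta>2 (card V) C"
proof -
  from g have h: "host V R q r" by (simp add: good_colouring_def)
  interpret host V R q r c by (rule h)
  have "\<bar>real (card (S j)) - real (card V) / real q\<bar> \<le> real (card V) / (8 * real q)" if "j \<in> {1..q}" for j
  proof -
    have "x * real (card V) \<le> 1 / (8 * q) * real (card V)" using x by (intro mult_right_mono) auto
    moreover have "\<bar>real (card (S j)) - real (card V) / real q\<bar> \<le> x * real (card V)"
      using g that by (simp add: good_colouring_def)
    ultimately show ?thesis by simp
  qed
  thus ?thesis
    by unfold_locales (use g r1 \<theta> large in \<open>auto simp: good_colouring_def rmax_def\<close>)
qed

lemma good_colouring_S: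
  assumes "good_colouring V R q r t x C c"
  shows "host.S V c = (\<lambda>j. {v \<in> V. c v = j})"
proof -
  interpret host V R q r c using assms by (simp add: good_colouring_def)
  show ?thesis by (simp add: S_def fun_eq_iff)
qed

lemma good_colouring_size:
  assumes "good_colouring V R q r t x C c" "j \<in> {1..q}" "x \<le> y"
  shows "\<bar>real (card {v \<in> V. c v = j}) - real (card V) / real q\<bar> \<le> y * real (card V)"
proof -
  have "x * real (card V) \<le> y * real (card V)" using assms(3) by (intro mult_right_mono) auto
  moreover have "\<bar>real (card {v \<in> V. c v = j}) - real (card V) / real q\<bar> \<le> x * real (card V)"
    using assms(1,2) good_colouring_S[OF assms(1)] by (auto simp: good_colouring_def)
  ultimately show ?thesis by linarith
qed

lemma extremal_structured_1:
  fixes \<xi> :: real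
  assumes q: "q > 0" and rpos: "\<forall>i\<in>{1..Suc q}. r i > 0" and rmono: "mono_on {1..Suc q} r"
    and \<xi>: "0 < \<xi>" and r1: "r 1 = 1"
  shows "\<exists>N0::nat. \<forall>(V::'a set) R. extremal_K V R q r \<longrightarrow> N0 \<le> card V \<longrightarrow> (\<exists>c. structured V R q r \<xi> c)"
proof -
  define M where "M = real q * r (Suc q) + r 1 + r 2 + r (Suc q) + 2"
  have M: "M \<ge> 2" by (simp add: M_def)
  have q1: "real q \<ge> 1" using q by simp
  define \<theta>1 \<theta>2 where "\<theta>1 = 1 / (8 * q * M)" and "\<theta>2 = \<theta>1 / (4 * M)"
  have \<theta>1: "\<theta>1 > 0" "8 * real q * M * \<theta>1 \<le> 1" using M q1 by (auto simp: \<theta>1_def)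
  have \<theta>2: "\<theta>2 > 0" "4 * M * \<theta>2 \<le> \<theta>1" using \<theta>1 M by (auto simp: \<theta>2_def)
  have "1 * \<theta>2 \<le> 4 * M * \<theta>2" using M \<theta>2 by (intro mult_right_mono) auto
  hence \<theta>21: "\<theta>2 \<le> \<theta>1" using \<theta>2 by linarith
  have "1 * \<theta>1 \<le> 8 * real q * M * \<theta>1"
  proof (rule mult_right_mono)
    have "8 * 1 * 1 \<le> 8 * real q * M" using q1 M by (intro mult_mono) auto
    thus "1 \<le> 8 * real q * M" by linarith
  qed (use \<theta>1 in simp)
  hence \<theta>2_1: "\<theta>2 \<le> 1" using \<theta>1 \<theta>21 by linarith
  define x where "x = min \<xi> (1 / (8 * q))"
  have x: "0 < x" "x \<le> \<xi>" "x \<le> 1 / (8 * q)" using \<xi> q by (auto simp: x_def)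
  from extremal_good_colouring[OF q rpos rmono \<theta>2(1) \<theta>2_1 x(1), where ?'a = 'a]
  obtain C N1 :: nat where N1: "\<forall>(V::'a set) R. extremal_K V R q r \<longrightarrow> N1 \<le> card V \<longrightarrow>
     (\<exists>c. good_colouring V R q r \<theta>2 x C c)" by (elim exE)
  show ?thesis
  proof (rule exI[of _ "N1 + nat \<lceil>4 * (real (r (Suc q)) + r 2 + C) / \<theta>2\<rceil>"], intro allI impI)
    fix V :: "'a set" and R
    assume ex: "extremal_K V R q r" and N0: "N1 + nat \<lceil>4 * (real (r (Suc q)) + r 2 + C) / \<theta>2\<rceil> \<le> card V"
    have "N1 \<le> card V" using N0 by linarith
    from N1[THEN spec, THEN spec, THEN mp, THEN mp, OF ex this]
    obtain c where c: "good_colouring V R q r \<theta>2 x C c" by (elim exE)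
    have "4 * (real (r (Suc q)) + r 2 + C) / \<theta>2 \<le> card V" using N0 by linarith
    hence large: "4 * (real (r (Suc q)) + r 2 + C) \<le> \<theta>2 * card V" using \<theta>2(1) by (simp add: pos_divide_le_eq mult.commute)
    interpret coloured_host V R q r c \<theta>1 \<theta>2 "card V" C
      by (rule coloured_hostI[where x = x]) (use c x r1 \<theta>2 \<theta>21 \<theta>1 large in \<open>simp_all only: M_def zero_less_one\<close>)
    have free: "\<not> has_bip R {v \<in> V. c v = j} (r 1) (r 2)" if "j \<in> {1..q}" for j
      using class_free[OF that] D_empty_1[OF r1] by (simp add: S_def)
    show "\<exists>c. structured V R q r \<xi> c"
      by (rule structuredI[OF cV, of 1]) (use q free r1 good_colouring_size[OF c _ x(2)] in auto)
  qed
qed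

text \<open>The order of choice is essential: \<open>c0\<close>, \<open>c1\<close>,
  \<open>\<mu>\<close>, \<open>\<theta>1\<close>, \<open>\<theta>2\<close>, \<open>K2\<close>, then
  the balance \<open>x\<close>, then \<open>C\<close> from the colouring theorem, and the threshold
  for the order last.\<close>

lemma extremal_structured_2:
  fixes \<xi> :: real
  assumes q: "q > 0" and rpos: "\<forall>i\<in>{1..Suc q}. r i > 0" and rmono: "mono_on {1..Suc q} r"
    and \<xi>: "0 < \<xi>" and r1: "r 1 \<ge> 2" and r2: "r 2 \<ge> fact (r 1 - 1) + 1"
  shows "\<exists>N0::nat. \<forall>(V::'a set) R. extremal_K V R q r \<longrightarrow> N0 \<le> card V \<longrightarrow> (\<exists>c. structured V R q r \<xi> c)"
proof -
  note low = turan_lower_bound[OF q rpos rmono]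
  define M where "M = real q * r (Suc q) + r 1 + r 2 + r (Suc q) + 2"
  have M: "M \<ge> 2" by (simp add: M_def)
  have q1: "real q \<ge> 1" using q by simp
  from ex_number_bip_lower[OF r1 r2] obtain c0 :: real and N :: nat where
    c0: "c0 > 0" "\<forall>m\<ge>N. c0 * real m powr (2 - 1 / real (r 1)) \<le> real (ex_bip (r 1) (r 2) m)" by (elim exE conjE)
  define c1 where "c1 = c0 * (1 / (2 * q)) powr (2 - 1 / r 1) / q"
  have c1: "c1 > 0" using c0 q by (simp add: c1_def)
  define \<mu> where "\<mu> = max (real (r 1)) (8 * real (r 1) ^ r 1 * r 2 / c1)"
  have \<mu>: "real (r 1) \<le> \<mu>" "8 * real (r 1) ^ r 1 * r 2 / c1 \<le> \<mu>" by (auto simp: \<mu>_def)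
  have \<mu>1: "\<mu> \<ge> 1" using \<mu>(1) r1 by linarith
  have \<mu>2: "8 * real (r 1) ^ r 1 * r 2 \<le> c1 * \<mu> ^ (r 1 - 1)"
  proof -
    have "\<mu> ^ 1 \<le> \<mu> ^ (r 1 - 1)" by (rule power_increasing) (use r1 \<mu>1 in auto)
    hence "8 * real (r 1) ^ r 1 * r 2 / c1 \<le> \<mu> ^ (r 1 - 1)" using \<mu>(2) by simp
    thus ?thesis using c1 by (simp add: pos_divide_le_eq mult.commute)
  qed
  \<comment> \<open>The first bound leaves room for embeddings in every class. The second makes
    \<open>\<mu> * \<kappa>\<close> at most \<open>c1 / 8\<close> in the bound for the remainder of
    the heavy class.\<close>
  define \<theta>1 \<theta>2 where "\<theta>1 = min (1 / (8 * q * M)) (c1 / (16 * \<mu> * (real (r 2) + 1)))" and "\<theta>2 = \<theta>1 / (4 * M)"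
  have d: "0 < 8 * real q * M" "0 < 16 * \<mu> * (real (r 2) + 1)" using M q1 \<mu>1 by auto
  have \<theta>1: "\<theta>1 > 0" using d c1 by (simp add: \<theta>1_def)
  have "\<theta>1 \<le> 1 / (8 * real q * M)" "\<theta>1 \<le> c1 / (16 * \<mu> * (real (r 2) + 1))" by (simp_all add: \<theta>1_def)
  hence \<theta>1q: "8 * real q * M * \<theta>1 \<le> 1" and \<theta>1\<mu>: "16 * \<mu> * (real (r 2) + 1) * \<theta>1 \<le> c1"
    using d by (simp_all only: pos_le_divide_eq mult.commute mult.left_commute)
  have \<theta>2: "\<theta>2 > 0" "4 * M * \<theta>2 \<le> \<theta>1" using \<theta>1 M by (auto simp: \<theta>2_def)
  have "1 * \<theta>2 \<le> 4 * M * \<theta>2" using M \<theta>2 by (intro mult_right_mono) auto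
  hence \<theta>21: "\<theta>2 \<le> \<theta>1" using \<theta>2 by linarith
  have "1 * \<theta>1 \<le> 8 * real q * M * \<theta>1"
  proof (rule mult_right_mono)
    have "8 * 1 * 1 \<le> 8 * real q * M" using q1 M by (intro mult_mono) auto
    thus "1 \<le> 8 * real q * M" by linarith
  qed (use \<theta>1 in simp)
  hence \<theta>2_1: "\<theta>2 \<le> 1" using \<theta>1q \<theta>21 by linarith
  define K1 where "K1 = real (r 1 - 1) + real (r 1 - 1) ^ (r 1 - 1) * r (Suc q) / real (r 1 - 1) ^ (r 1 - 2)"
  have K1: "K1 \<ge> 0" by (simp add: K1_def)
  \<comment> \<open>The error budget must be small against the edges of a heavy class and at most
    the gain from a set of \<open>\<theta>2 / 4 * n\<close> vertices.\<close>
  define K2 where "K2 = min (c1 / 4) (c0 * (\<theta>2 / 4) powr (2 - 1 / r 1))"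
  have K2: "K2 > 0" "4 * K2 \<le> c1" "K2 \<le> c0 * (\<theta>2 / 4) powr (2 - 1 / r 1)" using c1 c0 \<theta>2 by (auto simp: K2_def)
  \<comment> \<open>The last bound makes the imbalance of a class small against the
    \<open>\<theta>2 * n\<close> neighbours of an exceptional vertex.\<close>
  define x where "x = min \<xi> (min (1 / (8 * q)) (\<theta>2 / 8))"
  have x: "0 < x" "x \<le> \<xi>" "x \<le> 1 / (8 * q)" "x \<le> \<theta>2 / 8" using \<xi> q \<theta>2 by (auto simp: x_def)
  from extremal_good_colouring[OF q rpos rmono \<theta>2(1) \<theta>2_1 x(1), where ?'a = 'a]
  obtain C N1 :: nat where N1: "\<forall>(V::'a set) R. extremal_K V R q r \<longrightarrow> N1 \<le> card V \<longrightarrow>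
     (\<exists>c. good_colouring V R q r \<theta>2 x C c)" by (elim exE)
  have lt: "2 - 1 / real (r 1 - 1) < 2 - 1 / real (r 1)"
  proof -
    have "0 < real (r 1 - 1)" "real (r 1 - 1) < real (r 1)" using r1 by auto
    thus ?thesis by (simp add: frac_less2)
  qed
  \<comment> \<open>The constant involves \<open>C\<close>, so this threshold is fixed only after
    the colouring theorem has supplied \<open>C\<close>.\<close>
  have "0 < real q + 2 * real q * C + real q * r 2 + 2 * K1 + 1"
    using K1 by (intro add_nonneg_pos add_nonneg_nonneg) auto
  from eventually_powr_dominates[OF lt K2(1) this] obtain N2 :: nat where N2: "\<And>n. n \<ge> N2 \<Longrightarrow>
    (real q + 2 * real q * C + real q * r 2 + 2 * K1 + 1) * real n powr (2 - 1 / real (r 1 - 1)) \<le>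
        K2 * real n powr (2 - 1 / r 1)" by blast
  define N0 where "N0 = N1 + N2 + nat \<lceil>4 * (real (r (Suc q)) + r 2 + C) / \<theta>2\<rceil> + nat \<lceil>4 * real N / \<theta>2\<rceil> + nat \<lceil>8 / \<theta>2\<rceil> + 2 * q * (N + 1)"
  show ?thesis
  proof (rule exI[of _ N0], intro allI impI)
    fix V :: "'a set" and R
    assume ex: "extremal_K V R q r" and N0: "N0 \<le> card V"
    have n: "N1 \<le> card V" "N2 \<le> card V" "4 * (real (r (Suc q)) + r 2 + C) / \<theta>2 \<le> card V" "4 * real N / \<theta>2 \<le> card V"
      "8 / \<theta>2 \<le> card V" "2 * q * (N + 1) \<le> card V"
      using N0 unfolding N0_def by linarith+
    from N1[THEN spec, THEN spec, THEN mp, THEN mp, OF ex n(1)]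
    obtain c where c: "good_colouring V R q r \<theta>2 x C c" by (elim exE)
    have large: "4 * (real (r (Suc q)) + r 2 + C) \<le> \<theta>2 * card V" "4 * real N \<le> \<theta>2 * card V" "8 \<le> \<theta>2 * card V"
      using \<theta>2(1) n(3-5) by (simp_all add: pos_divide_le_eq mult.commute)
    interpret coloured_host V R q r c \<theta>1 \<theta>2 "card V" C
      by (rule coloured_hostI[where x = x])
        (use c x rpos \<theta>2 \<theta>21 \<theta>1q large in \<open>simp_all add: M_def\<close>)
    interpret coloured_host2 V R q r c \<theta>1 \<theta>2 "card V" C c0 c1 \<mu> N K1 K2
    proof
      show "2 \<le> r 1" by (rule r1)
      show "0 < r 2" using r2 by linarith
      show "0 < c0" by (rule c0)
      show "c0 * real m powr (2 - 1 / real (r 1)) \<le> real (ex_bip (r 1) (r 2) m)" if "N \<le> m" for m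
        using c0(2) that by blast
      show "c1 = c0 * (1 / (2 * q)) powr (2 - 1 / r 1) / q" by (rule c1_def)
      show "real (r 1) \<le> \<mu>" by (rule \<mu>)
      show "8 * real (r 1) ^ r 1 * r 2 \<le> c1 * \<mu> ^ (r 1 - 1)" by (rule \<mu>2)
      show "16 * \<mu> * (r 2 + 1) * \<theta>1 \<le> c1" using \<theta>1\<mu> by (simp add: add.commute)
      show "K1 = real (r 1 - 1) + real (r 1 - 1) ^ (r 1 - 1) * rmax / real (r 1 - 1) ^ (r 1 - 2)"
        by (simp add: K1_def rmax_def)
      show "(real q + 2 * real q * C + real q * r 2 + 2 * K1 + 1) * real (card V) powr (2 - 1 / real (r 1 - 1)) \<le>
        K2 * real (card V) powr (2 - 1 / r 1)" by (rule N2[OF n(2)])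
      show "K2 \<le> c1" using K2 by linarith
      show "4 * K2 \<le> c1" by (rule K2)
      show "K2 \<le> c0 * (\<theta>2 / 4) powr (2 - 1 / r 1)" by (rule K2)
      show "4 * real N \<le> \<theta>2 * real (card V)" by (rule large)
      show "8 \<le> \<theta>2 * real (card V)" by (rule large)
      have "real (2 * q * (N + 1)) \<le> card V" using n(6) by (simp only: of_nat_le_iff)
      thus "2 * real q * (N + 1) \<le> real (card V)" by (simp add: algebra_simps)
      show "card (S j) \<le> real (card V) / q + \<theta>2 * real (card V) / 8" if "j \<in> {1..q}" for j
        using good_colouring_size[OF c that x(4)] unfolding S_def by linarith
      show "(1 - 1 / real q) * real (card V) ^ 2 - q + 2 * ex_bip (r 1) (r 2) (nat \<lfloor>real (card V)\<rfloor> div q) \<le> pair_count R V V"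
        using low[of "card V"] ex by (simp add: extremal_K_def)
    qed
    from structure_2 obtain a where a: "a \<in> {1..q}" "\<not> has_bip R (S a) (r 1) (r 2)"
      "\<forall>j\<in>{1..q}. j \<noteq> a \<longrightarrow> \<not> has_bip R (S j) 1 (r 2)" by (elim bexE conjE)
    show "\<exists>c. structured V R q r \<xi> c"
      by (rule structuredI[OF cV a(1) good_colouring_size[OF c _ x(2)]]) (use a in \<open>auto simp: S_def\<close>)
  qed
qed

lemma extremal_structured:
  fixes \<xi> :: real
  assumes q: "q > 0" and rpos: "\<forall>i\<in>{1..Suc q}. r i > 0" and rmono: "mono_on {1..Suc q} r"
    and \<xi>: "0 < \<xi>" and r2: "r 2 \<ge> fact (r 1 - 1) + 1"
  shows "\<exists>N0::nat. \<forall>(V::'a set) R. extremal_K V R q r \<longrightarrow> N0 \<le> card V \<longrightarrow> (\<exists>c. structured V R q r \<xi> c)"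
proof (cases "r 1 = 1")
  case True
  show ?thesis by (rule extremal_structured_1[OF q rpos rmono \<xi> True])
next
  case False
  have "r 1 > 0" using rpos by auto
  hence "r 1 \<ge> 2" using False by linarith
  thus ?thesis by (rule extremal_structured_2[OF q rpos rmono \<xi> _ r2])
qed

section \<open>Equality in the edge count\<close>

lemma sum_split_1: "q > 0 \<Longrightarrow> (\<Sum>i\<in>{1..q}. f i) = f 1 + (\<Sum>i\<in>{2..q::nat}. f i)"
  by (simp add: sum.atLeast_Suc_atMost numeral_2_eq_2)

text \<open>The lower bound is applied to the class sizes of the given colouring. On large classes
  the numbers for girth 5 and for stars agree, so the lower and the upper bound coincide and no pair
  between classes can be missing.\<close>

lemma extremal_tight:
  assumes q: "q > 0" and rpos: "\<forall>i\<in>{1..Suc q}. r i > 0" and rmono: "mono_on {1..Suc q} r"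
    and ex: "extremal_K V R q r" and st: "structured V R q r x c" and r2: "r 2 \<ge> 2"
    and large: "\<forall>j\<in>{2..q}. 2 * r 2 ^ 4 + 2 \<le> card {v \<in> V. c v = j}"
  shows "\<And>u v. u \<in> V \<Longrightarrow> v \<in> V \<Longrightarrow> c u \<noteq> c v \<Longrightarrow> R u v"
    and "pair_count R {v \<in> V. c v = 1} {v \<in> V. c v = 1} = 2 * ex_bip (r 1) (r 2) (card {v \<in> V. c v = 1})"
    and "\<And>j. j \<in> {2..q} \<Longrightarrow>
      pair_count R {v \<in> V. c v = j} {v \<in> V. c v = j} = 2 * ex_bip 1 (r 2) (card {v \<in> V. c v = j})"
proof -
  from ex have V: "finite V" and R: "symp R" "irreflp R" and free: "\<not> has_blocks R V {1..Suc q} r"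
    and pc: "pair_count R V V = 2 * ex_K q r (card V)" by (auto simp: extremal_K_def)
  interpret host V R q r c using V R q rmono free by unfold_locales
  from st have cV: "\<forall>v\<in>V. c v \<in> {1..q}" and f1: "\<not> has_bip R (S 1) (r 1) (r 2)"
    and f2: "\<forall>j\<in>{2..q}. \<not> has_bip R (S j) 1 (r 2)" by (simp_all add: structured_def S_def)
  define E where "E i = (if i = 1 then 2 * ex_bip (r 1) (r 2) (card (S i)) else 2 * ex_bip 1 (r 2) (card (S i)))" for i
  have le: "pair_count R (S i) (S i) \<le> E i" if i: "i \<in> {1..q}" for i
  proof (cases "i = 1")
    case True
    from free_bip_iff[OF finS R] f1 have "free_of (graph_of (S 1) R) {complete_multipartite [r 1, r 2]}" by blast
    from pair_count_le_ex_number[OF finS R this] show ?thesis by (simp add: E_def True)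
  next
    case False
    hence "i \<in> {2..q}" using i by auto
    hence "\<not> has_bip R (S i) 1 (r 2)" using f2 by blast
    with free_bip_iff[OF finS R] have "free_of (graph_of (S i) R) {complete_multipartite [1, r 2]}" by blast
    from pair_count_le_ex_number[OF finS R this] False show ?thesis by (simp add: E_def)
  qed
  have "card V ^ 2 + 2 * ex_bip (r 1) (r 2) (card (S 1)) + (\<Sum>i\<in>{2..q}. 2 * ex_number (card (S i)) (girth5_family (r 2))) \<le>
     pair_count R V V + (\<Sum>i\<in>{1..q}. card (S i) ^ 2)"
    unfolding pc by (rule join_lower_bound[OF q rpos rmono card_V_split[OF cV]])
  moreover have "2 * ex_bip (r 1) (r 2) (card (S 1)) + (\<Sum>i\<in>{2..q}. 2 * ex_number (card (S i)) (girth5_family (r 2))) = (\<Sum>i\<in>{1..q}. E i)"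
  proof -
    have "(\<Sum>i\<in>{2..q}. 2 * ex_number (card (S i)) (girth5_family (r 2))) = (\<Sum>i\<in>{2..q}. E i)"
    proof (rule sum.cong[OF refl])
      fix i assume i: "i \<in> {2..q}"
      from ex_number_girth5_eq_star[OF r2 large[rule_format, OF i]]
      show "2 * ex_number (card (S i)) (girth5_family (r 2)) = E i" using i by (simp add: E_def S_def)
    qed
    thus ?thesis unfolding sum_split_1[OF q] by (simp add: E_def)
  qed
  ultimately have lower: "card V ^ 2 + (\<Sum>i\<in>{1..q}. E i) \<le> pair_count R V V + (\<Sum>i\<in>{1..q}. card (S i) ^ 2)" by linarith
  have mono: "mono_count R V c = (\<Sum>j\<in>{1..q}. pair_count R (S j) (S j))"
    unfolding S_def by (rule mono_count_split[OF V]) (use cV in blast)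
  have upper: "(\<Sum>j\<in>{1..q}. pair_count R (S j) (S j)) \<le> (\<Sum>i\<in>{1..q}. E i)" by (rule sum_mono[OF le])
  have total: "(\<Sum>v\<in>V. total_miss v) = 0" and eq: "(\<Sum>j\<in>{1..q}. pair_count R (S j) (S j)) = (\<Sum>i\<in>{1..q}. E i)"
    using sum_total_miss[OF cV] lower upper mono by linarith+
  \<comment> \<open>Every summand is bounded by its counterpart and the sums agree, so the summands
    agree.\<close>
  have pcE: "pair_count R (S i) (S i) = E i" if "i \<in> {1..q}" for i
    by (rule sum_mono_inv[OF eq le that]) simp_all
  show "R u v" if uv: "u \<in> V" "v \<in> V" "c u \<noteq> c v" for u v
  proof (rule ccontr)
    assume nR: "\<not> R u v"
    have "total_miss u = 0" using total V uv(1) by simp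
    moreover have "c v \<in> {1..q} - {c u}" using cV uv by auto
    ultimately have "miss u (c v) = 0" unfolding total_miss_def by simp
    moreover have "v \<in> {w \<in> S (c v). \<not> R u w}" "finite {w \<in> S (c v). \<not> R u w}" using uv nR V by (auto simp: S_def)
    ultimately show False unfolding miss_def by auto
  qed
  show "pair_count R {v \<in> V. c v = 1} {v \<in> V. c v = 1} = 2 * ex_bip (r 1) (r 2) (card {v \<in> V. c v = 1})"
    using pcE[of 1] q by (simp add: E_def S_def)
  show "pair_count R {v \<in> V. c v = j} {v \<in> V. c v = j} = 2 * ex_bip 1 (r 2) (card {v \<in> V. c v = j})" if "j \<in> {2..q}" for j
    using pcE[of j] that by (simp add: E_def S_def)
qed

lemma induced_graph_eq: "simple_graph G \<Longrightarrow> U \<subseteq> verts G \<Longrightarrow> induced_graph G U = graph_of U (adj G)"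
  by (fastforce simp: induced_graph_def graph_of_def adj_def simple_graph_def card_2_iff)

lemma induced_graph_EX:
  assumes G: "simple_graph G" and U: "U \<subseteq> verts G" and free: "\<not> has_bip (adj G) U a b"
    and pc: "pair_count (adj G) U U = 2 * ex_bip a b (card U)"
  shows "induced_graph G U \<in> EX_graphs (card U) {complete_multipartite [a, b]}"
proof -
  have fin: "finite U" using G U by (auto simp: simple_graph_def intro: finite_subset)
  note R = symp_adj[of G] irreflp_adj[OF G]
  show ?thesis unfolding EX_graphs_def induced_graph_eq[OF G U]
    using simple_graph_of[OF fin R(2)] free_bip_iff[OF fin R] free pair_count_edges[OF fin R] pc by simp
qed

lemma graph_join_induced:
  assumes G: "simple_graph G" and cV: "\<forall>v\<in>verts G. c v \<in> {1..q}"
    and full: "\<And>u v. u \<in> verts G \<Longrightarrow> v \<in> verts G \<Longrightarrow> c u \<noteq> c v \<Longrightarrow> adj G u v"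
  shows "G = graph_join q (\<lambda>i. induced_graph G {v \<in> verts G. c v = i})"
proof (rule prod_eqI)
  show "verts G = verts (graph_join q (\<lambda>i. induced_graph G {v \<in> verts G. c v = i}))"
    using cV by (auto simp: graph_join_def induced_graph_def)
  show "edges G = edges (graph_join q (\<lambda>i. induced_graph G {v \<in> verts G. c v = i}))"
  proof (rule Set.set_eqI, rule iffI)
    fix e assume e: "e \<in> edges G"
    then obtain u v where uv: "e = {u, v}" "u \<in> verts G" "v \<in> verts G"
      using G by (fastforce simp: simple_graph_def card_2_iff)
    have c: "c u \<in> {1..q}" "c v \<in> {1..q}" using cV uv by auto
    show "e \<in> edges (graph_join q (\<lambda>i. induced_graph G {v \<in> verts G. c v = i}))"
    proof (cases "c u = c v")
      case True
      hence "e \<in> edges (induced_graph G {w \<in> verts G. c w = c u})" using e uv by (auto simp: induced_graph_def)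
      thus ?thesis using c(1) unfolding graph_join_def snd_conv by blast
    next
      case False
      thus ?thesis using c uv unfolding graph_join_def snd_conv induced_graph_def fst_conv by blast
    qed
  next
    fix e assume "e \<in> edges (graph_join q (\<lambda>i. induced_graph G {v \<in> verts G. c v = i}))"
    thus "e \<in> edges G" using full unfolding graph_join_def induced_graph_def fst_conv snd_conv adj_def by blast
  qed
qed

lemma EX_extremal_K:
  assumes "G \<in> EX_graphs n {complete_multipartite (map r [1..<q+2])}"
  shows "simple_graph G" "card (verts G) = n" "extremal_K (verts G) (adj G) q r"
proof -
  from assms have G: "simple_graph G" "card (verts G) = n" "free_of G {complete_multipartite (map r [1..<q+2])}"
    "card (edges G) = ex_K q r n" by (simp_all add: EX_graphs_def)
  have fin: "finite (verts G)" using G(1) by (simp add: simple_graph_def)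
  have "\<not> has_blocks (adj G) (verts G) {1..Suc q} r"
    using free_K_iff[OF fin symp_adj irreflp_adj[OF G(1)]] G(3) unfolding graph_of_adj[OF G(1)] by blast
  thus "extremal_K (verts G) (adj G) q r"
    using fin irreflp_adj[OF G(1)] pair_count_adj[OF G(1)] G by (simp add: extremal_K_def)
qed (use assms in \<open>simp_all add: EX_graphs_def\<close>)

lemma extremal_graphs_are_joins:
  fixes \<delta> :: real
  assumes q: "q > 0" and rpos: "\<forall>i\<in>{1..Suc q}. r i > 0" and rmono: "mono_on {1..Suc q} r"
    and r2: "r 2 \<ge> fact (r 1 - 1) + 1" and \<delta>: "\<delta> > 0"
  shows "\<exists>N0. \<forall>n\<ge>N0. \<forall>G::'a graph. G \<in> EX_graphs n {complete_multipartite (map r [1..<q+2])} \<longrightarrow>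
          (\<exists>U. verts G = (\<Union>i\<in>{1..q}. U i) \<and> disjoint_family_on U {1..q} \<and>
               G = graph_join q (\<lambda>i. induced_graph G (U i)) \<and>
               factor_conditions q r \<delta> n (\<lambda>i. induced_graph G (U i)))"
proof -
  \<comment> \<open>The bound \<open>1 / (2 * q)\<close> guarantees at least
    \<open>n / (2 * q)\<close> vertices in each class, as the comparison of girth 5 with stars needs
    large classes.\<close>
  define x where "x = min \<delta> (1 / (2 * q))"
  have x: "x > 0" "x \<le> \<delta>" "x \<le> 1 / (2 * q)" using \<delta> q by (auto simp: x_def)
  have r22: "r 2 \<ge> 2" using r2 fact_ge_1[of "r 1 - 1", where ?'a = nat] by linarith
  from extremal_structured[OF q rpos rmono x(1) r2, where ?'a = 'a]
  obtain N1 :: nat where N1: "\<forall>(V::'a set) R. extremal_K V R q r \<longrightarrow> N1 \<le> card V \<longrightarrow> (\<exists>c. structured V R q r x c)"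
    by (elim exE)
  show ?thesis
  proof (rule exI[of _ "N1 + 2 * q * (2 * r 2 ^ 4 + 2)"], intro allI impI)
    fix n and G :: "'a graph"
    assume n: "N1 + 2 * q * (2 * r 2 ^ 4 + 2) \<le> n"
      and "G \<in> EX_graphs n {complete_multipartite (map r [1..<q+2])}"
    note G = EX_extremal_K[OF this(2)]
    let ?V = "verts G"
    have "N1 \<le> card ?V" using n G(2) by linarith
    from N1[THEN spec, THEN spec, THEN mp, THEN mp, OF G(3) this] obtain c where st: "structured ?V (adj G) q r x c"
      by (elim exE)
    define U where "U i = {v \<in> ?V. c v = i}" for i
    have cV: "\<forall>v\<in>?V. c v \<in> {1..q}" and free: "\<not> has_bip (adj G) (U 1) (r 1) (r 2)"
      "\<And>j. j \<in> {2..q} \<Longrightarrow> \<not> has_bip (adj G) (U j) 1 (r 2)"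
      and size: "\<And>j. j \<in> {1..q} \<Longrightarrow> \<bar>real (card (U j)) - real n / real q\<bar> \<le> x * real n"
      using st G(2) by (simp_all add: structured_def U_def)
    have large: "\<forall>j\<in>{2..q}. 2 * r 2 ^ 4 + 2 \<le> card {v \<in> ?V. c v = j}"
    proof
      fix j assume j: "j \<in> {2..q}"
      have "x * real n \<le> 1 / (2 * q) * real n" using x(3) by (intro mult_right_mono) auto
      moreover have "\<bar>real (card (U j)) - real n / real q\<bar> \<le> x * real n" using size j by auto
      moreover have "n / q = n / (2 * q) + n / (2 * q)" by (simp add: field_simps)
      moreover have "1 / (2 * q) * real n = n / (2 * q)" by simp
      ultimately have "n / (2 * q) \<le> card (U j)" by linarith
      moreover have "real (2 * q * (2 * r 2 ^ 4 + 2)) \<le> n" using n by linarith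
      hence "(real (2 * r 2 ^ 4 + 2)) * (2 * q) \<le> n" by (simp only: of_nat_mult mult.commute)
      hence "real (2 * r 2 ^ 4 + 2) \<le> n / (2 * q)" using q by (simp add: pos_le_divide_eq)
      ultimately have "real (2 * r 2 ^ 4 + 2) \<le> card (U j)" by linarith
      thus "2 * r 2 ^ 4 + 2 \<le> card {v \<in> ?V. c v = j}" unfolding U_def of_nat_le_iff .
    qed
    note tight = extremal_tight[OF q rpos rmono G(3) st r22 large]
    have "factor_conditions q r \<delta> n (\<lambda>i. induced_graph G (U i))"
      unfolding factor_conditions_def
    proof (intro conjI ballI)
      fix i assume i: "i \<in> {1..q}"
      have "x * real n \<le> \<delta> * real n" using x(2) by (intro mult_right_mono) auto
      hence "\<bar>real (card (U i)) - real n / real q\<bar> \<le> \<delta> * real n" using size[OF i] by linarith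
      thus "real n / real q - \<delta> * real n \<le> real (card (verts (induced_graph G (U i))))"
        "real (card (verts (induced_graph G (U i)))) \<le> real n / real q + \<delta> * real n"
        by (simp_all add: induced_graph_def abs_le_iff)
    next
      show "induced_graph G (U 1) \<in> EX_graphs (card (verts (induced_graph G (U 1)))) {complete_multipartite [r 1, r 2]}"
        using induced_graph_EX[OF G(1) _ free(1)] tight(2) by (simp add: U_def induced_graph_def)
    next
      fix i assume i: "i \<in> {2..q}"
      show "induced_graph G (U i) \<in> EX_graphs (card (verts (induced_graph G (U i)))) {complete_multipartite [1, r 2]}"
        using induced_graph_EX[OF G(1) _ free(2)[OF i]] tight(3)[OF i] by (simp add: U_def induced_graph_def)
    qed
    moreover have "G = graph_join q (\<lambda>i. induced_graph G (U i))"
      unfolding U_def by (rule graph_join_induced[OF G(1) cV tight(1)])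
    moreover have "?V = (\<Union>i\<in>{1..q}. U i)" using cV by (auto simp: U_def)
    moreover have "disjoint_family_on U {1..q}" by (auto simp: disjoint_family_on_def U_def)
    ultimately show "\<exists>U. ?V = (\<Union>i\<in>{1..q}. U i) \<and> disjoint_family_on U {1..q} \<and>
               G = graph_join q (\<lambda>i. induced_graph G (U i)) \<and>
               factor_conditions q r \<delta> n (\<lambda>i. induced_graph G (U i))" by blast
  qed
qed

section \<open>Replacing the factors of an extremal join\<close>

lemma join_edge_count:
  assumes disj: "disjoint_family_on (\<lambda>i. verts (N i)) {1..q}" and simple: "\<forall>i\<in>{1..q}. simple_graph (N i)"
  shows "simple_graph (graph_join q N)"
    and "card (verts (graph_join q N)) = (\<Sum>i\<in>{1..q}. card (verts (N i)))"
    and "\<And>i u v. i \<in> {1..q} \<Longrightarrow> u \<in> verts (N i) \<Longrightarrow> v \<in> verts (N i) \<Longrightarrow> adj (graph_join q N) u v \<longleftrightarrow> adj (N i) u v"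
    and "2 * card (edges (graph_join q N)) + (\<Sum>i\<in>{1..q}. card (verts (N i)) ^ 2) =
      (\<Sum>i\<in>{1..q}. card (verts (N i))) ^ 2 + (\<Sum>i\<in>{1..q}. 2 * card (edges (N i)))"
proof -
  let ?G = "graph_join q N"
  have verts: "verts ?G = (\<Union>i\<in>{1..q}. verts (N i))" by (simp add: graph_join_def)
  have edgesN: "e \<subseteq> verts (N i)" "card e = 2" if "i \<in> {1..q}" "e \<in> edges (N i)" for i e
    using simple[rule_format, OF that(1)] that(2) by (simp_all add: simple_graph_def)
  have uniq: "i = j" if "i \<in> {1..q}" "j \<in> {1..q}" "v \<in> verts (N i)" "v \<in> verts (N j)" for i j v
    using disj that unfolding disjoint_family_on_def by blast
  have fin: "finite (verts (N i))" if "i \<in> {1..q}" for i using simple[rule_format, OF that] by (simp add: simple_graph_def)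
  show sG: "simple_graph ?G" unfolding simple_graph_def
  proof (intro conjI ballI)
    show "finite (verts ?G)" unfolding verts using fin by simp
    fix e assume "e \<in> edges ?G"
    then consider i where "i \<in> {1..q}" "e \<in> edges (N i)" |
      u v i j where "e = {u, v}" "i \<in> {1..q}" "j \<in> {1..q}" "i \<noteq> j" "u \<in> verts (N i)" "v \<in> verts (N j)"
      unfolding graph_join_def snd_conv by blast
    hence "e \<subseteq> verts ?G \<and> card e = 2"
    proof cases
      case 1
      thus ?thesis using edgesN[OF 1] unfolding verts by blast
    next
      case 2
      hence "u \<noteq> v" using uniq by blast
      thus ?thesis using 2 unfolding verts by auto
    qed
    thus "e \<subseteq> verts ?G" "card e = 2" by auto
  qed
  show card: "card (verts ?G) = (\<Sum>i\<in>{1..q}. card (verts (N i)))" unfolding verts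
    by (rule card_UN_disjoint') (use disj fin in auto)
  show inner: "adj ?G u v \<longleftrightarrow> adj (N i) u v" if i: "i \<in> {1..q}" and uv: "u \<in> verts (N i)" "v \<in> verts (N i)" for i u v
  proof
    assume "adj (N i) u v"
    thus "adj ?G u v" using i unfolding adj_def graph_join_def snd_conv by blast
  next
    assume "adj ?G u v"
    then consider j where "j \<in> {1..q}" "{u, v} \<in> edges (N j)" |
      u' v' k j where "{u, v} = {u', v'}" "k \<in> {1..q}" "j \<in> {1..q}" "k \<noteq> j" "u' \<in> verts (N k)" "v' \<in> verts (N j)"
      unfolding adj_def graph_join_def snd_conv by blast
    thus "adj (N i) u v"
    proof cases
      case 1
      have "u \<in> verts (N j)" using edgesN(1)[OF 1] by simp
      hence "j = i" using uniq[OF 1(1) i _ uv(1)] by simp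
      thus ?thesis using 1 by (simp add: adj_def)
    next
      case 2
      have "u' \<in> verts (N i)" "v' \<in> verts (N i)" using 2(1) uv by (auto simp: doubleton_eq_iff)
      hence "k = i" "j = i" using uniq[OF 2(2) i 2(5)] uniq[OF 2(3) i 2(6)] by auto
      thus ?thesis using 2(4) by simp
    qed
  qed
  \<comment> \<open>Disjointness of the factors makes the chosen index unique, so \<open>c\<close>
    colours each vertex by its factor.\<close>
  define c where "c v = (SOME i. i \<in> {1..q} \<and> v \<in> verts (N i))" for v
  have c: "c v \<in> {1..q}" "v \<in> verts (N (c v))" if "v \<in> verts ?G" for v
  proof -
    have "\<exists>i. i \<in> {1..q} \<and> v \<in> verts (N i)" using that unfolding verts by blast
    from someI_ex[OF this] show "c v \<in> {1..q}" "v \<in> verts (N (c v))" by (simp_all add: c_def)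
  qed
  have part: "{v \<in> verts ?G. c v = i} = verts (N i)" if i: "i \<in> {1..q}" for i
  proof
    show "{v \<in> verts ?G. c v = i} \<subseteq> verts (N i)" using c(2) by blast
    show "verts (N i) \<subseteq> {v \<in> verts ?G. c v = i}"
    proof
      fix v assume v: "v \<in> verts (N i)"
      hence "v \<in> verts ?G" using i unfolding verts by blast
      with uniq[OF c(1) i c(2) v] show "v \<in> {v \<in> verts ?G. c v = i}" by simp
    qed
  qed
  have "pair_count (adj ?G) (verts ?G) (verts ?G) + (\<Sum>i\<in>{1..q}. card {v \<in> verts ?G. c v = i} ^ 2) =
     card (verts ?G) ^ 2 + (\<Sum>i\<in>{1..q}. pair_count (adj ?G) {v \<in> verts ?G. c v = i} {v \<in> verts ?G. c v = i})"
  proof (rule complete_join_pair_count)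
    show "finite (verts ?G)" using sG by (simp add: simple_graph_def)
    show "\<forall>v\<in>verts ?G. c v \<in> {1..q}" using c(1) by blast
    show "adj ?G u v" if "u \<in> verts ?G" "v \<in> verts ?G" "c u \<noteq> c v" for u v
      using c[OF that(1)] c[OF that(2)] that(3) unfolding adj_def graph_join_def snd_conv by blast
  qed
  moreover have "(\<Sum>i\<in>{1..q}. card {v \<in> verts ?G. c v = i} ^ 2) = (\<Sum>i\<in>{1..q}. card (verts (N i)) ^ 2)"
    by (rule sum.cong[OF refl]) (simp only: part)
  moreover have "(\<Sum>i\<in>{1..q}. pair_count (adj ?G) {v \<in> verts ?G. c v = i} {v \<in> verts ?G. c v = i}) =
      (\<Sum>i\<in>{1..q}. 2 * card (edges (N i)))"
  proof (rule sum.cong[OF refl])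
    fix i assume i: "i \<in> {1..q}"
    have "pair_count (adj ?G) (verts (N i)) (verts (N i)) = pair_count (adj (N i)) (verts (N i)) (verts (N i))"
      unfolding pair_count_def by (intro sum.cong refl arg_cong[of _ _ card] Collect_cong) (auto simp: inner[OF i])
    thus "pair_count (adj ?G) {v \<in> verts ?G. c v = i} {v \<in> verts ?G. c v = i} = 2 * card (edges (N i))"
      by (simp only: part[OF i] pair_count_adj[OF simple[rule_format, OF i]])
  qed
  ultimately show "2 * card (edges ?G) + (\<Sum>i\<in>{1..q}. card (verts (N i)) ^ 2) =
      (\<Sum>i\<in>{1..q}. card (verts (N i))) ^ 2 + (\<Sum>i\<in>{1..q}. 2 * card (edges (N i)))"
    by (simp only: pair_count_adj[OF sG] card)
qed

lemma has_bip_cong: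
  assumes "\<And>u v. u \<in> W \<Longrightarrow> v \<in> W \<Longrightarrow> R u v \<longleftrightarrow> R' u v"
  shows "has_bip R W a b \<longleftrightarrow> has_bip R' W a b"
  unfolding has_bip_def using assms by (intro ex_cong1) (meson subsetD)

text \<open>Freeness holds for joins of such factors of any sizes; \<open>count\<close> says that
  for these sizes the join reaches the extremal number.\<close>

lemma join_extremal:
  assumes q: "q > 0" and rmono: "mono_on {1..Suc q} r"
    and disj: "disjoint_family_on (\<lambda>i. verts (N i)) {1..q}"
    and N1: "N 1 \<in> EX_graphs (card (verts (N 1))) {complete_multipartite [r 1, r 2]}"
    and N2: "\<And>i. i \<in> {2..q} \<Longrightarrow> N i \<in> EX_graphs (card (verts (N i))) (girth5_family (r 2))"
    and n: "n = (\<Sum>i\<in>{1..q}. card (verts (N i)))"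
    and count: "2 * ex_K q r n + (\<Sum>i\<in>{1..q}. card (verts (N i)) ^ 2) \<le> n ^ 2 + 2 * ex_bip (r 1) (r 2) (card (verts (N 1))) +
      (\<Sum>i\<in>{2..q}. 2 * ex_number (card (verts (N i))) (girth5_family (r 2)))"
  shows "graph_join q N \<in> EX_graphs n {complete_multipartite (map r [1..<q+2])}"
proof -
  let ?G = "graph_join q N"
  have cases: "i = 1 \<or> i \<in> {2..q}" if "i \<in> {1..q}" for i using that by auto
  have simple: "\<forall>i\<in>{1..q}. simple_graph (N i)"
    using cases N1 N2 unfolding EX_graphs_def by blast
  note G = join_edge_count[of N q, OF disj simple]
  note R = symp_adj[of ?G] irreflp_adj[OF G(1)]
  have fin: "finite (verts (N i))" if "i \<in> {1..q}" for i using simple[rule_format, OF that] by (simp add: simple_graph_def)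
  have finG: "finite (verts ?G)" using G(1) by (simp add: simple_graph_def)
  have bip: "has_bip (adj ?G) (verts (N i)) a b \<longleftrightarrow> has_bip (adj (N i)) (verts (N i)) a b" if "i \<in> {1..q}" for i a b
    by (rule has_bip_cong) (rule G(3)[OF that])
  have one: "1 \<in> {1..q}" and two: "\<And>i. i \<in> {2..q} \<Longrightarrow> i \<in> {1..q}" using q by auto
  have "\<not> has_blocks (adj ?G) (verts ?G) {1..Suc q} r"
  proof (rule join_no_blocks[OF q rmono fin R])
    show "verts ?G \<subseteq> (\<Union>i\<in>{1..q}. verts (N i))" by (simp add: graph_join_def)
    have "free_of (N 1) {complete_multipartite [r 1, r 2]}" using N1 by (simp add: EX_graphs_def)
    thus "\<not> has_bip (adj ?G) (verts (N 1)) (r 1) (r 2)"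
      using free_bip_iff[OF fin[OF one] symp_adj irreflp_adj[OF simple[rule_format, OF one]]]
      unfolding bip[OF one] graph_of_adj[OF simple[rule_format, OF one]] by blast
    fix i assume i: "i \<in> {2..q}"
    have "free_of (N i) (girth5_family (r 2))" using N2[OF i] by (simp only: EX_graphs_def mem_Collect_eq)
    hence g: "\<not> has_bip (adj (N i)) (verts (N i)) 1 (r 2) \<and> \<not> has_bip (adj (N i)) (verts (N i)) 2 2 \<and>
        \<not> (\<exists>u\<in>verts (N i). \<exists>v\<in>verts (N i). \<exists>w\<in>verts (N i). adj (N i) u v \<and> adj (N i) v w \<and> adj (N i) u w)"
      using free_girth5_iff[OF fin[OF two[OF i]] symp_adj irreflp_adj[OF simple[rule_format, OF two[OF i]]]]
      unfolding graph_of_adj[OF simple[rule_format, OF two[OF i]]] by blast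
    show "\<not> has_bip (adj ?G) (verts (N i)) 1 (r 2)" unfolding bip[OF two[OF i]] by (rule g[THEN conjunct1])
    show "\<not> has_bip (adj ?G) (verts (N i)) 2 2" unfolding bip[OF two[OF i]] by (rule g[THEN conjunct2, THEN conjunct1])
    show "\<not> (\<exists>u\<in>verts (N i). \<exists>v\<in>verts (N i). \<exists>w\<in>verts (N i). adj ?G u v \<and> adj ?G v w \<and> adj ?G u w)"
    proof
      assume "\<exists>u\<in>verts (N i). \<exists>v\<in>verts (N i). \<exists>w\<in>verts (N i). adj ?G u v \<and> adj ?G v w \<and> adj ?G u w"
      then obtain u v w where uvw: "u \<in> verts (N i)" "v \<in> verts (N i)" "w \<in> verts (N i)"
        "adj ?G u v" "adj ?G v w" "adj ?G u w" by (elim bexE conjE)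
      have "adj (N i) u v \<and> adj (N i) v w \<and> adj (N i) u w"
        using uvw(4-6) G(3)[OF two[OF i]] uvw(1-3) by simp
      thus False using g[THEN conjunct2, THEN conjunct2] uvw(1-3) by blast
    qed
  qed
  hence free: "free_of ?G {complete_multipartite (map r [1..<q+2])}"
    using free_K_iff[OF finG R] unfolding graph_of_adj[OF G(1)] by blast
  have cardG: "card (verts ?G) = n" unfolding G(2) n ..
  have le: "card (edges ?G) \<le> ex_K q r n" using card_edges_le_ex_number[OF G(1) free] unfolding cardG .
  have "(\<Sum>i\<in>{1..q}. 2 * card (edges (N i))) = 2 * ex_bip (r 1) (r 2) (card (verts (N 1))) +
      (\<Sum>i\<in>{2..q}. 2 * ex_number (card (verts (N i))) (girth5_family (r 2)))"
    unfolding sum_split_1[OF q]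
  proof (intro arg_cong2[of _ _ _ _ "(+)"] sum.cong refl)
    show "2 * card (edges (N 1)) = 2 * ex_bip (r 1) (r 2) (card (verts (N 1)))" using N1 by (simp add: EX_graphs_def)
    show "2 * card (edges (N i)) = 2 * ex_number (card (verts (N i))) (girth5_family (r 2))" if "i \<in> {2..q}" for i
      using N2[OF that] by (simp only: EX_graphs_def mem_Collect_eq)
  qed
  hence "ex_K q r n \<le> card (edges ?G)" using G(4) count unfolding n[symmetric] by linarith
  thus ?thesis using le G(1) cardG free by (simp add: EX_graphs_def)
qed

lemma ex_number_bip_upper:
  assumes "s > 0" "t > 0" "n > 0"
  shows "2 * real (ex_bip s t n) \<le> (real s + real s ^ s * t / real s ^ (s - 1)) * real n powr (2 - 1 / s)"
proof -
  have "\<forall>H\<in>{complete_multipartite [s, t]}. edges H \<noteq> {}" using edges_bip_nonempty[OF assms(1,2)] by simp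
  from ex_number_attained[OF finite_lessThan[of n] this] obtain R where
    R: "symp R" "irreflp R" "free_of (graph_of {..<n} R) {complete_multipartite [s, t]}"
    "pair_count R {..<n} {..<n} = 2 * ex_bip s t (card {..<n})" by metis
  have nb: "\<not> has_bip R {..<n} s t" using free_bip_iff[OF finite_lessThan R(1,2)] R(3) by blast
  have "real (pair_count R {..<n} {..<n}) \<le> (real s * 1 + real s ^ s * t / real s ^ (s - 1)) * real n powr (2 - 1 / s)"
  proof (rule kovari_sos_turan_powr)
    show "card {z \<in> {..<n}. \<forall>p\<in>P. R z p} \<le> t" if P: "P \<subseteq> {..<n}" "card P = s" for P
    proof (rule ccontr)
      assume less: "\<not> card {z \<in> {..<n}. \<forall>p\<in>P. R z p} \<le> t"
      have "has_bip R {..<n} s t" unfolding has_bip_def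
        by (rule exI[of _ P], rule exI[of _ "{z \<in> {..<n}. \<forall>p\<in>P. R z p}"])
          (use P less sympD[OF R(1)] in auto)
      thus False using nb by contradiction
    qed
  qed (use assms in auto)
  thus ?thesis using R(4) by simp
qed

text \<open>A single deviation from the mean is at most the root of the sum of squared
  deviations.\<close>

lemma part_size_lower:
  fixes m :: "nat \<Rightarrow> nat" and n :: real
  assumes q: "q > 0" and n: "n = (\<Sum>i\<in>{1..q}. real (m i))" "n \<ge> 0"
    and sq: "(\<Sum>i\<in>{1..q}. real (m i) ^ 2) - n ^ 2 / q \<le> (n / (2 * q)) ^ 2" and i: "i \<in> {1..q}"
  shows "n / (2 * q) \<le> m i"
proof -
  have "(real (m i) - n / q) ^ 2 \<le> (\<Sum>i\<in>{1..q}. (real (m i) - n / q) ^ 2)"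
    by (rule member_le_sum) (use i in auto)
  also have "\<dots> = (\<Sum>i\<in>{1..q}. real (m i) ^ 2 - 2 * (n / q) * m i + (n / q) ^ 2)"
    by (intro sum.cong refl) (simp add: power2_diff)
  also have "\<dots> = (\<Sum>i\<in>{1..q}. real (m i) ^ 2) - 2 * (n / q) * n + q * (n / q) ^ 2"
    unfolding n(1) by (simp add: sum.distrib sum_subtractf sum_distrib_left)
  also have "\<dots> = (\<Sum>i\<in>{1..q}. real (m i) ^ 2) - n ^ 2 / q" using q by (simp add: power2_eq_square field_simps)
  also note sq
  finally have "\<bar>real (m i) - n / q\<bar> \<le> n / (2 * q)" using n(2) by (simp add: abs_le_square_iff[symmetric])
  moreover have "n / q = n / (2 * q) + n / (2 * q)" by (simp add: field_simps)
  ultimately show ?thesis by linarith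
qed

text \<open>The new join has the same number of edges as the old one, because girth 5 costs nothing
  on large classes. The threshold has to be uniform in the tolerance \<open>\<delta>\<close> of the
  theorem, so the class sizes are recovered from the edge count: an extremal join has too many edges
  to be far from balanced.\<close>

lemma extremal_join_replacement:
  assumes q: "q > 0" and rpos: "\<forall>i\<in>{1..Suc q}. r i > 0" and rmono: "mono_on {1..Suc q} r" and r2: "r 2 \<ge> 2"
  shows "\<exists>N0. \<forall>n\<ge>N0. \<forall>(N :: nat \<Rightarrow> 'a graph) (N' :: nat \<Rightarrow> 'a graph).
    disjoint_family_on (\<lambda>i. verts (N' i)) {1..q} \<longrightarrow> disjoint_family_on (\<lambda>i. verts (N i)) {1..q} \<longrightarrow>
    graph_join q N \<in> EX_graphs n {complete_multipartite (map r [1..<q+2])} \<longrightarrow>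
    N 1 \<in> EX_graphs (card (verts (N 1))) {complete_multipartite [r 1, r 2]} \<longrightarrow>
    (\<forall>i\<in>{2..q}. N i \<in> EX_graphs (card (verts (N i))) {complete_multipartite [1, r 2]}) \<longrightarrow>
    (\<forall>i\<in>{1..q}. card (verts (N' i)) = card (verts (N i))) \<longrightarrow>
    N' 1 \<in> EX_graphs (card (verts (N' 1))) {complete_multipartite [r 1, r 2]} \<longrightarrow>
    (\<forall>i\<in>{2..q}. N' i \<in> EX_graphs (card (verts (N' i))) (girth5_family (r 2))) \<longrightarrow>
    graph_join q N' \<in> EX_graphs n {complete_multipartite (map r [1..<q+2])}"
proof -
  have r1: "r 1 > 0" using rpos by auto
  have r12: "r 1 \<le> r 2" by (rule mono_onD[OF rmono]) (use q in auto)
  define K where "K = real (r 1) + real (r 1) ^ r 1 * r 2 / real (r 1) ^ (r 1 - 1) + 1"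
  have K: "K > 0" unfolding K_def by (intro add_nonneg_pos add_nonneg_nonneg) auto
  have "2 - 1 / real (r 1) < 2" using r1 by simp
  from eventually_powr_dominates[OF this _ K, of "1 / (8 * real q ^ 2)"] q obtain N1 :: nat where
    N1: "\<And>n. n \<ge> N1 \<Longrightarrow> K * real n powr (2 - 1 / real (r 1)) \<le> 1 / (8 * real q ^ 2) * real n powr 2" by auto
  \<comment> \<open>The edges inside the first factor and the linear terms may each use
    \<open>n ^ 2 / (8 * q ^ 2)\<close>; together this is \<open>(n / (2 * q)) ^ 2\<close>, the
    deviation that \<open>part_size_lower\<close> tolerates.\<close>
  define N0 where "N0 = N1 + 2 * q * (2 * r 2 ^ 4 + 2) + 8 * q ^ 2 * (q + r 2) + 1"
  show ?thesis
  proof (rule exI[of _ N0], intro allI impI)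
    fix n and N N' :: "nat \<Rightarrow> 'a graph"
    assume n: "N0 \<le> n" and disj': "disjoint_family_on (\<lambda>i. verts (N' i)) {1..q}"
      and disj: "disjoint_family_on (\<lambda>i. verts (N i)) {1..q}"
      and G: "graph_join q N \<in> EX_graphs n {complete_multipartite (map r [1..<q+2])}"
      and Na: "N 1 \<in> EX_graphs (card (verts (N 1))) {complete_multipartite [r 1, r 2]}"
      and Nb: "\<forall>i\<in>{2..q}. N i \<in> EX_graphs (card (verts (N i))) {complete_multipartite [1, r 2]}"
      and same: "\<forall>i\<in>{1..q}. card (verts (N' i)) = card (verts (N i))"
      and N'a: "N' 1 \<in> EX_graphs (card (verts (N' 1))) {complete_multipartite [r 1, r 2]}"
      and N'b: "\<forall>i\<in>{2..q}. N' i \<in> EX_graphs (card (verts (N' i))) (girth5_family (r 2))"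
    define m where "m i = card (verts (N i))" for i
    have cases: "i = 1 \<or> i \<in> {2..q}" if "i \<in> {1..q}" for i using that by auto
    have "\<forall>i\<in>{1..q}. simple_graph (N i)"
      using cases Na Nb unfolding EX_graphs_def by blast
    note J = join_edge_count[of N q, OF disj this]
    have nm: "n = (\<Sum>i\<in>{1..q}. m i)" using J(2) G by (simp add: EX_graphs_def m_def)
    have "card (edges (graph_join q N)) = ex_K q r n" using G by (simp add: EX_graphs_def)
    moreover have "(\<Sum>i\<in>{1..q}. 2 * card (edges (N i))) = 2 * ex_bip (r 1) (r 2) (m 1) + (\<Sum>i\<in>{2..q}. 2 * ex_bip 1 (r 2) (m i))"
      unfolding sum_split_1[OF q] using Na Nb by (simp add: EX_graphs_def m_def)
    ultimately have count: "2 * ex_K q r n + (\<Sum>i\<in>{1..q}. m i ^ 2) =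
        n ^ 2 + 2 * ex_bip (r 1) (r 2) (m 1) + (\<Sum>i\<in>{2..q}. 2 * ex_bip 1 (r 2) (m i))"
      using J(4) nm by (simp add: m_def)
    have m_le: "m i \<le> n" if "i \<in> {1..q}" for i unfolding nm by (rule member_le_sum) (use that in auto)
    have "(\<Sum>i\<in>{2..q}. 2 * ex_bip 1 (r 2) (m i)) \<le> (\<Sum>i\<in>{2..q}. r 2 * m i)"
    proof (rule sum_mono)
      fix i
      have "2 * ex_bip 1 (r 2) (m i) \<le> (r 2 - 1) * m i" using ex_number_star_upper[of "r 2" "m i"] r2 by simp
      also have "\<dots> \<le> r 2 * m i" by (intro mult_right_mono) auto
      finally show "2 * ex_bip 1 (r 2) (m i) \<le> r 2 * m i" .
    qed
    also have "\<dots> \<le> r 2 * n" unfolding nm sum_split_1[OF q] by (simp add: sum_distrib_left distrib_left)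
    finally have stars: "real (\<Sum>i\<in>{2..q}. 2 * ex_bip 1 (r 2) (m i)) \<le> real (r 2 * n)" by (simp only: of_nat_le_iff)
    have "ex_bip (r 1) (r 2) (m 1) \<le> ex_bip (r 1) (r 2) n"
      using m_le[of 1] q r1 r12 by (intro ex_number_bip_mono) auto
    hence "2 * real (ex_bip (r 1) (r 2) (m 1)) \<le> 2 * real (ex_bip (r 1) (r 2) n)" by simp
    also have "\<dots> \<le> (K - 1) * real n powr (2 - 1 / real (r 1))"
      using ex_number_bip_upper[of "r 1" "r 2" n] n r1 r2 by (simp add: K_def N0_def)
    also have "\<dots> \<le> K * real n powr (2 - 1 / real (r 1))" by (intro mult_right_mono) auto
    also have "\<dots> \<le> 1 / (8 * real q ^ 2) * real n powr 2" using N1[of n] n by (simp add: N0_def)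
    also have "\<dots> = real n ^ 2 / (8 * real q ^ 2)" using n by (simp add: N0_def powr_numeral)
    finally have bip: "2 * real (ex_bip (r 1) (r 2) (m 1)) \<le> real n ^ 2 / (8 * real q ^ 2)" .
    have lin: "real q + r 2 * n \<le> real n ^ 2 / (8 * real q ^ 2)"
    proof -
      have "q + r 2 * n \<le> (q + r 2) * n" using n by (simp add: N0_def distrib_right)
      hence "8 * q ^ 2 * (q + r 2 * n) \<le> 8 * q ^ 2 * ((q + r 2) * n)" by (rule mult_left_mono) simp
      also have "\<dots> = (8 * q ^ 2 * (q + r 2)) * n" by (simp only: mult.assoc)
      also have "\<dots> \<le> n * n" using n by (intro mult_right_mono) (simp_all add: N0_def)
      finally have "real (8 * q ^ 2 * (q + r 2 * n)) \<le> real (n * n)" by (simp only: of_nat_le_iff)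
      hence "(real q + r 2 * n) * (8 * real q ^ 2) \<le> real n ^ 2" by (simp add: power2_eq_square mult.commute)
      thus ?thesis using q by (simp add: pos_le_divide_eq)
    qed
    have low: "(1 - 1 / real q) * real n ^ 2 - q \<le> 2 * real (ex_K q r n)"
      using turan_lower_bound[OF q rpos rmono, of n] of_nat_0_le_iff[of "ex_bip (r 1) (r 2) (n div q)", where ?'a = real] by linarith
    have "real (2 * ex_K q r n + (\<Sum>i\<in>{1..q}. m i ^ 2)) =
        real (n ^ 2 + 2 * ex_bip (r 1) (r 2) (m 1) + (\<Sum>i\<in>{2..q}. 2 * ex_bip 1 (r 2) (m i)))" by (simp only: count)
    hence creal: "2 * real (ex_K q r n) + (\<Sum>i\<in>{1..q}. real (m i) ^ 2) =
        real n ^ 2 + 2 * real (ex_bip (r 1) (r 2) (m 1)) + real (\<Sum>i\<in>{2..q}. 2 * ex_bip 1 (r 2) (m i))"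
      by (simp only: of_nat_add of_nat_mult of_nat_numeral of_nat_power of_nat_sum)
    have "(1 - 1 / real q) * real n ^ 2 = real n ^ 2 - real n ^ 2 / q" by (simp add: left_diff_distrib)
    moreover have "real (r 2 * n) = real (r 2) * n" by simp
    ultimately have "(\<Sum>i\<in>{1..q}. real (m i) ^ 2) - real n ^ 2 / q \<le> real n ^ 2 / (8 * real q ^ 2) + real n ^ 2 / (8 * real q ^ 2)"
      using creal low bip lin stars by linarith
    also have "\<dots> = (real n / (2 * q)) ^ 2" by (simp add: power2_eq_square)
    finally have sq: "(\<Sum>i\<in>{1..q}. real (m i) ^ 2) - real n ^ 2 / q \<le> (real n / (2 * q)) ^ 2" .
    have big: "2 * r 2 ^ 4 + 2 \<le> m i" if i: "i \<in> {2..q}" for i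
    proof -
      have "real n / (2 * q) \<le> m i"
        by (rule part_size_lower[OF q _ _ sq]) (use i in \<open>auto simp: nm intro!: sum_nonneg\<close>)
      moreover have "2 * q * (2 * r 2 ^ 4 + 2) \<le> n" using n unfolding N0_def by linarith
      hence "real (2 * q * (2 * r 2 ^ 4 + 2)) \<le> n" by (simp only: of_nat_le_iff)
      hence "(real (2 * r 2 ^ 4 + 2)) * (2 * q) \<le> n" by (simp only: of_nat_mult mult.commute)
      hence "real (2 * r 2 ^ 4 + 2) \<le> n / (2 * q)" using q by (simp add: pos_le_divide_eq)
      ultimately have "real (2 * r 2 ^ 4 + 2) \<le> m i" by linarith
      thus ?thesis unfolding of_nat_le_iff .
    qed
    have m': "card (verts (N' i)) = m i" if "i \<in> {1..q}" for i using same that by (simp add: m_def)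
    have girth: "(\<Sum>i\<in>{2..q}. 2 * ex_bip 1 (r 2) (m i)) = (\<Sum>i\<in>{2..q}. 2 * ex_number (m i) (girth5_family (r 2)))"
      by (intro sum.cong refl) (simp only: ex_number_girth5_eq_star[OF r2 big])
    have sums: "(\<Sum>i\<in>{1..q}. card (verts (N' i)) ^ 2) = (\<Sum>i\<in>{1..q}. m i ^ 2)"
      "(\<Sum>i\<in>{1..q}. card (verts (N' i))) = n"
      "(\<Sum>i\<in>{2..q}. 2 * ex_number (card (verts (N' i))) (girth5_family (r 2))) = (\<Sum>i\<in>{2..q}. 2 * ex_number (m i) (girth5_family (r 2)))"
      unfolding nm by (intro sum.cong refl; use m' in simp)+
    show "graph_join q N' \<in> EX_graphs n {complete_multipartite (map r [1..<q+2])}"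
    proof (rule join_extremal[OF q rmono disj' N'a])
      show "N' i \<in> EX_graphs (card (verts (N' i))) (girth5_family (r 2))" if "i \<in> {2..q}" for i
        using N'b that by (rule bspec)
      show "n = (\<Sum>i\<in>{1..q}. card (verts (N' i)))" by (rule sums(2)[symmetric])
      show "2 * ex_K q r n + (\<Sum>i\<in>{1..q}. card (verts (N' i)) ^ 2) \<le> n ^ 2 + 2 * ex_bip (r 1) (r 2) (card (verts (N' 1))) +
        (\<Sum>i\<in>{2..q}. 2 * ex_number (card (verts (N' i))) (girth5_family (r 2)))"
        unfolding sums using count girth m'[of 1] q by simp
    qed
  qed
qed

theorem theorem6p3:
  fixes q :: nat and r :: "nat \<Rightarrow> nat"
  assumes "q \<ge> 1"
    and "\<forall>i\<in>{1..q+1}. r i > 0"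
    and "mono_on {1..q+1} r"
    and "r 2 \<ge> fact (r 1 - 1) + 1"
  defines "K \<equiv> complete_multipartite (map r [1..<q+2])"
  shows
    "(\<forall>\<delta>::real. \<delta> > 0 \<longrightarrow>
       (\<exists>N0. \<forall>n\<ge>N0. \<forall>G::'a graph. G \<in> EX_graphs n {K} \<longrightarrow>
          (\<exists>U. verts G = (\<Union>i\<in>{1..q}. U i) \<and> disjoint_family_on U {1..q} \<and>
               G = graph_join q (\<lambda>i. induced_graph G (U i)) \<and>
               factor_conditions q r \<delta> n (\<lambda>i. induced_graph G (U i)))))
     \<and>
     (\<exists>N0. \<forall>n\<ge>N0. \<forall>\<delta>::real. \<delta> > 0 \<longrightarrow> (\<forall>N' :: nat \<Rightarrow> 'a graph.
        disjoint_family_on (\<lambda>i. verts (N' i)) {1..q} \<and>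
        (\<exists>N :: nat \<Rightarrow> 'a graph.
           disjoint_family_on (\<lambda>i. verts (N i)) {1..q} \<and>
           graph_join q N \<in> EX_graphs n {K} \<and>
           factor_conditions q r \<delta> n N \<and>
           (\<forall>i\<in>{1..q}. card (verts (N' i)) = card (verts (N i)))) \<and>
        N' 1 \<in> EX_graphs (card (verts (N' 1))) {complete_multipartite [r 1, r 2]} \<and>
        (\<forall>i\<in>{2..q}. N' i \<in> EX_graphs (card (verts (N' i)))
           {complete_multipartite [1, r 2], complete_multipartite [2, 2],
            complete_multipartite [1, 1, 1]})
        \<longrightarrow> graph_join q N' \<in> EX_graphs n {K}))"
proof -
  have q: "q > 0" and rpos: "\<forall>i\<in>{1..Suc q}. r i > 0" and rmono: "mono_on {1..Suc q} r"
    using assms(1-3) by simp_all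
  have r2: "r 2 \<ge> 2" using assms(4) fact_ge_1[of "r 1 - 1", where ?'a = nat] by linarith
  show ?thesis
  proof (rule conjI, intro allI impI)
    fix \<delta> :: real assume "\<delta> > 0"
    from extremal_graphs_are_joins[OF q rpos rmono assms(4) this]
    show "\<exists>N0. \<forall>n\<ge>N0. \<forall>G::'a graph. G \<in> EX_graphs n {K} \<longrightarrow>
          (\<exists>U. verts G = (\<Union>i\<in>{1..q}. U i) \<and> disjoint_family_on U {1..q} \<and>
               G = graph_join q (\<lambda>i. induced_graph G (U i)) \<and>
               factor_conditions q r \<delta> n (\<lambda>i. induced_graph G (U i)))"
      unfolding K_def .
  next
    from extremal_join_replacement[OF q rpos rmono r2, where ?'a = 'a] obtain N0 where
      N0: "\<forall>n\<ge>N0. \<forall>(N :: nat \<Rightarrow> 'a graph) (N' :: nat \<Rightarrow> 'a graph).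
        disjoint_family_on (\<lambda>i. verts (N' i)) {1..q} \<longrightarrow> disjoint_family_on (\<lambda>i. verts (N i)) {1..q} \<longrightarrow>
        graph_join q N \<in> EX_graphs n {K} \<longrightarrow>
        N 1 \<in> EX_graphs (card (verts (N 1))) {complete_multipartite [r 1, r 2]} \<longrightarrow>
        (\<forall>i\<in>{2..q}. N i \<in> EX_graphs (card (verts (N i))) {complete_multipartite [1, r 2]}) \<longrightarrow>
        (\<forall>i\<in>{1..q}. card (verts (N' i)) = card (verts (N i))) \<longrightarrow>
        N' 1 \<in> EX_graphs (card (verts (N' 1))) {complete_multipartite [r 1, r 2]} \<longrightarrow>
        (\<forall>i\<in>{2..q}. N' i \<in> EX_graphs (card (verts (N' i))) (girth5_family (r 2))) \<longrightarrow>
        graph_join q N' \<in> EX_graphs n {K}"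
      unfolding K_def by (elim exE)
    show "\<exists>N0. \<forall>n\<ge>N0. \<forall>\<delta>::real. \<delta> > 0 \<longrightarrow> (\<forall>N' :: nat \<Rightarrow> 'a graph.
        disjoint_family_on (\<lambda>i. verts (N' i)) {1..q} \<and>
        (\<exists>N :: nat \<Rightarrow> 'a graph.
           disjoint_family_on (\<lambda>i. verts (N i)) {1..q} \<and>
           graph_join q N \<in> EX_graphs n {K} \<and>
           factor_conditions q r \<delta> n N \<and>
           (\<forall>i\<in>{1..q}. card (verts (N' i)) = card (verts (N i)))) \<and>
        N' 1 \<in> EX_graphs (card (verts (N' 1))) {complete_multipartite [r 1, r 2]} \<and>
        (\<forall>i\<in>{2..q}. N' i \<in> EX_graphs (card (verts (N' i))) (girth5_family (r 2)))
        \<longrightarrow> graph_join q N' \<in> EX_graphs n {K})"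
    proof (rule exI[of _ N0], intro allI impI, elim conjE exE)
      fix n and N' N :: "nat \<Rightarrow> 'a graph" and \<delta> :: real
      assume n: "N0 \<le> n" and fc: "factor_conditions q r \<delta> n N"
        and a: "disjoint_family_on (\<lambda>i. verts (N' i)) {1..q}" "disjoint_family_on (\<lambda>i. verts (N i)) {1..q}"
          "graph_join q N \<in> EX_graphs n {K}"
        and b: "\<forall>i\<in>{1..q}. card (verts (N' i)) = card (verts (N i))"
          "N' 1 \<in> EX_graphs (card (verts (N' 1))) {complete_multipartite [r 1, r 2]}"
          "\<forall>i\<in>{2..q}. N' i \<in> EX_graphs (card (verts (N' i))) (girth5_family (r 2))"
      have f: "N 1 \<in> EX_graphs (card (verts (N 1))) {complete_multipartite [r 1, r 2]}"
        "\<forall>i\<in>{2..q}. N i \<in> EX_graphs (card (verts (N i))) {complete_multipartite [1, r 2]}"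
        using fc by (simp_all add: factor_conditions_def)
      note replace = N0[THEN spec, THEN mp, OF n, THEN spec, of N, THEN spec, of N']
      show "graph_join q N' \<in> EX_graphs n {K}"
        by (rule replace[THEN mp, THEN mp, THEN mp, THEN mp, THEN mp, THEN mp, THEN mp, THEN mp, OF a f b])
    qed
  qed
qed

end
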